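(* Let $\varepsilon>0$ be a small enough constant and $\Delta=\mathrm{poly}(\varepsilon)$. Given a feasible solution $(z_S)_{S\subseteq V}$ of the cluster LP (given as the list of its non-zero coordinates) in which every coordinate is either $0$ or at least $\Delta$, one can output a clustering whose expected cost is at most $(1.485+\varepsilon)\,\mathrm{obj}(x)$, in time $\widetilde O(n/\Delta^2)$ in the sublinear model.
   Context: A Correlation Clustering instance consists of a finite vertex set $V$ with $n=|V|$ and a labeling of every unordered pair of vertices as a $+$edge or a $-$edge; $E^+$ and $E^-$ denote the sets of $+$edges and $-$edges ($E^+$ includes all self-loops $uu$ by convention). A clustering is a partition of $V$; its cost is the number of $+$edges joining different clusters plus the number of $-$edges inside clusters. The cluster LP has a variable $z_S\ge0$ for every nonempty $S\subseteq V$ and constraints $\sum_{S\ni u}z_S=1$ for all $u\in V$; $x_{uv}=1-\sum_{S\supseteq\{u,v\}}z_S$ and $\mathrm{obj}(x)=\sum_{uv\in E^+}x_{uv}+\sum_{uv\in E^-}(1-x_{uv})$. Sublinear model: input accessed only via $O(1)$-time queries for the $+$degree of a vertex, the $i$-th $+$neighbor of a vertex, and whether a pair is a $+$edge. $\widetilde O$ hides polylogarithmic factors in $n$. *)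

theory Defs
  imports "HOL-Probability.Probability" "HOL-Computational_Algebra.Polynomial"
    "HOL-Library.Disjoint_Sets"
begin

section \<open>Correlation Clustering and the cluster LP\<close>

text \<open>An unordered pair $uv$ is the set $\{u,v\}$, so the self-loop $uu$ is the singleton $\{u\}$.\<close>

definition vertex_pairs :: "'a set \<Rightarrow> 'a set set" where
  "vertex_pairs V = {{u, v} | u v. u \<in> V \<and> v \<in> V}"

definition cc_instance :: "'a set \<Rightarrow> 'a set set \<Rightarrow> bool" where
  "cc_instance V Ep \<longleftrightarrow> finite V \<and> Ep \<subseteq> vertex_pairs V \<and> (\<forall>u\<in>V. {u} \<in> Ep)"

definition minus_edges :: "'a set \<Rightarrow> 'a set set \<Rightarrow> 'a set set" where
  "minus_edges V Ep = vertex_pairs V - Ep"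

definition cc_cost :: "'a set \<Rightarrow> 'a set set \<Rightarrow> 'a set set \<Rightarrow> nat" where
  "cc_cost V Ep \<C> =
     card {e \<in> Ep. \<not> (\<exists>K\<in>\<C>. e \<subseteq> K)} + card {e \<in> minus_edges V Ep. \<exists>K\<in>\<C>. e \<subseteq> K}"

text \<open>Only the values of \<open>z\<close> on nonempty subsets of \<open>V\<close> are LP variables; the other values are ignored.\<close>

definition cluster_lp_feasible :: "'a set \<Rightarrow> ('a set \<Rightarrow> real) \<Rightarrow> bool" where
  "cluster_lp_feasible V z \<longleftrightarrow>
     (\<forall>S. S \<subseteq> V \<and> S \<noteq> {} \<longrightarrow> 0 \<le> z S) \<and>
     (\<forall>u\<in>V. (\<Sum>S | S \<subseteq> V \<and> u \<in> S. z S) = 1)"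

definition lp_dist :: "'a set \<Rightarrow> ('a set \<Rightarrow> real) \<Rightarrow> 'a set \<Rightarrow> real" where
  "lp_dist V z e = 1 - (\<Sum>S | S \<subseteq> V \<and> e \<subseteq> S. z S)"

definition lp_obj :: "'a set \<Rightarrow> 'a set set \<Rightarrow> ('a set \<Rightarrow> real) \<Rightarrow> real" where
  "lp_obj V Ep z =
     (\<Sum>e\<in>Ep. lp_dist V z e) + (\<Sum>e\<in>minus_edges V Ep. 1 - lp_dist V z e)"


section \<open>The sublinear model\<close>

text \<open>
  Randomized algorithms are programs for a real RAM: a word RAM (arithmetic modulo a
  word bound \<open>W\<close>) with additional exact real registers and real memory. Reals support only
  the field operations and comparison; there is no rounding, so no conversion from reals to
  words. Every instruction, including a query and a random draw, takes one unit of time.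

  Vertices are the words \<open>0, \<dots>, n - 1\<close>. The list \<open>in_sol\<close> of nonzero LP coordinates
  holds, for each set of the support, an enumeration of its members and its LP value.
\<close>

record cc_input =
  in_n :: nat
  in_plus :: "nat set set"
  in_nbrs :: "nat \<Rightarrow> nat list"
  in_sol :: "(nat list \<times> real) list"
  in_eps :: real
  in_delta :: real

text \<open>The order of the adjacency lists, of the coordinates and of the members of each set is
  arbitrary. As $E^+$ contains the self-loops, a vertex is its own $+$neighbor.\<close>

definition encodes ::
  "cc_input \<Rightarrow> nat \<Rightarrow> nat set set \<Rightarrow> (nat set \<Rightarrow> real) \<Rightarrow> real \<Rightarrow> real \<Rightarrow> bool" where
  "encodes I n Ep z \<epsilon> \<Delta> \<longleftrightarrow>
     in_n I = n \<and> in_plus I = Ep \<and> in_eps I = \<epsilon> \<and> in_delta I = \<Delta> \<and>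
     (\<forall>u<n. distinct (in_nbrs I u) \<and> set (in_nbrs I u) = {v. {u, v} \<in> Ep}) \<and>
     (\<forall>(xs, y) \<in> set (in_sol I). distinct xs \<and> y = z (set xs)) \<and>
     distinct (map (set \<circ> fst) (in_sol I)) \<and>
     (set \<circ> fst) ` set (in_sol I) = {S. S \<subseteq> {..<n} \<and> S \<noteq> {} \<and> z S \<noteq> 0}"

definition input_size :: "cc_input \<Rightarrow> nat" where
  "input_size I = 2 + in_n I + (\<Sum>(xs, y) \<leftarrow> in_sol I. length xs)"

type_synonym reg = nat

datatype word_op = WPlus | WMinus | WTimes | WDiv | WMod
datatype real_op = RPlus | RMinus | RTimes | RDivide

text \<open>
  The first argument of an instruction is its destination register (of the word or of the
  real register bank), except for stores and jumps. \<open>Store a b\<close> and \<open>RStore a b\<close> write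
  register \<open>b\<close> to the memory cell addressed by word register \<open>a\<close>. \<open>RandWord d a\<close> draws a
  uniform number below the content of \<open>a\<close>; \<open>Flip d a\<close> compares a fresh uniform real from
  $[0,1]$ with real register \<open>a\<close>, i.e. tosses a coin of that bias.
\<close>

datatype instr =
    SetWord reg nat
  | WordOp word_op reg reg reg
  | Load reg reg
  | Store reg reg
  | RealOfWord reg reg
  | RealOp real_op reg reg reg
  | RLoad reg reg
  | RStore reg reg
  | Jump nat
  | JumpLess reg reg nat
  | RJumpLess reg reg nat
  | RandWord reg reg
  | Flip reg reg
  | QNumVertices reg
  | QDegree reg reg
  | QNeighbor reg reg reg
  | QPlusEdge reg reg reg
  | QNumSets reg
  | QSetSize reg reg
  | QSetMember reg reg reg
  | QSetValue reg reg
  | QEps reg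
  | QDelta reg

record ram_state =
  pc :: nat
  wreg :: "reg \<Rightarrow> nat"
  rreg :: "reg \<Rightarrow> real"
  wmem :: "nat \<Rightarrow> nat"
  rmem :: "nat \<Rightarrow> real"

definition init_state :: ram_state where
  "init_state = \<lparr>pc = 0, wreg = \<lambda>_. 0, rreg = \<lambda>_. 0, wmem = \<lambda>_. 0, rmem = \<lambda>_. 0\<rparr>"

fun sem_word_op :: "word_op \<Rightarrow> nat \<Rightarrow> nat \<Rightarrow> nat" where
  "sem_word_op WPlus x y = x + y"
| "sem_word_op WMinus x y = x - y"
| "sem_word_op WTimes x y = x * y"
| "sem_word_op WDiv x y = x div y"
| "sem_word_op WMod x y = x mod y"

fun sem_real_op :: "real_op \<Rightarrow> real \<Rightarrow> real \<Rightarrow> real" where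
  "sem_real_op RPlus x y = x + y"
| "sem_real_op RMinus x y = x - y"
| "sem_real_op RTimes x y = x * y"
| "sem_real_op RDivide x y = x / y"

definition next_pc :: "ram_state \<Rightarrow> ram_state" where
  "next_pc s = s\<lparr>pc := pc s + 1\<rparr>"

definition put_word :: "nat \<Rightarrow> reg \<Rightarrow> nat \<Rightarrow> ram_state \<Rightarrow> ram_state" where
  "put_word W d x s = next_pc (s\<lparr>wreg := (wreg s)(d := x mod W)\<rparr>)"

definition put_real :: "reg \<Rightarrow> real \<Rightarrow> ram_state \<Rightarrow> ram_state" where
  "put_real d x s = next_pc (s\<lparr>rreg := (rreg s)(d := x)\<rparr>)"

definition nth_or :: "'a \<Rightarrow> 'a list \<Rightarrow> nat \<Rightarrow> 'a" where
  "nth_or x xs i = (if i < length xs then xs ! i else x)"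

text \<open>Queries with an index out of range return 0.\<close>

fun exec :: "nat \<Rightarrow> cc_input \<Rightarrow> instr \<Rightarrow> ram_state \<Rightarrow> ram_state pmf" where
  "exec W I (SetWord d k) s = return_pmf (put_word W d k s)"
| "exec W I (WordOp f d a b) s = return_pmf (put_word W d (sem_word_op f (wreg s a) (wreg s b)) s)"
| "exec W I (Load d a) s = return_pmf (put_word W d (wmem s (wreg s a)) s)"
| "exec W I (Store a b) s =
     return_pmf (next_pc (s\<lparr>wmem := (wmem s)(wreg s a := wreg s b)\<rparr>))"
| "exec W I (RealOfWord d a) s = return_pmf (put_real d (real (wreg s a)) s)"
| "exec W I (RealOp f d a b) s = return_pmf (put_real d (sem_real_op f (rreg s a) (rreg s b)) s)"
| "exec W I (RLoad d a) s = return_pmf (put_real d (rmem s (wreg s a)) s)"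
| "exec W I (RStore a b) s =
     return_pmf (next_pc (s\<lparr>rmem := (rmem s)(wreg s a := rreg s b)\<rparr>))"
| "exec W I (Jump l) s = return_pmf (s\<lparr>pc := l\<rparr>)"
| "exec W I (JumpLess a b l) s =
     return_pmf (if wreg s a < wreg s b then s\<lparr>pc := l\<rparr> else next_pc s)"
| "exec W I (RJumpLess a b l) s =
     return_pmf (if rreg s a < rreg s b then s\<lparr>pc := l\<rparr> else next_pc s)"
| "exec W I (RandWord d a) s =
     (if wreg s a = 0 then return_pmf (put_word W d 0 s)
      else map_pmf (\<lambda>x. put_word W d x s) (pmf_of_set {..<wreg s a}))"
| "exec W I (Flip d a) s =
     map_pmf (\<lambda>b. put_word W d (of_bool b) s) (bernoulli_pmf (max 0 (min 1 (rreg s a))))"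
| "exec W I (QNumVertices d) s = return_pmf (put_word W d (in_n I) s)"
| "exec W I (QDegree d a) s =
     return_pmf (put_word W d (if wreg s a < in_n I then length (in_nbrs I (wreg s a)) else 0) s)"
| "exec W I (QNeighbor d a b) s =
     return_pmf (put_word W d
       (if wreg s a < in_n I then nth_or 0 (in_nbrs I (wreg s a)) (wreg s b) else 0) s)"
| "exec W I (QPlusEdge d a b) s =
     return_pmf (put_word W d (of_bool ({wreg s a, wreg s b} \<in> in_plus I)) s)"
| "exec W I (QNumSets d) s = return_pmf (put_word W d (length (in_sol I)) s)"
| "exec W I (QSetSize d a) s =
     return_pmf (put_word W d (length (fst (nth_or ([], 0) (in_sol I) (wreg s a)))) s)"
| "exec W I (QSetMember d a b) s =
     return_pmf (put_word W d
       (nth_or 0 (fst (nth_or ([], 0) (in_sol I) (wreg s a))) (wreg s b)) s)"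
| "exec W I (QSetValue d a) s =
     return_pmf (put_real d (snd (nth_or ([], 0) (in_sol I) (wreg s a))) s)"
| "exec W I (QEps d) s = return_pmf (put_real d (in_eps I) s)"
| "exec W I (QDelta d) s = return_pmf (put_real d (in_delta I) s)"

definition halted :: "instr list \<Rightarrow> ram_state \<Rightarrow> bool" where
  "halted P s \<longleftrightarrow> length P \<le> pc s"

definition step :: "nat \<Rightarrow> cc_input \<Rightarrow> instr list \<Rightarrow> ram_state \<Rightarrow> ram_state pmf" where
  "step W I P s = (if halted P s then return_pmf s else exec W I (P ! pc s) s)"

text \<open>Distribution of the state after \<open>t\<close> time units; halted states no longer change.\<close>

fun run :: "nat \<Rightarrow> cc_input \<Rightarrow> instr list \<Rightarrow> nat \<Rightarrow> ram_state pmf" where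
  "run W I P 0 = return_pmf init_state"
| "run W I P (Suc t) = bind_pmf (run W I P t) (step W I P)"

text \<open>The output is a cluster label for every vertex, in the word memory cells \<open>0, \<dots>, n - 1\<close>.\<close>

definition output_clustering :: "nat \<Rightarrow> ram_state \<Rightarrow> nat set set" where
  "output_clustering n s = (\<lambda>u. {v. v < n \<and> wmem s v = wmem s u}) ` {..<n}"

lemma partition_on_output_clustering: "partition_on {..<n} (output_clustering n s)"
  unfolding output_clustering_def partition_on_def disjoint_def by auto

text \<open>
  The support contains each vertex at most \<open>1/\<Delta>\<close> times, so
  \<open>input_size I \<le> 2 + n + n/\<Delta>\<close>. Program \<open>P\<close> on words of \<open>O(log (input_size I))\<close> bits always halts within time \<open>T\<close>
  (a real bound), and the expected cost of its output clustering is at most \<open>B\<close>.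
\<close>

definition clusters_within ::
  "nat \<Rightarrow> instr list \<Rightarrow> cc_input \<Rightarrow> real \<Rightarrow> real \<Rightarrow> bool" where
  "clusters_within c P I T B \<longleftrightarrow>
     (let D = run (input_size I ^ c) I P (nat \<lfloor>T\<rfloor>) in
        (\<forall>s\<in>set_pmf D. halted P s) \<and>
        measure_pmf.expectation D
          (\<lambda>s. real (cc_cost {..<in_n I} (in_plus I) (output_clustering (in_n I) s))) \<le> B)"

end

(* The algorithm is a mixture of two roundings. With probability 23/31 the sets of the support are hit in random
   order with probabilities z_S, each one absorbing its unclustered members; a pair at LP distance x is then separated
   with probability 2x/(1+x). Otherwise clusters are first grown from random pivots u: short +neighbours join surely,
   vertices joined to u by a minus edge join with probability 1-x, and the long +neighbours are either those in one
   random set containing u or are chosen independently. A triangle inequality pays the pivot step with the price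
   that complements 2x/(1+x) to 46/31 < 1.485 in the mixture. Truncating the number of trials and the scanned lists
   costs a factor 1 + O(Delta) only. *)
theory Submission
  imports Defs
begin

text \<open>The constants come from one balance: if a pair pays \<open>cluster_cost\<close> with
  probability 23/31, then \<open>price\<close> is exactly what it may still pay with probability
  8/31. A pivot step is judged by whether the prices released by the pairs it decides cover the cost
  it causes.

  True costs are not compared triangle by triangle. Two long neighbours may join a pivot through one
  common random set; the covariance of their memberships is added to the cost of the triangle, which
  relieves triangles with negative correlation. Over all pairs of neighbours of one pivot the
  covariances sum to a variance, so the additions are nonnegative in total. The diagonal of that sum
  is paid by degenerate triangles through the pivot itself.

  Time must be bounded on every run, yet reading the sets around a pivot is cheap only on average.
  The potential \<open>work\<close> bounds the expected reading by \<open>2 * n / \<Delta>\<close>,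
  so by Markov a cap of \<open>n / \<Delta>\<^sup>2\<close> is reached with probability at most
  \<open>2 * \<Delta>\<close>. Pairs still undecided then are left to the hits, where they pay
  little more than twice their LP cost.\<close>

section \<open>Polynomial certificates for the critical triangles\<close>

text \<open>A Handelman-type certificate, as are the next four: minus the left side is a
  combination, with positive coefficients, of products of quantities that the hypotheses make
  nonnegative. The identity is checked by \<open>algebra\<close>. The three summands are the three
  pivots of a triangle of long + edges, with \<open>budget\<close> replaced by its tangent at
  1/3.\<close>

lemma certificate_plus3:
  fixes x1 x2 x3 Y :: real
  assumes "3/10 \<le> x1" "3/10 \<le> x2" "3/10 \<le> x3" "x1 \<le> 1" "x2 \<le> 1" "x3 \<le> 1"
    "0 \<le> Y" "Y \<le> 1 - x1" "Y \<le> 1 - x2" "Y \<le> 1 - x3"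
    "1 - x1 - x2 \<le> Y" "1 - x1 - x3 \<le> Y" "1 - x2 - x3 \<le> Y"
  shows "((1 - 7/10 * (x1 + x2 - 1 + Y) - 3/10 * (x1^2 * x2^2)) * (1 - 23/64 * (7 * x3 - 1))
     - 7/10 * Y - 3/10 * ((1 - x1^2) * (1 - x2^2)) + Y - (1 - x1) * (1 - x2))
   + ((1 - 7/10 * (x1 + x3 - 1 + Y) - 3/10 * (x1^2 * x3^2)) * (1 - 23/64 * (7 * x2 - 1))
     - 7/10 * Y - 3/10 * ((1 - x1^2) * (1 - x3^2)) + Y - (1 - x1) * (1 - x3))
   + ((1 - 7/10 * (x2 + x3 - 1 + Y) - 3/10 * (x2^2 * x3^2)) * (1 - 23/64 * (7 * x1 - 1))
     - 7/10 * Y - 3/10 * ((1 - x2^2) * (1 - x3^2)) + Y - (1 - x2) * (1 - x3)) \<le> 0"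
proof -
  define a1 where "a1 = x1 - 3/10"
  define a2 where "a2 = x2 - 3/10"
  define a3 where "a3 = x3 - 3/10"
  define y1 where "y1 = 1 - x1"
  define y2 where "y2 = 1 - x2"
  define y3 where "y3 = 1 - x3"
  define Z where "Z = Y"
  define d12 where "d12 = Y - 1 + x1 + x2"
  define d13 where "d13 = Y - 1 + x1 + x3"
  define d23 where "d23 = Y - 1 + x2 + x3"
  define u1 where "u1 = 1 - x1 - Y"
  define u2 where "u2 = 1 - x2 - Y"
  define u3 where "u3 = 1 - x3 - Y"
  have nonneg: "0 \<le> a1" "0 \<le> a2" "0 \<le> a3" "0 \<le> y1" "0 \<le> y2" "0 \<le> y3" "0 \<le> Z" "0 \<le> d12" "0 \<le> d13" "0 \<le> d23" "0 \<le> u1" "0 \<le> u2" "0 \<le> u3"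
    using assms by (simp_all add: a1_def a2_def a3_def y1_def y2_def y3_def Z_def d12_def d13_def d23_def u1_def u2_def u3_def)
  have "((1 - 7/10 * (x1 + x2 - 1 + Y) - 3/10 * (x1^2 * x2^2)) * (1 - 23/64 * (7 * x3 - 1))
     - 7/10 * Y - 3/10 * ((1 - x1^2) * (1 - x2^2)) + Y - (1 - x1) * (1 - x2))
   + ((1 - 7/10 * (x1 + x3 - 1 + Y) - 3/10 * (x1^2 * x3^2)) * (1 - 23/64 * (7 * x2 - 1))
     - 7/10 * Y - 3/10 * ((1 - x1^2) * (1 - x3^2)) + Y - (1 - x1) * (1 - x3))
   + ((1 - 7/10 * (x2 + x3 - 1 + Y) - 3/10 * (x2^2 * x3^2)) * (1 - 23/64 * (7 * x1 - 1))
     - 7/10 * Y - 3/10 * ((1 - x2^2) * (1 - x3^2)) + Y - (1 - x2) * (1 - x3)) =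
    - ((973561/6400000) * u3 + (164271/320000) * a1 * u1 + (399229/320000) * a1 * u3
       + (50495941/38080000) * a1 * y2 + (5459/5000) * a2 * u1 + (7192297/10880000) * a2 * u3
       + (25190677/38080000) * a2 * y1 + (2132213/10880000) * a2 * y2
       + (8243493/5440000) * a3 * u2 + (10091671/10880000) * a3 * y1
       + (334527/640000) * a3 * y3 + (2567771/5440000) * y2 * d23
       + (2977249/10880000) * y3 * d12 + (15543/32000) * a1 * a2 * y3
       + (14139/64000) * a2 * y1 * d13 + (14139/64000) * a2 * y1 * d23
       + (14139/64000) * a2 * y3 * d13 + (171/12800) * a3 * y1 * d12
       + (171/12800) * a3 * y1 * d23 + (171/12800) * a3 * y2 * d12
       + (3321/11200) * a1^2 * a3 * y2 + (747/800) * a1 * a2 * a3 * Z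
       + (14139/22400) * a1 * a2 * y3 * d12 + (3321/11200) * a1 * a3^2 * y2
       + (171/4480) * a1 * a3 * y2 * d13 + (3321/11200) * a2 * a3^2 * y1
       + (1071/3200) * a2 * a3 * y1 * d23 + (3081/4480) * a1^2 * a2^2 * y3
       + (15/448) * a1^2 * a2 * a3 * Z + (3081/4480) * a1^2 * a3^2 * y2
       + (15/448) * a1 * a2^2 * a3 * Z + (15/448) * a1 * a2 * a3^2 * Z
       + (15/448) * a1 * a2 * a3 * y1 * d23 + (15/448) * a1 * a2 * a3 * y2 * d13
       + (15/448) * a1 * a2 * a3 * y3 * d12 + (3081/4480) * a2^2 * a3^2 * y1)"
    unfolding a1_def a2_def a3_def y1_def y2_def y3_def Z_def d12_def d13_def d23_def u1_def u2_def u3_def by algebra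
  also have "\<dots> \<le> 0"
    unfolding neg_le_0_iff_le by (intro add_nonneg_nonneg mult_nonneg_nonneg zero_le_power nonneg) simp_all
  finally show ?thesis .
qed

text \<open>Two long + edges and a longest minus edge \<open>x3\<close>. The joint inclusion
  \<open>Y\<close> is already raised to its largest value \<open>1 - x3\<close>. The + prices are
  tangents of \<open>budget\<close> at 1/2, the minus price is its quadratic minorant.\<close>

lemma certificate_plus2_minus_long:
  fixes x1 x2 x3 :: real
  assumes "3/10 \<le> x1" "x1 \<le> x2" "x2 \<le> x3" "x3 \<le> 1" "x3 \<le> x1 + x2"
  shows "17/10 * (1 - x3) + 3/10 * ((1 - x1^2) * (1 - x2^2)) - (1 - x1) * (1 - x2)
   - (1 - 7/10 * (x1 + x2 - 1 + (1 - x3)) - 3/10 * (x1^2 * x2^2)) * (23/8 * ((1 - x3) * (1 + x3/2)))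
   + (1 - x1 * (7 + 3 * x1) / 10 * x3) * (1 - 23/36 * (5 * x2 - 1)) - (1 - x1 * (7 + 3 * x1) / 10) * (1 - x3)
   + (1 - x2 * (7 + 3 * x2) / 10 * x3) * (1 - 23/36 * (5 * x1 - 1)) - (1 - x2 * (7 + 3 * x2) / 10) * (1 - x3) \<le> 0"
proof -
  define a1 where "a1 = x1 - 3/10"
  define y1 where "y1 = 1 - x1"
  define y2 where "y2 = 1 - x2"
  define y3 where "y3 = 1 - x3"
  define x21 where "x21 = x2 - x1"
  define x32 where "x32 = x3 - x2"
  define t where "t = x1 + x2 - x3"
  define a2 where "a2 = x2 - 3/10"
  have nonneg: "0 \<le> a1" "0 \<le> y1" "0 \<le> y2" "0 \<le> y3" "0 \<le> x21" "0 \<le> x32" "0 \<le> t" "0 \<le> a2"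
    using assms by (simp_all add: a1_def y1_def y2_def y3_def x21_def x32_def t_def a2_def)
  have "17/10 * (1 - x3) + 3/10 * ((1 - x1^2) * (1 - x2^2)) - (1 - x1) * (1 - x2)
   - (1 - 7/10 * (x1 + x2 - 1 + (1 - x3)) - 3/10 * (x1^2 * x2^2)) * (23/8 * ((1 - x3) * (1 + x3/2)))
   + (1 - x1 * (7 + 3 * x1) / 10 * x3) * (1 - 23/36 * (5 * x2 - 1)) - (1 - x1 * (7 + 3 * x1) / 10) * (1 - x3)
   + (1 - x2 * (7 + 3 * x2) / 10 * x3) * (1 - 23/36 * (5 * x1 - 1)) - (1 - x2 * (7 + 3 * x2) / 10) * (1 - x3) =
    - ((6700643/117250000) * y2 + (2682957553/13507200000) * y3
       + (557277653/964800000) * x21^2 + (6602854849/3376800000) * x32 * t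
       + (24182381/24120000) * y1 * t + (3272779879/1350720000) * y3 * a2
       + (380592869/13507200000) * y3 * x21 + (3280258589/1350720000) * y3 * x32
       + (2674939/1350720) * a1 * y3 * a2 + (140232493/112560000) * x21^2 * a2
       + (21001379/16080000) * x21^2 * x32 + (3870487/112560000) * x32^2 * t
       + (3348071/14070000) * y1 * a2^2 + (139601233/112560000) * y1 * t * a2
       + (204577913/450240000) * y3 * t^2 + (15679289/225120000) * y3 * x21 * x32
       + (8072939/21440000) * y3^3 + (59057/1072000) * a1 * x21^2 * a2
       + (3059/536000) * a1 * y1 * x21 * t + (1519/53600) * a1 * y1^2 * t
       + (643/268000) * x21 * a2^3 + (349/42880) * x21^2 * t * a2 + (18249/536000) * y1 * t^3
       + (22629/1072000) * y1 * x21^2 * x32 + (76794731/315168000) * y1^2 * y2 * y3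
       + (15073553/105056000) * y1 * y2^2 * y3 + (7611/1072000) * y1 * y2 * y3^2
       + (114603/1072000) * y1 * y3^3 + (11297/1072000) * y2 * t^3
       + (7807/214400) * y2 * y3^3 + (50367/1072000) * y3 * t^3
       + (25201/1072000) * y3 * x32^3 + (12583/536000) * y3^3 * x32
       + (176643697/220617600) * a1^2 * y2 * y3 * a2 + (207/800) * a1^2 * y3^2 * a2
       + (108780323/220617600) * a1 * y1 * y3 * a2^2 + (207/800) * a1 * y3^2 * a2^2
       + (69/160) * a1^2 * y3^2 * a2^2)"
    unfolding a1_def y1_def y2_def y3_def x21_def x32_def t_def a2_def by algebra
  also have "\<dots> \<le> 0"
    unfolding neg_le_0_iff_le by (intro add_nonneg_nonneg mult_nonneg_nonneg zero_le_power nonneg) simp_all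
  finally show ?thesis .
qed

text \<open>The companion case in which a + edge \<open>x1\<close> is longest, so that
  \<open>1 - x1\<close> is the largest value of \<open>Y\<close>. The minus edge may now be short,
  hence the lower end 0 for \<open>x3\<close>.\<close>

lemma certificate_plus2_minus_short:
  fixes x1 x2 x3 :: real
  assumes "3/10 \<le> x2" "x2 \<le> x1" "x1 \<le> 1" "0 \<le> x3" "x3 \<le> x1" "x1 \<le> x2 + x3"
  shows "17/10 * (1 - x1) + 3/10 * ((1 - x1^2) * (1 - x2^2)) - (1 - x1) * (1 - x2)
   - (1 - 7/10 * (x1 + x2 - 1 + (1 - x1)) - 3/10 * (x1^2 * x2^2)) * (23/8 * ((1 - x3) * (1 + x3/2)))
   + (1 - x1 * (7 + 3 * x1) / 10 * x3) * (1 - 23/36 * (5 * x2 - 1)) - (1 - x1 * (7 + 3 * x1) / 10) * (1 - x3)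
   + (1 - x2 * (7 + 3 * x2) / 10 * x3) * (1 - 23/36 * (5 * x1 - 1)) - (1 - x2 * (7 + 3 * x2) / 10) * (1 - x3) \<le> 0"
proof -
  define a2 where "a2 = x2 - 3/10"
  define y1 where "y1 = 1 - x1"
  define y2 where "y2 = 1 - x2"
  define v3 where "v3 = x3"
  define x13 where "x13 = x1 - x3"
  define x12 where "x12 = x1 - x2"
  define t2 where "t2 = x2 + x3 - x1"
  define a1 where "a1 = x1 - 3/10"
  define y3 where "y3 = 1 - x3"
  have nonneg: "0 \<le> a2" "0 \<le> y1" "0 \<le> y2" "0 \<le> v3" "0 \<le> x13" "0 \<le> x12" "0 \<le> t2" "0 \<le> a1" "0 \<le> y3"
    using assms by (simp_all add: a2_def y1_def y2_def v3_def x13_def x12_def t2_def a1_def y3_def)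
  have "17/10 * (1 - x1) + 3/10 * ((1 - x1^2) * (1 - x2^2)) - (1 - x1) * (1 - x2)
   - (1 - 7/10 * (x1 + x2 - 1 + (1 - x1)) - 3/10 * (x1^2 * x2^2)) * (23/8 * ((1 - x3) * (1 + x3/2)))
   + (1 - x1 * (7 + 3 * x1) / 10 * x3) * (1 - 23/36 * (5 * x2 - 1)) - (1 - x1 * (7 + 3 * x1) / 10) * (1 - x3)
   + (1 - x2 * (7 + 3 * x2) / 10 * x3) * (1 - 23/36 * (5 * x1 - 1)) - (1 - x2 * (7 + 3 * x2) / 10) * (1 - x3) =
    - ((3931448657188289/2099389132800000) * x13 + (1791302213189413/2099389132800000) * y3
       + (403272964624649/1049694566400000) * v3 * y3
       + (6973353309671/12349347840000) * y1 * a1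
       + (153048687280831/146957239296000) * y2 * a1
       + (3862078611439/12349347840000) * y2 * x13
       + (3022550155583/104969456640000) * a1 * y3^2
       + (705885160831/8644543488000) * a2 * y1 * t2
       + (366114047906617/146957239296000) * a2 * y1 * v3
       + (5689304530397/7347861964800) * a2 * y2 * a1 + (125650469/123493478400) * v3 * y3^2
       + (1353978743807/3498981888000) * y1 * x12 * y3
       + (89136735521161/48985746432000) * y2 * a1^2
       + (5514999910849/10496945664000) * y2 * v3 * x13
       + (668910403807/1234934784000) * y2 * x13 * t2
       + (5024400097259/12246436608000) * a2 * a1 * y3^2
       + (125650469/123493478400) * a2 * y2 * t2 * y3
       + (4554738229939/14695723929600) * a2 * y2 * x13 * a1
       + (125650469/123493478400) * t2^3 * y3 + (12610978921/308733696000) * v3^2 * x12^2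
       + (735952747/123493478400) * x12 * y3^3
       + (175638157009/5248472832000) * y1 * x12 * y3^2
       + (125650469/123493478400) * y1^2 * x12 * y3
       + (888140674321/14695723929600) * y2 * a1^3
       + (888140674321/14695723929600) * y2 * x13 * t2 * a1
       + (806088097459/3673930982400) * a2 * a1^2 * y3^2 + (207/800) * a2^2 * a1 * y3^2
       + (327919395441/816429107200) * a2^2 * y1 * a1 * y3
       + (17950067/12349347840) * a2 * v3^2 * y3^2
       + (2869175522981/7347861964800) * a2 * y1 * a1^2 * y3
       + (2869175522981/7347861964800) * a2 * y1 * t2 * a1 * y3
       + (17950067/12349347840) * v3^4 * x12 + (17950067/12349347840) * y1 * v3^2 * y3^2
       + (37881208709/104969456640) * a2 * y2 * v3 * a1^2 * y3
       + (7386869467/104969456640) * y2^2 * v3^2 * a1^2)"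
    unfolding a2_def y1_def y2_def v3_def x13_def x12_def t2_def a1_def y3_def by algebra
  also have "\<dots> \<le> 0"
    unfolding neg_le_0_iff_le by (intro add_nonneg_nonneg mult_nonneg_nonneg zero_le_power nonneg) simp_all
  finally show ?thesis .
qed

text \<open>One short and two long + edges. The joint term belongs to the common endpoint of the
  long edges. Tangents are taken at 1/3 for the long edges and at 1/9 for the short one.\<close>

lemma certificate_short_long2:
  fixes x1 x2 x3 Y :: real
  assumes "0 \<le> x1" "x1 \<le> 3/10" "3/10 \<le> x2" "x2 \<le> x3" "x3 \<le> 1" "x3 \<le> x1 + x2"
    "0 \<le> Y" "1 - x1 - x2 \<le> Y" "1 - x1 - x3 \<le> Y" "1 - x2 - x3 \<le> Y" "Y \<le> 1 - x3"
  shows "2 - 2/5 * Y - (1 - x2) * (1 - x3) - 3/5 * ((1 - x2^2) * (1 - x3^2))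
   - 23/64 * (7 * x2 - 1) - 23/64 * (7 * x3 - 1)
   - (1 - 7/10 * (x2 + x3 - 1 + Y) - 3/10 * (x2^2 * x3^2)) * (23/400 * (19 * x1 - 1)) \<le> 0"
proof -
  define v1 where "v1 = x1"
  define s1 where "s1 = 3/10 - x1"
  define a2 where "a2 = x2 - 3/10"
  define x32 where "x32 = x3 - x2"
  define y3 where "y3 = 1 - x3"
  define t where "t = x1 + x2 - x3"
  define Z where "Z = Y"
  define d13 where "d13 = Y - 1 + x1 + x3"
  define u3 where "u3 = 1 - x3 - Y"
  define d23 where "d23 = Y - 1 + x2 + x3"
  have nonneg: "0 \<le> v1" "0 \<le> s1" "0 \<le> a2" "0 \<le> x32" "0 \<le> y3" "0 \<le> t" "0 \<le> Z" "0 \<le> d13" "0 \<le> u3" "0 \<le> d23"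
    using assms by (simp_all add: v1_def s1_def a2_def x32_def y3_def t_def Z_def d13_def u3_def d23_def)
  have "2 - 2/5 * Y - (1 - x2) * (1 - x3) - 3/5 * ((1 - x2^2) * (1 - x3^2))
   - 23/64 * (7 * x2 - 1) - 23/64 * (7 * x3 - 1)
   - (1 - 7/10 * (x2 + x3 - 1 + Y) - 3/10 * (x2^2 * x3^2)) * (23/400 * (19 * x1 - 1)) =
    - ((55488981/35000000) * a2 + (19147049/40000000) * v1 + (258692163/280000000) * x32
       + (4136497/2800000) * a2^2 + (26818443/56000000) * a2 * d23
       + (50476481/56000000) * a2 * x32 + (367461/2000000) * s1 * a2
       + (349493/4000000) * s1 * d23 + (1313457/2000000) * v1 * u3
       + (72831/3500000) * v1 * y3 + (8156871/14000000) * x32 * d23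
       + (2213187/4000000) * x32 * t + (8156871/14000000) * y3 * d13
       + (2469/2000) * a2 * x32 * y3 + (309171/200000) * a2 * y3^2
       + (300219/800000) * s1 * a2 * d23 + (14421/800000) * s1 * a2 * x32
       + (11799/400000) * s1 * x32 * d23 + (11799/400000) * s1 * y3 * Z
       + (276621/800000) * v1 * a2 * Z + (20757/40000) * a2^2 * y3^2
       + (3933/20000) * s1 * a2 * y3^2 + (1311/2000) * v1 * a2^2 * y3
       + (1311/4000) * s1 * a2^2 * y3^2)"
    unfolding v1_def s1_def a2_def x32_def y3_def t_def Z_def d13_def u3_def d23_def by algebra
  also have "\<dots> \<le> 0"
    unfolding neg_le_0_iff_le by (intro add_nonneg_nonneg mult_nonneg_nonneg zero_le_power nonneg) simp_all
  finally show ?thesis .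
qed

text \<open>Edges short +, long +, minus. The tangents are at 1/5 for \<open>x1\<close> and 3/5 for
  \<open>x2\<close>; the two triangle inequalities enter as the slacks \<open>t\<close> and
  \<open>w\<close>.\<close>

lemma certificate_short_long_minus:
  fixes x1 x2 x3 :: real
  assumes "0 \<le> x1" "x1 \<le> 3/10" "3/10 \<le> x2" "x2 \<le> 1" "x3 \<le> 1" "x3 \<le> x1 + x2" "x2 \<le> x1 + x3"
  shows "1 + 2 * (1 - x2 * (7 + 3 * x2) / 10) * x3 - 23/8 * ((1 - x3) * (1 + x3/2)) - 23/256 * (39 * x2 - 9)
   - (1 - x2 * (7 + 3 * x2) / 10 * x3) * (23/144 * (11 * x1 - 1)) \<le> 0"
proof -
  define s1 where "s1 = 3/10 - x1"
  define a2 where "a2 = x2 - 3/10"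
  define y2 where "y2 = 1 - x2"
  define y3 where "y3 = 1 - x3"
  define t where "t = x1 + x2 - x3"
  define w where "w = x1 + x3 - x2"
  have nonneg: "0 \<le> s1" "0 \<le> a2" "0 \<le> y2" "0 \<le> y3" "0 \<le> t" "0 \<le> w"
    using assms by (simp_all add: s1_def a2_def y2_def y3_def t_def w_def)
  have "1 + 2 * (1 - x2 * (7 + 3 * x2) / 10) * x3 - 23/8 * ((1 - x3) * (1 + x3/2)) - 23/256 * (39 * x2 - 9)
   - (1 - x2 * (7 + 3 * x2) / 10 * x3) * (23/144 * (11 * x1 - 1)) =
    - ((5480027/1800000) * s1 + (29369879/7200000) * t + (2851/5040000) * a2^2
       + (38949/70000) * a2 * t + (535709/360000) * s1 * a2 + (368449/720000) * s1 * w
       + (1472093/1440000) * t * w + (597907/1440000) * y3 * w + (2671043/3528000) * a2^3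
       + (8809/201600) * a2 * t * w + (121811/201600) * a2 * y2 * t
       + (8809/201600) * a2 * y3 * t + (5131/3600) * s1 * a2^2 + (2783/3600) * s1 * a2 * w
       + (49013/67200) * s1 * y2 * t + (385193/3528000) * y2^3 + (253/960) * a2^2 * y3 * t
       + (253/960) * a2^2 * y3 * w)"
    unfolding s1_def a2_def y2_def y3_def t_def w_def by algebra
  also have "\<dots> \<le> 0"
    unfolding neg_le_0_iff_le by (intro add_nonneg_nonneg mult_nonneg_nonneg zero_le_power nonneg) simp_all
  finally show ?thesis .
qed

section \<open>Prices, inclusion probabilities and the triangle inequality\<close>

text \<open>The solution of
  \<open>23/31 * (2 * x / (1 + x)) + 8/31 * budget x = 46/31 * x\<close>.\<close>

definition budget :: "real \<Rightarrow> real" where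
  "budget x = 23/4 * x\<^sup>2 / (1 + x)"

text \<open>\<open>s\<close> tells whether the pair is a + edge. The minus price solves the same
  balance with \<open>(1 - x) / (1 + x)\<close> in place of \<open>2 * x / (1 + x)\<close> and LP
  cost \<open>1 - x\<close>.\<close>

definition price :: "bool \<Rightarrow> real \<Rightarrow> real" where
  "price s x = (if s then budget x else 23/8 - budget x)"

definition long :: "bool \<Rightarrow> real \<Rightarrow> bool" where
  "long s x \<longleftrightarrow> s \<and> 3/10 < x"

text \<open>The probability of joining a pivot at distance \<open>x\<close>. For a long + edge it is
  the mixture \<open>7/10 * (1 - x) + 3/10 * (1 - x\<^sup>2)\<close> of the joint and the
  independent choice.\<close>

definition incl :: "bool \<Rightarrow> real \<Rightarrow> real" where
  "incl s x = (if long s x then 1 - x * (7 + 3 * x) / 10 else if s then 1 else 1 - x)"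

text \<open>The probability that both neighbours join. \<open>Y\<close> is the LP mass of the sets
  containing the pivot and both; it matters only if both edges are long, otherwise the decisions are
  independent.\<close>

definition incl2 :: "bool \<Rightarrow> real \<Rightarrow> bool \<Rightarrow> real \<Rightarrow> real \<Rightarrow> real" where
  "incl2 s x s' x' Y =
     (if long s x \<and> long s' x' then 7/10 * Y + 3/10 * ((1 - x\<^sup>2) * (1 - x'\<^sup>2)) else incl s x * incl s' x')"

text \<open>The pivot sees the edges \<open>s x\<close> and \<open>s' x'\<close>; the pair whose
  cost is measured is the opposite edge \<open>t w\<close>. The three lines are the expected cost of
  that pair, minus its price times the probability that it gets decided, plus the covariance relief
  for two long edges.\<close>

definition excess :: "bool \<Rightarrow> real \<Rightarrow> bool \<Rightarrow> real \<Rightarrow> real \<Rightarrow> bool \<Rightarrow> real \<Rightarrow> real" where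
  "excess s x s' x' Y t w =
     (if t then incl s x + incl s' x' - 2 * incl2 s x s' x' Y else incl2 s x s' x' Y)
     - (incl s x + incl s' x' - incl2 s x s' x' Y) * price t w
     + (if long s x \<and> long s' x' then Y - (1 - x) * (1 - x') else 0)"

text \<open>Each corner serves once as the pivot; \<open>Y\<close> is symmetric in the three corners
  and therefore shared.\<close>

definition triangle_excess :: "bool \<Rightarrow> real \<Rightarrow> bool \<Rightarrow> real \<Rightarrow> bool \<Rightarrow> real \<Rightarrow> real \<Rightarrow> real" where
  "triangle_excess s x s' x' t w Y =
     excess s x s' x' Y t w + excess s x t w Y s' x' + excess s' x' t w Y s x"

lemma excess_commute: "excess s x s' x' Y t w = excess s' x' s x Y t w"
  by (auto simp: excess_def incl2_def mult.commute add.commute)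

lemma triangle_excess_swap: "triangle_excess s x s' x' t w Y = triangle_excess s' x' s x t w Y"
  by (simp add: triangle_excess_def excess_commute[of s' x' s x])

lemma triangle_excess_swap': "triangle_excess s x s' x' t w Y = triangle_excess s x t w s' x' Y"
  by (simp add: triangle_excess_def excess_commute[of s' x' t w])

lemma budget_nonneg: "0 \<le> x \<Longrightarrow> 0 \<le> budget x"
  by (simp add: budget_def)

text \<open>\<open>budget\<close> is convex: the gap to its tangent at \<open>t\<close> is a square
  over a positive denominator. Tangents turn the rational prices into linear ones, so that the case
  analysis becomes polynomial.\<close>

lemma budget_tangent:
  assumes "0 \<le> x" "0 \<le> t"
  shows "23/4 * (t * (2 + t) * x - t\<^sup>2) / (1 + t)\<^sup>2 \<le> budget x"
proof -
  have "budget x - 23/4 * (t * (2 + t) * x - t\<^sup>2) / (1 + t)\<^sup>2 = 23/4 * (x - t)\<^sup>2 / ((1 + x) * (1 + t)\<^sup>2)"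
    using assms unfolding budget_def by (simp add: divide_simps) (simp add: algebra_simps power2_eq_square)
  moreover have "0 \<le> 23/4 * (x - t)\<^sup>2 / ((1 + x) * (1 + t)\<^sup>2)" using assms by simp
  ultimately show ?thesis by linarith
qed

text \<open>The minus price is concave. This quadratic meets it at 0 and touches it at 1, the gap
  being \<open>23/16 * x * (1 - x)\<^sup>2 / (1 + x)\<close>.\<close>

lemma minus_price_lower:
  assumes "0 \<le> x" "x \<le> 1"
  shows "23/8 * ((1 - x) * (1 + x/2)) \<le> 23/8 - budget x"
proof -
  have "23/8 - budget x - 23/8 * ((1 - x) * (1 + x/2)) = 23/16 * (x * (1 - x) * (1 - x)) / (1 + x)"
    using assms unfolding budget_def by (simp add: divide_simps) (simp add: algebra_simps power2_eq_square)
  moreover have "0 \<le> 23/16 * (x * (1 - x) * (1 - x)) / (1 + x)" using assms by simp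
  ultimately show ?thesis by linarith
qed

lemma minus_price_ge:
  assumes "0 \<le> x" "x \<le> 1"
  shows "23/8 * (1 - x) \<le> 23/8 - budget x"
proof -
  have "(1 - x) * 1 \<le> (1 - x) * (1 + x/2)" using assms by (intro mult_left_mono) auto
  then show ?thesis using minus_price_lower[OF assms] by simp
qed

lemma budget_le: "0 \<le> x \<Longrightarrow> x \<le> 1 \<Longrightarrow> budget x \<le> 23/8 * x"
  using minus_price_ge[of x] by simp

text \<open>This is the probability that at least one of two long neighbours joins: neither joins
  with probability \<open>a + b - 1 + Y\<close> in the joint mode and
  \<open>a\<^sup>2 * b\<^sup>2\<close> in the independent mode. Its sign allows the price it
  multiplies to be replaced by a lower bound.\<close>

lemma long_pair_cover_nonneg:
  fixes a b Y :: real
  assumes "0 \<le> a" "a \<le> 1" "0 \<le> b" "b \<le> 1" "0 \<le> Y" "Y \<le> 1 - a" "Y \<le> 1 - b"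
  shows "0 \<le> 1 - 7/10 * (a + b - 1 + Y) - 3/10 * (a\<^sup>2 * b\<^sup>2)"
proof -
  have "a\<^sup>2 * b\<^sup>2 \<le> 1" using assms by (simp add: mult_le_one power_le_one)
  moreover have "a + b - 1 + Y \<le> 1" using assms by argo
  ultimately have "7/10 * (a + b - 1 + Y) + 3/10 * (a\<^sup>2 * b\<^sup>2) \<le> 7/10 * 1 + 3/10 * 1"
    by (intro add_mono mult_left_mono) auto
  then show ?thesis by argo
qed

lemma excess_long_long_plus:
  assumes "3/10 < a" "3/10 < b"
  shows "excess True a True b Y True c =
    (1 - 7/10 * (a + b - 1 + Y) - 3/10 * (a\<^sup>2 * b\<^sup>2)) * (1 - budget c)
     - 7/10 * Y - 3/10 * ((1 - a\<^sup>2) * (1 - b\<^sup>2)) + Y - (1 - a) * (1 - b)"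
  using assms by (simp add: excess_def incl2_def incl_def long_def price_def) (simp add: field_simps power2_eq_square)

lemma triangle_long3:
  assumes "3/10 < x1" "3/10 < x2" "3/10 < x3"
    "0 \<le> Y" "Y \<le> 1 - x1" "Y \<le> 1 - x2" "Y \<le> 1 - x3"
    "1 - x1 - x2 \<le> Y" "1 - x1 - x3 \<le> Y" "1 - x2 - x3 \<le> Y"
  shows "triangle_excess True x1 True x2 True x3 Y \<le> 0"
proof -
  have b: "23/64 * (7 * x - 1) \<le> budget x" if "0 \<le> x" for x
    using budget_tangent[OF that, of "1/3"] by (simp add: field_simps power2_eq_square)
  have step: "excess True a True b Y True c \<le>
    (1 - 7/10 * (a + b - 1 + Y) - 3/10 * (a\<^sup>2 * b\<^sup>2)) * (1 - 23/64 * (7 * c - 1))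
     - 7/10 * Y - 3/10 * ((1 - a\<^sup>2) * (1 - b\<^sup>2)) + Y - (1 - a) * (1 - b)"
    if "3/10 < a" "3/10 < b" "3/10 < c" "Y \<le> 1 - a" "Y \<le> 1 - b" for a b c
    unfolding excess_long_long_plus[OF that(1,2)]
    using that assms(4) b[of c] by (intro add_mono diff_mono mult_left_mono long_pair_cover_nonneg order_refl) auto
  show ?thesis unfolding triangle_excess_def
    by (rule order_trans[OF add_mono[OF add_mono[OF step step] step] certificate_plus3]) (use assms in simp_all)
qed

lemma excess_long_long_minus:
  assumes "3/10 < a" "3/10 < b"
  shows "excess True a True b Y False c =
    17/10 * Y + 3/10 * ((1 - a\<^sup>2) * (1 - b\<^sup>2)) - (1 - a) * (1 - b)
     - (1 - 7/10 * (a + b - 1 + Y) - 3/10 * (a\<^sup>2 * b\<^sup>2)) * (23/8 - budget c)"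
  using assms by (simp add: excess_def incl2_def incl_def long_def price_def) (simp add: field_simps power2_eq_square)

lemma excess_long_minus_plus:
  assumes "3/10 < a"
  shows "excess True a False c Y True b =
    (1 - a * (7 + 3 * a) / 10 * c) * (1 - budget b) - (1 - a * (7 + 3 * a) / 10) * (1 - c)"
  using assms by (simp add: excess_def incl2_def incl_def long_def price_def) (simp add: field_simps power2_eq_square)

lemma miss_le_one: "0 \<le> a \<Longrightarrow> a \<le> 1 \<Longrightarrow> a * (7 + 3 * a) / 10 \<le> 1" for a :: real
proof -
  assume "0 \<le> a" "a \<le> 1"
  then have "a * (7 + 3 * a) \<le> 1 * 10" by (intro mult_mono) auto
  then show ?thesis by simp
qed

lemma miss_mult_le_one: "0 \<le> a \<Longrightarrow> a \<le> 1 \<Longrightarrow> 0 \<le> c \<Longrightarrow> c \<le> 1 \<Longrightarrow> a * (7 + 3 * a) / 10 * c \<le> 1" for a c :: real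
  using miss_le_one[of a] by (intro mult_le_one) auto

lemma triangle_long2_minus:
  assumes x: "3/10 < x1" "x1 \<le> x2" "0 \<le> x3"
    and Y: "0 \<le> Y" "Y \<le> 1 - x1" "Y \<le> 1 - x2" "Y \<le> 1 - x3"
      "1 - x1 - x2 \<le> Y" "1 - x1 - x3 \<le> Y" "1 - x2 - x3 \<le> Y"
  shows "triangle_excess True x1 True x2 False x3 Y \<le> 0"
proof -
  \<comment> \<open>\<open>E\<close> bounds the pivot between the two long edges as a function of
    the joint inclusion; \<open>P\<close> bounds the two other pivots, which do not depend on
    it.\<close>
  define E where "E = (\<lambda>Z. 17/10 * Z + 3/10 * ((1 - x1\<^sup>2) * (1 - x2\<^sup>2)) - (1 - x1) * (1 - x2)
     - (1 - 7/10 * (x1 + x2 - 1 + Z) - 3/10 * (x1\<^sup>2 * x2\<^sup>2)) * (23/8 * ((1 - x3) * (1 + x3/2))))"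
  define P where "P = (\<lambda>a b. (1 - a * (7 + 3 * a) / 10 * x3) * (1 - 23/36 * (5 * b - 1))
     - (1 - a * (7 + 3 * a) / 10) * (1 - x3))"
  have b: "23/36 * (5 * x - 1) \<le> budget x" if "0 \<le> x" for x
    using budget_tangent[OF that, of "1/2"] by (simp add: field_simps power2_eq_square)
  have "x1\<^sup>2 \<le> 1" "x2\<^sup>2 \<le> 1" using x Y by (auto simp: power_le_one)
  have "excess True x1 True x2 Y False x3 \<le> E Y"
    unfolding excess_long_long_minus[OF x(1) less_le_trans[OF x(1,2)]] E_def
    using x Y minus_price_lower[of x3] by (intro diff_mono mult_left_mono long_pair_cover_nonneg order_refl) auto
  \<comment> \<open>The coefficient of \<open>Z\<close> is 17/10 plus 7/10 of a nonnegative price.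
    Hence \<open>Y\<close> may be raised to the smaller of \<open>1 - x2\<close> and
    \<open>1 - x3\<close>, which gives the two certificate cases.\<close>
  moreover have E_mono: "E Z \<le> E Z'" if "Z \<le> Z'" for Z Z'
    unfolding E_def using that x Y \<open>x1\<^sup>2 \<le> 1\<close> \<open>x2\<^sup>2 \<le> 1\<close> by (intro diff_mono add_mono mult_left_mono mult_right_mono mult_nonneg_nonneg) auto
  moreover have "excess True a False x3 Y True b \<le> P a b" if "3/10 < a" "a \<le> 1" "3/10 < b" for a b
    unfolding excess_long_minus_plus[OF that(1)] P_def
    using that x Y b[of b] miss_mult_le_one[of a x3] by (intro diff_mono mult_left_mono order_refl) auto
  then have "excess True x1 False x3 Y True x2 \<le> P x1 x2" "excess True x2 False x3 Y True x1 \<le> P x2 x1"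
    using x Y by auto
  moreover have "E (1 - x3) + P x1 x2 + P x2 x1 \<le> 0" if "x2 \<le> x3"
    unfolding E_def P_def using certificate_plus2_minus_long[of x1 x2 x3] that x Y by (simp add: algebra_simps)
  moreover have "E (1 - x2) + P x1 x2 + P x2 x1 \<le> 0" if "x3 \<le> x2"
    unfolding E_def P_def using certificate_plus2_minus_short[of x1 x2 x3] certificate_plus2_minus_short[of x2 x1 x3] that x Y
    by (simp add: algebra_simps)
  ultimately have "x2 \<le> x3 \<Longrightarrow> ?thesis" "x3 \<le> x2 \<Longrightarrow> ?thesis"
    unfolding triangle_excess_def using E_mono[OF Y(4)] E_mono[OF Y(3)] by linarith+
  then show ?thesis by linarith
qed

lemma excess_long_short_plus:
  assumes "3/10 < a" "c \<le> 3/10"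
  shows "excess True a True c Y True b = a * (7 + 3 * a) / 10 - budget b"
  using assms by (simp add: excess_def incl2_def incl_def long_def price_def)

lemma triangle_short_long2:
  assumes x: "x1 \<le> 3/10" "3/10 < x2" "x2 \<le> x3" "0 \<le> x1"
    and Y: "0 \<le> Y" "Y \<le> 1 - x1" "Y \<le> 1 - x2" "Y \<le> 1 - x3"
      "1 - x1 - x2 \<le> Y" "1 - x1 - x3 \<le> Y" "1 - x2 - x3 \<le> Y"
  shows "triangle_excess True x1 True x2 True x3 Y \<le> 0"
proof -
  have b: "23/64 * (7 * x - 1) \<le> budget x" if "0 \<le> x" for x
    using budget_tangent[OF that, of "1/3"] by (simp add: field_simps power2_eq_square)
  have b1: "23/400 * (19 * x1 - 1) \<le> budget x1"
    using budget_tangent[OF x(4), of "1/9"] by (simp add: field_simps power2_eq_square)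
  have e: "excess True x2 True x3 Y True x1 + x2 * (7 + 3 * x2) / 10 + x3 * (7 + 3 * x3) / 10
     = 2 - 2/5 * Y - (1 - x2) * (1 - x3) - 3/5 * ((1 - x2\<^sup>2) * (1 - x3\<^sup>2))
      - (1 - 7/10 * (x2 + x3 - 1 + Y) - 3/10 * (x2\<^sup>2 * x3\<^sup>2)) * budget x1"
    using x by (subst excess_long_long_plus) (auto simp: field_simps power2_eq_square)
  have "excess True x2 True x3 Y True x1 + (x2 * (7 + 3 * x2) / 10 - budget x3) + (x3 * (7 + 3 * x3) / 10 - budget x2)
     = 2 - 2/5 * Y - (1 - x2) * (1 - x3) - 3/5 * ((1 - x2\<^sup>2) * (1 - x3\<^sup>2)) - budget x2 - budget x3
      - (1 - 7/10 * (x2 + x3 - 1 + Y) - 3/10 * (x2\<^sup>2 * x3\<^sup>2)) * budget x1"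
    using e by linarith
  also have "\<dots> \<le> 2 - 2/5 * Y - (1 - x2) * (1 - x3) - 3/5 * ((1 - x2\<^sup>2) * (1 - x3\<^sup>2))
      - 23/64 * (7 * x2 - 1) - 23/64 * (7 * x3 - 1)
      - (1 - 7/10 * (x2 + x3 - 1 + Y) - 3/10 * (x2\<^sup>2 * x3\<^sup>2)) * (23/400 * (19 * x1 - 1))"
    using x Y by (intro diff_mono order_refl mult_left_mono long_pair_cover_nonneg b b1) auto
  also have "\<dots> \<le> 0" using x Y by (intro certificate_short_long2) auto
  finally have "excess True x2 True x3 Y True x1 + (x2 * (7 + 3 * x2) / 10 - budget x3) + (x3 * (7 + 3 * x3) / 10 - budget x2) \<le> 0" .
  then show ?thesis
    unfolding triangle_excess_def excess_commute[of True x1 True]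
    using x excess_long_short_plus[of x2 x1 Y x3] excess_long_short_plus[of x3 x1 Y x2] by simp
qed

text \<open>The triangle inequality caps the long edge at 6/10, where the possible miss of the long
  neighbour is small enough for the three tangents to pay twice for it.\<close>

lemma triangle_short2_long:
  assumes x: "0 \<le> x1" "x1 \<le> 3/10" "0 \<le> x2" "x2 \<le> 3/10" "3/10 < x3"
    and "x3 \<le> x1 + x2"
  shows "triangle_excess True x1 True x2 True x3 Y \<le> 0"
proof -
  have ub: "x3 \<le> 6/10" using x assms by argo
  have b3: "23/64 * (7 * x3 - 1) \<le> budget x3"
    using budget_tangent[of x3 "1/3"] x by (simp add: field_simps power2_eq_square)
  have b: "23/144 * (11 * x - 1) \<le> budget x" if "0 \<le> x" for x
    using budget_tangent[OF that, of "1/5"] by (simp add: field_simps power2_eq_square)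
  have "x3 * (7 + 3 * x3) \<le> x3 * (44/5)" using ub x by (intro mult_left_mono) auto
  then have "2 * (x3 * (7 + 3 * x3) / 10) \<le> 23/64 * (7 * x3 - 1) + 23/144 * (11 * (x1 + x2) - 2)"
    using assms by argo
  moreover have "triangle_excess True x1 True x2 True x3 Y
    = 2 * (x3 * (7 + 3 * x3) / 10) - budget x3 - budget x1 - budget x2"
    using x by (simp add: triangle_excess_def excess_def incl2_def incl_def long_def price_def)
  ultimately show ?thesis using b3 b[OF x(1)] b[OF x(3)] by argo
qed

lemma triangle_short3:
  assumes "0 \<le> x1" "x1 \<le> 3/10" "0 \<le> x2" "x2 \<le> 3/10" "0 \<le> x3" "x3 \<le> 3/10"
  shows "triangle_excess True x1 True x2 True x3 Y \<le> 0"
  using assms budget_nonneg[of x1] budget_nonneg[of x2] budget_nonneg[of x3]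
  by (simp add: triangle_excess_def excess_def incl2_def incl_def long_def price_def)

lemma triangle_short2_minus:
  assumes x: "0 \<le> x1" "x1 \<le> 3/10" "0 \<le> x2" "x2 \<le> 3/10" "0 \<le> x3" "x3 \<le> 1"
    and "x3 \<le> x1 + x2"
  shows "triangle_excess True x1 True x2 False x3 Y \<le> 0"
proof -
  have b: "23/144 * (11 * x - 1) \<le> budget x" if "0 \<le> x" for x
    using budget_tangent[OF that, of "1/5"] by (simp add: field_simps power2_eq_square)
  have "x3\<^sup>2 \<le> 6/10 * x3" using x assms(7) unfolding power2_eq_square by (intro mult_right_mono) auto
  moreover have "(1 - x3) * (1 + x3/2) = 1 - x3/2 - x3\<^sup>2/2" by algebra
  ultimately have "1 + 2 * x3 - 23/8 * ((1 - x3) * (1 + x3/2)) - 23/144 * (11 * (x1 + x2) - 2) \<le> 0"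
    using assms by argo
  moreover note b[OF x(1)] b[OF x(3)] minus_price_lower[OF x(5,6)]
  ultimately show ?thesis using x
    by (simp add: triangle_excess_def excess_def incl2_def incl_def long_def price_def)
qed

lemma triangle_short_long_minus:
  assumes x: "0 \<le> x1" "x1 \<le> 3/10" "3/10 < x2" "x2 \<le> 1" "0 \<le> x3" "x3 \<le> 1"
    and "x3 \<le> x1 + x2" "x2 \<le> x1 + x3"
  shows "triangle_excess True x1 True x2 False x3 Y \<le> 0"
proof -
  have b2: "23/256 * (39 * x2 - 9) \<le> budget x2"
    using budget_tangent[of x2 "3/5"] x by (simp add: field_simps power2_eq_square)
  have b1: "23/144 * (11 * x1 - 1) \<le> budget x1"
    using budget_tangent[of x1 "1/5"] x by (simp add: field_simps power2_eq_square)
  have b3: "23/8 * ((1 - x3) * (1 + x3/2)) \<le> 23/8 - budget x3" using minus_price_lower x by blast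
  have "triangle_excess True x1 True x2 False x3 Y =
    1 + 2 * (1 - x2 * (7 + 3 * x2) / 10) * x3 - (23/8 - budget x3) - budget x2
     - (1 - x2 * (7 + 3 * x2) / 10 * x3) * budget x1"
    using x by (simp add: triangle_excess_def excess_def incl2_def incl_def long_def price_def) (simp add: field_simps)
  also have "\<dots> \<le> 1 + 2 * (1 - x2 * (7 + 3 * x2) / 10) * x3 - 23/8 * ((1 - x3) * (1 + x3/2)) - 23/256 * (39 * x2 - 9)
     - (1 - x2 * (7 + 3 * x2) / 10 * x3) * (23/144 * (11 * x1 - 1))"
    using x b1 b2 b3 miss_mult_le_one[of x2 x3] by (intro diff_mono order_refl mult_left_mono) auto
  also have "\<dots> \<le> 0" using assms by (intro certificate_short_long_minus) auto
  finally show ?thesis .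
qed

lemma triangle_short_minus2:
  assumes x: "0 \<le> x1" "x1 \<le> 3/10" "0 \<le> x2" "x2 \<le> 1" "0 \<le> x3" "x3 \<le> 1"
  shows "triangle_excess True x1 False x2 False x3 Y \<le> 0"
proof -
  have "0 \<le> (1 - x2 * x3) * budget x1" using x budget_nonneg by (intro mult_nonneg_nonneg) (auto simp: mult_le_one)
  moreover have "0 \<le> (1 - x2) * (1 - x3)" using x by simp
  moreover note minus_price_ge[OF x(3,4)] minus_price_ge[OF x(5,6)]
  moreover have "triangle_excess True x1 False x2 False x3 Y =
     2 * (1 - x2) + 2 * (1 - x3) - 2 * ((1 - x2) * (1 - x3)) - (23/8 - budget x2) - (23/8 - budget x3)
     - (1 - x2 * x3) * budget x1"
    using x by (simp add: triangle_excess_def excess_def incl2_def incl_def long_def price_def) (simp add: field_simps)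
  ultimately show ?thesis using x by argo
qed

lemma triangle_long_minus2:
  assumes x: "3/10 < x1" "x1 \<le> 1" "0 \<le> x2" "x2 \<le> 1" "0 \<le> x3" "x3 \<le> 1"
  shows "triangle_excess True x1 False x2 False x3 Y \<le> 0"
proof -
  define p where "p = 1 - x1 * (7 + 3 * x1) / 10"
  have p: "0 \<le> p" "p \<le> 1" using miss_le_one[of x1] x by (auto simp: p_def)
  have b: "23/36 * (5 * x1 - 1) \<le> budget x1"
    using budget_tangent[of x1 "1/2"] x by (simp add: field_simps power2_eq_square)
  have "x1 * (7 + 3 * x1) \<le> x1 * 10" using x by (intro mult_left_mono) auto
  \<comment> \<open>15/8 is 23/8 - 1; with it the whole bound below factors through
    \<open>(1 - x2) * (1 - x3)\<close>.\<close>
  then have "1 - budget x1 \<le> 15/8 * p" unfolding p_def using b x by argo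
  moreover have d: "0 \<le> 1 - x2 * x3" using x by (simp add: mult_le_one)
  ultimately have "(1 - x2 * x3) * (1 - budget x1) \<le> (1 - x2 * x3) * (15/8 * p)" by (intro mult_left_mono)
  moreover have "(1 - (1 - p) * x) * (23/8 * (1 - y)) \<le> (1 - (1 - p) * x) * (23/8 - budget y)"
    if "0 \<le> x" "x \<le> 1" "0 \<le> y" "y \<le> 1" for x y
    using that p minus_price_ge[of y] by (intro mult_left_mono) (auto simp: mult_le_one)
  note this[OF x(3-6)] this[OF x(5,6,3,4)]
  moreover have "p * (1 - x2) + p * (1 - x3) + (1 - x2 * x3) * (15/8 * p) - (1 - x2) * (1 - x3)
      - (1 - (1 - p) * x2) * (23/8 * (1 - x3)) - (1 - (1 - p) * x3) * (23/8 * (1 - x2)) \<le> 0"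
  proof -
    have "p * (1 - x2) + p * (1 - x3) + (1 - x2 * x3) * (15/8 * p) - (1 - x2) * (1 - x3)
      - (1 - (1 - p) * x2) * (23/8 * (1 - x3)) - (1 - (1 - p) * x3) * (23/8 * (1 - x2))
      = - ((1 - x2) * (1 - x3) * (1 + 23/4 * (1 - p) + 15/8 * p))" by algebra
    then show ?thesis using p x by (simp add: mult_nonneg_nonneg)
  qed
  moreover have "triangle_excess True x1 False x2 False x3 Y =
     p * (1 - x2) + p * (1 - x3) + (1 - x2 * x3) * (1 - budget x1) - (1 - x2) * (1 - x3)
      - (1 - (1 - p) * x2) * (23/8 - budget x3) - (1 - (1 - p) * x3) * (23/8 - budget x2)"
    using x by (simp add: triangle_excess_def excess_def incl2_def incl_def long_def price_def p_def) (simp add: field_simps)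
  ultimately show ?thesis by argo
qed

text \<open>Since \<open>1 - a * b\<close> is at least both \<open>1 - a\<close> and
  \<open>1 - b\<close>, it is at least their average. With the average the sum collapses to the
  second elementary symmetric polynomial of the \<open>1 - xi\<close>, times
  \<open>1 - 23/8\<close>.\<close>

lemma triangle_minus3:
  assumes x: "0 \<le> x1" "x1 \<le> 1" "0 \<le> x2" "x2 \<le> 1" "0 \<le> x3" "x3 \<le> 1"
  shows "triangle_excess False x1 False x2 False x3 Y \<le> 0"
proof -
  have "(1 - a * b) * (23/8 - budget c) \<ge> ((1 - a) + (1 - b)) / 2 * (23/8 * (1 - c))"
    if "0 \<le> a" "a \<le> 1" "0 \<le> b" "b \<le> 1" "0 \<le> c" "c \<le> 1" for a b c
  proof (intro mult_mono)
    have "a * b \<le> a * 1" "a * b \<le> 1 * b" using that by (intro mult_mono; simp)+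
    then show "((1 - a) + (1 - b)) / 2 \<le> 1 - a * b" by simp
    show "0 \<le> 1 - a * b" using that by (simp add: mult_le_one)
  qed (use that minus_price_ge in auto)
  from this[of x1 x2 x3] this[of x1 x3 x2] this[of x2 x3 x1]
  have "(1 - x1) * (1 - x2) - (1 - x1 * x2) * (23/8 - budget x3)
      + ((1 - x1) * (1 - x3) - (1 - x1 * x3) * (23/8 - budget x2))
      + ((1 - x2) * (1 - x3) - (1 - x2 * x3) * (23/8 - budget x1))
    \<le> (1 - x1) * (1 - x2) - ((1 - x1) + (1 - x2)) / 2 * (23/8 * (1 - x3))
      + ((1 - x1) * (1 - x3) - ((1 - x1) + (1 - x3)) / 2 * (23/8 * (1 - x2)))
      + ((1 - x2) * (1 - x3) - ((1 - x2) + (1 - x3)) / 2 * (23/8 * (1 - x1)))"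
    using x by (intro add_mono diff_mono order_refl) auto
  also have "\<dots> = ((1 - x1) * (1 - x2) + (1 - x1) * (1 - x3) + (1 - x2) * (1 - x3)) * (1 - 23/8)" by algebra
  also have "(1 - x1) * (1 - x2) - (1 - x1 * x2) * (23/8 - budget x3)
      + ((1 - x1) * (1 - x3) - (1 - x1 * x3) * (23/8 - budget x2))
      + ((1 - x2) * (1 - x3) - (1 - x2 * x3) * (23/8 - budget x1)) = triangle_excess False x1 False x2 False x3 Y"
    by (simp add: triangle_excess_def excess_def incl2_def incl_def long_def price_def) (simp add: field_simps)
  finally have *: "triangle_excess False x1 False x2 False x3 Y \<le>
     ((1 - x1) * (1 - x2) + (1 - x1) * (1 - x3) + (1 - x2) * (1 - x3)) * (1 - 23/8)" .
  have "0 \<le> (1 - x1) * (1 - x2) + (1 - x1) * (1 - x3) + (1 - x2) * (1 - x3)" using x by simp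
  then have "((1 - x1) * (1 - x2) + (1 - x1) * (1 - x3) + (1 - x2) * (1 - x3)) * (1 - 23/8) \<le> 0"
    by (intro mult_nonneg_nonpos) auto
  with * show ?thesis by linarith
qed

lemma triangle_plus3:
  assumes "0 \<le> a" "0 \<le> b" "0 \<le> c" "a \<le> b" "b \<le> c"
    and "0 \<le> Y" "Y \<le> 1 - a" "Y \<le> 1 - b" "Y \<le> 1 - c"
    and "1 - a - b \<le> Y" "1 - a - c \<le> Y" "1 - b - c \<le> Y"
  shows "triangle_excess True a True b True c Y \<le> 0"
proof -
  consider "c \<le> 3/10" | "b \<le> 3/10" "3/10 < c" | "a \<le> 3/10" "3/10 < b" | "3/10 < a" by linarith
  then show ?thesis
  proof cases
    case 1 then show ?thesis using assms by (intro triangle_short3) auto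
  next
    case 2 then show ?thesis using assms by (intro triangle_short2_long) auto
  next
    case 3 then show ?thesis using assms by (intro triangle_short_long2) auto
  next
    case 4 then show ?thesis using assms by (intro triangle_long3) auto
  qed
qed

lemma triangle_plus2_minus:
  assumes "0 \<le> a" "0 \<le> b" "0 \<le> c" "a \<le> b"
    and "0 \<le> Y" "Y \<le> 1 - a" "Y \<le> 1 - b" "Y \<le> 1 - c"
    and "1 - a - b \<le> Y" "1 - a - c \<le> Y" "1 - b - c \<le> Y"
  shows "triangle_excess True a True b False c Y \<le> 0"
proof -
  consider "b \<le> 3/10" | "a \<le> 3/10" "3/10 < b" | "3/10 < a" by linarith
  then show ?thesis
  proof cases
    case 1 then show ?thesis using assms by (intro triangle_short2_minus) auto
  next
    case 2 then show ?thesis using assms by (intro triangle_short_long_minus) auto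
  next
    case 3 then show ?thesis using assms by (intro triangle_long2_minus) auto
  qed
qed

lemma triangle_plus_minus2:
  assumes "0 \<le> a" "0 \<le> b" "0 \<le> c" "a \<le> 1" "b \<le> 1" "c \<le> 1"
  shows "triangle_excess True a False b False c Y \<le> 0"
  using assms triangle_short_minus2[of a b c Y] triangle_long_minus2[of a b c Y] by (cases "a \<le> 3/10") simp_all

text \<open>The hypotheses describe the masses of sets meeting three vertices. An upper and a lower
  bound on \<open>Y\<close> together yield each triangle inequality, for instance
  \<open>x3 \<le> x1 + x2\<close>.\<close>

theorem triangle_excess_nonpos:
  assumes nonneg: "0 \<le> x1" "0 \<le> x2" "0 \<le> x3" "0 \<le> Y"
    and upper: "Y \<le> 1 - x1" "Y \<le> 1 - x2" "Y \<le> 1 - x3"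
    and lower: "1 - x1 - x2 \<le> Y" "1 - x1 - x3 \<le> Y" "1 - x2 - x3 \<le> Y"
  shows "triangle_excess s1 x1 s2 x2 s3 x3 Y \<le> 0"
proof -
  \<comment> \<open>Admissibility is symmetric in the three edges, so lengths can be sorted among
    edges of equal sign and signs can be brought into a standard order.\<close>
  define adm where "adm a b c \<longleftrightarrow> 0 \<le> a \<and> 0 \<le> b \<and> 0 \<le> c \<and> Y \<le> 1 - a \<and> Y \<le> 1 - b \<and> Y \<le> 1 - c \<and>
    1 - a - b \<le> Y \<and> 1 - a - c \<le> Y \<and> 1 - b - c \<le> Y" for a b c
  have plus_le: "triangle_excess True a True b True c Y \<le> 0" if "adm a b c" "a \<le> b" "b \<le> c" for a b c
    using that nonneg(4) triangle_plus3[of a b c Y] by (simp add: adm_def)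
  have perm: "adm a c b" "adm b a c" "adm b c a" "adm c a b" "adm c b a" if "adm a b c" for a b c
    using that unfolding adm_def by auto
  have swaps: "triangle_excess s a t b u c Y = triangle_excess s a u c t b Y"
      "triangle_excess s a t b u c Y = triangle_excess t b s a u c Y"
      "triangle_excess s a t b u c Y = triangle_excess t b u c s a Y"
      "triangle_excess s a t b u c Y = triangle_excess u c s a t b Y"
      "triangle_excess s a t b u c Y = triangle_excess u c t b s a Y" for s a t b u c
    by (simp_all add: triangle_excess_def excess_commute)
  have plus: "triangle_excess True a True b True c Y \<le> 0" if "adm a b c" for a b c
  proof -
    consider "a \<le> b" "b \<le> c" | "a \<le> c" "c \<le> b" | "b \<le> a" "a \<le> c" | "b \<le> c" "c \<le> a" | "c \<le> a" "a \<le> b" | "c \<le> b" "b \<le> a"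
      using linear[of a b] linear[of b c] linear[of a c] by blast
    then show ?thesis
    proof cases
      case 1 then show ?thesis using plus_le that by blast
    next
      case 2 then show ?thesis using plus_le[OF perm(1)[OF that]] swaps(1) by metis
    next
      case 3 then show ?thesis using plus_le[OF perm(2)[OF that]] swaps(2) by metis
    next
      case 4 then show ?thesis using plus_le[OF perm(3)[OF that]] swaps(3) by metis
    next
      case 5 then show ?thesis using plus_le[OF perm(4)[OF that]] swaps(4) by metis
    next
      case 6 then show ?thesis using plus_le[OF perm(5)[OF that]] swaps(5) by metis
    qed
  qed
  have pm_le: "triangle_excess True a True b False c Y \<le> 0" if "adm a b c" "a \<le> b" for a b c
    using that nonneg(4) triangle_plus2_minus[of a b c Y] by (simp add: adm_def)
  have pm: "triangle_excess True a True b False c Y \<le> 0" if "adm a b c" for a b c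
  proof (cases "a \<le> b")
    case True then show ?thesis using pm_le that by blast
  next
    case False then show ?thesis using pm_le[OF perm(2)[OF that]] swaps(2)[of True a True b] by simp
  qed
  have mm: "triangle_excess True a False b False c Y \<le> 0" if "adm a b c" for a b c
    using that nonneg(4) triangle_plus_minus2[of a b c Y] by (simp add: adm_def)
  have mmm: "triangle_excess False a False b False c Y \<le> 0" if "adm a b c" for a b c
    using that nonneg(4) triangle_minus3[of a b c Y] by (simp add: adm_def)
  have a: "adm x1 x2 x3" using assms unfolding adm_def by auto
  show ?thesis
  proof (cases s1; cases s2; cases s3)
    assume "s1" "s2" "s3" then show ?thesis using plus[OF a] by simp
  next
    assume "s1" "s2" "\<not> s3" then show ?thesis using pm[OF a] by simp
  next
    assume "s1" "\<not> s2" "s3" then show ?thesis using pm[OF perm(1)[OF a]] swaps(1)[of s1 x1 s2 x2] by simp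
  next
    assume "s1" "\<not> s2" "\<not> s3" then show ?thesis using mm[OF a] by simp
  next
    assume "\<not> s1" "s2" "s3" then show ?thesis using pm[OF perm(3)[OF a]] swaps(3)[of s1 x1 s2 x2] by simp
  next
    assume "\<not> s1" "s2" "\<not> s3" then show ?thesis using mm[OF perm(2)[OF a]] swaps(2)[of s1 x1 s2 x2] by simp
  next
    assume "\<not> s1" "\<not> s2" "s3" then show ?thesis using mm[OF perm(4)[OF a]] swaps(4)[of s1 x1 s2 x2] by simp
  next
    assume "\<not> s1" "\<not> s2" "\<not> s3" then show ?thesis using mmm[OF a] by simp
  qed
qed

section \<open>Expectations over finite supports and elementary random choices\<close>

abbreviation expect :: "'a pmf \<Rightarrow> ('a \<Rightarrow> real) \<Rightarrow> real" where
  "expect \<equiv> measure_pmf.expectation"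

lemma expect_bind:
  assumes "finite (set_pmf p)" "\<And>x. x \<in> set_pmf p \<Longrightarrow> finite (set_pmf (f x))"
  shows "expect (p \<bind> f) g = expect p (\<lambda>x. expect (f x) g)"
  by (subst pmf_expectation_bind[where A = "set_pmf p"])
    (use assms in \<open>simp_all add: integral_measure_pmf[of "set_pmf p"]\<close>)

lemma finite_integrable: "finite (set_pmf p) \<Longrightarrow> integrable (measure_pmf p) (f :: _ \<Rightarrow> real)"
  by (rule integrable_measure_pmf_finite)

lemma expect_mono:
  assumes "finite (set_pmf p)" "\<And>x. x \<in> set_pmf p \<Longrightarrow> f x \<le> g x"
  shows "expect p f \<le> expect p g"
  by (rule integral_mono_AE) (use assms in \<open>auto intro: finite_integrable simp: AE_measure_pmf_iff\<close>)

lemma expect_cong: "(\<And>x. x \<in> set_pmf p \<Longrightarrow> f x = g x) \<Longrightarrow> expect p f = expect p g" for f g :: "_ \<Rightarrow> real"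
  by (rule integral_cong_AE) (auto simp: AE_measure_pmf_iff)

lemma expect_le_const:
  assumes "finite (set_pmf p)" "\<And>x. x \<in> set_pmf p \<Longrightarrow> f x \<le> c"
  shows "expect p f \<le> c"
  using expect_mono[OF assms(1), of f "\<lambda>_. c"] assms(2) by simp

lemma expect_bernoulli: "0 \<le> p \<Longrightarrow> p \<le> 1 \<Longrightarrow> expect (bernoulli_pmf p) f = p * f True + (1 - p) * f False"
  by (simp add: integral_measure_pmf[of "{True, False}"] UNIV_bool)

lemma expect_pmf_of_set: "finite S \<Longrightarrow> S \<noteq> {} \<Longrightarrow> expect (pmf_of_set S) f = (\<Sum>x\<in>S. f x) / card S"
  by (rule integral_pmf_of_set)

primrec iterate_pmf :: "nat \<Rightarrow> ('s \<Rightarrow> 's pmf) \<Rightarrow> 's \<Rightarrow> 's pmf" where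
  "iterate_pmf 0 f s = return_pmf s"
| "iterate_pmf (Suc k) f s = f s \<bind> iterate_pmf k f"

lemma set_iterate_pmf:
  assumes "\<And>s s'. I s \<Longrightarrow> s' \<in> set_pmf (f s) \<Longrightarrow> I s'" "I s" "s' \<in> set_pmf (iterate_pmf k f s)"
  shows "I s'"
  using assms(2,3) by (induction k arbitrary: s) (auto dest: assms(1))

lemma finite_iterate_pmf:
  assumes "\<And>s. finite (set_pmf (f s))"
  shows "finite (set_pmf (iterate_pmf k f s))"
  by (induction k arbitrary: s) (auto simp: assms)

text \<open>\<open>g i\<close> is a bound valid with \<open>i\<close> steps still to go. Counting
  remaining steps lets a bound that decays geometrically be handled like a supermartingale.\<close>

lemma expect_iterate_pmf_le:
  assumes fin: "\<And>s. finite (set_pmf (f s))"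
    and inv: "\<And>s s'. I s \<Longrightarrow> s' \<in> set_pmf (f s) \<Longrightarrow> I s'"
    and step: "\<And>i s. I s \<Longrightarrow> expect (f s) (g i) \<le> g (Suc i) s"
    and "I s"
  shows "expect (iterate_pmf k f s) (g 0) \<le> g k s"
  using \<open>I s\<close>
proof (induction k arbitrary: s)
  case (Suc k)
  have "expect (iterate_pmf (Suc k) f s) (g 0) = expect (f s) (\<lambda>s'. expect (iterate_pmf k f s') (g 0))"
    by (simp add: expect_bind fin finite_iterate_pmf)
  also have "\<dots> \<le> expect (f s) (g k)"
    using Suc inv by (intro expect_mono fin) auto
  also have "\<dots> \<le> g (Suc k) s" by (rule step) fact
  finally show ?case .
qed simp

text \<open>A weighted choice made of coin tosses, which is all that the machine offers:
  \<open>r\<close> is the mass not yet rejected. With positive weights of total \<open>r\<close> the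
  last coin has bias 1, so the default 0 of the empty list is never returned. The clamping is that
  of the \<open>Flip\<close> instruction.\<close>

fun pick_pmf :: "(nat \<Rightarrow> real) \<Rightarrow> nat list \<Rightarrow> real \<Rightarrow> nat pmf" where
  "pick_pmf w [] r = return_pmf 0"
| "pick_pmf w (j # js) r =
     bernoulli_pmf (max 0 (min 1 (w j / r))) \<bind> (\<lambda>b. if b then return_pmf j else pick_pmf w js (r - w j))"

lemma finite_pick_pmf [simp]: "finite (set_pmf (pick_pmf w js r))"
  by (induction js arbitrary: r) (auto intro: finite_subset[OF subset_UNIV])

lemma expect_pick_pmf:
  assumes "\<And>j. j \<in> set js \<Longrightarrow> 0 < w j" "r = (\<Sum>j\<leftarrow>js. w j)" "js \<noteq> []"
  shows "expect (pick_pmf w js r) f = (\<Sum>j\<leftarrow>js. w j * f j) / r"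
  using assms
proof (induction js arbitrary: r)
  case (Cons j js)
  have sum_nonneg: "0 \<le> (\<Sum>j\<leftarrow>js. w j)" using Cons.prems(1) by (intro sum_list_nonneg) (auto intro: less_imp_le)
  have r: "0 < r" "w j \<le> r" using Cons.prems sum_nonneg by (auto intro: add_pos_nonneg)
  have "expect (pick_pmf w (j # js) r) f = w j / r * f j + (1 - w j / r) * expect (pick_pmf w js (r - w j)) f"
    using r Cons.prems(1)[of j] by (simp add: expect_bind expect_bernoulli)
  also have "\<dots> = (\<Sum>j\<leftarrow>j # js. w j * f j) / r"
  proof (cases js)
    case Nil then show ?thesis using Cons.prems r by simp
  next
    case (Cons k ks)
    then have ne: "js \<noteq> []" by simp
    have "0 < w k" "0 \<le> (\<Sum>j\<leftarrow>ks. w j)" using Cons.prems(1) Cons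
      by (auto intro!: sum_list_nonneg simp: less_imp_le)
    then have "0 < (\<Sum>j\<leftarrow>js. w j)" using Cons by simp
    then have pos: "0 < r - w j" using Cons.prems(2) by simp
    have "expect (pick_pmf w js (r - w j)) f = (\<Sum>j\<leftarrow>js. w j * f j) / (r - w j)"
      using Cons.prems ne by (intro Cons.IH) auto
    then show ?thesis using pos r by (simp add: field_simps)
  qed
  finally show ?case .
qed simp

text \<open>The probability of \<open>k\<close> is the expectation of its indicator, which the
  weighted-average formula evaluates to 0 for \<open>k\<close> outside the list.\<close>

lemma set_pick_pmf:
  assumes "\<And>j. j \<in> set js \<Longrightarrow> 0 < w j" "r = (\<Sum>j\<leftarrow>js. w j)" "js \<noteq> []" "k \<in> set_pmf (pick_pmf w js r)"
  shows "k \<in> set js"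
proof (rule ccontr)
  assume "k \<notin> set js"
  then have "(\<Sum>j\<leftarrow>js. w j * indicator {k} j) = (\<Sum>j\<leftarrow>js. 0)" by (intro arg_cong[of _ _ sum_list] map_cong) (auto simp: indicator_def)
  then have "expect (pick_pmf w js r) (indicator {k}) = 0" using expect_pick_pmf[OF assms(1-3), of "indicator {k}"] by simp
  then have "pmf (pick_pmf w js r) k = 0" by (simp add: pmf.rep_eq)
  with assms(4) show False by (simp add: set_pmf_iff)
qed

lemma expect_Pi_pmf_pair:
  assumes "finite S" "v \<in> S" "t \<in> S" "v \<noteq> t" "\<And>v. v \<in> S \<Longrightarrow> 0 \<le> p v" "\<And>v. v \<in> S \<Longrightarrow> p v \<le> 1"
  shows "expect (Pi_pmf S False (\<lambda>v. bernoulli_pmf (p v))) (\<lambda>B. of_bool (B v) * of_bool (B t)) = p v * p t"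
proof -
  have prod_pair: "(\<Prod>s\<in>S. if s \<in> {v, t} then g s else 1) = g v * g t" for g :: "_ \<Rightarrow> real"
  proof -
    have "(\<Prod>s\<in>S. if s \<in> {v, t} then g s else 1) = (\<Prod>s\<in>{v, t}. if s \<in> {v, t} then g s else 1)"
      using assms(1-3) by (intro prod.mono_neutral_right) auto
    then show ?thesis using assms(4) by simp
  qed
  have "of_bool (B v) * of_bool (B t) = (\<Prod>s\<in>S. if s \<in> {v, t} then of_bool (B s) else 1 :: real)" for B
    using prod_pair[of "\<lambda>s. of_bool (B s)"] by simp
  then have "expect (Pi_pmf S False (\<lambda>v. bernoulli_pmf (p v))) (\<lambda>B. of_bool (B v) * of_bool (B t)) =
    (\<Prod>s\<in>S. expect (bernoulli_pmf (p s)) (\<lambda>b. if s \<in> {v, t} then of_bool b else 1))"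
    by (simp only:) (rule expectation_prod_Pi_pmf, use assms in \<open>auto intro!: finite_integrable\<close>)
  also have "\<dots> = (\<Prod>s\<in>S. if s \<in> {v, t} then p s else 1)"
    using assms by (intro prod.cong) (auto simp: expect_bernoulli)
  also have "\<dots> = p v * p t" by (rule prod_pair)
  finally show ?thesis .
qed

lemma expect_Pi_pmf_single:
  assumes "finite S" "v \<in> S" "0 \<le> p v" "p v \<le> 1"
  shows "expect (Pi_pmf S False (\<lambda>v. bernoulli_pmf (p v))) (\<lambda>B. of_bool (B v)) = p v"
proof -
  have "expect (Pi_pmf S False (\<lambda>v. bernoulli_pmf (p v))) (\<lambda>B. of_bool (B v)) =
      expect (map_pmf (\<lambda>B. B v) (Pi_pmf S False (\<lambda>v. bernoulli_pmf (p v)))) of_bool"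
    by simp
  also have "\<dots> = p v" using assms by (simp only: Pi_pmf_component) (simp add: expect_bernoulli)
  finally show ?thesis .
qed

lemma finite_set_Pi_pmf: "finite S \<Longrightarrow> (\<And>v. v \<in> S \<Longrightarrow> finite (set_pmf (p v))) \<Longrightarrow> finite (set_pmf (Pi_pmf S d p))"
  by (subst set_Pi_pmf) (auto intro: finite_PiE_dflt)

section \<open>Summing the triangle inequality over an LP solution\<close>

text \<open>The triangle with corners \<open>u\<close>, \<open>u\<close>, \<open>v\<close>: the
  pivot joins itself surely, and the factor 2 counts both orders of the pair. The slack must also
  pay \<open>x * (1 - x)\<close>, the variance of a single long neighbour, which is left over from
  the diagonal of the covariances.\<close>

lemma degenerate_excess_nonpos:
  assumes "0 \<le> x" "x \<le> 1"
  shows "2 * excess True 0 s x Y s x + of_bool (long s x) * (x * (1 - x)) \<le> 0"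
proof -
  have long: "2 * (x * (7 + 3 * x) / 10 - budget x) + x * (1 - x) \<le> 0" if "3/10 < x"
  proof -
    have "23/64 * (7 * x - 1) \<le> budget x"
      using budget_tangent[of x "1/3"] assms by (simp add: field_simps power2_eq_square)
    moreover have "0 \<le> x * x" using assms by simp
    moreover have "2 * (x * (7 + 3 * x) / 10) + x * (1 - x) = 12/5 * x - 2/5 * (x * x)" by algebra
    ultimately show ?thesis using that by argo
  qed
  show ?thesis
    using assms long budget_nonneg[of x] minus_price_ge[of x]
    by (cases s; cases "3/10 < x") (simp_all add: excess_def incl2_def incl_def long_def price_def)
qed

text \<open>Cluster labels with 0 for unclustered vertices, for each set a list of members that may
  contain stale entries, and the number of list entries read so far.\<close>

type_synonym round_state = "(nat \<Rightarrow> nat) \<times> (nat \<Rightarrow> nat list) \<times> real"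

locale cluster_lp =
  fixes n m :: nat and A :: "nat \<Rightarrow> nat set" and w :: "nat \<Rightarrow> real" and \<Delta> :: real and plus :: "nat \<Rightarrow> nat \<Rightarrow> bool"
  assumes n_pos: "0 < n"
    and A_subset: "\<And>j. j < m \<Longrightarrow> A j \<subseteq> {..<n}"
    and A_nonempty: "\<And>j. j < m \<Longrightarrow> A j \<noteq> {}"
    and Delta_pos: "0 < \<Delta>"
    and w_ge: "\<And>j. j < m \<Longrightarrow> \<Delta> \<le> w j"
    and cover: "\<And>u. u < n \<Longrightarrow> (\<Sum>j | j < m \<and> u \<in> A j. w j) = 1"
    and plus_commute: "plus u v = plus v u"
    and plus_refl: "u < n \<Longrightarrow> plus u u"
begin

definition J :: "nat \<Rightarrow> nat set" where "J u = {j. j < m \<and> u \<in> A j}"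

definition sim :: "nat \<Rightarrow> nat \<Rightarrow> real" where "sim u v = (\<Sum>j\<in>J u \<inter> J v. w j)"

text \<open>The \<open>Y\<close> of the triangle analysis for three concrete vertices.\<close>

definition sim3 :: "nat \<Rightarrow> nat \<Rightarrow> nat \<Rightarrow> real" where "sim3 u v t = (\<Sum>j\<in>J u \<inter> J v \<inter> J t. w j)"

abbreviation x :: "nat \<Rightarrow> nat \<Rightarrow> real" where "x u v \<equiv> 1 - sim u v"

lemma finite_J [simp]: "finite (J u)" by (simp add: J_def)

lemma w_pos: "j < m \<Longrightarrow> 0 < w j" using w_ge[of j] Delta_pos by linarith

lemma w_nonneg: "j \<in> J u \<Longrightarrow> 0 \<le> w j" using w_pos by (auto simp: J_def intro: less_imp_le)

lemma sum_J: "u < n \<Longrightarrow> (\<Sum>j\<in>J u. w j) = 1" using cover by (simp add: J_def)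

lemma J_nonempty: "u < n \<Longrightarrow> J u \<noteq> {}" using sum_J[of u] by auto

lemma sim_commute: "sim u v = sim v u" by (simp add: sim_def Int_commute)

lemma sim_nonneg: "0 \<le> sim u v" unfolding sim_def by (intro sum_nonneg) (auto intro: w_nonneg)

lemma sim_le_1: "u < n \<Longrightarrow> sim u v \<le> 1"
  unfolding sim_def sum_J[symmetric] by (intro sum_mono2) (auto intro: w_nonneg)

lemma sim_self: "u < n \<Longrightarrow> sim u u = 1" by (simp add: sim_def sum_J)

lemma sim_eq: "sim u v = (\<Sum>j\<in>J u. w j * of_bool (v \<in> A j))"
  unfolding sim_def by (intro sum.mono_neutral_cong_left) (auto simp: J_def)

lemma sim3_eq: "sim3 u v t = (\<Sum>j\<in>J u. w j * (of_bool (v \<in> A j) * of_bool (t \<in> A j)))"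
  unfolding sim3_def by (intro sum.mono_neutral_cong_left) (auto simp: J_def)

lemma sim3_commute: "sim3 u v t = sim3 v u t" "sim3 u v t = sim3 u t v"
  by (simp_all add: sim3_def Int_commute Int_left_commute Int_assoc)

lemma sim3_nonneg: "0 \<le> sim3 u v t" unfolding sim3_def by (intro sum_nonneg) (auto intro: w_nonneg)

lemma sim3_le: "sim3 u v t \<le> sim u v"
  unfolding sim3_def sim_def by (intro sum_mono2) (auto intro: w_nonneg)

text \<open>For indicators \<open>a + b - 1 \<le> a * b\<close>; averaging over the sets containing
  \<open>u\<close>, whose weights sum to 1, gives the bound.\<close>

lemma sim3_ge: "u < n \<Longrightarrow> sim u v + sim u t - 1 \<le> sim3 u v t"
proof -
  assume u: "u < n"
  have "(\<Sum>j\<in>J u. w j * (of_bool (v \<in> A j) + of_bool (t \<in> A j) - 1)) \<le> sim3 u v t"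
    unfolding sim3_eq by (intro sum_mono mult_left_mono) (auto intro: w_nonneg)
  then show ?thesis using u
    by (simp add: sim_eq sum_J algebra_simps sum.distrib sum_subtractf)
qed

definition lng :: "nat \<Rightarrow> nat \<Rightarrow> bool" where "lng u v = long (plus u v) (x u v)"

definition exc :: "nat \<Rightarrow> nat \<Rightarrow> nat \<Rightarrow> real" where
  "exc u v t = excess (plus u v) (x u v) (plus u t) (x u t) (sim3 u v t) (plus v t) (x v t)"

text \<open>The covariance of the memberships of \<open>v\<close> and \<open>t\<close> in a set
  drawn with weights \<open>w\<close> among those containing \<open>u\<close>, restricted to long
  neighbours.\<close>

definition lcov :: "nat \<Rightarrow> nat \<Rightarrow> nat \<Rightarrow> real" where
  "lcov u v t = of_bool (lng u v \<and> lng u t) * (sim3 u v t - sim u v * sim u t)"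

lemma exc_triangle:
  assumes "u < n" "v < n" "t < n"
  shows "exc u v t + exc v t u + exc t u v \<le> 0"
proof -
  have "triangle_excess (plus u v) (x u v) (plus u t) (x u t) (plus v t) (x v t) (sim3 u v t) \<le> 0"
  proof (rule triangle_excess_nonpos)
    show "1 - x u v - x u t \<le> sim3 u v t" using sim3_ge[of u v t] assms by simp
    show "1 - x u v - x v t \<le> sim3 u v t" using sim3_ge[of v u t] assms by (simp add: sim3_commute(1) sim_commute)
    show "1 - x u t - x v t \<le> sim3 u v t"
      using sim3_ge[of t u v] assms by (simp add: sim3_commute sim_commute[of t])
    show "sim3 u v t \<le> 1 - x u v" "sim3 u v t \<le> 1 - x u t" "sim3 u v t \<le> 1 - x v t"
      using sim3_le[of u v t] sim3_le[of u t v] sim3_le[of v t u] by (simp_all add: sim3_commute)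
  qed (use assms sim_le_1 sim3_nonneg in auto)
  moreover have "exc v t u = excess (plus u v) (x u v) (plus v t) (x v t) (sim3 u v t) (plus u t) (x u t)"
    unfolding exc_def by (subst excess_commute) (simp add: sim3_commute sim_commute plus_commute)
  moreover have "exc t u v = excess (plus u t) (x u t) (plus v t) (x v t) (sim3 u v t) (plus u v) (x u v)"
    unfolding exc_def by (simp add: sim3_commute sim_commute plus_commute)
  ultimately show ?thesis by (simp add: triangle_excess_def exc_def)
qed

text \<open>The double sum of a covariance matrix is the variance of the sum of the
  variables.\<close>

lemma lcov_sum_nonneg:
  assumes "finite V" "u < n"
  shows "0 \<le> (\<Sum>v\<in>V. \<Sum>t\<in>V. lcov u v t)"
proof -
  \<comment> \<open>The centred membership indicator, set to 0 for neighbours that are not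
    long.\<close>
  define g where "g v j = of_bool (lng u v) * (of_bool (v \<in> A j) - sim u v)" for v j
  have "lcov u v t = (\<Sum>j\<in>J u. w j * (g v j * g t j))" for v t
  proof -
    have "(\<Sum>j\<in>J u. w j * ((of_bool (v \<in> A j) - sim u v) * (of_bool (t \<in> A j) - sim u t)))
      = sim3 u v t - (\<Sum>j\<in>J u. w j * of_bool (v \<in> A j)) * sim u t - (\<Sum>j\<in>J u. w j * of_bool (t \<in> A j)) * sim u v
        + (\<Sum>j\<in>J u. w j) * (sim u v * sim u t)"
      unfolding sim3_eq sum_distrib_right sum.distrib[symmetric] sum_subtractf[symmetric]
      by (intro sum.cong refl) algebra
    also have "\<dots> = sim3 u v t - sim u v * sim u t"
      using assms by (simp add: sum_J flip: sim_eq)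
    finally show ?thesis
      by (cases "lng u v \<and> lng u t") (auto simp: lcov_def g_def)
  qed
  then have "(\<Sum>v\<in>V. \<Sum>t\<in>V. lcov u v t) = (\<Sum>v\<in>V. \<Sum>t\<in>V. \<Sum>j\<in>J u. w j * (g v j * g t j))" by simp
  also have "\<dots> = (\<Sum>v\<in>V. \<Sum>j\<in>J u. \<Sum>t\<in>V. w j * (g v j * g t j))"
    by (intro sum.cong refl sum.swap)
  also have "\<dots> = (\<Sum>j\<in>J u. \<Sum>v\<in>V. \<Sum>t\<in>V. w j * (g v j * g t j))"
    by (rule sum.swap)
  also have "\<dots> = (\<Sum>j\<in>J u. w j * (\<Sum>v\<in>V. g v j)\<^sup>2)"
    unfolding power2_eq_square sum_product sum_distrib_left[symmetric] ..
  also have "0 \<le> \<dots>" by (intro sum_nonneg mult_nonneg_nonneg) (auto intro: w_nonneg)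
  finally show ?thesis .
qed

lemma lcov_self: "v < n \<Longrightarrow> lcov u v v = of_bool (lng u v) * (x u v * (1 - x u v))"
  by (simp add: lcov_def sim3_def sim_def Int_assoc algebra_simps)

lemma rotate_sum3: "(\<Sum>u\<in>V. \<Sum>v\<in>V. \<Sum>t\<in>V. f u v t) = (\<Sum>u\<in>V. \<Sum>v\<in>V. \<Sum>t\<in>V. f v t u)"
  for f :: "nat \<Rightarrow> nat \<Rightarrow> nat \<Rightarrow> real"
proof -
  have "(\<Sum>u\<in>V. \<Sum>v\<in>V. \<Sum>t\<in>V. f v t u) = (\<Sum>v\<in>V. \<Sum>u\<in>V. \<Sum>t\<in>V. f v t u)" by (rule sum.swap)
  also have "\<dots> = (\<Sum>v\<in>V. \<Sum>t\<in>V. \<Sum>u\<in>V. f v t u)" by (intro sum.cong refl sum.swap)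
  finally show ?thesis by simp
qed

text \<open>Over all pivots and ordered pairs, \<open>exc - lcov\<close> is the expected change of
  the potential. Genuine triangles are paid by \<open>exc_triangle\<close>. The full covariance sum
  has the favourable sign, but it includes the pairs with \<open>v = t\<close>; this diagonal is
  moved to the degenerate triangles.\<close>

lemma exc_sum_nonpos:
  assumes "finite V" "V \<subseteq> {..<n}"
  shows "(\<Sum>u\<in>V. \<Sum>v\<in>V. \<Sum>t\<in>V. of_bool (v \<noteq> t) * (exc u v t - lcov u v t)) \<le> 0"
proof -
  define f where "f u v t = of_bool (u \<noteq> v \<and> v \<noteq> t \<and> u \<noteq> t) * exc u v t" for u v t
  \<comment> \<open>Both degenerate orders of a pair through the pivot, together with the diagonal
    covariance charged to them.\<close>
  define d where "d u v = of_bool (u \<noteq> v) * (2 * exc u u v + lcov u v v)" for u v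
  \<comment> \<open>Rotating the summation indices brings the three pivots of each triangle
    together.\<close>
  have "3 * (\<Sum>u\<in>V. \<Sum>v\<in>V. \<Sum>t\<in>V. f u v t) = (\<Sum>u\<in>V. \<Sum>v\<in>V. \<Sum>t\<in>V. f u v t + f v t u + f t u v)"
    using rotate_sum3[of f V] rotate_sum3[of "\<lambda>u v t. f v t u" V] by (simp add: sum.distrib)
  also have "\<dots> \<le> 0"
    using assms exc_triangle by (intro sum_nonpos) (auto simp: f_def subset_iff)
  finally have f: "(\<Sum>u\<in>V. \<Sum>v\<in>V. \<Sum>t\<in>V. f u v t) \<le> 0" by simp
  have d: "d u v \<le> 0" if "u \<in> V" "v \<in> V" for u v
  proof -
    have uv: "u < n" "v < n" using that assms by auto
    have "2 * excess True 0 (plus u v) (x u v) (sim3 u u v) (plus u v) (x u v) + lcov u v v \<le> 0"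
      using degenerate_excess_nonpos[of "x u v" "plus u v" "sim3 u u v"] uv sim_nonneg[of u v] sim_le_1[of u v]
      by (simp add: lcov_self lng_def)
    then show ?thesis using uv by (simp add: d_def exc_def plus_refl sim_self)
  qed
  have inner: "(\<Sum>v\<in>V. \<Sum>t\<in>V. of_bool (v \<noteq> t) * (exc u v t - lcov u v t))
     \<le> (\<Sum>v\<in>V. \<Sum>t\<in>V. f u v t) + (\<Sum>v\<in>V. d u v)" if u: "u \<in> V" for u
  proof -
    have un: "u < n" using u assms by auto
    have lu: "lcov u u t = 0" "lcov u t u = 0" for t
      using un by (auto simp: lcov_def lng_def long_def sim_self)
    have excsym: "exc u t u = exc u u t" for t
      by (simp add: exc_def sim3_commute(2)[of u t u] sim_commute[of t u] plus_commute[of t u]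
        excess_commute[of "plus u t" "x u t" "plus u u"])
    have split: "of_bool (v \<noteq> t) * exc u v t = f u v t + of_bool (v = u \<and> t \<noteq> u) * exc u u t + of_bool (t = u \<and> v \<noteq> u) * exc u u v" for v t
      using excsym[of v] by (cases "v = u"; cases "t = u"; cases "v = t") (simp_all add: f_def)
    have "(\<Sum>v\<in>V. \<Sum>t\<in>V. of_bool (v \<noteq> t) * exc u v t) = (\<Sum>v\<in>V. \<Sum>t\<in>V. f u v t)
      + (\<Sum>v\<in>V. \<Sum>t\<in>V. of_bool (v = u \<and> t \<noteq> u) * exc u u t) + (\<Sum>v\<in>V. \<Sum>t\<in>V. of_bool (t = u \<and> v \<noteq> u) * exc u u v)"
      by (simp only: split sum.distrib)
    moreover have "(\<Sum>v\<in>V. \<Sum>t\<in>V. of_bool (v = u \<and> t \<noteq> u) * exc u u t) = (\<Sum>t\<in>V. of_bool (t \<noteq> u) * exc u u t)"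
    proof -
      have "(\<Sum>v\<in>V. \<Sum>t\<in>V. of_bool (v = u \<and> t \<noteq> u) * exc u u t) = (\<Sum>v\<in>V. if v = u then \<Sum>t\<in>V. of_bool (t \<noteq> u) * exc u u t else 0)"
        by (intro sum.cong) auto
      then show ?thesis using u assms by simp
    qed
    moreover have "(\<Sum>v\<in>V. \<Sum>t\<in>V. of_bool (t = u \<and> v \<noteq> u) * exc u u v) = (\<Sum>v\<in>V. of_bool (v \<noteq> u) * exc u u v)"
    proof (rule sum.cong[OF refl])
      fix v
      have "(\<Sum>t\<in>V. of_bool (t = u \<and> v \<noteq> u) * exc u u v) = (\<Sum>t\<in>V. if t = u then of_bool (v \<noteq> u) * exc u u v else 0)"
        by (intro sum.cong) auto
      then show "(\<Sum>t\<in>V. of_bool (t = u \<and> v \<noteq> u) * exc u u v) = of_bool (v \<noteq> u) * exc u u v"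
        using u assms by simp
    qed
    moreover have "(\<Sum>v\<in>V. \<Sum>t\<in>V. of_bool (v \<noteq> t) * lcov u v t) = (\<Sum>v\<in>V. \<Sum>t\<in>V. lcov u v t) - (\<Sum>v\<in>V. lcov u v v)"
    proof -
      have "(\<Sum>t\<in>V. of_bool (v \<noteq> t) * lcov u v t) = (\<Sum>t\<in>V. lcov u v t) - lcov u v v" if "v \<in> V" for v
      proof -
        have "(\<Sum>t\<in>V. of_bool (v \<noteq> t) * lcov u v t) = (\<Sum>t\<in>V. lcov u v t - (if t = v then lcov u v v else 0))"
          by (intro sum.cong) auto
        then show ?thesis using that assms by (simp add: sum_subtractf)
      qed
      then show ?thesis by (simp add: sum_subtractf)
    qed
    moreover have "(\<Sum>v\<in>V. d u v) = 2 * (\<Sum>v\<in>V. of_bool (v \<noteq> u) * exc u u v) + (\<Sum>v\<in>V. lcov u v v)"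
    proof -
      have "d u v = 2 * (of_bool (v \<noteq> u) * exc u u v) + lcov u v v" for v
        using lu by (auto simp: d_def)
      then show ?thesis by (simp add: sum.distrib sum_distrib_left)
    qed
    ultimately show ?thesis using lcov_sum_nonneg[OF assms(1) un]
      by (simp add: sum_subtractf right_diff_distrib)
  qed
  have "(\<Sum>u\<in>V. \<Sum>v\<in>V. \<Sum>t\<in>V. of_bool (v \<noteq> t) * (exc u v t - lcov u v t))
     \<le> (\<Sum>u\<in>V. (\<Sum>v\<in>V. \<Sum>t\<in>V. f u v t) + (\<Sum>v\<in>V. d u v))"
    by (rule sum_mono) (rule inner)
  also have "\<dots> = (\<Sum>u\<in>V. \<Sum>v\<in>V. \<Sum>t\<in>V. f u v t) + (\<Sum>u\<in>V. \<Sum>v\<in>V. d u v)" by (simp add: sum.distrib)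
  also have "(\<Sum>u\<in>V. \<Sum>v\<in>V. d u v) \<le> 0" using d by (intro sum_nonpos) auto
  with f have "(\<Sum>u\<in>V. \<Sum>v\<in>V. \<Sum>t\<in>V. f u v t) + (\<Sum>u\<in>V. \<Sum>v\<in>V. d u v) \<le> 0" by linarith
  finally show ?thesis .
qed

section \<open>A potential for partial clusterings\<close>

definition live :: "(nat \<Rightarrow> nat) \<Rightarrow> nat set" where "live lab = {v. v < n \<and> lab v = 0}"

text \<open>A pair with both endpoints unclustered is charged the promise \<open>\<phi>\<close>, any
  other pair its actual cost. One labelled endpoint already decides the pair, because new clusters
  only receive labels not in use; comparing with label 0 then gives the final answer. Ordered pairs
  are summed, so a complete clustering has potential twice its cost.\<close>

definition charge :: "(nat \<Rightarrow> nat \<Rightarrow> real) \<Rightarrow> (nat \<Rightarrow> nat) \<Rightarrow> nat \<Rightarrow> nat \<Rightarrow> real" where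
  "charge \<phi> lab v t =
     (if v = t then 0 else if lab v = 0 \<and> lab t = 0 then \<phi> v t else of_bool (plus v t \<longleftrightarrow> lab v \<noteq> lab t))"

definition potential :: "(nat \<Rightarrow> nat \<Rightarrow> real) \<Rightarrow> (nat \<Rightarrow> nat) \<Rightarrow> real" where
  "potential \<phi> lab = (\<Sum>v<n. \<Sum>t<n. charge \<phi> lab v t)"

definition paint :: "nat \<Rightarrow> nat set \<Rightarrow> (nat \<Rightarrow> nat) \<Rightarrow> nat \<Rightarrow> nat" where
  "paint l C lab = (\<lambda>v. if v \<in> C then l else lab v)"

text \<open>The change of \<open>charge\<close> written as a polynomial in the two membership
  indicators. Its expectation thus needs only single and pairwise inclusion probabilities.\<close>

definition delta :: "(nat \<Rightarrow> nat \<Rightarrow> real) \<Rightarrow> nat set \<Rightarrow> nat \<Rightarrow> nat \<Rightarrow> real" where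
  "delta \<phi> C v t = (of_bool (plus v t) - \<phi> v t) * (of_bool (v \<in> C) + of_bool (t \<in> C))
     + ((if plus v t then - 2 else 1) + \<phi> v t) * (of_bool (v \<in> C) * of_bool (t \<in> C))"

lemma finite_live [simp]: "finite (live lab)" by (simp add: live_def)

lemma live_subset: "live lab \<subseteq> {..<n}" by (auto simp: live_def)

lemma potential_paint:
  assumes "C \<subseteq> live lab" "l \<noteq> 0" "C \<noteq> {} \<Longrightarrow> \<forall>v<n. lab v \<noteq> l"
  shows "potential \<phi> (paint l C lab) = potential \<phi> lab
    + (\<Sum>v\<in>live lab. \<Sum>t\<in>live lab. of_bool (v \<noteq> t) * delta \<phi> C v t)"
proof -
  have "charge \<phi> (paint l C lab) v t = charge \<phi> lab v t
      + of_bool (v \<in> live lab) * (of_bool (t \<in> live lab) * (of_bool (v \<noteq> t) * delta \<phi> C v t))"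
    if "v < n" "t < n" for v t
    using that assms by (cases "v \<in> C"; cases "t \<in> C") (auto simp: charge_def paint_def delta_def live_def subset_iff)
  then have "potential \<phi> (paint l C lab) = potential \<phi> lab
    + (\<Sum>v<n. \<Sum>t<n. of_bool (v \<in> live lab) * (of_bool (t \<in> live lab) * (of_bool (v \<noteq> t) * delta \<phi> C v t)))"
    by (simp add: potential_def sum.distrib)
  moreover have restrict: "(\<Sum>v<n. of_bool (v \<in> live lab) * h v) = (\<Sum>v\<in>live lab. h v)" for h :: "nat \<Rightarrow> real"
    by (rule sum.mono_neutral_cong_right) (use live_subset[of lab] in auto)
  ultimately show ?thesis by (simp add: restrict flip: sum_distrib_left)
qed

section \<open>The random cluster of a pivot\<close>

definition JL :: "nat \<Rightarrow> nat list" where "JL u = filter (\<lambda>j. u \<in> A j) [0..<m]"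

lemma set_JL: "set (JL u) = J u" by (auto simp: JL_def J_def)

lemma distinct_JL: "distinct (JL u)" by (simp add: JL_def)

lemma sum_list_JL: "(\<Sum>j\<leftarrow>JL u. f j) = (\<Sum>j\<in>J u. f j)" for f :: "nat \<Rightarrow> 'b::comm_monoid_add"
  by (simp add: sum_list_distinct_conv_sum_set distinct_JL set_JL)

text \<open>\<open>h\<close> selects the independent mode, and \<open>j\<close> is the common random
  set of the other mode. The threshold \<open>7/10 \<le> sim u v\<close> means distance at most
  3/10. Given \<open>h\<close> and \<open>j\<close> all vertices decide independently.\<close>

definition bias :: "bool \<Rightarrow> nat \<Rightarrow> nat \<Rightarrow> nat \<Rightarrow> real" where
  "bias h j u v =
     (if \<not> plus u v then sim u v
      else if 7/10 \<le> sim u v then 1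
      else if h then 1 - (1 - sim u v)\<^sup>2 else of_bool (v \<in> A j))"

lemma bias_range: "u < n \<Longrightarrow> 0 \<le> bias h j u v" "u < n \<Longrightarrow> bias h j u v \<le> 1"
  using sim_nonneg[of u v] sim_le_1[of u v] by (auto simp: bias_def power_le_one)

definition cluster_pmf :: "nat \<Rightarrow> nat set \<Rightarrow> (nat \<Rightarrow> bool) pmf" where
  "cluster_pmf u V = bernoulli_pmf (3/10) \<bind> (\<lambda>h. pick_pmf w (JL u) 1 \<bind>
     (\<lambda>j. Pi_pmf V False (\<lambda>v. bernoulli_pmf (bias h j u v))))"

lemma finite_set_bernoulli [simp]: "finite (set_pmf (bernoulli_pmf p))"
  by (rule finite_subset[OF subset_UNIV]) simp

lemma finite_cluster_pmf [simp]: "finite V \<Longrightarrow> finite (set_pmf (cluster_pmf u V))"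
  by (auto simp: cluster_pmf_def intro!: finite_set_Pi_pmf)

lemma expect_cluster:
  assumes "u < n" "finite V"
  shows "expect (cluster_pmf u V) g =
    3/10 * (\<Sum>j\<in>J u. w j * expect (Pi_pmf V False (\<lambda>v. bernoulli_pmf (bias True j u v))) g)
    + 7/10 * (\<Sum>j\<in>J u. w j * expect (Pi_pmf V False (\<lambda>v. bernoulli_pmf (bias False j u v))) g)"
proof -
  have pick: "expect (pick_pmf w (JL u) 1) f = (\<Sum>j\<in>J u. w j * f j)" for f
    using expect_pick_pmf[of "JL u" w 1 f] assms w_pos J_nonempty[of u]
    by (simp add: sum_list_JL sum_J set_JL flip: set_empty) (auto simp: J_def)
  show ?thesis unfolding cluster_pmf_def
    by (subst expect_bind; (subst expect_bind)?)
      (use assms(2) in \<open>auto simp: expect_bernoulli pick expect_bind finite_set_Pi_pmf\<close>)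
qed

lemma bias_not_lng: "\<not> lng u v \<Longrightarrow> bias h j u v = incl (plus u v) (x u v)"
  by (auto simp: lng_def bias_def incl_def long_def)

lemma average_bias:
  assumes "u < n"
  shows "3/10 * (\<Sum>j\<in>J u. w j * bias True j u v) + 7/10 * (\<Sum>j\<in>J u. w j * bias False j u v) = incl (plus u v) (x u v)"
proof (cases "lng u v")
  case True
  then have b: "bias True j u v = 1 - (x u v)\<^sup>2" "bias False j u v = of_bool (v \<in> A j)" for j
    by (auto simp: lng_def long_def bias_def)
  have "(\<Sum>j\<in>J u. w j * bias True j u v) = 1 - (x u v)\<^sup>2"
    using assms by (simp only: b sum_distrib_right[symmetric] sum_J mult_1_left)
  moreover have "(\<Sum>j\<in>J u. w j * bias False j u v) = sim u v" by (simp only: b sim_eq)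
  moreover have "3/10 * (1 - (x u v)\<^sup>2) + 7/10 * sim u v = 1 - x u v * (7 + 3 * x u v) / 10" by algebra
  ultimately show ?thesis using True by (simp add: incl_def lng_def)
next
  case False
  then have b: "bias True j u v = incl (plus u v) (x u v)" "bias False j u v = incl (plus u v) (x u v)" for j
    by (simp_all add: bias_not_lng)
  show ?thesis using assms
    by (simp add: b sum_J flip: sum_distrib_right)
qed

lemma expect_cluster_single:
  assumes "u < n" "finite V" "v \<in> V"
  shows "expect (cluster_pmf u V) (\<lambda>B. of_bool (B v)) = incl (plus u v) (x u v)"
proof -
  have "expect (Pi_pmf V False (\<lambda>v. bernoulli_pmf (bias h j u v))) (\<lambda>B. of_bool (B v)) = bias h j u v" for h j
    using assms bias_range by (intro expect_Pi_pmf_single) auto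
  then have "expect (cluster_pmf u V) (\<lambda>B. of_bool (B v)) =
    3/10 * (\<Sum>j\<in>J u. w j * bias True j u v) + 7/10 * (\<Sum>j\<in>J u. w j * bias False j u v)"
    using assms by (simp add: expect_cluster)
  then show ?thesis using average_bias[OF assms(1), of v] by simp
qed

lemma expect_cluster_pair:
  assumes "u < n" "finite V" "v \<in> V" "t \<in> V" "v \<noteq> t"
  shows "expect (cluster_pmf u V) (\<lambda>B. of_bool (B v) * of_bool (B t)) =
     incl2 (plus u v) (x u v) (plus u t) (x u t) (sim3 u v t)"
proof -
  have "expect (Pi_pmf V False (\<lambda>v. bernoulli_pmf (bias h j u v))) (\<lambda>B. of_bool (B v) * of_bool (B t)) = bias h j u v * bias h j u t" for h j
    using assms bias_range by (intro expect_Pi_pmf_pair) auto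
  then have e: "expect (cluster_pmf u V) (\<lambda>B. of_bool (B v) * of_bool (B t)) =
    3/10 * (\<Sum>j\<in>J u. w j * (bias True j u v * bias True j u t)) + 7/10 * (\<Sum>j\<in>J u. w j * (bias False j u v * bias False j u t))"
    using assms by (simp add: expect_cluster)
  note single = average_bias[OF assms(1)] and const = bias_not_lng
  \<comment> \<open>The bias of a neighbour that is not long does not depend on \<open>h\<close> and
    \<open>j\<close>, so it factors out of the average.\<close>
  consider "\<not> lng u v" | "\<not> lng u t" | "lng u v" "lng u t" by blast
  then show ?thesis
  proof cases
    case 1
    have f: "(\<Sum>j\<in>J u. w j * (bias h j u v * bias h j u t)) = incl (plus u v) (x u v) * (\<Sum>j\<in>J u. w j * bias h j u t)" for h
      unfolding sum_distrib_left by (intro sum.cong refl) (simp add: const[OF 1])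
    then have "expect (cluster_pmf u V) (\<lambda>B. of_bool (B v) * of_bool (B t)) = incl (plus u v) (x u v) *
      (3/10 * (\<Sum>j\<in>J u. w j * bias True j u t) + 7/10 * (\<Sum>j\<in>J u. w j * bias False j u t))"
      unfolding e f by (simp add: algebra_simps)
    with 1 show ?thesis by (simp only: single) (simp add: incl2_def lng_def)
  next
    case 2
    have f: "(\<Sum>j\<in>J u. w j * (bias h j u v * bias h j u t)) = incl (plus u t) (x u t) * (\<Sum>j\<in>J u. w j * bias h j u v)" for h
      unfolding sum_distrib_left by (intro sum.cong refl) (simp add: const[OF 2])
    then have "expect (cluster_pmf u V) (\<lambda>B. of_bool (B v) * of_bool (B t)) = incl (plus u t) (x u t) *
      (3/10 * (\<Sum>j\<in>J u. w j * bias True j u v) + 7/10 * (\<Sum>j\<in>J u. w j * bias False j u v))"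
      unfolding e f by (simp add: algebra_simps)
    with 2 show ?thesis by (simp only: single) (simp add: incl2_def lng_def)
  next
    case 3
    then have b: "bias True j u s = 1 - (x u s)\<^sup>2" "bias False j u s = of_bool (s \<in> A j)" if "s \<in> {v, t}" for j s
      using that by (auto simp: lng_def long_def bias_def)
    show ?thesis using 3 assms(1) unfolding e
      by (simp add: b sum_J incl2_def lng_def flip: sum_distrib_right sim3_eq)
  qed
qed

text \<open>The link between the process and the triangle analysis: \<open>excess\<close> contains
  the covariance relief, which is taken off again here.\<close>

lemma expect_delta:
  assumes "u < n" "V \<subseteq> {..<n}" "finite V" "v \<in> V" "t \<in> V" "v \<noteq> t"
  shows "expect (cluster_pmf u V) (\<lambda>B. delta (\<lambda>v t. price (plus v t) (x v t)) {v \<in> V. B v} v t) = exc u v t - lcov u v t"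
proof -
  have "expect (cluster_pmf u V) (\<lambda>B. delta (\<lambda>v t. price (plus v t) (x v t)) {v \<in> V. B v} v t)
    = (of_bool (plus v t) - price (plus v t) (x v t)) * (incl (plus u v) (x u v) + incl (plus u t) (x u t))
     + ((if plus v t then - 2 else 1) + price (plus v t) (x v t)) * incl2 (plus u v) (x u v) (plus u t) (x u t) (sim3 u v t)"
    unfolding delta_def using assms
    by (simp add: finite_integrable expect_cluster_single expect_cluster_pair)
  also have "\<dots> = exc u v t - lcov u v t"
    by (simp add: exc_def lcov_def excess_def lng_def algebra_simps)
  finally show ?thesis .
qed

lemma expect_sum: "finite (set_pmf p) \<Longrightarrow> expect p (\<lambda>s. \<Sum>i\<in>I. f i s) = (\<Sum>i\<in>I. expect p (f i))"
  by (intro Bochner_Integration.integral_sum finite_integrable)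

section \<open>Pivot steps, invariants and amortized reading\<close>

text \<open>The lists of all sets containing \<open>u\<close> are read in full, which is what the
  counter records, and are purged by the labels from before the step. Members of the new cluster
  stay in them until a later scan.\<close>

definition pivot :: "nat \<Rightarrow> round_state \<Rightarrow> round_state pmf" where
  "pivot u = (\<lambda>(lab, L, c). map_pmf
     (\<lambda>B. (\<lambda>v. if v < n \<and> lab v = 0 \<and> B v then Suc u else lab v,
           \<lambda>j. if j \<in> J u then filter (\<lambda>v. lab v = 0) (L j) else L j,
           c + (\<Sum>j\<in>J u. real (length (L j)))))
     (cluster_pmf u (live lab)))"

text \<open>The labels \<open>n + 1 + j\<close> do not collide with the pivot labels
  \<open>1..n\<close>. Emptying the list pays for the reading and makes a second absorption of the
  same set harmless.\<close>

definition absorb :: "nat \<Rightarrow> round_state \<Rightarrow> round_state" where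
  "absorb j = (\<lambda>(lab, L, c). (\<lambda>v. if v \<in> set (L j) \<and> lab v = 0 then n + 1 + j else lab v, L(j := []), c))"

text \<open>A label in use reveals its origin: either its pivot vertex is labelled, or the list of
  its set is empty. Hence neither an unlabelled pivot nor a set with live members can reuse a
  label.\<close>

definition fresh :: "(nat \<Rightarrow> nat) \<Rightarrow> (nat \<Rightarrow> nat list) \<Rightarrow> bool" where
  "fresh lab L \<longleftrightarrow> (\<forall>v<n. lab v \<noteq> 0 \<longrightarrow>
     (lab v \<le> n \<and> lab (lab v - 1) \<noteq> 0) \<or> (n < lab v \<and> lab v \<le> n + m \<and> L (lab v - n - 1) = []))"

text \<open>Lists may contain stale vertices but must not miss a live one.\<close>

definition inv :: "round_state \<Rightarrow> bool" where
  "inv = (\<lambda>(lab, L, c). (\<forall>j<m. distinct (L j) \<and> set (L j) \<subseteq> A j \<and> {v \<in> A j. lab v = 0} \<subseteq> set (L j)) \<and> fresh lab L \<and> 0 \<le> c)"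

lemma pivot_paint:
  "(\<lambda>v. if v < n \<and> lab v = 0 \<and> B v then Suc u else lab v) = paint (Suc u) {v \<in> live lab. B v} lab"
  by (auto simp: paint_def live_def fun_eq_iff)

lemma fresh_pivot_label: "fresh lab L \<Longrightarrow> u < n \<Longrightarrow> lab u = 0 \<Longrightarrow> \<forall>v<n. lab v \<noteq> Suc u"
  by (fastforce simp: fresh_def)

text \<open>The self-loop is a + edge at distance 0, hence has bias 1. This guarantees progress and
  preserves \<open>fresh\<close>.\<close>

lemma cluster_contains_pivot:
  assumes "B \<in> set_pmf (cluster_pmf u V)" "finite V" "u \<in> V" "u < n"
  shows "B u"
proof -
  obtain h j where B: "B \<in> set_pmf (Pi_pmf V False (\<lambda>v. bernoulli_pmf (bias h j u v)))"
    using assms(1) by (auto simp: cluster_pmf_def)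
  have "bias h j u u = 1" using assms(4) by (simp add: bias_def plus_refl sim_self)
  moreover have "B u \<in> set_pmf (bernoulli_pmf (bias h j u u))"
    using B assms(2,3) by (auto simp: set_Pi_pmf PiE_dflt_def)
  ultimately show ?thesis by (cases "B u") (auto simp: set_pmf_iff)
qed

lemma inv_pivot:
  assumes "inv s" "u < n" "fst s u = 0" "s' \<in> set_pmf (pivot u s)"
  shows "inv s'"
proof -
  obtain lab L c where s: "s = (lab, L, c)" by (cases s)
  obtain B where B: "B \<in> set_pmf (cluster_pmf u (live lab))" and
    s': "s' = (\<lambda>v. if v < n \<and> lab v = 0 \<and> B v then Suc u else lab v,
           \<lambda>j. if j \<in> J u then filter (\<lambda>v. lab v = 0) (L j) else L j,
           c + (\<Sum>j\<in>J u. real (length (L j))))"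
    using assms(4) by (auto simp: s pivot_def)
  have "B u" using cluster_contains_pivot[OF B] assms by (simp add: live_def s)
  then show ?thesis using assms(1-3)
    unfolding s' by (auto simp: inv_def s fresh_def sum_nonneg intro!: add_nonneg_nonneg)
qed

lemma pivot_labels_self:
  assumes "u < n" "lab u = 0" "s' \<in> set_pmf (pivot u (lab, L, c))"
  shows "fst s' u \<noteq> 0"
proof -
  obtain B where B: "B \<in> set_pmf (cluster_pmf u (live lab))" and
    s': "fst s' = (\<lambda>v. if v < n \<and> lab v = 0 \<and> B v then Suc u else lab v)"
    using assms(3) by (auto simp: pivot_def)
  have "B u" using cluster_contains_pivot[OF B] assms by (simp add: live_def)
  then show ?thesis using assms s' by simp
qed

lemma pivot_monotone:
  "s' \<in> set_pmf (pivot u (lab, L, c)) \<Longrightarrow> lab v \<noteq> 0 \<Longrightarrow> fst s' v \<noteq> 0"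
  "s' \<in> set_pmf (pivot u (lab, L, c)) \<Longrightarrow> c \<le> snd (snd s')"
  by (auto simp: pivot_def sum_nonneg)

abbreviation (input) price_potential :: "(nat \<Rightarrow> nat) \<Rightarrow> real" where
  "price_potential \<equiv> potential (\<lambda>v t. price (plus v t) (x v t))"

lemma expect_pivot_potential:
  assumes "inv (lab, L, c)" "u \<in> live lab"
  shows "expect (pivot u (lab, L, c)) (\<lambda>s. price_potential (fst s)) = price_potential lab
     + (\<Sum>v\<in>live lab. \<Sum>t\<in>live lab. of_bool (v \<noteq> t) * (exc u v t - lcov u v t))"
proof -
  have u: "u < n" "lab u = 0" using assms by (auto simp: live_def)
  have "expect (pivot u (lab, L, c)) (\<lambda>s. price_potential (fst s)) =
    expect (cluster_pmf u (live lab)) (\<lambda>B. price_potential (paint (Suc u) {v \<in> live lab. B v} lab))"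
    by (simp add: pivot_def pivot_paint)
  also have "\<dots> = expect (cluster_pmf u (live lab)) (\<lambda>B. price_potential lab
     + (\<Sum>v\<in>live lab. \<Sum>t\<in>live lab. of_bool (v \<noteq> t) * delta (\<lambda>v t. price (plus v t) (x v t)) {v \<in> live lab. B v} v t))"
    by (subst potential_paint) (use fresh_pivot_label[of lab L u] assms u in \<open>auto simp: inv_def\<close>)
  also have "\<dots> = price_potential lab + (\<Sum>v\<in>live lab. \<Sum>t\<in>live lab. of_bool (v \<noteq> t) *
      expect (cluster_pmf u (live lab)) (\<lambda>B. delta (\<lambda>v t. price (plus v t) (x v t)) {v \<in> live lab. B v} v t))"
    by (simp add: finite_integrable expect_sum)
  also have "\<dots> = price_potential lab + (\<Sum>v\<in>live lab. \<Sum>t\<in>live lab. of_bool (v \<noteq> t) * (exc u v t - lcov u v t))"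
    using expect_delta[OF u(1) live_subset[of lab]] by (intro arg_cong2[of _ _ _ _ "(+)"] refl sum.cong) auto
  finally show ?thesis .
qed

text \<open>Entries already read, entries that may still be read as stale, and a reserve of
  \<open>1 / \<Delta>\<close> per live vertex for reading it while it is live.\<close>

definition work :: "round_state \<Rightarrow> real" where
  "work = (\<lambda>(lab, L, c). c + (\<Sum>j<m. real (length (L j))) + card (live lab) / \<Delta>)"

text \<open>Stale entries are paid by their removal from the lists. The live entries read number at
  most \<open>1 / \<Delta>\<close> times the sum of \<open>sim u v\<close> over live
  \<open>v\<close>, as every weight is at least \<open>\<Delta>\<close>; that sum is at most the
  expected number of vertices that leave with the pivot, whose reserves are released.\<close>

lemma expect_pivot_work:
  assumes "inv (lab, L, c)" "u \<in> live lab"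
  shows "expect (pivot u (lab, L, c)) work \<le> work (lab, L, c)"
proof -
  have u: "u < n" using assms by (auto simp: live_def)
  define len' where "len' j = real (length (if j \<in> J u then filter (\<lambda>v. lab v = 0) (L j) else L j))" for j
  define c' where "c' = c + (\<Sum>j\<in>J u. real (length (L j))) + (\<Sum>j<m. len' j)"
  have card: "real (length (filter (\<lambda>v. lab v = 0) (L j))) = (\<Sum>v\<in>live lab. of_bool (v \<in> A j))" if "j < m" for j
  proof -
    have "distinct (L j)" "set (filter (\<lambda>v. lab v = 0) (L j)) = A j \<inter> live lab"
      using assms(1) that A_subset[OF that] by (auto simp: inv_def live_def)
    then have "length (filter (\<lambda>v. lab v = 0) (L j)) = card (A j \<inter> live lab)"
      using distinct_card[of "filter (\<lambda>v. lab v = 0) (L j)"] by simp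
    also have "real \<dots> = (\<Sum>v\<in>live lab. of_bool (v \<in> A j))" by (simp add: Int_commute Int_def)
    finally show ?thesis .
  qed
  have "(\<Sum>j<m. len' j) = (\<Sum>j<m. real (length (L j))) - (\<Sum>j\<in>J u. real (length (L j))) + (\<Sum>j\<in>J u. \<Sum>v\<in>live lab. of_bool (v \<in> A j))"
  proof -
    have sub: "J u \<subseteq> {..<m}" by (auto simp: J_def)
    have "(\<Sum>j<m. f j) = (\<Sum>j\<in>J u. f j) + (\<Sum>j\<in>{..<m} - J u. f j)" for f :: "nat \<Rightarrow> real"
      using sub by (simp add: sum.subset_diff[of "J u" "{..<m}"])
    from this[of len'] this[of "\<lambda>j. real (length (L j))"] show ?thesis
      using card sub by (simp add: len'_def subset_iff)
  qed
  then have c': "c' = c + (\<Sum>j<m. real (length (L j))) + (\<Sum>j\<in>J u. \<Sum>v\<in>live lab. of_bool (v \<in> A j))"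
    by (simp add: c'_def)
  have card': "real (card (live (\<lambda>v. if v < n \<and> lab v = 0 \<and> B v then Suc u else lab v)))
      = real (card (live lab)) - (\<Sum>v\<in>live lab. of_bool (B v))" for B
  proof -
    have "live (\<lambda>v. if v < n \<and> lab v = 0 \<and> B v then Suc u else lab v) = live lab - {v \<in> live lab. B v}"
      by (auto simp: live_def)
    then have "real (card (live (\<lambda>v. if v < n \<and> lab v = 0 \<and> B v then Suc u else lab v))) = real (card (live lab)) - card {v \<in> live lab. B v}"
      by (simp add: card_Diff_subset card_mono of_nat_diff)
    then show ?thesis by (simp add: Int_def)
  qed
  have "expect (pivot u (lab, L, c)) work = expect (cluster_pmf u (live lab)) (\<lambda>B. c' + (real (card (live lab)) - (\<Sum>v\<in>live lab. of_bool (B v))) / \<Delta>)"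
    unfolding pivot_def work_def by (simp add: card' c'_def len'_def del: sum_of_bool_eq)
  also have "\<dots> = c' + (real (card (live lab)) - (\<Sum>v\<in>live lab. incl (plus u v) (x u v))) / \<Delta>"
    using u by (simp add: finite_integrable expect_sum expect_cluster_single diff_divide_distrib del: sum_of_bool_eq)
  \<comment> \<open>Every vertex joins with probability at least its similarity to the pivot,
    whatever the kind of edge.\<close>
  also have "\<dots> \<le> c' + (real (card (live lab)) - (\<Sum>v\<in>live lab. sim u v)) / \<Delta>"
  proof -
    have "sim u v \<le> incl (plus u v) (x u v)" for v
    proof -
      have "(1 - sim u v) * (7 + 3 * (1 - sim u v)) \<le> (1 - sim u v) * 10"
        using sim_nonneg[of u v] sim_le_1[OF u, of v] by (intro mult_left_mono) auto
      then show ?thesis using sim_le_1[OF u, of v] by (simp add: incl_def)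
    qed
    then show ?thesis using Delta_pos by (intro add_left_mono divide_right_mono diff_left_mono sum_mono) auto
  qed
  also have "(\<Sum>v\<in>live lab. sim u v) = (\<Sum>j\<in>J u. w j * (\<Sum>v\<in>live lab. of_bool (v \<in> A j)))"
    unfolding sim_eq sum_distrib_left by (rule sum.swap)
  also have "c' + (real (card (live lab)) - \<dots>) / \<Delta> \<le> work (lab, L, c)"
  proof -
    have "\<Delta> * (\<Sum>j\<in>J u. \<Sum>v\<in>live lab. of_bool (v \<in> A j)) \<le> (\<Sum>j\<in>J u. w j * (\<Sum>v\<in>live lab. of_bool (v \<in> A j)))"
      unfolding sum_distrib_left[of \<Delta>] using w_ge
      by (intro sum_mono) (auto simp: J_def mult.commute[of _ \<Delta>] intro: mult_right_mono)
    then have "(\<Sum>j\<in>J u. \<Sum>v\<in>live lab. of_bool (v \<in> A j)) \<le> (\<Sum>j\<in>J u. w j * (\<Sum>v\<in>live lab. of_bool (v \<in> A j))) / \<Delta>"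
      using Delta_pos by (simp only: pos_le_divide_eq mult.commute)
    then show ?thesis unfolding c' work_def by (simp add: diff_divide_distrib del: sum_of_bool_eq)
  qed
  finally show ?thesis .
qed

section \<open>Trials, hits and the final sweep\<close>

definition tot :: "(nat \<Rightarrow> nat \<Rightarrow> real) \<Rightarrow> real" where
  "tot \<phi> = (\<Sum>v<n. \<Sum>t<n. of_bool (v \<noteq> t) * \<phi> v t)"

definition und :: "(nat \<Rightarrow> nat \<Rightarrow> real) \<Rightarrow> (nat \<Rightarrow> nat) \<Rightarrow> real" where
  "und \<phi> lab = (\<Sum>v<n. \<Sum>t<n. of_bool (v \<noteq> t \<and> lab v = 0 \<and> lab t = 0) * \<phi> v t)"

definition obj :: "nat \<Rightarrow> nat \<Rightarrow> real" where
  "obj v t = (if plus v t then x v t else sim v t)"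

text \<open>The expected cost of a pair under unlimited hits: the first set to touch it contains
  exactly one endpoint with probability \<open>2 * x / (1 + x)\<close> and both with probability
  \<open>(1 - x) / (1 + x)\<close>.\<close>

definition cluster_cost :: "nat \<Rightarrow> nat \<Rightarrow> real" where
  "cluster_cost v t = (if plus v t then 2 * x v t else sim v t) / (1 + x v t)"

text \<open>The worst cost of a pair in the sweep. A pair at distance 0 is split by no support set,
  and a pair at distance 1 is contained in none, so a + pair of the first kind and a minus pair of
  the second cost nothing.\<close>

definition nonzero_obj :: "nat \<Rightarrow> nat \<Rightarrow> real" where
  "nonzero_obj v t = of_bool (if plus v t then sim v t < 1 else 0 < sim v t)"

text \<open>The bound with \<open>i\<close> hits to go: the limit cost plus a transient for pairs
  that the sweep must decide.\<close>

definition cluster_bound :: "nat \<Rightarrow> nat \<Rightarrow> nat \<Rightarrow> real" where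
  "cluster_bound i v t = cluster_cost v t + (1 - 1/m) ^ i * nonzero_obj v t"

text \<open>Drawing from all vertices avoids maintaining the live ones: a labelled vertex wastes the
  trial, and conditioned on success the pivot is uniform among the live vertices.\<close>

definition trial :: "real \<Rightarrow> round_state \<Rightarrow> round_state pmf" where
  "trial b s = pmf_of_set {..<n} \<bind> (\<lambda>u. if fst s u = 0 \<and> snd (snd s) < b then pivot u s else return_pmf s)"

text \<open>A uniform index and a coin of bias \<open>w j\<close>: sets are absorbed at rates
  proportional to their weights without sampling from the whole distribution.\<close>

definition hit :: "round_state \<Rightarrow> round_state pmf" where
  "hit s = pmf_of_set {..<m} \<bind> (\<lambda>j. bernoulli_pmf (w j) \<bind> (\<lambda>b. return_pmf (if b then absorb j s else s)))"

definition finish :: "round_state \<Rightarrow> round_state" where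
  "finish s = fold absorb [0..<m] s"

definition rounding :: "real \<Rightarrow> nat \<Rightarrow> nat \<Rightarrow> round_state \<Rightarrow> round_state pmf" where
  "rounding b R R' s = bernoulli_pmf (23/31) \<bind> (\<lambda>h.
     (if h then return_pmf s else iterate_pmf R (trial b) s) \<bind> (\<lambda>s'.
     iterate_pmf R' hit s' \<bind> (\<lambda>s''. return_pmf (finish s''))))"

lemma m_pos: "0 < m"
  using J_nonempty[OF n_pos] by (auto simp: J_def)

lemma lessThan_nonempty: "{..<n} \<noteq> {}" "{..<m} \<noteq> {}"
  using n_pos m_pos by auto

lemma w_le_1: "j < m \<Longrightarrow> w j \<le> 1"
proof -
  assume j: "j < m"
  then obtain u where u: "u \<in> A j" using A_nonempty by blast
  then have "u < n" using A_subset[OF j] by auto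
  moreover have "w j \<le> (\<Sum>j\<in>J u. w j)" using u j by (intro member_le_sum) (auto simp: J_def w_pos less_imp_le)
  ultimately show "w j \<le> 1" by (simp add: sum_J)
qed

lemma finite_pivot [simp]: "finite (set_pmf (pivot u s))" by (cases s) (simp add: pivot_def)

lemma finite_trial [simp]: "finite (set_pmf (trial b s))"
  using lessThan_nonempty by (auto simp: trial_def)

lemma finite_hit [simp]: "finite (set_pmf (hit s))"
  using lessThan_nonempty by (auto simp: hit_def)

lemma expect_trial:
  "expect (trial b s) g = (\<Sum>u<n. if fst s u = 0 \<and> snd (snd s) < b then expect (pivot u s) g else g s) / n"
proof -
  have "expect (trial b s) g = (\<Sum>u<n. expect (if fst s u = 0 \<and> snd (snd s) < b then pivot u s else return_pmf s) g) / n"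
    unfolding trial_def using lessThan_nonempty by (subst expect_bind) (auto simp: expect_pmf_of_set)
  also have "\<dots> = (\<Sum>u<n. if fst s u = 0 \<and> snd (snd s) < b then expect (pivot u s) g else g s) / n"
    by (intro arg_cong2[of _ _ _ _ "(/)"] sum.cong) auto
  finally show ?thesis .
qed

lemma expect_hit: "expect (hit s) g = (\<Sum>j<m. w j * g (absorb j s) + (1 - w j) * g s) / m"
  unfolding hit_def using lessThan_nonempty
  by (subst expect_bind) (auto simp: expect_pmf_of_set expect_bind expect_bernoulli w_le_1 less_imp_le[OF w_pos] intro!: sum.cong)

lemma expect_trial_leI:
  assumes "(\<Sum>u<n. if fst s u = 0 \<and> snd (snd s) < b then expect (pivot u s) g else g s) \<le> real n * y"
  shows "expect (trial b s) g \<le> y"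
  unfolding expect_trial using assms n_pos by (simp only: pos_divide_le_eq mult.commute of_nat_0_less_iff)

lemma expect_hit_leI:
  assumes "(\<Sum>j<m. w j * g (absorb j s) + (1 - w j) * g s) \<le> real m * y"
  shows "expect (hit s) g \<le> y"
  unfolding expect_hit using assms m_pos by (simp only: pos_divide_le_eq mult.commute of_nat_0_less_iff)

lemma inv_trial: "inv s \<Longrightarrow> s' \<in> set_pmf (trial b s) \<Longrightarrow> inv s'"
  using lessThan_nonempty by (auto simp: trial_def inv_pivot split: if_splits)

lemma absorb_paint:
  assumes "inv (lab, L, c)" "j < m"
  shows "fst (absorb j (lab, L, c)) = paint (n + 1 + j) (A j \<inter> live lab) lab"
  using assms A_subset[OF assms(2)] by (fastforce simp: absorb_def paint_def inv_def live_def)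

lemma inv_absorb:
  assumes "inv s" "j < m"
  shows "inv (absorb j s)"
proof -
  obtain lab L c where s: "s = (lab, L, c)" by (cases s)
  have "fresh (\<lambda>v. if v \<in> set (L j) \<and> lab v = 0 then n + 1 + j else lab v) (L(j := []))"
    using assms unfolding fresh_def inv_def s by auto
  then show ?thesis using assms by (auto simp: inv_def s absorb_def)
qed

lemma inv_hit: "inv s \<Longrightarrow> s' \<in> set_pmf (hit s) \<Longrightarrow> inv s'"
  using lessThan_nonempty by (auto simp: hit_def inv_absorb split: if_splits)

lemma expect_trial_le:
  assumes "\<And>u. u \<in> live (fst s) \<Longrightarrow> expect (pivot u s) g \<le> g s"
  shows "expect (trial b s) g \<le> g s"
proof -
  have "(\<Sum>u<n. if fst s u = 0 \<and> snd (snd s) < b then expect (pivot u s) g else g s) \<le> (\<Sum>u<n. g s)"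
    using assms by (intro sum_mono) (auto simp: live_def)
  then show ?thesis by (intro expect_trial_leI) simp
qed

lemma expect_trial_work: "inv s \<Longrightarrow> expect (trial b s) work \<le> work s"
  by (cases s) (auto intro!: expect_trial_le expect_pivot_work)

text \<open>The cap depends on the state and not on the vertex drawn, so either every live vertex
  can become pivot or none can. The sum over all pivots is needed, since a single pivot may increase
  the potential.\<close>

lemma expect_trial_potential:
  assumes "inv s"
  shows "expect (trial b s) (\<lambda>s. price_potential (fst s)) \<le> price_potential (fst s)"
proof -
  obtain lab L c where s: "s = (lab, L, c)" by (cases s)
  let ?d = "\<lambda>u. \<Sum>v\<in>live lab. \<Sum>t\<in>live lab. of_bool (v \<noteq> t) * (exc u v t - lcov u v t)"
  have "(\<Sum>u<n. if lab u = 0 \<and> c < b then expect (pivot u s) (\<lambda>s. price_potential (fst s)) else price_potential lab)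
    = (\<Sum>u<n. price_potential lab + of_bool (u \<in> live lab \<and> c < b) * ?d u)"
    using expect_pivot_potential[of lab L c] assms by (intro sum.cong) (auto simp: s live_def)
  also have "\<dots> = n * price_potential lab + (\<Sum>u<n. of_bool (u \<in> live lab \<and> c < b) * ?d u)"
    by (simp add: sum.distrib)
  finally have e: "(\<Sum>u<n. if lab u = 0 \<and> c < b then expect (pivot u s) (\<lambda>s. price_potential (fst s)) else price_potential lab)
    = n * price_potential lab + (\<Sum>u<n. of_bool (u \<in> live lab \<and> c < b) * ?d u)" .
  have "(\<Sum>u<n. of_bool (u \<in> live lab \<and> c < b) * ?d u) = (\<Sum>u\<in>live lab. of_bool (c < b) * ?d u)"
    by (rule sum.mono_neutral_cong_right) (use live_subset[of lab] in auto)
  also have "\<dots> = of_bool (c < b) * (\<Sum>u\<in>live lab. ?d u)" by (rule sum_distrib_left[symmetric])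
  also have "\<dots> \<le> 0" by (rule mult_nonneg_nonpos[OF _ exc_sum_nonpos[OF finite_live live_subset]]) simp
  finally have "(\<Sum>u<n. if lab u = 0 \<and> c < b then expect (pivot u s) (\<lambda>s. price_potential (fst s)) else price_potential lab)
    \<le> n * price_potential lab" unfolding e by linarith
  then show ?thesis using expect_trial_leI[of s b "\<lambda>s. price_potential (fst s)" "price_potential lab"]
    by (simp only: s fst_conv snd_conv)
qed

lemma und_nonneg: "(\<And>v t. 0 \<le> \<phi> v t) \<Longrightarrow> 0 \<le> und \<phi> lab"
  by (auto simp: und_def intro!: sum_nonneg)

lemma und_le_tot: "(\<And>v t. 0 \<le> \<phi> v t) \<Longrightarrow> und \<phi> lab \<le> tot \<phi>"
  unfolding und_def tot_def by (intro sum_mono mult_right_mono) auto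

text \<open>An undecided pair is decided at the latest when its first endpoint is drawn, which has
  probability \<open>1/n\<close>. The indicator restricts the claim to states below the cap; above
  it the left side vanishes.\<close>

lemma expect_trial_und:
  assumes nonneg: "\<And>v t. 0 \<le> \<phi> v t"
  shows "expect (trial b s) (\<lambda>s. of_bool (snd (snd s) < b) * und \<phi> (fst s))
    \<le> (1 - 1/n) * (of_bool (snd (snd s) < b) * und \<phi> (fst s))"
proof (cases "snd (snd s) < b")
  case False
  then show ?thesis by (simp add: expect_trial)
next
  case True
  obtain lab L c where s: "s = (lab, L, c)" by (cases s)
  \<comment> \<open>A pair survives only if the pivot differs from its first endpoint, which leaves
    \<open>n - 1\<close> of the \<open>n\<close> choices.\<close>
  let ?f = "\<lambda>u v t. of_bool (u \<noteq> v) * (of_bool (v \<noteq> t \<and> lab v = 0 \<and> lab t = 0) * \<phi> v t)"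
  have pivot: "expect (pivot u s) (\<lambda>s. of_bool (snd (snd s) < b) * und \<phi> (fst s)) \<le> (\<Sum>v<n. \<Sum>t<n. ?f u v t)"
    if u: "u < n" "lab u = 0" for u
  proof (rule expect_le_const)
    fix s' assume s': "s' \<in> set_pmf (pivot u s)"
    have "of_bool (snd (snd s') < b) * und \<phi> (fst s') \<le> und \<phi> (fst s')"
      using und_nonneg[OF nonneg] by simp
    also have "\<dots> \<le> (\<Sum>v<n. \<Sum>t<n. ?f u v t)"
    proof -
      have imp: "lab v = 0 \<and> u \<noteq> v" if "fst s' v = 0" for v
        using pivot_labels_self[of u lab s' L c] u pivot_monotone(1)[of s' u lab L c v] s' that by (auto simp: s)
      have "of_bool (v \<noteq> t \<and> fst s' v = 0 \<and> fst s' t = 0) * \<phi> v t \<le> ?f u v t" for v t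
        using imp[of v] imp[of t] nonneg[of v t] by (cases "fst s' v = 0 \<and> fst s' t = 0") auto
      then show ?thesis unfolding und_def by (intro sum_mono)
    qed
    finally show "of_bool (snd (snd s') < b) * und \<phi> (fst s') \<le> (\<Sum>v<n. \<Sum>t<n. ?f u v t)" .
  qed simp
  have "(\<Sum>u<n. if fst s u = 0 \<and> snd (snd s) < b then expect (pivot u s) (\<lambda>s. of_bool (snd (snd s) < b) * und \<phi> (fst s))
      else of_bool (snd (snd s) < b) * und \<phi> (fst s)) \<le> (\<Sum>u<n. \<Sum>v<n. \<Sum>t<n. ?f u v t)"
  proof (intro sum_mono)
    fix u assume "u \<in> {..<n}"
    moreover have "und \<phi> lab = (\<Sum>v<n. \<Sum>t<n. ?f u v t)" if "lab u \<noteq> 0"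
      unfolding und_def using that by (intro sum.cong) auto
    ultimately show "(if fst s u = 0 \<and> snd (snd s) < b then expect (pivot u s) (\<lambda>s. of_bool (snd (snd s) < b) * und \<phi> (fst s))
      else of_bool (snd (snd s) < b) * und \<phi> (fst s)) \<le> (\<Sum>v<n. \<Sum>t<n. ?f u v t)"
      using pivot True by (auto simp: s)
  qed
  also have "\<dots> = (\<Sum>v<n. \<Sum>u<n. \<Sum>t<n. ?f u v t)" by (rule sum.swap)
  also have "\<dots> = (\<Sum>v<n. \<Sum>t<n. \<Sum>u<n. ?f u v t)" by (intro sum.cong refl sum.swap)
  also have "\<dots> = (\<Sum>v<n. \<Sum>t<n. (real n - 1) * (of_bool (v \<noteq> t \<and> lab v = 0 \<and> lab t = 0) * \<phi> v t))"
  proof (intro sum.cong refl)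
    fix v t assume "v \<in> {..<n}"
    then have "(\<Sum>u<n. of_bool (u \<noteq> v)) = (\<Sum>u\<in>{..<n} - {v}. 1 :: real)"
      by (intro sum.mono_neutral_cong_right) auto
    also have "\<dots> = real n - 1" using \<open>v \<in> {..<n}\<close> n_pos by (simp add: of_nat_diff)
    finally have "(\<Sum>u<n. of_bool (u \<noteq> v)) = real n - 1" .
    then show "(\<Sum>u<n. ?f u v t) = (real n - 1) * (of_bool (v \<noteq> t \<and> lab v = 0 \<and> lab t = 0) * \<phi> v t)"
      by (simp only: flip: sum_distrib_right)
  qed
  also have "\<dots> = (real n - 1) * und \<phi> lab" unfolding und_def sum_distrib_left ..
  also have "\<dots> = n * ((1 - 1/n) * (of_bool (snd (snd s) < b) * und \<phi> (fst s)))"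
    using n_pos True by (simp add: s field_simps)
  finally show ?thesis by (rule expect_trial_leI)
qed

lemma potential_diff:
  "potential \<psi> lab = potential \<phi> lab + (\<Sum>v\<in>live lab. \<Sum>t\<in>live lab. of_bool (v \<noteq> t) * (\<psi> v t - \<phi> v t))"
proof -
  have restrict: "(\<Sum>v<n. of_bool (v \<in> live lab) * h v) = (\<Sum>v\<in>live lab. h v)" for h :: "nat \<Rightarrow> real"
    by (rule sum.mono_neutral_cong_right) (use live_subset[of lab] in auto)
  have "charge \<psi> lab v t = charge \<phi> lab v t
      + of_bool (v \<in> live lab) * (of_bool (t \<in> live lab) * (of_bool (v \<noteq> t) * (\<psi> v t - \<phi> v t)))"
    if "v < n" "t < n" for v t
    using that by (auto simp: charge_def live_def)
  then have "potential \<psi> lab = potential \<phi> lab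
    + (\<Sum>v<n. \<Sum>t<n. of_bool (v \<in> live lab) * (of_bool (t \<in> live lab) * (of_bool (v \<noteq> t) * (\<psi> v t - \<phi> v t))))"
    by (simp add: potential_def sum.distrib)
  then show ?thesis by (simp add: restrict flip: sum_distrib_left)
qed

lemma potential_absorb:
  assumes "inv s" "j < m"
  shows "potential \<phi> (fst (absorb j s)) = potential \<phi> (fst s)
    + (\<Sum>v\<in>live (fst s). \<Sum>t\<in>live (fst s). of_bool (v \<noteq> t) * delta \<phi> (A j \<inter> live (fst s)) v t)"
proof -
  obtain lab L c where s: "s = (lab, L, c)" by (cases s)
  \<comment> \<open>By \<open>fresh\<close> this label can be in use only once list \<open>j\<close>
    is empty, but then \<open>A j\<close> has no live vertex left.\<close>
  have "lab v \<noteq> n + 1 + j" if ne: "A j \<inter> live lab \<noteq> {}" and v: "v < n" for v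
  proof
    assume "lab v = n + 1 + j"
    then have "L j = []" using assms(1) v by (auto simp: inv_def s fresh_def)
    moreover obtain y where "y \<in> A j \<inter> live lab" using ne by blast
    then have "y \<in> A j" "lab y = 0" by (auto simp: live_def)
    moreover have "{v \<in> A j. lab v = 0} \<subseteq> set (L j)" using assms by (simp add: inv_def s)
    ultimately show False by auto
  qed
  then show ?thesis using potential_paint[of "A j \<inter> live lab" lab "n + 1 + j"] absorb_paint[of lab L c j] assms
    by (auto simp: s)
qed

lemma x_nonneg: "u < n \<Longrightarrow> 0 \<le> x u v" using sim_le_1[of u v] by simp

lemma nonzero_obj_nonneg: "0 \<le> nonzero_obj v t" by (simp add: nonzero_obj_def)

text \<open>\<open>cluster_cost\<close> is the fixed point of a hit, and any deviation from it
  shrinks by the factor \<open>1 - (1 + x) / m\<close>, which is at most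
  \<open>1 - 1 / m\<close>.\<close>

lemma expect_hit_potential:
  assumes "inv s"
  shows "expect (hit s) (\<lambda>s. potential (cluster_bound i) (fst s)) \<le> potential (cluster_bound (Suc i)) (fst s)"
proof -
  define V where "V = live (fst s)"
  define r where "r = 1 - 1 / real m"
  have r: "0 \<le> r" using m_pos by (simp add: r_def)
  let ?g = "cluster_bound i"
  let ?base = "\<lambda>v t. (1 + x v t) * (cluster_cost v t - ?g v t)"
  \<comment> \<open>The weights of the sets through one vertex sum to 1 and those through both
    endpoints to \<open>sim v t\<close>; the coefficient of the promise is therefore
    \<open>2 - sim v t = 1 + x v t\<close>.\<close>
  have avg: "(\<Sum>j<m. w j * delta ?g (A j \<inter> V) v t) = ?base v t" if "v \<in> V" "t \<in> V" for v t
  proof -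
    have vn: "v < n" "t < n" using that by (auto simp: V_def live_def)
    have one: "(\<Sum>j<m. w j * of_bool (v \<in> A j \<inter> V)) = 1" if "v \<in> V" "v < n" for v
    proof -
      have "(\<Sum>j<m. w j * of_bool (v \<in> A j \<inter> V)) = (\<Sum>j\<in>J v. w j)"
        using that(1) by (intro sum.mono_neutral_cong_right) (auto simp: J_def)
      then show ?thesis using that by (simp add: sum_J)
    qed
    have two: "(\<Sum>j<m. w j * (of_bool (v \<in> A j \<inter> V) * of_bool (t \<in> A j \<inter> V))) = sim v t"
      unfolding sim_def using that by (intro sum.mono_neutral_cong_right) (auto simp: J_def)
    have "(\<Sum>j<m. w j * delta ?g (A j \<inter> V) v t) =
      (of_bool (plus v t) - ?g v t) * ((\<Sum>j<m. w j * of_bool (v \<in> A j \<inter> V)) + (\<Sum>j<m. w j * of_bool (t \<in> A j \<inter> V)))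
      + ((if plus v t then - 2 else 1) + ?g v t) * (\<Sum>j<m. w j * (of_bool (v \<in> A j \<inter> V) * of_bool (t \<in> A j \<inter> V)))"
      unfolding delta_def distrib_left sum_distrib_left sum.distrib[symmetric]
      by (intro sum.cong refl) algebra
    also have "\<dots> = (of_bool (plus v t) - ?g v t) * 2 + ((if plus v t then - 2 else 1) + ?g v t) * sim v t"
      using one that vn two by (simp only:) simp
    also have "\<dots> = ?base v t"
      using x_nonneg[OF vn(1), of t] by (cases "plus v t") (simp_all add: cluster_cost_def field_simps)
    finally show ?thesis .
  qed
  have "(\<Sum>j<m. w j * potential ?g (fst (absorb j s)) + (1 - w j) * potential ?g (fst s))
     = (\<Sum>j<m. potential ?g (fst s) + w j * (\<Sum>v\<in>V. \<Sum>t\<in>V. of_bool (v \<noteq> t) * delta ?g (A j \<inter> V) v t))"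
    using potential_absorb[OF assms] by (intro sum.cong refl) (simp add: V_def algebra_simps)
  also have "\<dots> = m * potential ?g (fst s) + (\<Sum>j<m. \<Sum>v\<in>V. \<Sum>t\<in>V. of_bool (v \<noteq> t) * (w j * delta ?g (A j \<inter> V) v t))"
    by (simp add: sum.distrib sum_distrib_left mult.left_commute)
  finally have e: "(\<Sum>j<m. w j * potential ?g (fst (absorb j s)) + (1 - w j) * potential ?g (fst s))
    = m * potential ?g (fst s) + (\<Sum>j<m. \<Sum>v\<in>V. \<Sum>t\<in>V. of_bool (v \<noteq> t) * (w j * delta ?g (A j \<inter> V) v t))" .
  have "(\<Sum>j<m. \<Sum>v\<in>V. \<Sum>t\<in>V. of_bool (v \<noteq> t) * (w j * delta ?g (A j \<inter> V) v t))
     = (\<Sum>v\<in>V. \<Sum>j<m. \<Sum>t\<in>V. of_bool (v \<noteq> t) * (w j * delta ?g (A j \<inter> V) v t))" by (rule sum.swap)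
  also have "\<dots> = (\<Sum>v\<in>V. \<Sum>t\<in>V. \<Sum>j<m. of_bool (v \<noteq> t) * (w j * delta ?g (A j \<inter> V) v t))"
    by (intro sum.cong refl sum.swap)
  also have "\<dots> = (\<Sum>v\<in>V. \<Sum>t\<in>V. of_bool (v \<noteq> t) * ?base v t)"
    using avg by (intro sum.cong refl) (simp flip: sum_distrib_left)
  also have "\<dots> \<le> (\<Sum>v\<in>V. \<Sum>t\<in>V. of_bool (v \<noteq> t) * (m * (cluster_bound (Suc i) v t - ?g v t)))"
  proof (intro sum_mono mult_left_mono)
    fix v t assume "v \<in> V"
    then have "0 \<le> x v t" using x_nonneg by (auto simp: V_def live_def)
    then have "0 \<le> x v t * (r ^ i * nonzero_obj v t)" using r nonzero_obj_nonneg by simp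
    moreover have "m * (cluster_bound (Suc i) v t - ?g v t) = - (r ^ i * nonzero_obj v t)"
      using m_pos by (simp add: cluster_bound_def r_def field_simps)
    moreover have "?base v t = - (r ^ i * nonzero_obj v t) - x v t * (r ^ i * nonzero_obj v t)"
      by (simp add: cluster_bound_def r_def[symmetric] algebra_simps)
    ultimately show "?base v t \<le> m * (cluster_bound (Suc i) v t - ?g v t)" by linarith
  qed simp
  also have "\<dots> = m * (potential (cluster_bound (Suc i)) (fst s) - potential ?g (fst s))"
    using potential_diff[of "cluster_bound (Suc i)" "fst s" ?g]
    by (simp only: V_def sum_distrib_left mult.left_commute[of "real m"] add_diff_cancel_left')
  finally have "(\<Sum>j<m. w j * potential ?g (fst (absorb j s)) + (1 - w j) * potential ?g (fst s))
    \<le> real m * potential ?g (fst s) + real m * (potential (cluster_bound (Suc i)) (fst s) - potential ?g (fst s))"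
    unfolding e by (rule add_left_mono)
  also have "\<dots> = real m * potential (cluster_bound (Suc i)) (fst s)" by (simp add: right_diff_distrib)
  finally show ?thesis by (rule expect_hit_leI)
qed

text \<open>A set that splits a pair witnesses positive distance, and a set that contains both
  endpoints witnesses positive similarity, so no pair costs more than its indicator.\<close>

lemma potential_absorb_le:
  assumes "inv s" "j < m"
  shows "potential nonzero_obj (fst (absorb j s)) \<le> potential nonzero_obj (fst s)"
proof -
  have "delta nonzero_obj (A j \<inter> live (fst s)) v t \<le> 0" if "v \<in> live (fst s)" "t \<in> live (fst s)" for v t
  proof -
    have vn: "v < n" "t < n" using that by (auto simp: live_def)
    have lt1: "sim v t < 1" if "v \<in> A j" "t \<notin> A j" "v < n" for v t
    proof -
      have "(\<Sum>i\<in>J v \<inter> J t. w i) < (\<Sum>i\<in>J v. w i)"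
        using that assms w_pos by (intro sum_strict_mono2[of _ _ j]) (auto simp: J_def less_imp_le)
      then show ?thesis using sum_J[OF that(3)] by (simp add: sim_def)
    qed
    have gt0: "0 < sim v t" if "v \<in> A j" "t \<in> A j"
      unfolding sim_def using that assms w_pos by (intro sum_pos2[of _ j]) (auto simp: J_def less_imp_le)
    show ?thesis using that lt1[of v t] lt1[of t v] vn gt0 sim_commute[of t v]
      by (auto simp: delta_def nonzero_obj_def)
  qed
  then have "(\<Sum>v\<in>live (fst s). \<Sum>t\<in>live (fst s). of_bool (v \<noteq> t) * delta nonzero_obj (A j \<inter> live (fst s)) v t) \<le> 0"
    by (intro sum_nonpos mult_nonneg_nonpos) auto
  then show ?thesis using potential_absorb[OF assms, of nonzero_obj] by linarith
qed

lemma finish_invariant: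
  assumes "inv s" "k \<le> m"
  shows "inv (fold absorb [0..<k] s) \<and> potential nonzero_obj (fst (fold absorb [0..<k] s)) \<le> potential nonzero_obj (fst s)
    \<and> (\<forall>j<k. fst (snd (fold absorb [0..<k] s)) j = [])"
  using assms(2)
proof (induction k)
  case 0 show ?case using assms(1) by simp
next
  case (Suc k)
  let ?s = "fold absorb [0..<k] s"
  have *: "inv ?s" "potential nonzero_obj (fst ?s) \<le> potential nonzero_obj (fst s)" "\<forall>j<k. fst (snd ?s) j = []"
    using Suc by auto
  have "\<forall>j<Suc k. fst (snd (absorb k ?s)) j = []"
    using *(3) by (cases ?s) (auto simp: absorb_def less_Suc_eq)
  then show ?case using * inv_absorb[of ?s k] potential_absorb_le[of ?s k] Suc.prems by simp
qed

text \<open>Some set contains \<open>v\<close>, its list is empty after the sweep, and the invariant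
  would keep an unlabelled \<open>v\<close> in that list.\<close>

lemma finish_labels_all: "inv s \<Longrightarrow> v < n \<Longrightarrow> fst (finish s) v \<noteq> 0"
proof
  assume s: "inv s" "v < n" "fst (finish s) v = 0"
  obtain j where j: "j < m" "v \<in> A j" using J_nonempty[OF s(2)] by (auto simp: J_def)
  then have "inv (finish s)" "fst (snd (finish s)) j = []" using finish_invariant[OF s(1) order_refl] by (auto simp: finish_def)
  moreover obtain lab L c where f: "finish s = (lab, L, c)" by (cases "finish s")
  ultimately have "inv (lab, L, c)" "L j = []" by simp_all
  then have "\<forall>j<m. distinct (L j) \<and> set (L j) \<subseteq> A j \<and> {v \<in> A j. lab v = 0} \<subseteq> set (L j)"
    unfolding inv_def case_prod_conv by (elim conjE)
  from this[rule_format, OF j(1)] have "{v \<in> A j. lab v = 0} \<subseteq> set (L j)" by (elim conjE)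
  moreover have "v \<in> {v \<in> A j. lab v = 0}" using s(3) j(2) f by simp
  ultimately have "v \<in> set (L j)" by (rule subsetD)
  then show False using \<open>L j = []\<close> by simp
qed

lemma cluster_cost_nonneg: "v < n \<Longrightarrow> 0 \<le> cluster_cost v t"
  using x_nonneg[of v t] sim_nonneg[of v t] by (simp add: cluster_cost_def)

lemma cluster_bound_ge: "v < n \<Longrightarrow> nonzero_obj v t \<le> cluster_bound 0 v t"
  using cluster_cost_nonneg by (simp add: cluster_bound_def)

lemma potential_mono:
  assumes "\<And>v t. v < n \<Longrightarrow> t < n \<Longrightarrow> \<phi> v t \<le> \<psi> v t"
  shows "potential \<phi> lab \<le> potential \<psi> lab"
  unfolding potential_def using assms by (intro sum_mono) (auto simp: charge_def)

lemma expect_hits_finish: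
  assumes "inv s"
  shows "expect (iterate_pmf R hit s \<bind> (\<lambda>s. return_pmf (finish s))) (\<lambda>s. potential nonzero_obj (fst s))
     \<le> potential (cluster_bound R) (fst s)"
proof -
  have "expect (iterate_pmf R hit s \<bind> (\<lambda>s. return_pmf (finish s))) (\<lambda>s. potential nonzero_obj (fst s))
    = expect (iterate_pmf R hit s) (\<lambda>s. potential nonzero_obj (fst (finish s)))"
    by (simp add: expect_bind finite_iterate_pmf)
  also have "\<dots> \<le> expect (iterate_pmf R hit s) (\<lambda>s. potential (cluster_bound 0) (fst s))"
  proof (intro expect_mono finite_iterate_pmf finite_hit)
    fix s' assume "s' \<in> set_pmf (iterate_pmf R hit s)"
    then have "inv s'" using set_iterate_pmf[of inv hit] inv_hit assms by blast
    then have "potential nonzero_obj (fst (finish s')) \<le> potential nonzero_obj (fst s')"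
      using finish_invariant[of s' m] by (simp add: finish_def)
    also have "\<dots> \<le> potential (cluster_bound 0) (fst s')" using cluster_bound_ge by (intro potential_mono)
    finally show "potential nonzero_obj (fst (finish s')) \<le> potential (cluster_bound 0) (fst s')" .
  qed
  also have "\<dots> \<le> potential (cluster_bound R) (fst s)"
    using expect_iterate_pmf_le[of hit inv "\<lambda>i s. potential (cluster_bound i) (fst s)" s R]
      inv_hit expect_hit_potential assms by auto
  finally show ?thesis .
qed

lemma price_nonneg: "v < n \<Longrightarrow> 0 \<le> price (plus v t) (x v t)"
  using x_nonneg[of v t] sim_nonneg[of v t] budget_nonneg[of "x v t"] minus_price_ge[of "x v t"] by (simp add: price_def)

text \<open>The balance that determines \<open>budget\<close>, for + and minus pairs alike.\<close>

lemma price_obj: "v < n \<Longrightarrow> 23/31 * cluster_cost v t + 8/31 * price (plus v t) (x v t) = 46/31 * obj v t"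
  using x_nonneg[of v t]
  by (simp add: cluster_cost_def price_def obj_def budget_def divide_simps) (simp add: algebra_simps power2_eq_square)

lemma obj_nonneg: "v < n \<Longrightarrow> 0 \<le> obj v t"
  using x_nonneg[of v t] sim_nonneg[of v t] by (simp add: obj_def)

lemma cluster_cost_le: "v < n \<Longrightarrow> cluster_cost v t \<le> 2 * obj v t"
proof -
  assume v: "v < n"
  have "a / (1 + y) \<le> a" if "0 \<le> a" "0 \<le> y" for a y :: real
    using that divide_left_mono[of 1 "1 + y" a] by simp
  from this[of "if plus v t then 2 * x v t else sim v t" "x v t"] show ?thesis
    using x_nonneg[OF v, of t] sim_nonneg[of v t] by (auto simp: cluster_cost_def obj_def split: if_splits)
qed

text \<open>A nonzero LP cost is a nonempty sum of coordinates, each at least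
  \<open>\<Delta>\<close>. This is where granularity turns an error per pair into a multiple of the
  objective.\<close>

lemma nonzero_obj_le: "v < n \<Longrightarrow> nonzero_obj v t \<le> obj v t / \<Delta>"
proof -
  assume v: "v < n"
  have "\<Delta> \<le> sim v t" if "0 < sim v t"
  proof -
    have "J v \<inter> J t \<noteq> {}" using that by (auto simp: sim_def)
    then obtain j where j: "j \<in> J v \<inter> J t" by blast
    then have "w j \<le> sim v t" unfolding sim_def by (intro member_le_sum) (auto intro: w_nonneg)
    then show ?thesis using w_ge[of j] j by (auto simp: J_def)
  qed
  moreover have "\<Delta> \<le> x v t" if "sim v t < 1"
  proof -
    \<comment> \<open>The distance is the mass of the sets that contain \<open>v\<close> but not
      \<open>t\<close>.\<close>
    have x: "x v t = (\<Sum>j\<in>J v - J t. w j)"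
      using sum_J[OF v] sum.subset_diff[of "J v \<inter> J t" "J v" w] by (simp add: sim_def Diff_Int2 Diff_Int)
    have "J v - J t \<noteq> {}"
    proof
      assume "J v - J t = {}"
      then have "(\<Sum>j\<in>J v - J t. w j) = 0" by (simp only: sum.empty)
      then show False using that x by linarith
    qed
    then obtain j where j: "j \<in> J v - J t" by blast
    then have "w j \<le> x v t" unfolding x by (intro member_le_sum) (auto intro: w_nonneg)
    then show ?thesis using w_ge[of j] j by (auto simp: J_def)
  qed
  ultimately have "nonzero_obj v t * \<Delta> \<le> obj v t"
    using obj_nonneg[OF v, of t] sim_nonneg[of v t] sim_le_1[OF v, of t] by (auto simp: nonzero_obj_def obj_def)
  then show ?thesis using Delta_pos by (simp only: pos_le_divide_eq)
qed

lemma potential_unlabelled: "(\<And>v. lab v = 0) \<Longrightarrow> potential \<phi> lab = tot \<phi>"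
  unfolding potential_def tot_def by (intro sum.cong refl) (simp add: charge_def)

lemma tot_mono: "(\<And>v t. v < n \<Longrightarrow> t < n \<Longrightarrow> \<phi> v t \<le> \<psi> v t) \<Longrightarrow> tot \<phi> \<le> tot \<psi>"
  unfolding tot_def by (intro sum_mono mult_left_mono) auto

lemma tot_scale: "tot (\<lambda>v t. a * \<phi> v t) = a * tot \<phi>"
  by (simp only: tot_def sum_distrib_left mult.left_commute)

lemma tot_add: "tot (\<lambda>v t. \<phi> v t + \<psi> v t) = tot \<phi> + tot \<psi>"
  by (simp only: tot_def sum.distrib distrib_left)

lemma tot_obj_nonneg: "0 \<le> tot obj"
  unfolding tot_def using obj_nonneg by (intro sum_nonneg) auto

text \<open>A pair is left undecided either because the trials missed it, which decays geometrically
  below the cap, or because the cap was reached, which Markov's inequality bounds through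
  \<open>work\<close>.\<close>

lemma expect_trials_und:
  assumes "inv s" "0 < b" and nonneg: "\<And>v t. 0 \<le> \<phi> v t"
  shows "expect (iterate_pmf R (trial b) s) (\<lambda>s. und \<phi> (fst s)) \<le> tot \<phi> * ((1 - 1/n) ^ R + work s / b)"
proof -
  let ?p = "iterate_pmf R (trial b) s"
  let ?U = "\<lambda>s. of_bool (snd (snd s) < b) * und \<phi> (fst s)"
  have fin: "finite (set_pmf ?p)" by (simp add: finite_iterate_pmf)
  have r: "0 \<le> 1 - 1 / real n" using n_pos by simp
  have invp: "inv s'" if "s' \<in> set_pmf ?p" for s'
    using set_iterate_pmf[of inv "trial b" s s' R] inv_trial assms(1) that by blast
  \<comment> \<open>Below the cap the first summand is all of \<open>und\<close>; at the cap
    \<open>work s / b\<close> is at least 1 and the second summand covers it.\<close>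
  have "expect ?p (\<lambda>s. und \<phi> (fst s)) \<le> expect ?p (\<lambda>s. ?U s + tot \<phi> / b * work s)"
  proof (intro expect_mono fin)
    fix s' assume "s' \<in> set_pmf ?p"
    obtain lab L c where s': "s' = (lab, L, c)" by (cases s')
    have "0 \<le> c" using invp[OF \<open>s' \<in> set_pmf ?p\<close>] by (simp add: inv_def s')
    then have "c \<le> work s'" using Delta_pos by (simp add: work_def s' sum_nonneg)
    have t: "und \<phi> lab \<le> tot \<phi>" "0 \<le> und \<phi> lab" using und_le_tot und_nonneg nonneg by blast+
    show "und \<phi> (fst s') \<le> ?U s' + tot \<phi> / b * work s'"
    proof (cases "c < b")
      case True
      have "0 \<le> tot \<phi> / b * work s'" using t \<open>0 \<le> c\<close> \<open>c \<le> work s'\<close> assms(2) by (intro mult_nonneg_nonneg divide_nonneg_pos) auto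
      then show ?thesis using True by (simp add: s')
    next
      case False
      then have "tot \<phi> / b * b \<le> tot \<phi> / b * work s'" using t \<open>c \<le> work s'\<close> assms(2) by (intro mult_left_mono) auto
      then show ?thesis using t False assms(2) by (simp add: s')
    qed
  qed
  also have "\<dots> = expect ?p ?U + tot \<phi> / b * expect ?p work"
    by (simp add: finite_integrable[OF fin])
  finally have 1: "expect ?p (\<lambda>s. und \<phi> (fst s)) \<le> expect ?p ?U + tot \<phi> / b * expect ?p work" .
  have "expect (trial b s) (\<lambda>s. (1 - 1/n) ^ i * ?U s) \<le> (1 - 1/n) ^ Suc i * ?U s" for i s
  proof -
    have "expect (trial b s) (\<lambda>s. (1 - 1/n) ^ i * ?U s) = (1 - 1/n) ^ i * expect (trial b s) ?U"
      by (rule integral_mult_right_zero)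
    also have "\<dots> \<le> (1 - 1/n) ^ i * ((1 - 1/n) * ?U s)"
      using r by (intro mult_left_mono expect_trial_und nonneg) auto
    finally show ?thesis by (simp only: power_Suc2 mult.assoc)
  qed
  then have "expect ?p ?U \<le> (1 - 1/n) ^ R * ?U s"
    using expect_iterate_pmf_le[of "trial b" inv "\<lambda>i s. (1 - 1/n) ^ i * ?U s" s R] inv_trial assms(1) by auto
  also have "\<dots> \<le> (1 - 1/n) ^ R * tot \<phi>"
    using r und_le_tot[of \<phi> "fst s"] und_nonneg[of \<phi> "fst s"] nonneg by (intro mult_left_mono) auto
  finally have 2: "expect ?p ?U \<le> (1 - 1/n) ^ R * tot \<phi>" .
  have "expect ?p work \<le> work s"
    using expect_iterate_pmf_le[of "trial b" inv "\<lambda>_. work" s R] inv_trial expect_trial_work assms(1) by auto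
  moreover have "0 \<le> tot \<phi> / b"
    using und_nonneg[of \<phi> "fst s"] und_le_tot[of \<phi> "fst s"] nonneg assms(2) by simp
  ultimately have 3: "tot \<phi> / b * expect ?p work \<le> tot \<phi> / b * work s" by (rule mult_left_mono)
  have "tot \<phi> * ((1 - 1/n) ^ R + work s / b) = (1 - 1/n) ^ R * tot \<phi> + tot \<phi> / b * work s"
    by (simp add: distrib_left)
  then show ?thesis using 1 2 3 by linarith
qed

text \<open>The exact balance gives 46/31. The rest measures truncation: the hits lose
  \<open>(1 - 1/m) ^ R' / \<Delta>\<close>, and pairs that the trials leave undecided pay the hit
  bound a second time.\<close>

theorem expect_rounding:
  assumes "inv s" "\<And>v. fst s v = 0" "0 < b"
  shows "expect (rounding b R R' s) (\<lambda>s. potential nonzero_obj (fst s)) \<le>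
    (46/31 + (1 - 1/m) ^ R' / \<Delta> + ((1 - 1/n) ^ R + work s / b) * (2 + (1 - 1/m) ^ R' / \<Delta>)) * tot obj"
proof -
  define \<eta> where "\<eta> = (1 - 1 / real m) ^ R'"
  define \<zeta> where "\<zeta> = (1 - 1 / real n) ^ R + work s / b"
  have \<eta>: "0 \<le> \<eta>" using m_pos by (simp add: \<eta>_def)
  have \<zeta>: "0 \<le> \<zeta>"
    using assms n_pos Delta_pos by (cases s) (auto simp: \<zeta>_def work_def inv_def intro!: add_nonneg_nonneg divide_nonneg_pos sum_nonneg)
  define F where "F s = expect (iterate_pmf R' hit s \<bind> (\<lambda>s. return_pmf (finish s))) (\<lambda>s. potential nonzero_obj (fst s))" for s
  have F: "F s \<le> potential (cluster_bound R') (fst s)" if "inv s" for s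
    unfolding F_def by (rule expect_hits_finish[OF that])
  let ?p = "iterate_pmf R (trial b) s"
  have fin: "finite (set_pmf ?p)" by (simp add: finite_iterate_pmf)
  have invp: "inv s'" if "s' \<in> set_pmf ?p" for s'
    using set_iterate_pmf[of inv "trial b" s s' R] inv_trial assms(1) that by blast
  \<comment> \<open>Nonnegativity of the bound is at hand for real vertices only, and
    \<open>und\<close> asks for it everywhere.\<close>
  define g where "g v t = (if v < n then cluster_bound R' v t else 0)" for v t
  have g_nonneg: "0 \<le> g v t" for v t
    using cluster_cost_nonneg[of v t] nonzero_obj_nonneg[of v t] \<eta> by (simp add: g_def cluster_bound_def \<eta>_def)
  have tot_g: "tot (cluster_bound R') = tot cluster_cost + \<eta> * tot nonzero_obj"
    by (simp add: cluster_bound_def[abs_def] tot_add tot_scale \<eta>_def)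
  have tot_g': "tot g = tot (cluster_bound R')"
    unfolding tot_def g_def by (intro sum.cong refl) simp
  have nz: "tot nonzero_obj \<le> tot obj / \<Delta>"
  proof -
    have "tot nonzero_obj \<le> tot (\<lambda>v t. 1 / \<Delta> * obj v t)" by (rule tot_mono) (use nonzero_obj_le in simp)
    then show ?thesis by (simp only: tot_scale) simp
  qed
  have cc: "tot cluster_cost \<le> 2 * tot obj"
    using tot_mono[of cluster_cost "\<lambda>v t. 2 * obj v t"] cluster_cost_le by (simp add: tot_scale)
  have price_eq: "23/31 * tot cluster_cost + 8/31 * tot (\<lambda>v t. price (plus v t) (x v t)) = 46/31 * tot obj"
  proof -
    have "tot (\<lambda>v t. 23/31 * cluster_cost v t + 8/31 * price (plus v t) (x v t)) = tot (\<lambda>v t. 46/31 * obj v t)"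
      unfolding tot_def by (intro sum.cong refl) (use price_obj in auto)
    then show ?thesis by (simp only: tot_add tot_scale)
  qed
  \<comment> \<open>An undecided pair is charged its price in the trials but the hit bound
    afterwards; replacing one by the sum of both costs at most \<open>und g\<close>.\<close>
  have "expect ?p F \<le> expect ?p (\<lambda>s. price_potential (fst s) + und g (fst s))"
  proof (intro expect_mono fin)
    fix s' assume "s' \<in> set_pmf ?p"
    then have "F s' \<le> potential (cluster_bound R') (fst s')" using F invp by blast
    also have "\<dots> \<le> price_potential (fst s') + und g (fst s')"
      unfolding potential_def und_def sum.distrib[symmetric]
      by (intro sum_mono) (auto simp: charge_def g_def price_nonneg)
    finally show "F s' \<le> price_potential (fst s') + und g (fst s')" .
  qed
  also have "\<dots> = expect ?p (\<lambda>s. price_potential (fst s)) + expect ?p (\<lambda>s. und g (fst s))"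
    by (simp add: finite_integrable[OF fin])
  also have "expect ?p (\<lambda>s. price_potential (fst s)) \<le> price_potential (fst s)"
    using expect_iterate_pmf_le[of "trial b" inv "\<lambda>_ s. price_potential (fst s)" s R] inv_trial expect_trial_potential assms(1)
    by auto
  also have "price_potential (fst s) = tot (\<lambda>v t. price (plus v t) (x v t))"
    by (rule potential_unlabelled) (rule assms)
  also have "expect ?p (\<lambda>s. und g (fst s)) \<le> tot g * \<zeta>"
    unfolding \<zeta>_def by (rule expect_trials_und[OF assms(1,3) g_nonneg])
  finally have pivot_part: "expect ?p F \<le> tot (\<lambda>v t. price (plus v t) (x v t)) + tot g * \<zeta>" by simp
  have cluster_part: "F s \<le> tot cluster_cost + \<eta> * tot nonzero_obj"
    using F[OF assms(1)] potential_unlabelled[OF assms(2)] tot_g by simp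
  have "expect (rounding b R R' s) (\<lambda>s. potential nonzero_obj (fst s)) = 23/31 * F s + 8/31 * expect ?p F"
    unfolding rounding_def F_def
    by (subst expect_bind) (auto simp: expect_bernoulli expect_bind[OF fin] expect_bind finite_iterate_pmf bind_return_pmf)
  also have "\<dots> \<le> 23/31 * (tot cluster_cost + \<eta> * tot nonzero_obj) + 8/31 * (tot (\<lambda>v t. price (plus v t) (x v t)) + tot g * \<zeta>)"
    using pivot_part cluster_part by (intro add_mono mult_left_mono) auto
  also have "\<dots> = 46/31 * tot obj + (23/31 * (\<eta> * tot nonzero_obj) + 8/31 * (tot g * \<zeta>))"
    using price_eq by (simp add: distrib_left)
  \<comment> \<open>In the error terms the mixing probabilities are simply bounded by 1.\<close>
  also have "\<dots> \<le> 46/31 * tot obj + (1 * (\<eta> * (tot obj / \<Delta>)) + 1 * ((2 * tot obj + \<eta> * (tot obj / \<Delta>)) * \<zeta>))"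
    unfolding tot_g' tot_g using nz cc \<eta> \<zeta> Delta_pos tot_obj_nonneg
    by (intro add_left_mono add_mono mult_mono mult_right_mono mult_left_mono mult_nonneg_nonneg add_nonneg_nonneg)
      (auto simp: tot_def nonzero_obj_nonneg cluster_cost_nonneg intro!: sum_nonneg)
  also have "\<dots> = (46/31 + \<eta> / \<Delta> + \<zeta> * (2 + \<eta> / \<Delta>)) * tot obj" by (simp add: algebra_simps)
  finally show ?thesis unfolding \<eta>_def \<zeta>_def .
qed

end

section \<open>Runs of the machine with path-dependent lengths\<close>

text \<open>\<open>path_run s D\<close>: runs from \<open>s\<close> that are stopped after a path-dependent number of steps yield the
  distribution \<open>D\<close> of label, state and number of steps. The labels record the abstract values that the
  states represent; rule \<open>mix\<close> lets the labels be random.\<close>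

inductive path_run :: "nat \<Rightarrow> cc_input \<Rightarrow> instr list \<Rightarrow> ram_state \<Rightarrow> ('a \<times> ram_state \<times> nat) pmf \<Rightarrow> bool" for W I P where
  stop: "path_run W I P s (return_pmf (a, s, 0))"
| step: "(\<And>s'. s' \<in> set_pmf (step W I P s) \<Longrightarrow> path_run W I P s' (F s')) \<Longrightarrow>
    path_run W I P s (step W I P s \<bind> (\<lambda>s'. map_pmf (\<lambda>(a, s', t). (a, s', Suc t)) (F s')))"
| mix: "(\<And>D. D \<in> set_pmf p \<Longrightarrow> path_run W I P s D) \<Longrightarrow> path_run W I P s (join_pmf p)"

lemma path_run_mix: "(\<And>y. y \<in> set_pmf p \<Longrightarrow> path_run W I P s (G y)) \<Longrightarrow> path_run W I P s (p \<bind> G)"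
proof -
  assume *: "\<And>y. y \<in> set_pmf p \<Longrightarrow> path_run W I P s (G y)"
  have "path_run W I P s (join_pmf (map_pmf G p))" by (rule path_run.mix) (use * in auto)
  then show ?thesis by (simp add: join_eq_bind_pmf bind_map_pmf)
qed

lemma path_run_bind:
  assumes "path_run W I P s D" "\<And>a s' t. (a, s', t) \<in> set_pmf D \<Longrightarrow> path_run W I P s' (G (a, s', t))"
  shows "path_run W I P s (D \<bind> (\<lambda>(a, s', t). map_pmf (\<lambda>(b, s'', t'). (b, s'', t + t')) (G (a, s', t))))"
  using assms
proof (induction arbitrary: G)
  case (stop s a)
  then have "path_run W I P s (G (a, s, 0))" by simp
  then show ?case by (simp add: bind_return_pmf case_prod_beta)
next
  case (step s F)
  have "path_run W I P s' (F s' \<bind> (\<lambda>(a, s'', t). map_pmf (\<lambda>(b, s'', t'). (b, s'', t + t')) (G (a, s'', Suc t))))"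
    if s': "s' \<in> set_pmf (Defs.step W I P s)" for s'
  proof -
    have "path_run W I P s'' (G (a, s'', Suc t))" if "(a, s'', t) \<in> set_pmf (F s')" for a s'' t
      by (rule step.prems) (use s' that in \<open>auto intro!: bexI[of _ s'] image_eqI[of _ _ "(a, s'', t)"]\<close>)
    then show ?thesis using step.IH[OF s', of "\<lambda>(a, s'', t). G (a, s'', Suc t)"] by (simp add: split_def)
  qed
  then have "path_run W I P s (Defs.step W I P s \<bind> (\<lambda>s'. map_pmf (\<lambda>(a, s', t). (a, s', Suc t))
     (F s' \<bind> (\<lambda>(a, s'', t). map_pmf (\<lambda>(b, s'', t'). (b, s'', t + t')) (G (a, s'', Suc t))))))"
    by (rule path_run.step)
  then show ?case
    by (simp add: bind_assoc_pmf map_bind_pmf bind_map_pmf case_prod_beta map_pmf_comp)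
next
  case (mix p s)
  have "path_run W I P s (p \<bind> (\<lambda>D. D \<bind> (\<lambda>(a, s', t). map_pmf (\<lambda>(b, s'', t'). (b, s'', t + t')) (G (a, s', t)))))"
  proof (rule path_run_mix)
    fix D assume D: "D \<in> set_pmf p"
    show "path_run W I P s (D \<bind> (\<lambda>(a, s', t). map_pmf (\<lambda>(b, s'', t'). (b, s'', t + t')) (G (a, s', t))))"
      by (rule mix.IH[OF D]) (rule mix.prems, use D in \<open>auto simp: join_eq_bind_pmf\<close>)
  qed
  then show ?case by (simp add: join_eq_bind_pmf bind_assoc_pmf)
qed

text \<open>Steps are added at the front, which suits induction along a path; \<open>run\<close>
  adds them at the end.\<close>

primrec run_from :: "nat \<Rightarrow> cc_input \<Rightarrow> instr list \<Rightarrow> nat \<Rightarrow> ram_state \<Rightarrow> ram_state pmf" where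
  "run_from W I P 0 s = return_pmf s"
| "run_from W I P (Suc t) s = step W I P s \<bind> run_from W I P t"

lemma run_from_Suc: "run_from W I P (Suc t) s = run_from W I P t s \<bind> step W I P"
proof (induction t arbitrary: s)
  case 0
  have "run_from W I P 0 = return_pmf" by (rule ext) simp
  then show ?case by (simp add: bind_return_pmf bind_return_pmf')
next
  case (Suc t)
  have "run_from W I P (Suc t) = (\<lambda>s. run_from W I P t s \<bind> step W I P)" by (rule ext) (rule Suc.IH)
  then have "run_from W I P (Suc (Suc t)) s = step W I P s \<bind> (\<lambda>s. run_from W I P t s \<bind> step W I P)"
    by (simp only: run_from.simps(2)[of W I P "Suc t" s])
  then show ?case by (simp add: bind_assoc_pmf)
qed

lemma run_eq_run_from: "run W I P t = run_from W I P t init_state"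
  by (induction t) (simp_all only: run.simps run_from_Suc run_from.simps(1))

lemma run_from_halted: "halted P s \<Longrightarrow> run_from W I P t s = return_pmf s"
  by (induction t) (simp_all add: step_def bind_return_pmf)

text \<open>Halted states do not change, so paths that stop at different times all agree with the
  run after \<open>T\<close> steps.\<close>

lemma run_from_path_run:
  assumes "path_run W I P s D" "\<And>a s' t. (a, s', t) \<in> set_pmf D \<Longrightarrow> halted P s' \<and> t \<le> T"
  shows "run_from W I P T s = map_pmf (\<lambda>x. fst (snd x)) D"
  using assms
proof (induction arbitrary: T)
  case (stop s a)
  then show ?case by (simp add: run_from_halted)
next
  case (step s F)
  have mem: "halted P s'' \<and> Suc t \<le> T" if "s' \<in> set_pmf (Defs.step W I P s)" "(a, s'', t) \<in> set_pmf (F s')" for a s' s'' t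
    using step.prems[of a s'' "Suc t"] that by force
  \<comment> \<open>Supports are nonempty, so some path takes this step, and the bound on its length
    makes \<open>T\<close> a successor.\<close>
  obtain s' where s': "s' \<in> set_pmf (Defs.step W I P s)" using set_pmf_not_empty by fast
  obtain a s'' t where "(a, s'', t) \<in> set_pmf (F s')" using set_pmf_not_empty[of "F s'"] by (metis prod_cases3 ex_in_conv)
  with mem s' obtain T' where T: "T = Suc T'" by (cases T) auto
  have "run_from W I P T' s' = map_pmf (\<lambda>x. fst (snd x)) (F s')" if "s' \<in> set_pmf (Defs.step W I P s)" for s'
    using step.IH[OF that, of T'] mem[OF that] T by auto
  then show ?case
    by (simp add: T map_bind_pmf map_pmf_comp case_prod_beta cong: bind_pmf_cong)
next
  case (mix p s)
  have "run_from W I P T s = map_pmf (\<lambda>x. fst (snd x)) D" if "D \<in> set_pmf p" for D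
    using mix.IH[OF that, of T] mix.prems that by (auto simp: join_eq_bind_pmf)
  then have "map_pmf (\<lambda>x. fst (snd x)) (join_pmf p) = p \<bind> (\<lambda>_. run_from W I P T s)"
    by (simp add: join_eq_bind_pmf map_bind_pmf cong: bind_pmf_cong)
  then show ?case by simp
qed

section \<open>Structured programs and their compilation\<close>

datatype com = Block "instr list" | Draw instr | Seq com com (infixr ";;" 60)
  | IfLess reg reg com com | IfRLess reg reg com com | WhileLess reg reg com | WhileRLess reg reg com

fun size_com :: "com \<Rightarrow> nat" where
  "size_com (Block is) = length is"
| "size_com (Draw i) = 1"
| "size_com (c ;; d) = size_com c + size_com d"
| "size_com (IfLess a b c d) = size_com c + size_com d + 2"
| "size_com (IfRLess a b c d) = size_com c + size_com d + 2"
| "size_com (WhileLess a b c) = size_com c + 3"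
| "size_com (WhileRLess a b c) = size_com c + 3"

text \<open>Jump targets are absolute, so the start address \<open>k\<close> is a parameter. A
  conditional jump is taken when its test holds, which places the second branch of a conditional
  before the first.\<close>

fun compile :: "nat \<Rightarrow> com \<Rightarrow> instr list" where
  "compile k (Block is) = is"
| "compile k (Draw i) = [i]"
| "compile k (c ;; d) = compile k c @ compile (k + size_com c) d"
| "compile k (IfLess a b c d) = JumpLess a b (k + 2 + size_com d) # compile (k + 1) d
     @ Jump (k + 2 + size_com d + size_com c) # compile (k + 2 + size_com d) c"
| "compile k (IfRLess a b c d) = RJumpLess a b (k + 2 + size_com d) # compile (k + 1) d
     @ Jump (k + 2 + size_com d + size_com c) # compile (k + 2 + size_com d) c"
| "compile k (WhileLess a b c) = JumpLess a b (k + 2) # Jump (k + 3 + size_com c) # compile (k + 2) c @ [Jump k]"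
| "compile k (WhileRLess a b c) = RJumpLess a b (k + 2) # Jump (k + 3 + size_com c) # compile (k + 2) c @ [Jump k]"

lemma length_compile [simp]: "length (compile k c) = size_com c"
  by (induction c arbitrary: k) auto

primrec code_at :: "instr list \<Rightarrow> nat \<Rightarrow> instr list \<Rightarrow> bool" where
  "code_at P k [] \<longleftrightarrow> True"
| "code_at P k (i # is) \<longleftrightarrow> k < length P \<and> P ! k = i \<and> code_at P (Suc k) is"

lemmas code_at_Cons = code_at.simps(2)

lemma code_at_append: "code_at P k (is @ js) \<longleftrightarrow> code_at P k is \<and> code_at P (k + length is) js"
  by (induction "is" arbitrary: k) auto

lemma code_at_suffix: "code_at (xs @ is) (length xs) is"
proof (induction "is" arbitrary: xs)
  case (Cons i "is")
  show ?case using Cons.IH[of "xs @ [i]"] by (simp add: nth_append)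
qed simp

text \<open>The effect of an instruction apart from the program counter, which makes the meaning of
  straight-line code independent of its address.\<close>

fun det_step :: "nat \<Rightarrow> cc_input \<Rightarrow> instr \<Rightarrow> ram_state \<Rightarrow> ram_state" where
  "det_step W I (SetWord d k) s = s\<lparr>wreg := (wreg s)(d := k mod W)\<rparr>"
| "det_step W I (WordOp f d a b) s = s\<lparr>wreg := (wreg s)(d := sem_word_op f (wreg s a) (wreg s b) mod W)\<rparr>"
| "det_step W I (Load d a) s = s\<lparr>wreg := (wreg s)(d := wmem s (wreg s a) mod W)\<rparr>"
| "det_step W I (Store a b) s = s\<lparr>wmem := (wmem s)(wreg s a := wreg s b)\<rparr>"
| "det_step W I (RealOfWord d a) s = s\<lparr>rreg := (rreg s)(d := real (wreg s a))\<rparr>"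
| "det_step W I (RealOp f d a b) s = s\<lparr>rreg := (rreg s)(d := sem_real_op f (rreg s a) (rreg s b))\<rparr>"
| "det_step W I (RLoad d a) s = s\<lparr>rreg := (rreg s)(d := rmem s (wreg s a))\<rparr>"
| "det_step W I (RStore a b) s = s\<lparr>rmem := (rmem s)(wreg s a := rreg s b)\<rparr>"
| "det_step W I (QNumVertices d) s = s\<lparr>wreg := (wreg s)(d := in_n I mod W)\<rparr>"
| "det_step W I (QPlusEdge d a b) s = s\<lparr>wreg := (wreg s)(d := of_bool ({wreg s a, wreg s b} \<in> in_plus I) mod W)\<rparr>"
| "det_step W I (QNumSets d) s = s\<lparr>wreg := (wreg s)(d := length (in_sol I) mod W)\<rparr>"
| "det_step W I (QSetSize d a) s =
     s\<lparr>wreg := (wreg s)(d := length (fst (nth_or ([], 0) (in_sol I) (wreg s a))) mod W)\<rparr>"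
| "det_step W I (QSetMember d a b) s =
     s\<lparr>wreg := (wreg s)(d := nth_or 0 (fst (nth_or ([], 0) (in_sol I) (wreg s a))) (wreg s b) mod W)\<rparr>"
| "det_step W I (QSetValue d a) s = s\<lparr>rreg := (rreg s)(d := snd (nth_or ([], 0) (in_sol I) (wreg s a)))\<rparr>"
| "det_step W I (QDelta d) s = s\<lparr>rreg := (rreg s)(d := in_delta I)\<rparr>"
| "det_step W I _ s = s"

fun det_instr :: "instr \<Rightarrow> bool" where
  "det_instr (Jump _) = False" | "det_instr (JumpLess _ _ _) = False" | "det_instr (RJumpLess _ _ _) = False"
| "det_instr (RandWord _ _) = False" | "det_instr (Flip _ _) = False"
| "det_instr (QDegree _ _) = False" | "det_instr (QNeighbor _ _ _) = False" | "det_instr (QEps _) = False"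
| "det_instr _ = True"

lemma exec_det: "det_instr i \<Longrightarrow> exec W I i s = return_pmf ((det_step W I i s)\<lparr>pc := Suc (pc s)\<rparr>)"
  by (cases i) (auto simp: put_word_def put_real_def next_pc_def)

lemma det_step_pc: "det_step W I i (s\<lparr>pc := k\<rparr>) = (det_step W I i s)\<lparr>pc := k\<rparr>"
  by (cases i) auto

lemma pc_det_step [simp]: "pc (det_step W I i s) = pc s"
  by (cases i) auto

section \<open>A program logic that couples machine runs with abstract distributions\<close>

locale ram = fixes W :: nat and I :: cc_input
begin

definition block :: "instr list \<Rightarrow> ram_state \<Rightarrow> ram_state" where
  "block is s = fold (det_step W I) is s"

lemma block_simps [simp]: "block [] s = s" "block (i # is) s = block is (det_step W I i s)"
  by (simp_all add: block_def)

lemma block_append: "block (is @ js) s = block js (block is s)"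
  by (simp add: block_def)

text \<open>Started in \<open>s\<close>, the command \<open>c\<close> terminates on every path, and its final states are coupled with the
  distribution \<open>D\<close> on abstract values so that coupled values, states and path lengths satisfy \<open>Q\<close>.\<close>

definition sim_com :: "com \<Rightarrow> ram_state \<Rightarrow> 'a pmf \<Rightarrow> ('a \<Rightarrow> ram_state \<Rightarrow> nat \<Rightarrow> bool) \<Rightarrow> bool" where
  "sim_com c s D Q \<longleftrightarrow> (\<forall>P k. code_at P k (compile k c) \<longrightarrow>
     (\<exists>E. path_run W I P (s\<lparr>pc := k\<rparr>) (map_pmf (\<lambda>(a, s', t). ((a, s'), s'\<lparr>pc := k + size_com c\<rparr>, t)) E) \<and>
        map_pmf fst E = D \<and> (\<forall>a s' t. (a, s', t) \<in> set_pmf E \<longrightarrow> Q a s' t)))"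

lemma sim_comD:
  assumes "sim_com c s D Q" "code_at P k (compile k c)"
  obtains E where "path_run W I P (s\<lparr>pc := k\<rparr>) (map_pmf (\<lambda>(a, s', t). ((a, s'), s'\<lparr>pc := k + size_com c\<rparr>, t)) E)"
    "map_pmf fst E = D" "\<And>a s' t. (a, s', t) \<in> set_pmf E \<Longrightarrow> Q a s' t"
  using assms unfolding sim_com_def by blast

lemma sim_comI:
  assumes "\<And>P k. code_at P k (compile k c) \<Longrightarrow>
     \<exists>E. path_run W I P (s\<lparr>pc := k\<rparr>) (map_pmf (\<lambda>(a, s', t). ((a, s'), s'\<lparr>pc := k + size_com c\<rparr>, t)) E) \<and>
        map_pmf fst E = D \<and> (\<forall>a s' t. (a, s', t) \<in> set_pmf E \<longrightarrow> Q a s' t)"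
  shows "sim_com c s D Q"
  using assms unfolding sim_com_def by blast

lemma label_mem: "map_pmf fst E = D \<Longrightarrow> (a, y) \<in> set_pmf E \<Longrightarrow> a \<in> set_pmf D"
  by force

lemma sim_com_consequence:
  assumes "sim_com c s D Q" "\<And>a s' t. a \<in> set_pmf D \<Longrightarrow> Q a s' t \<Longrightarrow> Q' a s' t"
  shows "sim_com c s D Q'"
proof (rule sim_comI)
  fix P k assume "code_at P k (compile k c)"
  from sim_comD[OF assms(1) this] obtain E where E: "path_run W I P (s\<lparr>pc := k\<rparr>) (map_pmf (\<lambda>(a, s', t). ((a, s'), s'\<lparr>pc := k + size_com c\<rparr>, t)) E)"
    "map_pmf fst E = D" "\<And>a s' t. (a, s', t) \<in> set_pmf E \<Longrightarrow> Q a s' t" by blast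
  have "Q' a s' t" if "(a, s', t) \<in> set_pmf E" for a s' t
    by (rule assms(2)[OF label_mem[OF E(2) that] E(3)[OF that]])
  then show "\<exists>E. path_run W I P (s\<lparr>pc := k\<rparr>) (map_pmf (\<lambda>(a, s', t). ((a, s'), s'\<lparr>pc := k + size_com c\<rparr>, t)) E) \<and>
        map_pmf fst E = D \<and> (\<forall>a s' t. (a, s', t) \<in> set_pmf E \<longrightarrow> Q' a s' t)"
    using E(1,2) by (intro exI[of _ E] conjI allI impI)
qed

text \<open>The composition rule behind sequences and loops: choose a coupling for the continuation
  of each outcome and glue them along the first. The label carries the intermediate state, since the
  continuation starts from it with another program counter.\<close>

lemma path_run_compose:
  assumes "path_run W I P s (map_pmf (\<lambda>(a, s', t). ((a, s'), p s', t)) E)" "map_pmf fst E = D"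
    and "\<And>a s' t. (a, s', t) \<in> set_pmf E \<Longrightarrow>
      \<exists>E'. path_run W I P (p s') (map_pmf (\<lambda>(b, s'', t'). ((b, s''), q s'', t')) E') \<and> map_pmf fst E' = F a \<and>
        (\<forall>b s'' t'. (b, s'', t') \<in> set_pmf E' \<longrightarrow> R b s'' (t + t'))"
  shows "\<exists>E'. path_run W I P s (map_pmf (\<lambda>(b, s'', t'). ((b, s''), q s'', t')) E') \<and> map_pmf fst E' = D \<bind> F \<and>
        (\<forall>b s'' t'. (b, s'', t') \<in> set_pmf E' \<longrightarrow> R b s'' t')"
proof -
  have "\<forall>x\<in>set_pmf E. \<exists>E'. path_run W I P (p (fst (snd x))) (map_pmf (\<lambda>(b, s'', t'). ((b, s''), q s'', t')) E') \<and> map_pmf fst E' = F (fst x) \<and>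
        (\<forall>b s'' t'. (b, s'', t') \<in> set_pmf E' \<longrightarrow> R b s'' (snd (snd x) + t'))"
  proof
    fix x assume "x \<in> set_pmf E"
    then show "\<exists>E'. path_run W I P (p (fst (snd x))) (map_pmf (\<lambda>(b, s'', t'). ((b, s''), q s'', t')) E') \<and> map_pmf fst E' = F (fst x) \<and>
        (\<forall>b s'' t'. (b, s'', t') \<in> set_pmf E' \<longrightarrow> R b s'' (snd (snd x) + t'))"
      using assms(3)[of "fst x" "fst (snd x)" "snd (snd x)"] by (simp only: prod.collapse)
  qed
  from bchoice[OF this] obtain G where G: "\<And>x. x \<in> set_pmf E \<Longrightarrow>
      path_run W I P (p (fst (snd x))) (map_pmf (\<lambda>(b, s'', t'). ((b, s''), q s'', t')) (G x)) \<and> map_pmf fst (G x) = F (fst x) \<and>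
        (\<forall>b s'' t'. (b, s'', t') \<in> set_pmf (G x) \<longrightarrow> R b s'' (snd (snd x) + t'))"
    by (elim exE) (rule that, drule bspec, assumption+)
  define E' where "E' = E \<bind> (\<lambda>x. map_pmf (\<lambda>(b, s'', t'). (b, s'', snd (snd x) + t')) (G x))"
  have "path_run W I P s (map_pmf (\<lambda>(a, s', t). ((a, s'), p s', t)) E \<bind> (\<lambda>(l, s', t). map_pmf (\<lambda>(b, s'', t'). (b, s'', t + t'))
     ((\<lambda>((a, s'), _, t). map_pmf (\<lambda>(b, s'', t'). ((b, s''), q s'', t')) (G (a, s', t))) (l, s', t))))"
  proof (rule path_run_bind[OF assms(1)])
    fix l s' t assume "(l, s', t) \<in> set_pmf (map_pmf (\<lambda>(a, s', t). ((a, s'), p s', t)) E)"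
    then obtain a s0 where "(a, s0, t) \<in> set_pmf E" "l = (a, s0)" "s' = p s0" by auto
    then show "path_run W I P s' ((\<lambda>((a, s'), _, t). map_pmf (\<lambda>(b, s'', t'). ((b, s''), q s'', t')) (G (a, s', t))) (l, s', t))"
      using G[of "(a, s0, t)"] by simp
  qed
  then have "path_run W I P s (map_pmf (\<lambda>(b, s'', t'). ((b, s''), q s'', t')) E')"
    by (simp add: E'_def bind_map_pmf map_bind_pmf map_pmf_comp case_prod_beta)
  moreover have "map_pmf fst E' = D \<bind> F"
  proof -
    have "map_pmf fst E' = E \<bind> (\<lambda>x. F (fst x))"
      unfolding E'_def map_bind_pmf by (intro bind_pmf_cong refl) (simp add: map_pmf_comp case_prod_beta G)
    then show ?thesis by (simp add: bind_map_pmf flip: assms(2))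
  qed
  moreover have "R b s'' t'" if m: "(b, s'', t') \<in> set_pmf E'" for b s'' t'
  proof -
    obtain x t0 where x: "x \<in> set_pmf E" "(b, s'', t0) \<in> set_pmf (G x)" "t' = snd (snd x) + t0"
      using m by (auto simp: E'_def)
    then show ?thesis using G[OF x(1)] by simp
  qed
  ultimately show ?thesis by (intro exI[of _ E'] conjI allI impI)
qed

text \<open>Rule \<open>step\<close> lets the continuation depend on the successor state alone;
  \<open>g\<close> reads the drawn value back from that state so that it can serve as label.\<close>

lemma path_run_single:
  assumes "k < length P" "P ! k = i" "exec W I i (s\<lparr>pc := k\<rparr>) = map_pmf (\<lambda>a. (f a)\<lparr>pc := k'\<rparr>) D"
    and g: "\<And>a. a \<in> set_pmf D \<Longrightarrow> g ((f a)\<lparr>pc := k'\<rparr>) = a"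
  shows "path_run W I P (s\<lparr>pc := k\<rparr>) (map_pmf (\<lambda>(a, s', t). ((a, s'), s'\<lparr>pc := k'\<rparr>, t)) (map_pmf (\<lambda>a. (a, f a, 1)) D))"
proof -
  have st: "step W I P (s\<lparr>pc := k\<rparr>) = map_pmf (\<lambda>a. (f a)\<lparr>pc := k'\<rparr>) D"
    using assms(1-3) by (simp add: step_def halted_def)
  have "path_run W I P (s\<lparr>pc := k\<rparr>) (step W I P (s\<lparr>pc := k\<rparr>) \<bind>
      (\<lambda>s'. map_pmf (\<lambda>(a, s', t). (a, s', Suc t)) (return_pmf ((g s', f (g s')), s', 0))))"
    by (rule path_run.step) (rule path_run.stop)
  also have "step W I P (s\<lparr>pc := k\<rparr>) \<bind> (\<lambda>s'. map_pmf (\<lambda>(a, s', t). (a, s', Suc t)) (return_pmf ((g s', f (g s')), s', 0)))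
    = D \<bind> (\<lambda>a. return_pmf ((a, f a), (f a)\<lparr>pc := k'\<rparr>, 1))"
    unfolding st bind_map_pmf by (rule bind_pmf_cong) (simp_all add: g)
  finally show ?thesis by (simp add: map_pmf_def bind_assoc_pmf bind_return_pmf)
qed

lemma sim_com_Block:
  assumes "list_all det_instr is" "Q a (block is s) (length is)"
  shows "sim_com (Block is) s (return_pmf a) Q"
proof -
  have run: "path_run W I P (s\<lparr>pc := k\<rparr>) (return_pmf (l, (block is s)\<lparr>pc := k + length is\<rparr>, length is))"
    if "code_at P k is" for P k and l :: "'a \<times> ram_state"
    using that assms(1)
  proof (induction "is" arbitrary: s k)
    case Nil show ?case using path_run.stop by simp
  next
    case (Cons i "is")
    then have P: "k < length P" "P ! k = i" "code_at P (Suc k) is" by (auto simp: code_at_Cons)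
    have st: "step W I P (s\<lparr>pc := k\<rparr>) = return_pmf ((det_step W I i s)\<lparr>pc := Suc k\<rparr>)"
      using P Cons.prems by (simp add: step_def halted_def exec_det det_step_pc)
    have "path_run W I P (s\<lparr>pc := k\<rparr>) (step W I P (s\<lparr>pc := k\<rparr>) \<bind> (\<lambda>_. map_pmf (\<lambda>(a, s', t). (a, s', Suc t))
        (return_pmf (l, (block is (det_step W I i s))\<lparr>pc := Suc k + length is\<rparr>, length is))))"
      by (rule path_run.step) (use st Cons.IH[OF P(3), of "det_step W I i s"] Cons.prems in simp)
    then show ?case using Cons.prems by (simp add: st bind_return_pmf)
  qed
  show ?thesis
    by (rule sim_comI, rule exI[of _ "return_pmf (a, block is s, length is)"]) (use run assms(2) in simp)
qed

lemma sim_com_Draw: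
  assumes "\<And>k. exec W I i (s\<lparr>pc := k\<rparr>) = map_pmf (\<lambda>a. (f a)\<lparr>pc := Suc k\<rparr>) D"
    "\<And>a k. a \<in> set_pmf D \<Longrightarrow> g ((f a)\<lparr>pc := k\<rparr>) = a"
    "\<And>a. a \<in> set_pmf D \<Longrightarrow> Q a (f a) 1"
  shows "sim_com (Draw i) s D Q"
proof (rule sim_comI)
  fix P k assume "code_at P k (compile k (Draw i))"
  then have P: "k < length P" "P ! k = i" by (auto simp: code_at_Cons)
  show "\<exists>E. path_run W I P (s\<lparr>pc := k\<rparr>) (map_pmf (\<lambda>(a, s', t). ((a, s'), s'\<lparr>pc := k + size_com (Draw i)\<rparr>, t)) E) \<and>
        map_pmf fst E = D \<and> (\<forall>a s' t. (a, s', t) \<in> set_pmf E \<longrightarrow> Q a s' t)"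
    by (rule exI[of _ "map_pmf (\<lambda>a. (a, f a, 1)) D"])
      (use path_run_single[OF P assms(1,2)] assms(3) in \<open>auto simp: map_pmf_comp\<close>)
qed

lemma path_run_jump:
  assumes "k < length P" "exec W I (P ! k) (s\<lparr>pc := k\<rparr>) = return_pmf (s\<lparr>pc := k'\<rparr>)"
    and "path_run W I P (s\<lparr>pc := k'\<rparr>) D"
  shows "path_run W I P (s\<lparr>pc := k\<rparr>) (map_pmf (\<lambda>(a, s', t). (a, s', Suc t)) D)"
proof -
  have st: "step W I P (s\<lparr>pc := k\<rparr>) = return_pmf (s\<lparr>pc := k'\<rparr>)" using assms by (simp add: step_def halted_def)
  have "path_run W I P (s\<lparr>pc := k\<rparr>) (step W I P (s\<lparr>pc := k\<rparr>) \<bind> (\<lambda>_. map_pmf (\<lambda>(a, s', t). (a, s', Suc t)) D))"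
    by (rule path_run.step) (use st assms(3) in simp)
  then show ?thesis by (simp add: st bind_return_pmf)
qed

lemma path_run_jump_stop:
  "k < length P \<Longrightarrow> P ! k = Jump k' \<Longrightarrow> path_run W I P (s\<lparr>pc := k\<rparr>) (return_pmf (l, s\<lparr>pc := k'\<rparr>, 1))"
  using path_run_jump[OF _ _ path_run.stop, of k P s k' l] by simp

lemma sim_com_Seq:
  assumes "sim_com c s D Q" "\<And>a s' t. a \<in> set_pmf D \<Longrightarrow> Q a s' t \<Longrightarrow> sim_com d s' (F a) (\<lambda>b s'' t'. R b s'' (t + t'))"
  shows "sim_com (c ;; d) s (D \<bind> F) R"
proof (rule sim_comI)
  fix P k assume "code_at P k (compile k (c ;; d))"
  then have code: "code_at P k (compile k c)" "code_at P (k + size_com c) (compile (k + size_com c) d)"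
    by (simp_all add: code_at_append)
  obtain E where E: "path_run W I P (s\<lparr>pc := k\<rparr>) (map_pmf (\<lambda>(a, s', t). ((a, s'), s'\<lparr>pc := k + size_com c\<rparr>, t)) E)"
    "map_pmf fst E = D" "\<And>a s' t. (a, s', t) \<in> set_pmf E \<Longrightarrow> Q a s' t" using sim_comD[OF assms(1) code(1)] by blast
  show "\<exists>E. path_run W I P (s\<lparr>pc := k\<rparr>) (map_pmf (\<lambda>(a, s', t). ((a, s'), s'\<lparr>pc := k + size_com (c ;; d)\<rparr>, t)) E) \<and>
        map_pmf fst E = D \<bind> F \<and> (\<forall>a s' t. (a, s', t) \<in> set_pmf E \<longrightarrow> R a s' t)"
  proof (rule path_run_compose[OF E(1,2)])
    fix a s' t assume m: "(a, s', t) \<in> set_pmf E"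
    then have "a \<in> set_pmf D" by (rule label_mem[OF E(2)])
    from assms(2)[OF this E(3)[OF m], unfolded sim_com_def, rule_format, OF code(2)]
    show "\<exists>E'. path_run W I P (s'\<lparr>pc := k + size_com c\<rparr>) (map_pmf (\<lambda>(b, s'', t'). ((b, s''), s''\<lparr>pc := k + size_com (c ;; d)\<rparr>, t')) E') \<and>
      map_pmf fst E' = F a \<and> (\<forall>b s'' t'. (b, s'', t') \<in> set_pmf E' \<longrightarrow> R b s'' (t + t'))"
      by (simp only: size_com.simps add.assoc)
  qed
qed

definition shifted :: "nat \<Rightarrow> ('a \<times> ram_state \<times> nat) \<Rightarrow> 'a \<times> ram_state \<times> nat" where
  "shifted d = (\<lambda>(a, s, t). (a, s, d + t))"

text \<open>Of the \<open>d\<close> extra time units, \<open>e\<close> are spent before the command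
  and \<open>d - e\<close> on the jump behind it.\<close>

lemma sim_com_branch:
  fixes D :: "'a pmf"
  assumes "sim_com c s D (\<lambda>a s' t. Q a s' (t + d))" "code_at P k' (compile k' c)"
    and "\<And>D'. path_run W I P (s\<lparr>pc := k'\<rparr>) (D' :: (('a \<times> ram_state) \<times> ram_state \<times> nat) pmf) \<Longrightarrow> path_run W I P (s\<lparr>pc := k\<rparr>) (map_pmf (shifted e) D')"
    and "\<And>s' l. path_run W I P (s'\<lparr>pc := k' + size_com c\<rparr>) (return_pmf (l :: 'a \<times> ram_state, s'\<lparr>pc := k''\<rparr>, d - e))" "e \<le> d"
  shows "\<exists>E. path_run W I P (s\<lparr>pc := k\<rparr>) (map_pmf (\<lambda>(a, s', t). ((a, s'), s'\<lparr>pc := k''\<rparr>, t)) E) \<and>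
        map_pmf fst E = D \<and> (\<forall>a s' t. (a, s', t) \<in> set_pmf E \<longrightarrow> Q a s' t)"
proof -
  obtain E where E: "path_run W I P (s\<lparr>pc := k'\<rparr>) (map_pmf (\<lambda>(a, s', t). ((a, s'), s'\<lparr>pc := k' + size_com c\<rparr>, t)) E)"
    "map_pmf fst E = D" "\<And>a s' t. (a, s', t) \<in> set_pmf E \<Longrightarrow> Q a s' (t + d)" using sim_comD[OF assms(1,2)] by blast
  have "path_run W I P (s\<lparr>pc := k'\<rparr>) (map_pmf (\<lambda>(a, s', t). ((a, s'), s'\<lparr>pc := k' + size_com c\<rparr>, t)) E \<bind>
     (\<lambda>(l, s', t). map_pmf (\<lambda>(b, s'', t'). (b, s'', t + t')) ((\<lambda>(l, _, _). return_pmf (l, (snd l)\<lparr>pc := k''\<rparr>, d - e)) (l, s', t))))"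
    by (rule path_run_bind[OF E(1)]) (auto intro!: assms(4))
  from assms(3)[OF this]
  have "path_run W I P (s\<lparr>pc := k\<rparr>) (map_pmf (\<lambda>(a, s', t). ((a, s'), s'\<lparr>pc := k''\<rparr>, t + d)) E)"
    using assms(5) by (simp add: bind_map_pmf map_bind_pmf case_prod_beta shifted_def map_pmf_def[symmetric] bind_return_pmf')
      (simp add: map_pmf_def case_prod_beta bind_assoc_pmf bind_return_pmf)
  then show ?thesis using E(2,3) assms(5)
    by (intro exI[of _ "map_pmf (\<lambda>(a, s', t). (a, s', t + d)) E"]) (auto simp: map_pmf_comp split_def)
qed

text \<open>The first branch costs the conditional jump alone, the second also the jump over the
  first.\<close>

lemma sim_com_If_code:
  fixes D :: "'a pmf"
  assumes P: "code_at P k (j # compile (k + 1) d @ Jump (k + 2 + size_com d + size_com c) # compile (k + 2 + size_com d) c)"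
    and j: "\<And>s. exec W I j (s\<lparr>pc := k\<rparr>) = return_pmf (s\<lparr>pc := if b s then k + 2 + size_com d else Suc k\<rparr>)"
    and sim: "if b s then sim_com c s D (\<lambda>a s' t. Q a s' (t + 1)) else sim_com d s D (\<lambda>a s' t. Q a s' (t + 2))"
  shows "\<exists>E. path_run W I P (s\<lparr>pc := k\<rparr>) (map_pmf (\<lambda>(a, s', t). ((a, s'), s'\<lparr>pc := k + (size_com c + size_com d + 2)\<rparr>, t)) E) \<and>
        map_pmf fst E = D \<and> (\<forall>a s' t. (a, s', t) \<in> set_pmf E \<longrightarrow> Q a s' t)"
proof -
  have c: "k < length P" "P ! k = j" "code_at P (Suc k) (compile (Suc k) d)" "Suc k + size_com d < length P"
    "P ! (Suc k + size_com d) = Jump (k + 2 + size_com d + size_com c)"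
    "code_at P (k + 2 + size_com d) (compile (k + 2 + size_com d) c)"
    using P by (auto simp: code_at_Cons code_at_append)
  show ?thesis
  proof (cases "b s")
    case True
    show ?thesis
    proof (rule sim_com_branch[where k' = "k + 2 + size_com d" and d = 1 and e = 1])
      show "path_run W I P (s\<lparr>pc := k\<rparr>) (map_pmf (shifted 1) D')" if "path_run W I P (s\<lparr>pc := k + 2 + size_com d\<rparr>) D'"
        for D' :: "(('a \<times> ram_state) \<times> ram_state \<times> nat) pmf"
        using path_run_jump[of k P s "k + 2 + size_com d" D'] that c j True by (simp add: shifted_def)
      show "path_run W I P (s'\<lparr>pc := k + 2 + size_com d + size_com c\<rparr>) (return_pmf (l, s'\<lparr>pc := k + (size_com c + size_com d + 2)\<rparr>, 1 - 1))"
        for s' and l :: "'a \<times> ram_state" using path_run.stop by (simp add: ac_simps)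
    qed (use sim True c in auto)
  next
    case False
    show ?thesis
    proof (rule sim_com_branch[where k' = "Suc k" and d = 2 and e = 1])
      show "path_run W I P (s\<lparr>pc := k\<rparr>) (map_pmf (shifted 1) D')" if "path_run W I P (s\<lparr>pc := Suc k\<rparr>) D'"
        for D' :: "(('a \<times> ram_state) \<times> ram_state \<times> nat) pmf"
        using path_run_jump[of k P s "Suc k" D'] that c j False by (simp add: shifted_def)
      show "path_run W I P (s'\<lparr>pc := Suc k + size_com d\<rparr>) (return_pmf (l, s'\<lparr>pc := k + (size_com c + size_com d + 2)\<rparr>, 2 - 1))"
        for s' and l :: "'a \<times> ram_state"
        using path_run_jump_stop[OF c(4,5), of s' l] by (simp add: add_ac)
    qed (use sim False c in auto)
  qed
qed

lemma sim_com_IfLess: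
  assumes "wreg s a < wreg s b \<Longrightarrow> sim_com c s D (\<lambda>x s' t. Q x s' (t + 1))"
    "\<not> wreg s a < wreg s b \<Longrightarrow> sim_com d s D (\<lambda>x s' t. Q x s' (t + 2))"
  shows "sim_com (IfLess a b c d) s D Q"
proof (rule sim_comI)
  fix P k assume P: "code_at P k (compile k (IfLess a b c d))"
  show "\<exists>E. path_run W I P (s\<lparr>pc := k\<rparr>) (map_pmf (\<lambda>(y, s', t). ((y, s'), s'\<lparr>pc := k + size_com (IfLess a b c d)\<rparr>, t)) E) \<and>
        map_pmf fst E = D \<and> (\<forall>y s' t. (y, s', t) \<in> set_pmf E \<longrightarrow> Q y s' t)"
    unfolding size_com.simps
    by (rule sim_com_If_code[where b = "\<lambda>s. wreg s a < wreg s b", OF P[unfolded compile.simps]])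
      (use assms in \<open>simp_all add: next_pc_def\<close>)
qed

lemma sim_com_IfRLess:
  assumes "rreg s a < rreg s b \<Longrightarrow> sim_com c s D (\<lambda>x s' t. Q x s' (t + 1))"
    "\<not> rreg s a < rreg s b \<Longrightarrow> sim_com d s D (\<lambda>x s' t. Q x s' (t + 2))"
  shows "sim_com (IfRLess a b c d) s D Q"
proof (rule sim_comI)
  fix P k assume P: "code_at P k (compile k (IfRLess a b c d))"
  show "\<exists>E. path_run W I P (s\<lparr>pc := k\<rparr>) (map_pmf (\<lambda>(y, s', t). ((y, s'), s'\<lparr>pc := k + size_com (IfRLess a b c d)\<rparr>, t)) E) \<and>
        map_pmf fst E = D \<and> (\<forall>y s' t. (y, s', t) \<in> set_pmf E \<longrightarrow> Q y s' t)"
    unfolding size_com.simps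
    by (rule sim_com_If_code[where b = "\<lambda>s. rreg s a < rreg s b", OF P[unfolded compile.simps]])
      (use assms in \<open>simp_all add: next_pc_def\<close>)
qed

lemma while_code:
  assumes P: "code_at P k (j # Jump (k + 3 + size_com c) # compile (k + 2) c @ [Jump k])"
    and j: "\<And>s. exec W I j (s\<lparr>pc := k\<rparr>) = return_pmf (s\<lparr>pc := if b s then k + 2 else Suc k\<rparr>)"
  shows while_code_exit: "\<not> b s \<Longrightarrow> path_run W I P (s\<lparr>pc := k\<rparr>) (return_pmf (l, s\<lparr>pc := k + (size_com c + 3)\<rparr>, 2))"
    and while_code_enter: "b s \<Longrightarrow> path_run W I P (s\<lparr>pc := k + 2\<rparr>) D' \<Longrightarrow> path_run W I P (s\<lparr>pc := k\<rparr>) (map_pmf (shifted 1) D')"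
    and while_code_back: "path_run W I P (s\<lparr>pc := k + 2 + size_com c\<rparr>) (return_pmf (l, s\<lparr>pc := k\<rparr>, 1))"
    and while_code_body: "code_at P (k + 2) (compile (k + 2) c)"
proof -
  have c: "k < length P" "P ! k = j" "Suc k < length P" "P ! Suc k = Jump (k + 3 + size_com c)"
    "code_at P (k + 2) (compile (k + 2) c)" "k + 2 + size_com c < length P" "P ! (k + 2 + size_com c) = Jump k"
    using P by (auto simp: code_at_Cons code_at_append)
  show "path_run W I P (s\<lparr>pc := k\<rparr>) (return_pmf (l, s\<lparr>pc := k + (size_com c + 3)\<rparr>, 2))" if "\<not> b s"
  proof -
    have eq: "k + 3 + size_com c = k + (size_com c + 3)" by simp
    have "path_run W I P (s\<lparr>pc := k\<rparr>) (map_pmf (\<lambda>(a, s', t). (a, s', Suc t)) (return_pmf (l, s\<lparr>pc := k + 3 + size_com c\<rparr>, 1)))"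
      by (rule path_run_jump[OF c(1) _ path_run_jump_stop[OF c(3,4)]]) (simp add: c j that)
    then show ?thesis unfolding eq by (simp add: numeral_2_eq_2)
  qed
  show "path_run W I P (s\<lparr>pc := k\<rparr>) (map_pmf (shifted 1) D')" if "b s" "path_run W I P (s\<lparr>pc := k + 2\<rparr>) D'"
    using path_run_jump[of k P s "k + 2" D'] that c j by (simp add: shifted_def)
  show "path_run W I P (s\<lparr>pc := k + 2 + size_com c\<rparr>) (return_pmf (l, s\<lparr>pc := k\<rparr>, 1))"
    by (rule path_run_jump_stop[OF c(6,7)])
  show "code_at P (k + 2) (compile (k + 2) c)" by (rule c)
qed

lemma sim_com_while_exit:
  assumes "\<not> wreg s a < wreg s b" "Q x s 2"
  shows "sim_com (WhileLess a b c) s (return_pmf x) Q"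
proof (rule sim_comI)
  fix P k assume P: "code_at P k (compile k (WhileLess a b c))"
  have "path_run W I P (s\<lparr>pc := k\<rparr>) (return_pmf ((x, s), s\<lparr>pc := k + (size_com c + 3)\<rparr>, 2))"
    by (rule while_code_exit[where b = "\<lambda>s. wreg s a < wreg s b", OF P[unfolded compile.simps]])
      (use assms in \<open>simp_all add: next_pc_def\<close>)
  then show "\<exists>E. path_run W I P (s\<lparr>pc := k\<rparr>) (map_pmf (\<lambda>(y, s', t). ((y, s'), s'\<lparr>pc := k + size_com (WhileLess a b c)\<rparr>, t)) E) \<and>
        map_pmf fst E = return_pmf x \<and> (\<forall>y s' t. (y, s', t) \<in> set_pmf E \<longrightarrow> Q y s' t)"
    using assms(2) by (intro exI[of _ "return_pmf (x, s, 2)"]) simp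
qed

lemma sim_com_rwhile_exit:
  assumes "\<not> rreg s a < rreg s b" "Q x s 2"
  shows "sim_com (WhileRLess a b c) s (return_pmf x) Q"
proof (rule sim_comI)
  fix P k assume P: "code_at P k (compile k (WhileRLess a b c))"
  have "path_run W I P (s\<lparr>pc := k\<rparr>) (return_pmf ((x, s), s\<lparr>pc := k + (size_com c + 3)\<rparr>, 2))"
    by (rule while_code_exit[where b = "\<lambda>s. rreg s a < rreg s b", OF P[unfolded compile.simps]])
      (use assms in \<open>simp_all add: next_pc_def\<close>)
  then show "\<exists>E. path_run W I P (s\<lparr>pc := k\<rparr>) (map_pmf (\<lambda>(y, s', t). ((y, s'), s'\<lparr>pc := k + size_com (WhileRLess a b c)\<rparr>, t)) E) \<and>
        map_pmf fst E = return_pmf x \<and> (\<forall>y s' t. (y, s', t) \<in> set_pmf E \<longrightarrow> Q y s' t)"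
    using assms(2) by (intro exI[of _ "return_pmf (x, s, 2)"]) simp
qed

text \<open>Each iteration costs two units beyond its body: the test that enters and the jump
  back.\<close>

lemma while_step_code:
  fixes D :: "'a pmf"
  assumes P: "code_at P k (j # Jump (k + 3 + size_com c) # compile (k + 2) c @ [Jump k])"
    and j: "\<And>s. exec W I j (s\<lparr>pc := k\<rparr>) = return_pmf (s\<lparr>pc := if b s then k + 2 else Suc k\<rparr>)"
    and "b s" and body: "sim_com c s D Q"
    and rest: "\<And>a s' t. a \<in> set_pmf D \<Longrightarrow> Q a s' t \<Longrightarrow>
      \<exists>E. path_run W I P (s'\<lparr>pc := k\<rparr>) (map_pmf (\<lambda>(y, s', t). ((y, s'), s'\<lparr>pc := k''\<rparr>, t)) E) \<and>
        map_pmf fst E = F a \<and> (\<forall>b s'' t'. (b, s'', t') \<in> set_pmf E \<longrightarrow> R b s'' (t + 2 + t'))"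
  shows "\<exists>E. path_run W I P (s\<lparr>pc := k\<rparr>) (map_pmf (\<lambda>(y, s', t). ((y, s'), s'\<lparr>pc := k''\<rparr>, t)) E) \<and>
        map_pmf fst E = D \<bind> F \<and> (\<forall>y s' t. (y, s', t) \<in> set_pmf E \<longrightarrow> R y s' t)"
proof -
  have "\<exists>E. path_run W I P (s\<lparr>pc := k\<rparr>) (map_pmf (\<lambda>(a, s', t). ((a, s'), s'\<lparr>pc := k\<rparr>, t)) E) \<and>
     map_pmf fst E = D \<and> (\<forall>a s' t. (a, s', t) \<in> set_pmf E \<longrightarrow> 2 \<le> t \<and> Q a s' (t - 2))"
  proof (rule sim_com_branch[where d = 2 and e = 1])
    show "sim_com c s D (\<lambda>a s' t. 2 \<le> t + 2 \<and> Q a s' (t + 2 - 2))" using body by simp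
    show "code_at P (k + 2) (compile (k + 2) c)" by (rule while_code_body[OF P j])
    show "path_run W I P (s\<lparr>pc := k\<rparr>) (map_pmf (shifted 1) D')" if "path_run W I P (s\<lparr>pc := k + 2\<rparr>) D'"
      for D' :: "(('a \<times> ram_state) \<times> ram_state \<times> nat) pmf"
      by (rule while_code_enter[OF P j \<open>b s\<close> that])
    show "path_run W I P (s'\<lparr>pc := k + 2 + size_com c\<rparr>) (return_pmf (l, s'\<lparr>pc := k\<rparr>, 2 - 1))"
      for s' and l :: "'a \<times> ram_state" using while_code_back[OF P j, of s' l] by simp
  qed simp
  then obtain E where E: "path_run W I P (s\<lparr>pc := k\<rparr>) (map_pmf (\<lambda>(a, s', t). ((a, s'), s'\<lparr>pc := k\<rparr>, t)) E)"
    "map_pmf fst E = D" "\<And>a s' t. (a, s', t) \<in> set_pmf E \<Longrightarrow> 2 \<le> t \<and> Q a s' (t - 2)" by (elim exE conjE) (rule that, assumption, assumption, blast)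
  show ?thesis
  proof (rule path_run_compose[OF E(1,2)])
    fix a s' t assume m: "(a, s', t) \<in> set_pmf E"
    then have "a \<in> set_pmf D" by (rule label_mem[OF E(2)])
    have t: "t = t - 2 + 2" using conjunct1[OF E(3)[OF m]] by arith
    from rest[OF \<open>a \<in> set_pmf D\<close> conjunct2[OF E(3)[OF m]], folded t]
    show "\<exists>E'. path_run W I P (s'\<lparr>pc := k\<rparr>) (map_pmf (\<lambda>(b, s'', t'). ((b, s''), s''\<lparr>pc := k''\<rparr>, t')) E') \<and>
      map_pmf fst E' = F a \<and> (\<forall>b s'' t'. (b, s'', t') \<in> set_pmf E' \<longrightarrow> R b s'' (t + t'))" .
  qed
qed

lemma sim_com_while_step:
  assumes "wreg s a < wreg s b" "sim_com c s D Q"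
    "\<And>x s' t. x \<in> set_pmf D \<Longrightarrow> Q x s' t \<Longrightarrow> sim_com (WhileLess a b c) s' (F x) (\<lambda>y s'' t'. R y s'' (t + 2 + t'))"
  shows "sim_com (WhileLess a b c) s (D \<bind> F) R"
proof (rule sim_comI)
  fix P k assume P: "code_at P k (compile k (WhileLess a b c))"
  show "\<exists>E. path_run W I P (s\<lparr>pc := k\<rparr>) (map_pmf (\<lambda>(y, s', t). ((y, s'), s'\<lparr>pc := k + size_com (WhileLess a b c)\<rparr>, t)) E) \<and>
        map_pmf fst E = D \<bind> F \<and> (\<forall>y s' t. (y, s', t) \<in> set_pmf E \<longrightarrow> R y s' t)"
    by (rule while_step_code[OF P[unfolded compile.simps], where b = "\<lambda>s. wreg s a < wreg s b", OF _ assms(1,2)])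
      (simp add: next_pc_def, rule assms(3)[unfolded sim_com_def, rule_format, OF _ _ P])
qed

lemma sim_com_rwhile_step:
  assumes "rreg s a < rreg s b" "sim_com c s D Q"
    "\<And>x s' t. x \<in> set_pmf D \<Longrightarrow> Q x s' t \<Longrightarrow> sim_com (WhileRLess a b c) s' (F x) (\<lambda>y s'' t'. R y s'' (t + 2 + t'))"
  shows "sim_com (WhileRLess a b c) s (D \<bind> F) R"
proof (rule sim_comI)
  fix P k assume P: "code_at P k (compile k (WhileRLess a b c))"
  show "\<exists>E. path_run W I P (s\<lparr>pc := k\<rparr>) (map_pmf (\<lambda>(y, s', t). ((y, s'), s'\<lparr>pc := k + size_com (WhileRLess a b c)\<rparr>, t)) E) \<and>
        map_pmf fst E = D \<bind> F \<and> (\<forall>y s' t. (y, s', t) \<in> set_pmf E \<longrightarrow> R y s' t)"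
    by (rule while_step_code[OF P[unfolded compile.simps], where b = "\<lambda>s. rreg s a < rreg s b", OF _ assms(1,2)])
      (simp add: next_pc_def, rule assms(3)[unfolded sim_com_def, rule_format, OF _ _ P])
qed

text \<open>Forgetting the path lengths turns a simulation into a coupling of the final machine
  state with the abstract result, provided that every path fits into \<open>T\<close> steps.\<close>

theorem run_compile:
  assumes "sim_com c init_state D Q" "\<And>a s t. a \<in> set_pmf D \<Longrightarrow> Q a s t \<Longrightarrow> t \<le> T"
  shows "\<exists>E. run W I (compile 0 c) T = map_pmf (\<lambda>x. (snd x)\<lparr>pc := size_com c\<rparr>) E \<and> map_pmf fst E = D \<and>
    (\<forall>a s. (a, s) \<in> set_pmf E \<longrightarrow> (\<exists>t. Q a s t))"
proof -
  have "code_at (compile 0 c) 0 (compile 0 c)" using code_at_suffix[of "[]"] by simp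
  from sim_comD[OF assms(1) this] obtain E where E:
    "path_run W I (compile 0 c) (init_state\<lparr>pc := 0\<rparr>) (map_pmf (\<lambda>(a, s', t). ((a, s'), s'\<lparr>pc := 0 + size_com c\<rparr>, t)) E)"
    "map_pmf fst E = D" "\<And>a s' t. (a, s', t) \<in> set_pmf E \<Longrightarrow> Q a s' t" by blast
  have t: "t \<le> T" if "(a, s', t) \<in> set_pmf E" for a s' t
    by (rule assms(2)[OF label_mem[OF E(2) that] E(3)[OF that]])
  have "init_state\<lparr>pc := 0\<rparr> = init_state" by (simp add: init_state_def)
  moreover have "run_from W I (compile 0 c) T (init_state\<lparr>pc := 0\<rparr>) =
      map_pmf (\<lambda>x. fst (snd x)) (map_pmf (\<lambda>(a, s', t). ((a, s'), s'\<lparr>pc := 0 + size_com c\<rparr>, t)) E)"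
  proof (rule run_from_path_run[OF E(1)])
    fix l s' t0 assume "(l, s', t0) \<in> set_pmf (map_pmf (\<lambda>(a, s', t). ((a, s'), s'\<lparr>pc := 0 + size_com c\<rparr>, t)) E)"
    then show "halted (compile 0 c) s' \<and> t0 \<le> T" using t by (auto simp: halted_def)
  qed
  ultimately have "run W I (compile 0 c) T = map_pmf (\<lambda>x. fst (snd x)) (map_pmf (\<lambda>(a, s', t). ((a, s'), s'\<lparr>pc := 0 + size_com c\<rparr>, t)) E)"
    by (simp add: run_eq_run_from)
  moreover have "\<exists>t. Q a s t" if "(a, s) \<in> set_pmf (map_pmf (\<lambda>(a, s', t). (a, s')) E)" for a s
    using that E(3) by force
  ultimately show ?thesis using E(2)
    by (intro exI[of _ "map_pmf (\<lambda>(a, s', t). (a, s')) E"]) (simp add: map_pmf_comp split_def)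
qed

end

section \<open>Random folds and loop rules\<close>

primrec foldM :: "('k \<Rightarrow> 'a \<Rightarrow> 'a pmf) \<Rightarrow> 'k list \<Rightarrow> 'a \<Rightarrow> 'a pmf" where
  "foldM F [] x = return_pmf x"
| "foldM F (k # ks) x = F k x \<bind> foldM F ks"

lemma foldM_append: "foldM F (xs @ ys) x = foldM F xs x \<bind> foldM F ys"
  by (induction xs arbitrary: x) (auto simp: bind_return_pmf bind_assoc_pmf intro!: bind_pmf_cong)

lemma foldM_concat: "foldM F (concat xss) x = foldM (\<lambda>xs. foldM F xs) xss x"
  by (induction xss arbitrary: x) (auto simp: foldM_append intro!: bind_pmf_cong)

lemma foldM_map: "foldM F (map f xs) x = foldM (\<lambda>k. F (f k)) xs x"
  by (induction xs arbitrary: x) (auto intro: bind_pmf_cong)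

lemma foldM_unit [simp]: "foldM (\<lambda>_ _. return_pmf ()) ks () = return_pmf ()"
  by (induction ks) (simp_all add: bind_return_pmf)

text \<open>\<open>P\<close> holds the candidates whose coin is still to be tossed. A vertex may
  occur in several lists, and only its first occurrence tosses.\<close>

fun sprinkle :: "nat \<Rightarrow> (nat \<Rightarrow> real) \<Rightarrow> nat \<Rightarrow> (nat \<Rightarrow> nat) \<times> nat set \<Rightarrow> ((nat \<Rightarrow> nat) \<times> nat set) pmf" where
  "sprinkle l \<beta> v (lab, P) = (if v \<in> P
     then map_pmf (\<lambda>b. (if b then lab(v := l) else lab, P - {v})) (bernoulli_pmf (\<beta> v)) else return_pmf (lab, P))"

text \<open>As every candidate tosses exactly once, neither order nor repetition matters and the
  tosses form a product distribution.\<close>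

lemma foldM_sprinkle:
  assumes "finite P" "P \<subseteq> set xs"
  shows "foldM (sprinkle l \<beta>) xs (lab, P) =
    map_pmf (\<lambda>B. (\<lambda>v. if v \<in> P \<and> B v then l else lab v, {})) (Pi_pmf P False (\<lambda>v. bernoulli_pmf (\<beta> v)))"
  using assms
proof (induction xs arbitrary: lab P)
  case Nil
  then show ?case by simp
next
  case (Cons v xs)
  show ?case
  proof (cases "v \<in> P")
    case True
    let ?P = "P - {v}"
    have IH: "foldM (sprinkle l \<beta>) xs (lab', ?P) = map_pmf (\<lambda>B. (\<lambda>v. if v \<in> ?P \<and> B v then l else lab' v, {}))
        (Pi_pmf ?P False (\<lambda>v. bernoulli_pmf (\<beta> v)))" for lab'
      by (rule Cons.IH) (use Cons.prems in auto)
    have "Pi_pmf P False (\<lambda>v. bernoulli_pmf (\<beta> v)) = bernoulli_pmf (\<beta> v) \<bind> (\<lambda>b. Pi_pmf ?P False (\<lambda>v. bernoulli_pmf (\<beta> v)) \<bind>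
        (\<lambda>B. return_pmf (B(v := b))))"
      using Pi_pmf_insert'[of ?P v False "\<lambda>v. bernoulli_pmf (\<beta> v)"] Cons.prems(1) True by (simp add: insert_absorb)
    then have "map_pmf (\<lambda>B. (\<lambda>v. if v \<in> P \<and> B v then l else lab v, {} :: nat set)) (Pi_pmf P False (\<lambda>v. bernoulli_pmf (\<beta> v)))
      = bernoulli_pmf (\<beta> v) \<bind> (\<lambda>b. map_pmf (\<lambda>B. (\<lambda>v'. if v' \<in> P \<and> (B(v := b)) v' then l else lab v', {}))
          (Pi_pmf ?P False (\<lambda>v. bernoulli_pmf (\<beta> v))))"
      by (simp add: map_pmf_def bind_assoc_pmf bind_return_pmf)
    also have "\<dots> = bernoulli_pmf (\<beta> v) \<bind> (\<lambda>b. foldM (sprinkle l \<beta>) xs (if b then lab(v := l) else lab, ?P))"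
      unfolding IH by (intro bind_pmf_cong map_pmf_cong refl) (use True in \<open>auto simp: fun_eq_iff\<close>)
    finally show ?thesis using True by (simp add: bind_map_pmf)
  next
    case False
    then have "P \<subseteq> set xs" using Cons.prems by auto
    then show ?thesis using Cons.IH[of P lab] Cons.prems False by (simp add: bind_return_pmf)
  qed
qed

context ram
begin

text \<open>Commands without loops and draws, whose effect the simplifier can compute through
  \<open>ev\<close>.\<close>

fun simple :: "com \<Rightarrow> bool" where
  "simple (Block is) = list_all det_instr is"
| "simple (c ;; d) = (simple c \<and> simple d)"
| "simple (IfLess a b c d) = (simple c \<and> simple d)"
| "simple (IfRLess a b c d) = (simple c \<and> simple d)"
| "simple _ = False"

fun ev :: "com \<Rightarrow> ram_state \<Rightarrow> ram_state" where
  "ev (Block is) s = block is s"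
| "ev (c ;; d) s = ev d (ev c s)"
| "ev (IfLess a b c d) s = (if wreg s a < wreg s b then ev c s else ev d s)"
| "ev (IfRLess a b c d) s = (if rreg s a < rreg s b then ev c s else ev d s)"
| "ev _ s = s"

lemma sim_com_simple:
  assumes "simple c" "\<And>t. t \<le> size_com c \<Longrightarrow> Q x (ev c s) t"
  shows "sim_com c s (return_pmf x) Q"
  using assms
proof (induction c arbitrary: s Q)
  case (Block "is")
  then show ?case by (intro sim_com_Block) auto
next
  case (Seq c d)
  have "sim_com (c ;; d) s (return_pmf x \<bind> return_pmf) Q"
  proof (rule sim_com_Seq)
    show "sim_com c s (return_pmf x) (\<lambda>y s' t. y = x \<and> s' = ev c s \<and> t \<le> size_com c)"
      using Seq.prems by (intro Seq.IH(1)) auto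
  next
    fix a s' t assume "a = x \<and> s' = ev c s \<and> t \<le> size_com c"
    then show "sim_com d s' (return_pmf a) (\<lambda>b s'' t'. Q b s'' (t + t'))"
      using Seq.prems by (auto intro!: Seq.IH(2))
  qed
  then show ?case by (simp add: bind_return_pmf)
next
  case (IfLess a b c d)
  then show ?case by (intro sim_com_IfLess IfLess.IH) auto
next
  case (IfRLess a b c d)
  then show ?case by (intro sim_com_IfRLess IfRLess.IH) auto
qed auto

lemma sim_com_Seq_det:
  assumes "sim_com c s (return_pmf x) Q" "\<And>s' t. Q x s' t \<Longrightarrow> sim_com d s' D (\<lambda>b s'' t'. R b s'' (t + t'))"
  shows "sim_com (c ;; d) s D R"
proof -
  have "sim_com (c ;; d) s (return_pmf x \<bind> (\<lambda>_. D)) R"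
    by (rule sim_com_Seq[OF assms(1)]) (use assms(2) in auto)
  then show ?thesis by (simp add: bind_return_pmf)
qed

lemma sim_com_map:
  assumes "sim_com c s D (\<lambda>a. Q (f a))"
  shows "sim_com c s (map_pmf f D) Q"
proof (rule sim_comI)
  fix P k assume "code_at P k (compile k c)"
  from sim_comD[OF assms this] obtain E where E: "path_run W I P (s\<lparr>pc := k\<rparr>) (map_pmf (\<lambda>(a, s', t). ((a, s'), s'\<lparr>pc := k + size_com c\<rparr>, t)) E)"
    "map_pmf fst E = D" "\<And>a s' t. (a, s', t) \<in> set_pmf E \<Longrightarrow> Q (f a) s' t" by blast
  from path_run_bind[OF E(1), of "\<lambda>(l, s', t). return_pmf ((f (fst l), snd l), s', 0)"]
  have "path_run W I P (s\<lparr>pc := k\<rparr>) (map_pmf (\<lambda>(a, s', t). ((f a, s'), s'\<lparr>pc := k + size_com c\<rparr>, t)) E)"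
    by (simp add: path_run.stop split_def map_pmf_comp flip: map_pmf_def)
  then show "\<exists>E. path_run W I P (s\<lparr>pc := k\<rparr>) (map_pmf (\<lambda>(a, s', t). ((a, s'), s'\<lparr>pc := k + size_com c\<rparr>, t)) E) \<and>
        map_pmf fst E = map_pmf f D \<and> (\<forall>a s' t. (a, s', t) \<in> set_pmf E \<longrightarrow> Q a s' t)"
    using E(2,3) by (intro exI[of _ "map_pmf (\<lambda>(a, s', t). (f a, s', t)) E"])
      (auto simp: map_pmf_comp split_def)
qed

lemma sim_com_for_from:
  assumes step: "\<And>i x s t. i < length ks \<Longrightarrow> Inv i x s t \<Longrightarrow>
      wreg s a < wreg s b \<and> sim_com c s (F (ks ! i) x) (\<lambda>y s' t'. Inv (Suc i) y s' (t + t' + 2))"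
    and exit: "\<And>x s t. Inv (length ks) x s t \<Longrightarrow> \<not> wreg s a < wreg s b \<and> Q x s (t + 2)"
    and "i \<le> length ks" "Inv i x s t"
  shows "sim_com (WhileLess a b c) s (foldM F (drop i ks) x) (\<lambda>y s' t'. Q y s' (t + t'))"
  using assms(3,4)
proof (induction "length ks - i" arbitrary: i x s t)
  case 0
  then have "i = length ks" by simp
  then show ?case using 0 exit by (auto intro!: sim_com_while_exit)
next
  case (Suc d)
  then have i: "i < length ks" by simp
  then have "drop i ks = ks ! i # drop (Suc i) ks" by (simp add: Cons_nth_drop_Suc)
  moreover have "sim_com (WhileLess a b c) s (F (ks ! i) x \<bind> foldM F (drop (Suc i) ks)) (\<lambda>y s' t'. Q y s' (t + t'))"
  proof (rule sim_com_while_step)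
    show "wreg s a < wreg s b" "sim_com c s (F (ks ! i) x) (\<lambda>y s' t'. Inv (Suc i) y s' (t + t' + 2))"
      using step[OF i Suc.prems(2)] by blast+
    fix y s' t' assume "Inv (Suc i) y s' (t + t' + 2)"
    from Suc.hyps(1)[OF _ _ this] Suc.hyps(2) i
    show "sim_com (WhileLess a b c) s' (foldM F (drop (Suc i) ks) y) (\<lambda>y s'' t''. Q y s'' (t + (t' + 2 + t'')))"
      by (simp add: add.assoc)
  qed
  ultimately show ?case by simp
qed

text \<open>The loop mirrors a fold along the abstract list \<open>ks\<close>. The invariant carries
  the elapsed time, so amortized bounds can be stated in it.\<close>

lemma sim_com_for:
  assumes "\<And>i x s t. i < length ks \<Longrightarrow> Inv i x s t \<Longrightarrow>
      wreg s a < wreg s b \<and> sim_com c s (F (ks ! i) x) (\<lambda>y s' t'. Inv (Suc i) y s' (t + t' + 2))"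
    and "\<And>x s t. Inv (length ks) x s t \<Longrightarrow> \<not> wreg s a < wreg s b \<and> Q x s (t + 2)"
    and "Inv 0 x s 0"
  shows "sim_com (WhileLess a b c) s (foldM F ks x) Q"
  using sim_com_for_from[where Inv = Inv and Q = Q, OF assms(1,2) le0 assms(3)] by simp

lemma sim_com_rfor_from:
  assumes step: "\<And>i x s t. i < R \<Longrightarrow> Inv i x s t \<Longrightarrow>
      rreg s a < rreg s b \<and> sim_com c s (F x) (\<lambda>y s' t'. Inv (Suc i) y s' (t + t' + 2))"
    and exit: "\<And>x s t. Inv R x s t \<Longrightarrow> \<not> rreg s a < rreg s b \<and> Q x s (t + 2)"
    and "i \<le> R" "Inv i x s t"
  shows "sim_com (WhileRLess a b c) s (iterate_pmf (R - i) F x) (\<lambda>y s' t'. Q y s' (t + t'))"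
  using assms(3,4)
proof (induction "R - i" arbitrary: i x s t)
  case 0
  then have "i = R" by simp
  then show ?case using 0 exit by (auto intro!: sim_com_rwhile_exit)
next
  case (Suc d)
  then have i: "i < R" by simp
  then have "R - i = Suc (R - Suc i)" by simp
  moreover have "sim_com (WhileRLess a b c) s (F x \<bind> iterate_pmf (R - Suc i) F) (\<lambda>y s' t'. Q y s' (t + t'))"
  proof (rule sim_com_rwhile_step)
    show "rreg s a < rreg s b" "sim_com c s (F x) (\<lambda>y s' t'. Inv (Suc i) y s' (t + t' + 2))"
      using step[OF i Suc.prems(2)] by blast+
    fix y s' t' assume "Inv (Suc i) y s' (t + t' + 2)"
    from Suc.hyps(1)[OF _ _ this] Suc.hyps(2) i
    show "sim_com (WhileRLess a b c) s' (iterate_pmf (R - Suc i) F y) (\<lambda>y s'' t''. Q y s'' (t + (t' + 2 + t'')))"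
      by (simp add: add.assoc)
  qed
  ultimately show ?case by simp
qed

text \<open>Repetition counts such as \<open>n / \<Delta>\<close> are reals and cannot be converted
  to words, so these loops count in a real register.\<close>

lemma sim_com_rfor:
  assumes "\<And>i x s t. i < R \<Longrightarrow> Inv i x s t \<Longrightarrow>
      rreg s a < rreg s b \<and> sim_com c s (F x) (\<lambda>y s' t'. Inv (Suc i) y s' (t + t' + 2))"
    and "\<And>x s t. Inv R x s t \<Longrightarrow> \<not> rreg s a < rreg s b \<and> Q x s (t + 2)"
    and "Inv 0 x s 0"
  shows "sim_com (WhileRLess a b c) s (iterate_pmf R F x) Q"
  using sim_com_rfor_from[where Inv = Inv and Q = Q, OF assms(1,2) le0 assms(3)] by simp

lemma sim_com_Flip:
  assumes "1 < W" "0 \<le> rreg s a" "rreg s a \<le> 1"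
    and "\<And>b. b \<in> set_pmf (bernoulli_pmf (rreg s a)) \<Longrightarrow> Q b (s\<lparr>wreg := (wreg s)(d := of_bool b)\<rparr>) 1"
  shows "sim_com (Draw (Flip d a)) s (bernoulli_pmf (rreg s a)) Q"
proof (rule sim_com_Draw[where f = "\<lambda>b. s\<lparr>wreg := (wreg s)(d := of_bool b)\<rparr>" and g = "\<lambda>s. wreg s d = 1"])
  fix k
  have "max 0 (min 1 (rreg s a)) = rreg s a" using assms by simp
  then show "exec W I (Flip d a) (s\<lparr>pc := k\<rparr>) =
    map_pmf (\<lambda>b. (s\<lparr>wreg := (wreg s)(d := of_bool b)\<rparr>)\<lparr>pc := Suc k\<rparr>) (bernoulli_pmf (rreg s a))"
    using assms(1) by (auto simp: put_word_def next_pc_def intro!: map_pmf_cong)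
qed (use assms in auto)

lemma sim_com_RandWord:
  assumes "0 < wreg s a" "wreg s a \<le> W"
    and "\<And>x. x < wreg s a \<Longrightarrow> Q x (s\<lparr>wreg := (wreg s)(d := x)\<rparr>) 1"
  shows "sim_com (Draw (RandWord d a)) s (pmf_of_set {..<wreg s a}) Q"
proof (rule sim_com_Draw[where f = "\<lambda>x. s\<lparr>wreg := (wreg s)(d := x)\<rparr>" and g = "\<lambda>s. wreg s d"])
  have ne: "{..<wreg s a} \<noteq> {}" using assms(1) by auto
  then have sp: "set_pmf (pmf_of_set {..<wreg s a}) = {..<wreg s a}" by (rule set_pmf_of_set) simp
  show "exec W I (RandWord d a) (s\<lparr>pc := k\<rparr>) =
    map_pmf (\<lambda>x. (s\<lparr>wreg := (wreg s)(d := x)\<rparr>)\<lparr>pc := Suc k\<rparr>) (pmf_of_set {..<wreg s a})" for k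
    using assms(1,2) by (auto simp: put_word_def next_pc_def sp intro!: map_pmf_cong)
  show "Q x (s\<lparr>wreg := (wreg s)(d := x)\<rparr>) 1" if "x \<in> set_pmf (pmf_of_set {..<wreg s a})" for x
    using assms(3) that ne by simp
qed simp

end

section \<open>Memory layout\<close>

text \<open>Register 4 holds the row width \<open>Q\<close>, and register 14 is scratch space for
  the address.\<close>

definition get :: "reg \<Rightarrow> reg \<Rightarrow> reg \<Rightarrow> instr list" where
  "get d r k = [WordOp WTimes 14 r 4, WordOp WPlus 14 14 k, Load d 14]"

definition put :: "reg \<Rightarrow> reg \<Rightarrow> reg \<Rightarrow> instr list" where
  "put r k v = [WordOp WTimes 14 r 4, WordOp WPlus 14 14 k, Store 14 v]"

lemma det_instr_get_put [simp]: "list_all det_instr (get d r k)" "list_all det_instr (put d r k)"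
  "length (get d r k) = 3" "length (put d r k) = 3"
  by (simp_all add: get_def put_def)

text \<open>The square in \<open>W_large\<close> makes all cell addresses of a table with
  \<open>n + m + 1\<close> rows and columns fit into a word; 32 leaves room for the constants 23 and
  31.\<close>

locale rounding_ram = cluster_lp n m A w \<Delta> plus + ram W I
  for n m A w \<Delta> plus W I +
  assumes in_n [simp]: "in_n I = n" and in_m [simp]: "length (in_sol I) = m" and in_delta [simp]: "in_delta I = \<Delta>"
    and set_sol: "\<And>j. j < m \<Longrightarrow> set (fst (in_sol I ! j)) = A j"
    and distinct_sol: "\<And>j. j < m \<Longrightarrow> distinct (fst (in_sol I ! j))"
    and val_sol: "\<And>j. j < m \<Longrightarrow> snd (in_sol I ! j) = w j"
    and plus_iff: "\<And>u v. {u, v} \<in> in_plus I \<longleftrightarrow> plus u v"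
    and W_large: "(n + m + 1) * (n + m + 1) \<le> W" "32 \<le> W"
begin

definition Q where "Q = n + m + 1"

definition cell where "cell r k = r * Q + k" for r k :: nat

lemma cell_0 [simp]: "cell 0 k = k" by (simp add: cell_def)

lemma Q_pos: "0 < Q" by (simp add: Q_def)

lemma n_less_Q: "n < Q" "m < Q" "v < n \<Longrightarrow> v < Q" "j < m \<Longrightarrow> j < Q" "j < m \<Longrightarrow> Suc j < Q" "v < n \<Longrightarrow> Suc v < Q"
  "v < n \<Longrightarrow> m + v < Q" "v < n \<Longrightarrow> Suc (m + v) < Q" "j < m \<Longrightarrow> Suc (n + j) < Q" "j < m \<Longrightarrow> n + j < Q" "n + m < Q"
  using m_pos n_pos by (auto simp: Q_def)

lemma Q_le_W: "Q \<le> W" "Q < W"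
proof -
  have "Q * 2 \<le> Q * Q" by (rule mult_le_mono2) (use m_pos n_pos in \<open>simp add: Q_def\<close>)
  then show "Q \<le> W" "Q < W" using W_large(1) Q_pos unfolding Q_def[symmetric] by linarith+
qed

lemma less_W: "k < Q \<Longrightarrow> k < W" "k \<le> Q \<Longrightarrow> k < W" using Q_le_W by linarith+

lemma mod_W [simp]: "k < Q \<Longrightarrow> k mod W = k" using less_W by simp

lemma row_less: "r < Q \<Longrightarrow> r * Q < W" and cell_less: "r < Q \<Longrightarrow> k < Q \<Longrightarrow> r * Q + k < W"
proof -
  assume r: "r < Q"
  then have "Suc r * Q \<le> Q * Q" by (intro mult_le_mono1) simp
  then have *: "r * Q + Q \<le> W" using W_large(1) unfolding Q_def[symmetric] by simp
  then show "r * Q < W" using Q_pos by linarith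
  show "r * Q + k < W" if "k < Q" using * that by linarith
qed

lemma cell_eq_iff: "k < Q \<Longrightarrow> k' < Q \<Longrightarrow> cell r k = cell r' k' \<longleftrightarrow> r = r' \<and> k = k'"
proof
  assume k: "k < Q" "k' < Q" and eq: "cell r k = cell r' k'"
  have "cell r k div Q = r" "cell r k mod Q = k" "cell r' k' div Q = r'" "cell r' k' mod Q = k'"
    using k by (simp_all add: cell_def)
  then show "r = r' \<and> k = k'" using eq by metis
qed simp

lemma cell_label [simp]: "0 < r \<Longrightarrow> v < n \<Longrightarrow> k < Q \<Longrightarrow> cell r k \<noteq> v" "0 < r \<Longrightarrow> v < n \<Longrightarrow> k < Q \<Longrightarrow> v \<noteq> cell r k"
  using cell_eq_iff[of k v r 0] n_less_Q(3) by auto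

lemma block_get:
  assumes "wreg s 4 = Q" "wreg s r < Q" "wreg s k < Q" "k \<noteq> 14"
  shows "block (get d r k @ is) s = block is
    (s\<lparr>wreg := (wreg s)(14 := cell (wreg s r) (wreg s k), d := wmem s (cell (wreg s r) (wreg s k)) mod W)\<rparr>)"
    "block (get d r k) s =
    (s\<lparr>wreg := (wreg s)(14 := cell (wreg s r) (wreg s k), d := wmem s (cell (wreg s r) (wreg s k)) mod W)\<rparr>)"
  using assms row_less[of "wreg s r"] cell_less[of "wreg s r" "wreg s k"] by (simp_all add: get_def cell_def)

lemma block_put:
  assumes "wreg s 4 = Q" "wreg s r < Q" "wreg s k < Q" "k \<noteq> 14" "v \<noteq> 14"
  shows "block (put r k v @ is) s = block is
    (s\<lparr>wreg := (wreg s)(14 := cell (wreg s r) (wreg s k)), wmem := (wmem s)(cell (wreg s r) (wreg s k) := wreg s v)\<rparr>)"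
    "block (put r k v) s =
    (s\<lparr>wreg := (wreg s)(14 := cell (wreg s r) (wreg s k)), wmem := (wmem s)(cell (wreg s r) (wreg s k) := wreg s v)\<rparr>)"
  using assms row_less[of "wreg s r"] cell_less[of "wreg s r" "wreg s k"] by (simp_all add: put_def cell_def)

text \<open>Row 0 of the memory holds the labels; each other row holds a list, with its length in the last column.\<close>

definition rep :: "(nat \<Rightarrow> nat) \<Rightarrow> (nat \<Rightarrow> nat) \<Rightarrow> (nat \<Rightarrow> nat list) \<Rightarrow> bool" where
  "rep M lab R \<longleftrightarrow> (\<forall>v<n. M v = lab v \<and> lab v < Q) \<and> (\<forall>r. 0 < r \<longrightarrow> r < Q \<longrightarrow>
     length (R r) \<le> n + m \<and> (\<forall>y\<in>set (R r). y < Q) \<and> M (cell r (n + m)) = length (R r) \<and>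
     (\<forall>k<length (R r). M (cell r k) = R r ! k))"

lemma rep_lab: "rep M lab R \<Longrightarrow> v < n \<Longrightarrow> M v = lab v" "rep M lab R \<Longrightarrow> v < n \<Longrightarrow> lab v < Q"
  by (auto simp: rep_def)

lemma rep_row:
  assumes "rep M lab R" "0 < r" "r < Q"
  shows "length (R r) \<le> n + m" "M (cell r (n + m)) = length (R r)" "length (R r) < Q"
    "k < length (R r) \<Longrightarrow> M (cell r k) = R r ! k" "k < length (R r) \<Longrightarrow> R r ! k < Q" "k < length (R r) \<Longrightarrow> k < Q"
  using assms by (auto simp: rep_def Q_def dest!: spec[of _ r])

lemma repI:
  assumes "\<And>v. v < n \<Longrightarrow> M v = lab v \<and> lab v < Q"
    and "\<And>r. 0 < r \<Longrightarrow> r < Q \<Longrightarrow> length (R r) \<le> n + m"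
    and "\<And>r y. 0 < r \<Longrightarrow> r < Q \<Longrightarrow> y \<in> set (R r) \<Longrightarrow> y < Q"
    and "\<And>r. 0 < r \<Longrightarrow> r < Q \<Longrightarrow> M (cell r (n + m)) = length (R r)"
    and "\<And>r k. 0 < r \<Longrightarrow> r < Q \<Longrightarrow> k < length (R r) \<Longrightarrow> M (cell r k) = R r ! k"
  shows "rep M lab R"
  unfolding rep_def by (intro conjI allI impI ballI; (rule assms; assumption)?) (use assms(1) in blast)+

lemma rep_cong: "rep M lab R \<Longrightarrow> (\<And>r. 0 < r \<Longrightarrow> r < Q \<Longrightarrow> R r = R' r) \<Longrightarrow> rep M lab R'"
  unfolding rep_def by simp

lemma rep_label:
  assumes "rep M lab R" "v < n" "y < Q"
  shows "rep (M(v := y)) (lab(v := y)) R"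
proof -
  have ne: "cell r k \<noteq> v" if "0 < r" "k < Q" for r k using that assms(2) by simp
  show ?thesis
  proof (rule repI)
    fix v' assume "v' < n"
    then show "(M(v := y)) v' = (lab(v := y)) v' \<and> (lab(v := y)) v' < Q" using rep_lab[OF assms(1), of v'] assms(3) by simp
  next
    fix r assume r: "0 < r" "r < Q"
    note row = rep_row[OF assms(1) r]
    show "length (R r) \<le> n + m" by (rule row(1))
    show "z < Q" if "z \<in> set (R r)" for z using that row(5) unfolding in_set_conv_nth by blast
    show "(M(v := y)) (cell r (n + m)) = length (R r)"
      unfolding fun_upd_other[OF ne[OF r(1) n_less_Q(11)]] by (rule row(2))
    show "(M(v := y)) (cell r k) = R r ! k" if "k < length (R r)" for k
      unfolding fun_upd_other[OF ne[OF r(1) row(6)[OF that]]] by (rule row(4)[OF that])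
  qed
qed

lemma rep_row_update:
  assumes "rep M lab R" "0 < r" "r < Q" "length xs \<le> n + m" "\<forall>y\<in>set xs. y < Q"
    and "M' (cell r (n + m)) = length xs" "\<And>k. k < length xs \<Longrightarrow> M' (cell r k) = xs ! k"
    and "\<And>a. (\<And>k. k < Q \<Longrightarrow> a \<noteq> cell r k) \<Longrightarrow> M' a = M a"
  shows "rep M' lab (R(r := xs))"
proof -
  have lab: "M' v = M v" if "v < n" for v by (rule assms(8)) (use assms(2) that in auto)
  have other: "M' (cell r' k) = M (cell r' k)" if "r' \<noteq> r" "k < Q" for r' k
    by (rule assms(8)) (use that in \<open>auto simp: cell_eq_iff\<close>)
  show ?thesis
  proof (rule repI)
    fix v assume "v < n"
    then show "M' v = lab v \<and> lab v < Q" using rep_lab[OF assms(1), of v] lab by simp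
  next
    fix r' assume r': "0 < r'" "r' < Q"
    note row = rep_row[OF assms(1) r']
    show "length ((R(r := xs)) r') \<le> n + m" using row(1) assms(4) by (cases "r' = r") simp_all
    show "z < Q" if "z \<in> set ((R(r := xs)) r')" for z
      using that row(5) assms(5) unfolding in_set_conv_nth by (cases "r' = r") (auto simp: in_set_conv_nth)
    show "M' (cell r' (n + m)) = length ((R(r := xs)) r')"
    proof (cases "r' = r")
      case False then show ?thesis using other[OF False n_less_Q(11)] row(2) by simp
    qed (use assms(6) in simp)
    show "M' (cell r' k) = (R(r := xs)) r' ! k" if k: "k < length ((R(r := xs)) r')" for k
    proof (cases "r' = r")
      case False
      then have k': "k < length (R r')" using k by simp
      show ?thesis using other[OF False row(6)[OF k']] row(4)[OF k'] False by simp
    qed (use assms(7) k in simp)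
  qed
qed

lemma rep_set:
  assumes "rep M lab R" "0 < r" "r < Q" "k < length (R r)" "y < Q"
  shows "rep (M(cell r k := y)) lab (R(r := (R r)[k := y]))"
proof (rule rep_row_update[OF assms(1-3)])
  note row = rep_row[OF assms(1-3)]
  have k: "k < Q" "k \<noteq> n + m" using row(6)[OF assms(4)] row(1) assms(4) by auto
  show "length ((R r)[k := y]) \<le> n + m" using row by simp
  show "\<forall>y\<in>set ((R r)[k := y]). y < Q"
    using row(5) assms(4,5) by (auto simp: in_set_conv_nth nth_list_update)
  show "(M(cell r k := y)) (cell r (n + m)) = length ((R r)[k := y])"
    using row k n_less_Q(11) by (simp add: cell_eq_iff)
  show "(M(cell r k := y)) (cell r k') = (R r)[k := y] ! k'" if "k' < length ((R r)[k := y])" for k'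
    using that row(4,6) k by (auto simp: cell_eq_iff nth_list_update)
  show "(M(cell r k := y)) a = M a" if "\<And>k. k < Q \<Longrightarrow> a \<noteq> cell r k" for a using that[OF k(1)] by simp
qed

lemma rep_take:
  assumes "rep M lab R" "0 < r" "r < Q" "k \<le> length (R r)"
  shows "rep (M(cell r (n + m) := k)) lab (R(r := take k (R r)))"
proof (rule rep_row_update[OF assms(1-3)])
  note row = rep_row[OF assms(1-3)]
  show "length (take k (R r)) \<le> n + m" using row by simp
  show "\<forall>y\<in>set (take k (R r)). y < Q" using row(5) by (auto simp: in_set_conv_nth)
  show "(M(cell r (n + m) := k)) (cell r (n + m)) = length (take k (R r))" using assms(4) by simp
  show "(M(cell r (n + m) := k)) (cell r k') = take k (R r) ! k'" if k': "k' < length (take k (R r))" for k'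
  proof -
    have "k' < length (R r)" "k' < k" using k' by auto
    then have "k' \<noteq> n + m" "k' < Q" using row by auto
    then show ?thesis using row(4)[OF \<open>k' < length (R r)\<close>] \<open>k' < k\<close> n_less_Q(11) by (simp add: cell_eq_iff)
  qed
  show "(M(cell r (n + m) := k)) a = M a" if "\<And>k. k < Q \<Longrightarrow> a \<noteq> cell r k" for a using that[OF n_less_Q(11)] by simp
qed

lemma rep_append:
  assumes "rep M lab R" "0 < r" "r < Q" "length (R r) < n + m" "y < Q"
  shows "rep (M(cell r (length (R r)) := y, cell r (n + m) := Suc (length (R r)))) lab (R(r := R r @ [y]))"
proof (rule rep_row_update[OF assms(1-3)])
  note row = rep_row[OF assms(1-3)]
  let ?M = "M(cell r (length (R r)) := y, cell r (n + m) := Suc (length (R r)))"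
  show "length (R r @ [y]) \<le> n + m" using assms(4) by simp
  show "\<forall>y\<in>set (R r @ [y]). y < Q" using row(5) assms(5) by (auto simp: in_set_conv_nth)
  show "?M (cell r (n + m)) = length (R r @ [y])" by simp
  show "?M (cell r k) = (R r @ [y]) ! k" if k: "k < length (R r @ [y])" for k
  proof -
    have "k \<noteq> n + m" "k < Q" using k assms(4) by (auto simp: Q_def)
    then show ?thesis using k row(3,4) n_less_Q(11) by (auto simp: cell_eq_iff nth_append less_Suc_eq)
  qed
  show "?M a = M a" if "\<And>k. k < Q \<Longrightarrow> a \<noteq> cell r k" for a using that[OF n_less_Q(11)] that[OF row(3)] by simp
qed

end

section \<open>Absorbing and scanning a list\<close>

text \<open>Registers: 12 row of the list, 13 its length, 15 position, 16 vertex, 10 new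
  label.\<close>

definition absorb_body :: com where
  "absorb_body = Block (get 16 12 15 @ [Load 17 16]) ;; IfLess 0 17 (Block []) (Block [Store 16 10]) ;;
     Block [WordOp WPlus 15 15 1]"

definition absorb_com :: com where
  "absorb_com = Block ([WordOp WPlus 12 11 1, WordOp WPlus 10 12 2] @ get 13 12 5 @ [WordOp WPlus 15 0 0]) ;;
     WhileLess 15 13 absorb_body ;; Block (put 12 5 0)"

text \<open>Live vertices are compacted in place, with write position 18 behind read position 15,
  and the weight of the set is added to the real cell of each.\<close>

definition scan_body :: com where
  "scan_body = Block (get 16 12 15 @ [Load 17 16]) ;;
     IfLess 0 17 (Block []) (Block (put 12 18 16 @ [RLoad 13 16, RealOp RPlus 13 13 12, RStore 16 13, WordOp WPlus 18 18 1])) ;;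
     Block [WordOp WPlus 15 15 1]"

definition scan_com :: com where
  "scan_com = Block (get 11 7 9 @ [QSetValue 12 11, WordOp WPlus 12 11 1] @ get 13 12 5 @
       [RealOfWord 13 13, RealOp RPlus 10 10 13, WordOp WPlus 15 0 0, WordOp WPlus 18 0 0]) ;;
     WhileLess 15 13 scan_body ;; Block (put 12 5 18 @ [WordOp WPlus 9 9 1])"

context rounding_ram
begin

definition fixed_regs :: "ram_state \<Rightarrow> bool" where
  "fixed_regs s \<longleftrightarrow> wreg s 0 = 0 \<and> wreg s 1 = 1 \<and> wreg s 2 = n \<and> wreg s 3 = m \<and> wreg s 4 = Q \<and> wreg s 5 = n + m \<and>
     rreg s 0 = 0 \<and> rreg s 1 = 1 \<and> rreg s 2 = \<Delta> \<and> rreg s 3 = 3/10 \<and> rreg s 4 = 7/10 \<and> rreg s 5 = 23/31 \<and>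
     rreg s 6 = n / \<Delta> \<and> rreg s 7 = n / \<Delta>\<^sup>2 \<and> rreg s 8 = m / \<Delta>"

text \<open>Registers from the bound up to 19 are scratch; those from 20 on survive every subroutine
  that is described in this way.\<close>

definition keeps :: "nat \<Rightarrow> nat \<Rightarrow> ram_state \<Rightarrow> ram_state \<Rightarrow> bool" where
  "keeps a b s s' \<longleftrightarrow> (\<forall>r. r < a \<or> 20 \<le> r \<longrightarrow> wreg s' r = wreg s r) \<and> (\<forall>r. r < b \<or> 20 \<le> r \<longrightarrow> rreg s' r = rreg s r)"

lemma keeps_refl [simp]: "keeps a b s s" by (simp add: keeps_def)

lemma keeps_trans: "keeps a b s s' \<Longrightarrow> keeps a b s' s'' \<Longrightarrow> keeps a b s s''" by (simp add: keeps_def)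

lemma keeps_mono: "keeps a b s s' \<Longrightarrow> a' \<le> a \<Longrightarrow> b' \<le> b \<Longrightarrow> keeps a' b' s s'" by (simp add: keeps_def)

lemma keeps_fixed_regs: "keeps a b s s' \<Longrightarrow> 6 \<le> a \<Longrightarrow> 9 \<le> b \<Longrightarrow> fixed_regs s \<Longrightarrow> fixed_regs s'"
  by (simp add: keeps_def fixed_regs_def)

text \<open>Rows \<open>1..m\<close> hold the member lists, and the next \<open>n\<close> rows hold
  for each vertex the indices of its sets.\<close>

definition rowsof :: "(nat \<Rightarrow> nat list) \<Rightarrow> nat \<Rightarrow> nat list" where
  "rowsof L r = (case r of 0 \<Rightarrow> [] | Suc j \<Rightarrow> if j < m then L j else JL (j - m))"

lemma rowsof_simps [simp]: "j < m \<Longrightarrow> rowsof L (Suc j) = L j" "rowsof L (Suc (m + u)) = JL u"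
  by (simp_all add: rowsof_def)

lemma rowsof_update: "j < m \<Longrightarrow> (rowsof L)(Suc j := xs) = rowsof (L(j := xs))"
  by (auto simp: rowsof_def fun_eq_iff split: nat.split)

lemma sim_absorb:
  assumes s: "fixed_regs s" "rep (wmem s) lab (rowsof L)" "wreg s 11 = j" "j < m"
    and L: "distinct (L j)" "set (L j) \<subseteq> {..<n}"
  shows "sim_com absorb_com s (return_pmf ()) (\<lambda>_ s' t. keeps 10 20 s s' \<and> rmem s' = rmem s \<and>
     rep (wmem s') (fst (absorb j (lab, L, c))) (rowsof (L(j := []))) \<and> t \<le> 20 + 10 * length (L j))"
proof -
  define xs where "xs = L j"
  define lab' where "lab' i = (\<lambda>v. if v \<in> set (take i xs) \<and> lab v = 0 then n + 1 + j else lab v)" for i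
  define s1 where "s1 = block ([WordOp WPlus 12 11 1, WordOp WPlus 10 12 2] @ get 13 12 5 @ [WordOp WPlus 15 0 0]) s"
  note row = rep_row[OF s(2), of "Suc j", simplified, OF n_less_Q(5)[OF s(4)]]
  have less: "j < Q" "Suc j < Q" "Suc (n + j) < Q" "Suc (j + n) < Q" "n + m < Q" "length xs < Q"
    using n_less_Q(4,5,9,11) s(4) row by (auto simp: xs_def add.commute)
  have s1: "keeps 10 20 s s1" "rmem s1 = rmem s" "rep (wmem s1) lab (rowsof L)" "fixed_regs s1"
    "wreg s1 10 = n + 1 + j" "wreg s1 11 = j" "wreg s1 12 = Suc j" "wreg s1 13 = length xs" "wreg s1 15 = 0"
    using s less row unfolding s1_def by (simp_all add: fixed_regs_def keeps_def block_get xs_def)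
  define Inv where "Inv i s' t \<longleftrightarrow> keeps 14 20 s1 s' \<and> wreg s' 15 = i \<and> rmem s' = rmem s \<and>
     rep (wmem s') (lab' i) (rowsof L) \<and> t \<le> 10 * i" for i s' t
  have loop: "sim_com (WhileLess 15 13 absorb_body) s1 (foldM (\<lambda>_ _. return_pmf ()) xs ())
    (\<lambda>_ s' t. \<exists>t'. t = t' + 2 \<and> Inv (length xs) s' t')"
  proof (rule sim_com_for[where Inv = "\<lambda>i _. Inv i"])
    show "Inv 0 s1 0" using s1 by (simp add: Inv_def lab'_def)
    show "\<not> wreg s' 15 < wreg s' 13 \<and> (\<exists>t'. t + 2 = t' + 2 \<and> Inv (length xs) s' t')" if "Inv (length xs) s' t" for y s' t
      using that s1 by (auto simp: Inv_def keeps_def)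
  next
    fix i :: nat and y :: unit and s' t assume i: "i < length xs" and Inv: "Inv i s' t"
    have r: "wreg s' 0 = 0" "wreg s' 1 = 1" "wreg s' 4 = Q" "wreg s' 10 = n + 1 + j" "wreg s' 12 = Suc j" "wreg s' 13 = length xs" "wreg s' 15 = i"
      using Inv s1 by (simp_all add: Inv_def keeps_def fixed_regs_def)
    have rp: "rep (wmem s') (lab' i) (rowsof L)" and m': "rmem s' = rmem s" using Inv by (simp_all add: Inv_def)
    note row' = rep_row[OF rp, of "Suc j", simplified, OF less(2)]
    have cell: "wmem s' (cell (Suc j) i) = xs ! i" using row'(4)[of i] i s(4) by (simp add: xs_def)
    have v: "xs ! i < n" using subsetD[OF L(2) nth_mem[of i "L j"]] i by (simp add: xs_def)
    have vQ: "xs ! i < Q" "i < Q" "Suc i < Q \<or> Suc i = Q" using n_less_Q(3)[OF v] i less by auto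
    have Sm: "Suc i mod W = Suc i" using i less less_W by simp
    have lv: "lab' i (xs ! i) = lab (xs ! i)" "wmem s' (xs ! i) = lab (xs ! i)" "lab (xs ! i) < Q"
    proof -
      \<comment> \<open>The list is distinct, so earlier iterations have not touched the label of
        this vertex.\<close>
      have "xs ! i \<notin> set (take i xs)" using L(1) i by (auto simp: in_set_conv_nth nth_eq_iff_index_eq xs_def)
      then show "lab' i (xs ! i) = lab (xs ! i)" by (simp add: lab'_def)
      then show "wmem s' (xs ! i) = lab (xs ! i)" "lab (xs ! i) < Q" using rep_lab[OF rp v] by simp_all
    qed
    have nx: "lab' (Suc i) = (if lab (xs ! i) = 0 then (lab' i)(xs ! i := n + 1 + j) else lab' i)"
      using i by (auto simp: lab'_def take_Suc_conv_app_nth fun_eq_iff)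
    have "sim_com absorb_body s' (return_pmf ()) (\<lambda>_ s'' t'. Inv (Suc i) s'' (t + t' + 2))"
    proof (rule sim_com_simple)
      show "Inv (Suc i) (ev absorb_body s') (t + t' + 2)" if "t' \<le> size_com absorb_body" for t'
        using that Inv r cell vQ lv nx Sm rep_label[OF rp v, of "n + 1 + j"] less
        by (auto simp: Inv_def keeps_def absorb_body_def block_get rp)
    qed (simp add: absorb_body_def)
    then show "wreg s' 15 < wreg s' 13 \<and> sim_com absorb_body s' (return_pmf ()) (\<lambda>_ s'' t'. Inv (Suc i) s'' (t + t' + 2))"
      using r i by simp
  qed
  show ?thesis unfolding absorb_com_def
  proof (rule sim_com_Seq_det)
    show "sim_com (Block ([WordOp WPlus 12 11 1, WordOp WPlus 10 12 2] @ get 13 12 5 @ [WordOp WPlus 15 0 0])) s (return_pmf ())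
      (\<lambda>_ s' t. s' = s1 \<and> t = 6)"
      by (rule sim_com_Block) (simp_all add: s1_def)
    fix s' and t :: nat assume "s' = s1 \<and> t = 6"
    then have st: "s' = s1" "t = 6" by simp_all
    show "sim_com (WhileLess 15 13 absorb_body ;; Block (put 12 5 0)) s' (return_pmf ()) (\<lambda>_ s' t'. keeps 10 20 s s' \<and> rmem s' = rmem s \<and>
     rep (wmem s') (fst (absorb j (lab, L, c))) (rowsof (L(j := []))) \<and> t + t' \<le> 20 + 10 * length (L j))"
      unfolding st
    proof (rule sim_com_Seq_det[OF loop[unfolded foldM_unit]])
      fix s' t assume "\<exists>t'. t = t' + 2 \<and> Inv (length xs) s' t'"
      then obtain t' where t: "t = t' + 2" and Inv: "Inv (length xs) s' t'" by auto
      have r: "wreg s' 0 = 0" "wreg s' 4 = Q" "wreg s' 5 = n + m" "wreg s' 12 = Suc j"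
        using Inv s1 by (simp_all add: Inv_def keeps_def fixed_regs_def)
      have lab: "lab' (length xs) = fst (absorb j (lab, L, c))" by (auto simp: lab'_def absorb_def xs_def)
      have rp: "rep (wmem s') (lab' (length xs)) (rowsof L)" using Inv by (simp add: Inv_def)
      show "sim_com (Block (put 12 5 0)) s' (return_pmf ()) (\<lambda>_ s'' t'. keeps 10 20 s s'' \<and> rmem s'' = rmem s \<and>
         rep (wmem s'') (fst (absorb j (lab, L, c))) (rowsof (L(j := []))) \<and> 6 + (t + t') \<le> 20 + 10 * length (L j))"
        by (rule sim_com_Block) (use t Inv s1 r less rep_take[OF rp, of "Suc j" 0] lab rowsof_update[OF s(4), of L "[]"]
          in \<open>simp_all add: block_put Inv_def keeps_def xs_def\<close>)
    qed
  qed
qed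

end

section \<open>Similarities to the pivot, the random set and its marks\<close>

text \<open>Starting from real memory 0, the accumulated weights make the cell of every live vertex
  equal to its similarity to the pivot. No other distances are ever computed.\<close>

definition pass1_com :: com where
  "pass1_com = Block [WordOp WPlus 9 0 0] ;; WhileLess 9 8 scan_com"

definition pick_prep :: "instr list" where
  "pick_prep = get 11 7 17 @ [QSetValue 12 11, RealOp RDivide 14 12 16]"

text \<open>On success the bound in register 18 is lowered to the current position, which ends the
  loop and keeps the position in register 17.\<close>

definition pick_body :: com where
  "pick_body = Block pick_prep ;; Draw (Flip 19 14) ;;
     IfLess 0 19 (Block [WordOp WPlus 18 17 0]) (Block [WordOp WPlus 17 17 1, RealOp RMinus 16 16 12])"

definition pick_com :: com where
  "pick_com = Block [WordOp WPlus 18 8 0, WordOp WPlus 17 0 0, RealOp RPlus 16 1 0] ;;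
     WhileLess 17 18 pick_body ;; Block (get 21 7 17)"

text \<open>Adding 1 marks the members of the chosen set: on candidates, which have positive
  similarity of at most 1, a value above 1 is the mark.\<close>

definition mark_body :: com where
  "mark_body = Block (get 16 12 15 @ [RLoad 13 16, RealOp RPlus 13 13 1, RStore 16 13, WordOp WPlus 15 15 1])"

definition mark_com :: com where
  "mark_com = (Block ([WordOp WPlus 12 21 1] @ get 13 12 5 @ [WordOp WPlus 15 0 0]) ;;
     IfRLess 0 11 (Block [WordOp WPlus 13 0 0]) (Block [])) ;; WhileLess 15 13 mark_body"

lemma distinct_nth_take: "distinct xs \<Longrightarrow> i < length xs \<Longrightarrow> xs ! i \<notin> set (take i xs)"
  by (auto simp: in_set_conv_nth nth_eq_iff_index_eq)

lemma nth_prefix_drop: "length ys \<le> i \<Longrightarrow> i < length xs \<Longrightarrow> (ys @ drop (length ys) xs) ! i = xs ! i"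
  by (simp add: nth_append)

lemma update_prefix_drop:
  "length ys < length xs \<Longrightarrow> (ys @ drop (length ys) xs)[length ys := v] = (ys @ [v]) @ drop (length (ys @ [v])) xs"
  by (simp add: list_update_append flip: Cons_nth_drop_Suc)

context rounding_ram
begin

lemma nth_or_sol [simp]: "j < m \<Longrightarrow> nth_or ([], 0) (in_sol I) j = in_sol I ! j" by (simp add: nth_or_def)

abbreviation alive :: "(nat \<Rightarrow> nat) \<Rightarrow> nat list \<Rightarrow> nat list" where "alive lab \<equiv> filter (\<lambda>v. lab v = 0)"

lemma sim_scan_loop:
  assumes s: "fixed_regs s" "rep (wmem s) lab R" "wreg s 12 = r" "0 < r" "r < Q"
    and xs: "R r = xs" "wreg s 13 = length xs" "wreg s 15 = 0" "wreg s 18 = 0" "distinct xs" "set xs \<subseteq> {..<n}"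
  shows "sim_com (WhileLess 15 13 scan_body) s (return_pmf ()) (\<lambda>_ s' t. keeps 13 13 s s' \<and>
     wreg s' 18 = length (alive lab xs) \<and> rep (wmem s') lab (R(r := alive lab xs @ drop (length (alive lab xs)) xs)) \<and>
     rmem s' = (\<lambda>v. rmem s v + (if v \<in> set (alive lab xs) then rreg s 12 else 0)) \<and> t \<le> 16 * length xs + 2)"
proof -
  define ys where "ys i = alive lab (take i xs)" for i
  define Inv where "Inv i s' t \<longleftrightarrow> keeps 14 13 s s' \<and> wreg s' 15 = i \<and> wreg s' 18 = length (ys i) \<and>
     rep (wmem s') lab (R(r := ys i @ drop (length (ys i)) xs)) \<and>
     rmem s' = (\<lambda>v. rmem s v + (if v \<in> set (ys i) then rreg s 12 else 0)) \<and> t \<le> 16 * i" for i s' t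
  have len: "length xs \<le> n + m" "length xs < Q" using rep_row[OF s(2,4,5)] xs(1) by auto
  have "sim_com (WhileLess 15 13 scan_body) s (foldM (\<lambda>_ _. return_pmf ()) xs ())
    (\<lambda>_ s' t. \<exists>t'. t = t' + 2 \<and> Inv (length xs) s' t')"
  proof (rule sim_com_for[where Inv = "\<lambda>i _. Inv i"])
    show "Inv 0 s 0" using s xs by (auto simp: Inv_def ys_def fun_upd_idem)
    show "\<not> wreg s' 15 < wreg s' 13 \<and> (\<exists>t'. t + 2 = t' + 2 \<and> Inv (length xs) s' t')" if "Inv (length xs) s' t" for y s' t
      using that xs by (auto simp: Inv_def keeps_def)
  next
    fix i :: nat and y :: unit and s' t assume i: "i < length xs" and Inv: "Inv i s' t"
    have r: "wreg s' 0 = 0" "wreg s' 1 = 1" "wreg s' 4 = Q" "wreg s' 12 = r" "wreg s' 13 = length xs" "wreg s' 15 = i"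
      "wreg s' 18 = length (ys i)" "rreg s' 12 = rreg s 12"
      using Inv s xs by (simp_all add: Inv_def keeps_def fixed_regs_def)
    have rp: "rep (wmem s') lab (R(r := ys i @ drop (length (ys i)) xs))" using Inv by (simp add: Inv_def)
    \<comment> \<open>The write position never passes the read position, so the entry about to be
      read is still the original one.\<close>
    have ly: "length (ys i) \<le> i" using length_filter_le[of "\<lambda>v. lab v = 0" "take i xs"] i by (simp add: ys_def)
    then have tot: "length (ys i @ drop (length (ys i)) xs) = length xs" "length (ys i) < length xs" using i by auto
    note row' = rep_row[OF rp s(4,5), unfolded fun_upd_same tot nth_prefix_drop[OF ly i]]
    have cell: "wmem s' (cell r i) = xs ! i" using row'(4)[OF i] nth_prefix_drop[OF ly i] by simp
    have v: "xs ! i < n" using subsetD[OF xs(6) nth_mem[OF i]] by simp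
    have vQ: "xs ! i < Q" "i < Q" "length (ys i) < Q" using n_less_Q(3)[OF v] i len tot by auto
    have Sm: "Suc i mod W = Suc i" "Suc (length (ys i)) mod W = Suc (length (ys i))" using i len tot less_W by simp_all
    have lv: "wmem s' (xs ! i) = lab (xs ! i)" "lab (xs ! i) < Q" using rep_lab[OF rp v] by simp_all
    have nin: "xs ! i \<notin> set (ys i)" using distinct_nth_take[OF xs(5) i] by (auto simp: ys_def)
    have nx: "ys (Suc i) = ys i @ (if lab (xs ! i) = 0 then [xs ! i] else [])"
      using i by (simp add: ys_def take_Suc_conv_app_nth)
    have set: "rep ((wmem s')(cell r (length (ys i)) := xs ! i)) lab
        (R(r := ys i @ xs ! i # drop (Suc (length (ys i))) xs))"
      using rep_set[OF rp s(4,5), of "length (ys i)" "xs ! i"] tot vQ update_prefix_drop[OF tot(2), of "xs ! i"] by simp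
    have "sim_com scan_body s' (return_pmf ()) (\<lambda>_ s'' t'. Inv (Suc i) s'' (t + t' + 2))"
    proof (rule sim_com_simple)
      show "Inv (Suc i) (ev scan_body s') (t + t' + 2)" if "t' \<le> size_com scan_body" for t'
        using that Inv r cell vQ lv nx Sm set s(5) nin
        by (auto simp: Inv_def keeps_def scan_body_def block_get block_put fun_eq_iff)
    qed (simp add: scan_body_def)
    then show "wreg s' 15 < wreg s' 13 \<and> sim_com scan_body s' (return_pmf ()) (\<lambda>_ s'' t'. Inv (Suc i) s'' (t + t' + 2))"
      using r i by simp
  qed
  then show ?thesis unfolding foldM_unit
    by (rule sim_com_consequence) (auto simp: Inv_def ys_def elim: keeps_mono)
qed

lemma JL_nth: "k < length (JL u) \<Longrightarrow> JL u ! k < m"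
  using nth_mem[of k "JL u"] by (auto simp: set_JL J_def)

lemma sim_scan:
  assumes s: "fixed_regs s" "rep (wmem s) lab (rowsof L)" "u < n" "wreg s 7 = Suc (m + u)" "wreg s 9 = k" "k < length (JL u)"
    and j: "JL u ! k = j" and L: "distinct (L j)" "set (L j) \<subseteq> {..<n}"
  shows "sim_com scan_com s (return_pmf ()) (\<lambda>_ s' t. keeps 9 10 s s' \<and> wreg s' 10 = wreg s 10 \<and> rreg s' 11 = rreg s 11 \<and>
     wreg s' 9 = Suc k \<and> rreg s' 10 = rreg s 10 + length (L j) \<and> rep (wmem s') lab (rowsof (L(j := alive lab (L j)))) \<and>
     rmem s' = (\<lambda>v. rmem s v + (if v \<in> set (alive lab (L j)) then w j else 0)) \<and> t \<le> 30 + 16 * length (L j))"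
proof -
  let ?B = "get 11 7 9 @ [QSetValue 12 11, WordOp WPlus 12 11 1] @ get 13 12 5 @
       [RealOfWord 13 13, RealOp RPlus 10 10 13, WordOp WPlus 15 0 0, WordOp WPlus 18 0 0]"
  define s1 where "s1 = block ?B s"
  have jm: "j < m" using JL_nth[OF s(6)] j by simp
  note urow = rep_row[OF s(2), of "Suc (m + u)", simplified, OF n_less_Q(8)[OF s(3)]]
  note row = rep_row[OF s(2), of "Suc j", simplified, OF n_less_Q(5)[OF jm]]
  have less: "j < Q" "Suc j < Q" "n + m < Q" "length (L j) < Q" "k < Q" "Suc (m + u) < Q" "Suc k \<le> Q"
    using n_less_Q(4,5,8,9,11) jm s(3,6) row(3) jm urow(3) by auto
  have cells: "wmem s (cell (Suc (m + u)) k) = j" "wmem s (cell (Suc j) (n + m)) = length (L j)"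
    using urow(4)[OF s(6)] row(2) jm j by simp_all
  have s1: "keeps 9 10 s s1" "wreg s1 10 = wreg s 10" "rreg s1 11 = rreg s 11" "wreg s1 9 = k" "rmem s1 = rmem s" "wmem s1 = wmem s"
    "fixed_regs s1" "wreg s1 12 = Suc j" "wreg s1 13 = length (L j)" "wreg s1 15 = 0" "wreg s1 18 = 0" "rreg s1 12 = w j"
    "rreg s1 10 = rreg s 10 + length (L j)"
    using s less cells jm unfolding s1_def by (simp_all add: fixed_regs_def keeps_def block_get val_sol)
  have rp1: "rep (wmem s1) lab (rowsof L)" using s1 s by simp
  let ?ys = "alive lab (L j)"
  have loop: "sim_com (WhileLess 15 13 scan_body) s1 (return_pmf ()) (\<lambda>_ s' t. keeps 13 13 s1 s' \<and>
     wreg s' 18 = length ?ys \<and> rep (wmem s') lab ((rowsof L)(Suc j := ?ys @ drop (length ?ys) (L j))) \<and>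
     rmem s' = (\<lambda>v. rmem s1 v + (if v \<in> set ?ys then rreg s1 12 else 0)) \<and> t \<le> 16 * length (L j) + 2)"
    by (rule sim_scan_loop[OF s1(7) rp1 s1(8) _ less(2) _ s1(9,10,11) L]) (simp_all add: jm)
  show ?thesis unfolding scan_com_def
  proof (rule sim_com_Seq_det)
    show "sim_com (Block ?B) s (return_pmf ()) (\<lambda>_ s' t. s' = s1 \<and> t = 12)"
      by (rule sim_com_Block) (simp_all add: s1_def)
    fix s' and t :: nat assume "s' = s1 \<and> t = 12"
    then have st: "s' = s1" "t = 12" by simp_all
    show "sim_com (WhileLess 15 13 scan_body ;; Block (put 12 5 18 @ [WordOp WPlus 9 9 1])) s' (return_pmf ())
      (\<lambda>_ s' t'. keeps 9 10 s s' \<and> wreg s' 10 = wreg s 10 \<and> rreg s' 11 = rreg s 11 \<and>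
       wreg s' 9 = Suc k \<and> rreg s' 10 = rreg s 10 + length (L j) \<and> rep (wmem s') lab (rowsof (L(j := ?ys))) \<and>
       rmem s' = (\<lambda>v. rmem s v + (if v \<in> set ?ys then w j else 0)) \<and> t + t' \<le> 30 + 16 * length (L j))"
      unfolding st
    proof (rule sim_com_Seq_det[OF loop])
      fix s' and t :: nat
      assume *: "keeps 13 13 s1 s' \<and> wreg s' 18 = length ?ys \<and>
        rep (wmem s') lab ((rowsof L)(Suc j := ?ys @ drop (length ?ys) (L j))) \<and>
        rmem s' = (\<lambda>v. rmem s1 v + (if v \<in> set ?ys then rreg s1 12 else 0)) \<and> t \<le> 16 * length (L j) + 2"
      then have l: "keeps 13 13 s1 s'" "wreg s' 18 = length ?ys" "t \<le> 16 * length (L j) + 2"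
        "rmem s' = (\<lambda>v. rmem s1 v + (if v \<in> set ?ys then rreg s1 12 else 0))"
        and rp: "rep (wmem s') lab ((rowsof L)(Suc j := ?ys @ drop (length ?ys) (L j)))" by blast+
      have r: "wreg s' 0 = 0" "wreg s' 1 = 1" "wreg s' 4 = Q" "wreg s' 5 = n + m" "wreg s' 12 = Suc j" "wreg s' 9 = k"
        using l(1) s1 by (simp_all add: keeps_def fixed_regs_def)
      have ly: "length ?ys < Q" using less(4) length_filter_le[of "\<lambda>v. lab v = 0" "L j"] by linarith
      have rp': "rep ((wmem s')(cell (Suc j) (n + m) := length ?ys)) lab (rowsof (L(j := ?ys)))"
        using rep_take[OF rp, of "Suc j" "length ?ys"] less jm by (simp add: rowsof_update)
      show "sim_com (Block (put 12 5 18 @ [WordOp WPlus 9 9 1])) s' (return_pmf ()) (\<lambda>_ s'' t'. keeps 9 10 s s'' \<and> wreg s'' 10 = wreg s 10 \<and> rreg s'' 11 = rreg s 11 \<and>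
         wreg s'' 9 = Suc k \<and> rreg s'' 10 = rreg s 10 + length (L j) \<and> rep (wmem s'') lab (rowsof (L(j := ?ys))) \<and>
         rmem s'' = (\<lambda>v. rmem s v + (if v \<in> set ?ys then w j else 0)) \<and> 12 + (t + t') \<le> 30 + 16 * length (L j))"
        by (rule sim_com_Block) (use r l(1-3) l(4)[unfolded s1(12)] s1 less ly rp' less_W(2)[OF less(7)] in \<open>simp_all add: block_put keeps_def\<close>)
    qed
  qed
qed

lemma sim_pass1:
  assumes s: "fixed_regs s" "rep (wmem s) lab (rowsof L)" "u < n" "wreg s 7 = Suc (m + u)" "wreg s 8 = length (JL u)"
    and L: "\<And>j. j < m \<Longrightarrow> distinct (L j) \<and> set (L j) \<subseteq> {..<n}"
  shows "sim_com pass1_com s (return_pmf ()) (\<lambda>_ s' t. keeps 9 10 s s' \<and> wreg s' 10 = wreg s 10 \<and> rreg s' 11 = rreg s 11 \<and>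
     rreg s' 10 = rreg s 10 + (\<Sum>j\<in>J u. real (length (L j))) \<and>
     rep (wmem s') lab (rowsof (\<lambda>j. if j \<in> J u then alive lab (L j) else L j)) \<and>
     rmem s' = (\<lambda>v. rmem s v + (\<Sum>j\<in>J u. if v \<in> set (alive lab (L j)) then w j else 0)) \<and>
     t \<le> 10 + 40 * length (JL u) + 16 * (\<Sum>j\<in>J u. length (L j)))"
proof -
  define P where "P k = set (take k (JL u))" for k
  define Inv where "Inv k s' t \<longleftrightarrow> keeps 9 10 s s' \<and> wreg s' 10 = wreg s 10 \<and> rreg s' 11 = rreg s 11 \<and> wreg s' 9 = k \<and>
     rreg s' 10 = rreg s 10 + (\<Sum>j\<in>P k. real (length (L j))) \<and>
     rep (wmem s') lab (rowsof (\<lambda>j. if j \<in> P k then alive lab (L j) else L j)) \<and>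
     rmem s' = (\<lambda>v. rmem s v + (\<Sum>j\<in>P k. if v \<in> set (alive lab (L j)) then w j else 0)) \<and>
     t \<le> 1 + 40 * k + 16 * (\<Sum>j\<in>P k. length (L j))" for k s' t
  have PJ: "P (length (JL u)) = J u" by (simp add: P_def set_JL)
  show ?thesis unfolding pass1_com_def
  proof (rule sim_com_Seq_det[where Q = "\<lambda>_ s' t. Inv 0 s' t \<and> t = 1"])
    show "sim_com (Block [WordOp WPlus 9 0 0]) s (return_pmf ()) (\<lambda>_ s' t. Inv 0 s' t \<and> t = 1)"
      by (rule sim_com_Block) (use s in \<open>simp_all add: Inv_def keeps_def P_def fixed_regs_def\<close>)
    fix s1 and t1 :: nat assume s1: "Inv 0 s1 t1 \<and> t1 = 1"
    have "sim_com (WhileLess 9 8 scan_com) s1 (foldM (\<lambda>_ _. return_pmf ()) (JL u) ())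
      (\<lambda>_ s' t. \<exists>t'. t = t' + 2 \<and> Inv (length (JL u)) s' (t' + 1))"
    proof (rule sim_com_for[where Inv = "\<lambda>i _ s t. Inv i s (t + 1)"])
      show "Inv 0 s1 (0 + 1)" using s1 by auto
      show "\<not> wreg s' 9 < wreg s' 8 \<and> (\<exists>t'. t + 2 = t' + 2 \<and> Inv (length (JL u)) s' (t' + 1))"
        if "Inv (length (JL u)) s' (t + 1)" for y s' t
        using that s by (auto simp: Inv_def keeps_def)
    next
      fix k :: nat and y :: unit and s' t assume k: "k < length (JL u)" and Inv: "Inv k s' (t + 1)"
      define j where "j = JL u ! k"
      have jm: "j < m" using JL_nth[OF k] by (simp add: j_def)
      have jP: "j \<notin> P k" "P (Suc k) = insert j (P k)"
        using distinct_nth_take[OF distinct_JL k] k by (auto simp: P_def j_def take_Suc_conv_app_nth)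
      have fin: "finite (P k)" by (simp add: P_def)
      let ?L = "\<lambda>j. if j \<in> P k then alive lab (L j) else L j"
      have Lj: "?L j = L j" using jP by simp
      have k1: "keeps 9 10 s s'" using Inv by (simp add: Inv_def)
      have r: "wreg s' 7 = Suc (m + u)" "wreg s' 8 = length (JL u)" using k1 s by (simp_all add: keeps_def)
      have upd: "?L(j := alive lab (L j)) = (\<lambda>j. if j \<in> P (Suc k) then alive lab (L j) else L j)"
        using jP by (auto simp: fun_eq_iff)
      have "sim_com scan_com s' (return_pmf ()) (\<lambda>_ s'' t'. keeps 9 10 s' s'' \<and> wreg s'' 10 = wreg s' 10 \<and> rreg s'' 11 = rreg s' 11 \<and>
         wreg s'' 9 = Suc k \<and> rreg s'' 10 = rreg s' 10 + length (?L j) \<and> rep (wmem s'') lab (rowsof (?L(j := alive lab (?L j)))) \<and>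
         rmem s'' = (\<lambda>v. rmem s' v + (if v \<in> set (alive lab (?L j)) then w j else 0)) \<and> t' \<le> 30 + 16 * length (?L j))"
        by (rule sim_scan[where u = u]) (use k1 r s Inv k L[OF jm] Lj in \<open>auto simp: Inv_def j_def intro: keeps_fixed_regs\<close>)
      then have "sim_com scan_com s' (return_pmf ()) (\<lambda>_ s'' t'. Inv (Suc k) s'' (t + t' + 2 + 1))"
      proof (rule sim_com_consequence)
        fix a s'' t' assume "keeps 9 10 s' s'' \<and> wreg s'' 10 = wreg s' 10 \<and> rreg s'' 11 = rreg s' 11 \<and>
         wreg s'' 9 = Suc k \<and> rreg s'' 10 = rreg s' 10 + length (?L j) \<and> rep (wmem s'') lab (rowsof (?L(j := alive lab (?L j)))) \<and>
         rmem s'' = (\<lambda>v. rmem s' v + (if v \<in> set (alive lab (?L j)) then w j else 0)) \<and> t' \<le> 30 + 16 * length (?L j)"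
        note q = this[unfolded Lj upd]
        have "keeps 9 10 s s''" using k1 q keeps_trans by blast
        then show "Inv (Suc k) s'' (t + t' + 2 + 1)"
          using q Inv jP(1) fin unfolding Inv_def jP(2) by (auto simp: fun_eq_iff)
      qed
      then show "wreg s' 9 < wreg s' 8 \<and> sim_com scan_com s' (return_pmf ()) (\<lambda>_ s'' t'. Inv (Suc k) s'' (t + t' + 2 + 1))"
        using r k Inv by (simp add: Inv_def)
    qed
    then show "sim_com (WhileLess 9 8 scan_com) s1 (return_pmf ()) (\<lambda>_ s' t. keeps 9 10 s s' \<and> wreg s' 10 = wreg s 10 \<and> rreg s' 11 = rreg s 11 \<and>
     rreg s' 10 = rreg s 10 + (\<Sum>j\<in>J u. real (length (L j))) \<and>
     rep (wmem s') lab (rowsof (\<lambda>j. if j \<in> J u then alive lab (L j) else L j)) \<and>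
     rmem s' = (\<lambda>v. rmem s v + (\<Sum>j\<in>J u. if v \<in> set (alive lab (L j)) then w j else 0)) \<and>
     t1 + t \<le> 10 + 40 * length (JL u) + 16 * (\<Sum>j\<in>J u. length (L j)))"
      unfolding foldM_unit by (rule sim_com_consequence) (use s1 PJ in \<open>auto simp: Inv_def\<close>)
  qed
qed

lemma sim_pick_loop:
  assumes s: "fixed_regs s" "rep (wmem s) lab R" "u < n" "wreg s 7 = Suc (m + u)" "R (Suc (m + u)) = JL u"
    and "wreg s 17 = i" "wreg s 18 = length (JL u)" "i < length (JL u)" "rreg s 16 = (\<Sum>j\<leftarrow>drop i (JL u). w j)"
  shows "sim_com (WhileLess 17 18 pick_body) s (pick_pmf w (drop i (JL u)) (rreg s 16)) (\<lambda>j s' t. keeps 11 12 s s' \<and>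
     wmem s' = wmem s \<and> rmem s' = rmem s \<and> wreg s' 17 < length (JL u) \<and> JL u ! wreg s' 17 = j \<and>
     t \<le> 20 * (length (JL u) - i) + 2)"
  using assms
proof (induction "length (JL u) - i" arbitrary: i s)
  case 0
  then show ?case by simp
next
  case (Suc d)
  note s = Suc.prems(1-5) and i = Suc.prems(6-9)
  define j where "j = JL u ! i"
  have jm: "j < m" using JL_nth[OF i(3)] by (simp add: j_def)
  have dr: "drop i (JL u) = j # drop (Suc i) (JL u)" using i(3) by (simp add: j_def Cons_nth_drop_Suc)
  define rest where "rest = (\<Sum>j\<leftarrow>drop (Suc i) (JL u). w j)"
  have r16: "rreg s 16 = w j + rest" using i(4) by (simp add: dr rest_def)
  have rest: "0 \<le> rest" unfolding rest_def using w_pos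
    by (intro sum_list_nonneg) (auto dest!: in_set_dropD simp: set_JL J_def intro: less_imp_le)
  have wj: "0 < w j" using w_pos[OF jm] .
  have p: "0 \<le> w j / rreg s 16" "w j / rreg s 16 \<le> 1" "max 0 (min 1 (w j / rreg s 16)) = w j / rreg s 16"
    using wj rest by (auto simp: r16 divide_le_eq)
  note urow = rep_row[OF s(2) _ n_less_Q(8)[OF s(3)], simplified, unfolded s(5)]
  have less: "i < Q" "Suc (m + u) < Q" "j < Q" "Suc i \<le> Q" using i(3) urow(3) n_less_Q(4,8) s(3) jm by auto
  have cell: "wmem s (cell (Suc (m + u)) i) = j" using urow(4)[OF i(3)] by (simp add: j_def)
  define s1 where "s1 = block pick_prep s"
  have s1: "keeps 11 12 s s1" "wmem s1 = wmem s" "rmem s1 = rmem s" "wreg s1 17 = i" "wreg s1 18 = length (JL u)"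
    "rreg s1 16 = rreg s 16" "rreg s1 14 = w j / rreg s 16" "rreg s1 12 = w j" "wreg s1 0 = 0" "wreg s1 1 = 1"
    using s i less cell jm unfolding s1_def by (simp_all add: fixed_regs_def keeps_def pick_prep_def block_get val_sol)
  define after where "after b s' t \<longleftrightarrow> keeps 11 12 s s' \<and> wmem s' = wmem s \<and> rmem s' = rmem s \<and> t \<le> 18 \<and>
     (if b then wreg s' 17 = i \<and> wreg s' 18 = i else rest \<noteq> 0 \<and> wreg s' 17 = Suc i \<and> wreg s' 18 = length (JL u) \<and> rreg s' 16 = rest)" for b s' and t :: nat
  have body: "sim_com pick_body s (bernoulli_pmf (w j / rreg s 16) \<bind> return_pmf) after"
    unfolding pick_body_def
  proof (rule sim_com_Seq_det)
    show "sim_com (Block pick_prep) s (return_pmf ()) (\<lambda>_ s' t. s' = s1 \<and> t = 5)"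
      by (rule sim_com_Block) (simp_all add: s1_def pick_prep_def)
    fix s' and t :: nat assume "s' = s1 \<and> t = 5"
    then have st: "s' = s1" "t = 5" by simp_all
    show "sim_com (Draw (Flip 19 14) ;; IfLess 0 19 (Block [WordOp WPlus 18 17 0]) (Block [WordOp WPlus 17 17 1, RealOp RMinus 16 16 12])) s'
       (bernoulli_pmf (w j / rreg s 16) \<bind> return_pmf) (\<lambda>b s'' t'. after b s'' (t + t'))"
      unfolding st
    proof (rule sim_com_Seq)
      show "sim_com (Draw (Flip 19 14)) s1 (bernoulli_pmf (w j / rreg s 16))
        (\<lambda>b s' t. s' = s1\<lparr>wreg := (wreg s1)(19 := of_bool b)\<rparr> \<and> t = 1 \<and> b \<in> set_pmf (bernoulli_pmf (w j / rreg s 16)))"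
        using sim_com_Flip[of s1 14 _ 19] W_large(2) p unfolding s1(7) by simp
      fix b s' and t :: nat assume b: "s' = s1\<lparr>wreg := (wreg s1)(19 := of_bool b)\<rparr> \<and> t = 1 \<and> b \<in> set_pmf (bernoulli_pmf (w j / rreg s 16))"
      \<comment> \<open>With nothing remaining the coin has bias 1, so a failure guarantees a
        further entry and the loop never runs off the list.\<close>
      have nz: "rest \<noteq> 0" if "\<not> b"
        using b that wj by (auto simp: r16 set_pmf_iff)
      show "sim_com (IfLess 0 19 (Block [WordOp WPlus 18 17 0]) (Block [WordOp WPlus 17 17 1, RealOp RMinus 16 16 12])) s'
         (return_pmf b) (\<lambda>b s'' t'. after b s'' (5 + (t + t')))"
        by (rule sim_com_simple) (use b s1 less nz less_W r16 in \<open>auto simp: after_def keeps_def\<close>)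
    qed
  qed
  have "sim_com (WhileLess 17 18 pick_body) s (bernoulli_pmf (w j / rreg s 16) \<bind>
      (\<lambda>b. if b then return_pmf j else pick_pmf w (drop (Suc i) (JL u)) (rreg s 16 - w j)))
     (\<lambda>j s' t. keeps 11 12 s s' \<and> wmem s' = wmem s \<and> rmem s' = rmem s \<and> wreg s' 17 < length (JL u) \<and> JL u ! wreg s' 17 = j \<and>
     t \<le> 20 * (length (JL u) - i) + 2)"
  proof (rule sim_com_while_step)
    show "wreg s 17 < wreg s 18" using i by simp
    show "sim_com pick_body s (bernoulli_pmf (w j / rreg s 16)) after" using body by (simp add: bind_return_pmf')
    fix b s' t assume a: "after b s' t"
    show "sim_com (WhileLess 17 18 pick_body) s' (if b then return_pmf j else pick_pmf w (drop (Suc i) (JL u)) (rreg s 16 - w j))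
      (\<lambda>j s'' t'. keeps 11 12 s s'' \<and> wmem s'' = wmem s \<and> rmem s'' = rmem s \<and> wreg s'' 17 < length (JL u) \<and> JL u ! wreg s'' 17 = j \<and>
       t + 2 + t' \<le> 20 * (length (JL u) - i) + 2)"
    proof (cases b)
      case True
      then have "sim_com (WhileLess 17 18 pick_body) s' (return_pmf j) (\<lambda>j s'' t'. keeps 11 12 s s'' \<and> wmem s'' = wmem s \<and> rmem s'' = rmem s \<and> wreg s'' 17 < length (JL u) \<and> JL u ! wreg s'' 17 = j \<and>
       t + 2 + t' \<le> 20 * (length (JL u) - i) + 2)"
        using a i(3) by (intro sim_com_while_exit) (auto simp: after_def j_def)
      with True show ?thesis by simp
    next
      case False
      have a': "keeps 11 12 s s'" "wmem s' = wmem s" "rmem s' = rmem s" "t \<le> 18" "rest \<noteq> 0" "wreg s' 17 = Suc i" "wreg s' 18 = length (JL u)"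
        "rreg s' 16 = rest" using a False by (simp_all add: after_def)
      have Si: "Suc i < length (JL u)" using a'(5) by (cases "Suc i < length (JL u)") (auto simp: rest_def)
      have "sim_com (WhileLess 17 18 pick_body) s' (pick_pmf w (drop (Suc i) (JL u)) (rreg s' 16)) (\<lambda>j s'' t. keeps 11 12 s' s'' \<and>
         wmem s'' = wmem s' \<and> rmem s'' = rmem s' \<and> wreg s'' 17 < length (JL u) \<and> JL u ! wreg s'' 17 = j \<and>
         t \<le> 20 * (length (JL u) - Suc i) + 2)"
        by (rule Suc.hyps(1)) (use Suc.hyps(2) a' Si s in \<open>auto simp: rest_def keeps_def fixed_regs_def\<close>)
      then have "sim_com (WhileLess 17 18 pick_body) s' (pick_pmf w (drop (Suc i) (JL u)) (rreg s' 16))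
        (\<lambda>j s'' t'. keeps 11 12 s s'' \<and> wmem s'' = wmem s \<and> rmem s'' = rmem s \<and> wreg s'' 17 < length (JL u) \<and> JL u ! wreg s'' 17 = j \<and>
         t + 2 + t' \<le> 20 * (length (JL u) - i) + 2)"
        by (rule sim_com_consequence) (use a' Si in \<open>auto simp: keeps_def\<close>)
      then show ?thesis using False a'(8) r16 by simp
    qed
  qed
  then show ?case by (simp add: dr p(3))
qed

lemma sim_mark:
  assumes s: "fixed_regs s" "rep (wmem s) lab (rowsof L)" "wreg s 21 = j" "j < m" "rreg s 11 = of_bool h"
    and L: "distinct (L j)" "set (L j) \<subseteq> {..<n}"
  shows "sim_com mark_com s (return_pmf ()) (\<lambda>_ s' t. keeps 11 13 s s' \<and> wmem s' = wmem s \<and>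
     rmem s' = (\<lambda>v. rmem s v + (if \<not> h \<and> v \<in> set (L j) then 1 else 0)) \<and> t \<le> 30 + 10 * length (L j))"
proof -
  define xs where "xs = (if h then [] else L j)"
  let ?c = "Block ([WordOp WPlus 12 21 1] @ get 13 12 5 @ [WordOp WPlus 15 0 0]) ;; IfRLess 0 11 (Block [WordOp WPlus 13 0 0]) (Block [])"
  define s1 where "s1 = ev ?c s"
  note row = rep_row[OF s(2), of "Suc j", simplified, OF n_less_Q(5)[OF s(4)]]
  have less: "j < Q" "Suc j < Q" "n + m < Q" "length (L j) < Q" "length xs \<le> length (L j)"
    using n_less_Q(4,5,9,11) s(4) row(3) by (auto simp: xs_def)
  have s1: "keeps 11 13 s s1" "wmem s1 = wmem s" "rmem s1 = rmem s" "wreg s1 12 = Suc j" "wreg s1 13 = length xs" "wreg s1 15 = 0"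
    using s less row(2) unfolding s1_def by (simp_all add: fixed_regs_def keeps_def block_get xs_def)
  define Inv where "Inv i s' t \<longleftrightarrow> keeps 14 13 s1 s' \<and> wreg s' 15 = i \<and> wmem s' = wmem s \<and>
     rmem s' = (\<lambda>v. rmem s v + (if v \<in> set (take i xs) then 1 else 0)) \<and> t \<le> 10 * i" for i s' t
  have "sim_com (WhileLess 15 13 mark_body) s1 (foldM (\<lambda>_ _. return_pmf ()) xs ())
    (\<lambda>_ s' t. \<exists>t'. t = t' + 2 \<and> Inv (length xs) s' t')"
  proof (rule sim_com_for[where Inv = "\<lambda>i _. Inv i"])
    show "Inv 0 s1 0" using s1 by (auto simp: Inv_def)
    show "\<not> wreg s' 15 < wreg s' 13 \<and> (\<exists>t'. t + 2 = t' + 2 \<and> Inv (length xs) s' t')" if "Inv (length xs) s' t" for y s' t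
      using that s1 by (auto simp: Inv_def keeps_def)
  next
    fix i :: nat and y :: unit and s' t assume i: "i < length xs" and Inv: "Inv i s' t"
    then have h: "\<not> h" "xs = L j" by (auto simp: xs_def split: if_splits)
    have r: "wreg s' 1 = 1" "wreg s' 4 = Q" "wreg s' 12 = Suc j" "wreg s' 13 = length xs" "wreg s' 15 = i" "rreg s' 1 = 1"
      using Inv s1 s by (simp_all add: Inv_def keeps_def fixed_regs_def)
    have cell: "wmem s (cell (Suc j) i) = xs ! i" using row(4)[of i] i s(4) h by simp
    have v: "xs ! i < n" using subsetD[OF L(2) nth_mem[of i "L j"]] i h by simp
    have vQ: "xs ! i < Q" "i < Q" using n_less_Q(3)[OF v] i less by auto
    have Sm: "Suc i mod W = Suc i" using i less less_W by simp
    have nin: "xs ! i \<notin> set (take i xs)" using distinct_nth_take[of xs i] L i h by simp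
    have "sim_com mark_body s' (return_pmf ()) (\<lambda>_ s'' t'. Inv (Suc i) s'' (t + t' + 2))"
    proof (rule sim_com_simple)
      show "Inv (Suc i) (ev mark_body s') (t + t' + 2)" if "t' \<le> size_com mark_body" for t'
        using that Inv r cell vQ Sm less nin i
        by (auto simp: Inv_def keeps_def mark_body_def block_get fun_eq_iff take_Suc_conv_app_nth)
    qed (simp add: mark_body_def)
    then show "wreg s' 15 < wreg s' 13 \<and> sim_com mark_body s' (return_pmf ()) (\<lambda>_ s'' t'. Inv (Suc i) s'' (t + t' + 2))"
      using r i by simp
  qed
  then have loop: "sim_com (WhileLess 15 13 mark_body) s1 (return_pmf ()) (\<lambda>_ s' t. \<exists>t'. t = t' + 2 \<and> Inv (length xs) s' t')"
    unfolding foldM_unit .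
  show ?thesis unfolding mark_com_def
  proof (rule sim_com_Seq_det)
    show "sim_com ?c s (return_pmf ()) (\<lambda>_ s' t. s' = s1 \<and> t \<le> 8)"
      by (rule sim_com_simple) (simp_all add: s1_def)
    fix s' and t :: nat assume st: "s' = s1 \<and> t \<le> 8"
    show "sim_com (WhileLess 15 13 mark_body) s' (return_pmf ()) (\<lambda>_ s' t'. keeps 11 13 s s' \<and> wmem s' = wmem s \<and>
     rmem s' = (\<lambda>v. rmem s v + (if \<not> h \<and> v \<in> set (L j) then 1 else 0)) \<and> t + t' \<le> 30 + 10 * length (L j))"
      unfolding conjunct1[OF st]
      by (rule sim_com_consequence[OF loop]) (use st s1 less in \<open>auto simp: Inv_def keeps_def xs_def fun_eq_iff\<close>)
  qed
qed

end

section \<open>Coin tosses of the candidates\<close>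

text \<open>Decodes the bias from the cell of a vertex: a value above 1 is a mark, removed to
  recover the similarity; otherwise register 11, which holds \<open>h\<close> as a real, switches
  \<open>1 - (1 - sim)\<^sup>2\<close> on or off. Clearing the cell first records the toss and
  restores zero memory without a separate pass.\<close>

definition sprinkle_prep :: com where
  "sprinkle_prep = Block [RStore 16 0, QPlusEdge 17 6 16] ;;
     IfRLess 1 13 (Block [RealOp RMinus 13 13 1, RealOp RPlus 14 1 0])
       (Block [RealOp RMinus 15 1 13, RealOp RTimes 15 15 15, RealOp RMinus 14 1 15, RealOp RTimes 14 14 11]) ;;
     IfLess 0 17 (IfRLess 13 4 (Block []) (Block [RealOp RPlus 14 1 0])) (Block [RealOp RPlus 14 13 0])"

definition sprinkle_com :: com where
  "sprinkle_com = sprinkle_prep ;; Draw (Flip 19 14) ;; IfLess 0 19 (Block [Store 16 10]) (Block [])"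

definition visit_body :: com where
  "visit_body = Block (get 16 12 15 @ [RLoad 13 16]) ;; IfRLess 0 13 sprinkle_com (Block []) ;; Block [WordOp WPlus 15 15 1]"

definition visit_com :: com where
  "visit_com = Block (get 11 7 9 @ [WordOp WPlus 12 11 1] @ get 13 12 5 @ [WordOp WPlus 15 0 0]) ;;
     WhileLess 15 13 visit_body ;; Block [WordOp WPlus 9 9 1]"

definition pass2_com :: com where
  "pass2_com = Block [WordOp WPlus 9 0 0] ;; WhileLess 9 8 visit_com"

context rounding_ram
begin

text \<open>The set component of \<open>z0\<close> is visible in real memory: exactly the pending
  candidates have nonzero cells.\<close>

definition pstate :: "nat \<Rightarrow> bool \<Rightarrow> nat \<Rightarrow> (nat \<Rightarrow> nat list) \<Rightarrow> real \<Rightarrow> real \<Rightarrow> (nat \<Rightarrow> nat) \<times> nat set \<Rightarrow> ram_state \<Rightarrow> bool" where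
  "pstate u h j L c a z0 s \<longleftrightarrow> fixed_regs s \<and> rep (wmem s) (fst z0) (rowsof L) \<and> wreg s 6 = u \<and> wreg s 7 = Suc (m + u) \<and>
     wreg s 8 = length (JL u) \<and> wreg s 10 = Suc u \<and> rreg s 9 = a \<and> rreg s 10 = c \<and> rreg s 11 = of_bool h \<and>
     rmem s = (\<lambda>v. if v \<in> snd z0 then sim u v + of_bool (\<not> h \<and> v \<in> A j) else 0) \<and> snd z0 \<subseteq> {v. v < n \<and> 0 < sim u v}"

lemma sim_sprinkle:
  assumes ps: "pstate u h j L c a (lab, P) s" and u: "u < n" and v: "v \<in> P" "wreg s 16 = v" "rreg s 13 = rmem s v"
  shows "sim_com sprinkle_com s (sprinkle (Suc u) (bias h j u) v (lab, P)) (\<lambda>z s' t. pstate u h j L c a z s' \<and>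
     (\<forall>r\<in>{9, 11, 12, 13, 15}. wreg s' r = wreg s r) \<and> t \<le> 30)"
proof -
  have vn: "v < n" "0 < sim u v" "sim u v \<le> 1" using ps v sim_le_1[OF u] by (auto simp: pstate_def)
  have mv: "rmem s v = sim u v + of_bool (\<not> h \<and> v \<in> A j)" using ps v by (simp add: pstate_def)
  define s1 where "s1 = ev sprinkle_prep s"
  have edge: "(of_bool (plus u v) :: nat) mod W = of_bool (plus u v)" using W_large(2) by simp
  have b: "rreg s1 14 = bias h j u v"
    using ps u v vn mv edge unfolding s1_def sprinkle_prep_def pstate_def fixed_regs_def
    by (cases "plus u v"; cases h; cases "v \<in> A j") (auto simp: bias_def plus_iff power2_eq_square)
  have keep: "wreg s1 r = wreg s r" if "r \<noteq> 17" for r using that by (simp add: s1_def sprinkle_prep_def)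
  have keepr: "rreg s1 r = rreg s r" if "r < 13" for r using that by (simp add: s1_def sprinkle_prep_def)
  have mem: "wmem s1 = wmem s" "rmem s1 = (rmem s)(v := 0)" using ps v by (simp_all add: s1_def sprinkle_prep_def pstate_def fixed_regs_def)
  have rm: "rmem s1 = (\<lambda>v'. if v' \<in> P - {v} then sim u v' + of_bool (\<not> h \<and> v' \<in> A j) else 0)"
    using ps by (auto simp: mem pstate_def fun_eq_iff)
  have Suc_u: "Suc u < Q" using n_less_Q(6)[OF u] .
  have rep: "rep (wmem s) lab (rowsof L)" using ps by (simp add: pstate_def)
  have fin: "pstate u h j L c a (if b then lab(v := Suc u) else lab, P - {v}) (ev (IfLess 0 19 (Block [Store 16 10]) (Block [])) (s1\<lparr>wreg := (wreg s1)(19 := of_bool b)\<rparr>))" for b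
    using ps rep_label[OF rep vn(1) Suc_u] rep rm by (auto simp: pstate_def fixed_regs_def keep keepr mem v)
  have "sim_com sprinkle_com s (map_pmf (\<lambda>b. (if b then lab(v := Suc u) else lab, P - {v})) (bernoulli_pmf (bias h j u v)))
    (\<lambda>z s' t. pstate u h j L c a z s' \<and> (\<forall>r\<in>{9, 11, 12, 13, 15}. wreg s' r = wreg s r) \<and> t \<le> 30)"
    unfolding sprinkle_com_def
  proof (rule sim_com_map, rule sim_com_Seq_det)
    show "sim_com sprinkle_prep s (return_pmf ()) (\<lambda>_ s' t. s' = s1 \<and> t \<le> 16)"
      by (rule sim_com_simple) (simp_all add: s1_def sprinkle_prep_def)
    fix s' and t :: nat assume "s' = s1 \<and> t \<le> 16"
    then have st: "s' = s1" "t \<le> 16" by simp_all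
    have "sim_com (Draw (Flip 19 14) ;; IfLess 0 19 (Block [Store 16 10]) (Block [])) s1 (bernoulli_pmf (bias h j u v) \<bind> return_pmf)
      (\<lambda>b s' t'. pstate u h j L c a (if b then lab(v := Suc u) else lab, P - {v}) s' \<and> (\<forall>r\<in>{9, 11, 12, 13, 15}. wreg s' r = wreg s r) \<and> t + t' \<le> 30)"
    proof (rule sim_com_Seq)
      show "sim_com (Draw (Flip 19 14)) s1 (bernoulli_pmf (bias h j u v)) (\<lambda>b s' t. s' = s1\<lparr>wreg := (wreg s1)(19 := of_bool b)\<rparr> \<and> t = 1)"
        using sim_com_Flip[of s1 14 _ 19] W_large(2) bias_range[OF u] unfolding b by simp
      fix b s' and t' :: nat assume *: "s' = s1\<lparr>wreg := (wreg s1)(19 := of_bool b)\<rparr> \<and> t' = 1"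
      show "sim_com (IfLess 0 19 (Block [Store 16 10]) (Block [])) s' (return_pmf b)
        (\<lambda>b s' t''. pstate u h j L c a (if b then lab(v := Suc u) else lab, P - {v}) s' \<and> (\<forall>r\<in>{9, 11, 12, 13, 15}. wreg s' r = wreg s r) \<and> t + (t' + t'') \<le> 30)"
        by (rule sim_com_simple) (use * fin[of b] st keep in auto)
    qed
    then show "sim_com (Draw (Flip 19 14) ;; IfLess 0 19 (Block [Store 16 10]) (Block [])) s' (bernoulli_pmf (bias h j u v))
      (\<lambda>b s' t'. pstate u h j L c a (if b then lab(v := Suc u) else lab, P - {v}) s' \<and> (\<forall>r\<in>{9, 11, 12, 13, 15}. wreg s' r = wreg s r) \<and> t + t' \<le> 30)"
      unfolding st by (simp only: bind_return_pmf')
  qed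
  then show ?thesis using v by simp
qed

lemma sim_visit:
  assumes ps: "pstate u h j L c a x0 s" and u: "u < n" and k: "wreg s 9 = k" "k < length (JL u)"
    and xs: "L (JL u ! k) = xs" "set xs \<subseteq> {..<n}"
  shows "sim_com visit_com s (foldM (sprinkle (Suc u) (bias h j u)) xs x0) (\<lambda>z s' t. pstate u h j L c a z s' \<and>
     wreg s' 9 = Suc k \<and> t \<le> 20 + 50 * length xs)"
proof -
  define i0 where "i0 = JL u ! k"
  have im: "i0 < m" using JL_nth[OF k(2)] by (simp add: i0_def)
  define row where "row r s' \<longleftrightarrow> wreg s' 9 = k \<and> wreg s' 12 = Suc i0 \<and> wreg s' 13 = length xs" for r :: nat and s' :: ram_state
  have rep: "rep (wmem s) (fst x0) (rowsof L)" using ps by (simp add: pstate_def)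
  note urow = rep_row[OF rep, of "Suc (m + u)", simplified, OF n_less_Q(8)[OF u]]
  have less: "i0 < Q" "Suc i0 < Q" "n + m < Q" "k < Q" "Suc (m + u) < Q" "Suc k \<le> Q"
    using n_less_Q(4,5,8,11) im u k(2) urow(3) by auto
  have e: "rowsof L (Suc i0) = xs" using im xs(1) by (simp add: i0_def)
  have rowrep: "length xs < Q \<and> M (cell (Suc i0) (n + m)) = length xs \<and> (\<forall>i<length xs. M (cell (Suc i0) i) = xs ! i)"
    if r: "rep M lab' (rowsof L)" for M lab'
    using rep_row(2)[OF r zero_less_Suc less(2)] rep_row(3)[OF r zero_less_Suc less(2)] rep_row(4)[OF r zero_less_Suc less(2)]
    unfolding e by blast
  have len: "length xs < Q" using rowrep[OF rep] by simp
  let ?B = "get 11 7 9 @ [WordOp WPlus 12 11 1] @ get 13 12 5 @ [WordOp WPlus 15 0 0]"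
  define s1 where "s1 = block ?B s"
  have cells: "wmem s (cell (Suc (m + u)) k) = i0" "wmem s (cell (Suc i0) (n + m)) = length xs"
    using urow(4)[OF k(2)] rowrep[OF rep] by (simp_all add: i0_def)
  have s1: "pstate u h j L c a x0 s1" "wreg s1 9 = k" "wreg s1 12 = Suc i0" "wreg s1 13 = length xs" "wreg s1 15 = 0"
    using ps k less cells len unfolding s1_def by (simp_all add: fixed_regs_def pstate_def block_get)
  have loop: "sim_com (WhileLess 15 13 visit_body) s1 (foldM (sprinkle (Suc u) (bias h j u)) xs x0)
    (\<lambda>z s' t. pstate u h j L c a z s' \<and> wreg s' 9 = k \<and> t \<le> 50 * length xs + 2)"
  proof (rule sim_com_for[where Inv = "\<lambda>i z s' t. pstate u h j L c a z s' \<and> row i s' \<and> wreg s' 15 = i \<and> t \<le> 50 * i"])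
    show "pstate u h j L c a x0 s1 \<and> row 0 s1 \<and> wreg s1 15 = 0 \<and> 0 \<le> 50 * (0::nat)" using s1 by (simp add: row_def)
    show "\<not> wreg s' 15 < wreg s' 13 \<and> pstate u h j L c a z s' \<and> wreg s' 9 = k \<and> t + 2 \<le> 50 * length xs + 2"
      if "pstate u h j L c a z s' \<and> row (length xs) s' \<and> wreg s' 15 = length xs \<and> t \<le> 50 * length xs" for z s' t
      using that by (simp add: row_def)
  next
    fix i z s' and t :: nat assume i: "i < length xs" and inv: "pstate u h j L c a z s' \<and> row i s' \<and> wreg s' 15 = i \<and> t \<le> 50 * i"
    obtain lab P where z: "z = (lab, P)" by (cases z)
    define v where "v = xs ! i"
    have vn: "v < n" using subsetD[OF xs(2) nth_mem[OF i]] by (simp add: v_def)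
    have rp: "rep (wmem s') lab (rowsof L)" using inv by (simp add: pstate_def z)
    have c1: "wmem s' (cell (Suc i0) i) = v" using rowrep[OF rp] i by (simp add: v_def)
    have l: "v < Q" "i < Q" "Suc i mod W = Suc i" using n_less_Q(3)[OF vn] i len less_W by simp_all
    let ?B1 = "get 16 12 15 @ [RLoad 13 16]"
    define s2 where "s2 = block ?B1 s'"
    have s2: "pstate u h j L c a (lab, P) s2" "row i s2" "wreg s2 15 = i" "wreg s2 16 = v" "rreg s2 13 = rmem s2 v" "wreg s2 0 = 0" "wreg s2 1 = 1"
      "rreg s2 0 = 0"
      using inv c1 l less unfolding s2_def by (simp_all add: fixed_regs_def pstate_def block_get row_def z)
    have "sim_com visit_body s' (sprinkle (Suc u) (bias h j u) v z)
       (\<lambda>y s'' t'. pstate u h j L c a y s'' \<and> row (Suc i) s'' \<and> wreg s'' 15 = Suc i \<and> t + t' + 2 \<le> 50 * Suc i)"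
      unfolding visit_body_def
    proof (rule sim_com_Seq_det)
      show "sim_com (Block ?B1) s' (return_pmf ()) (\<lambda>_ s' t. s' = s2 \<and> t = 4)"
        by (rule sim_com_Block) (simp_all add: s2_def)
      fix s3 and t1 :: nat assume "s3 = s2 \<and> t1 = 4"
      then have st: "s3 = s2" "t1 = 4" by simp_all
      have "sim_com (IfRLess 0 13 sprinkle_com (Block []) ;; Block [WordOp WPlus 15 15 1]) s2 (sprinkle (Suc u) (bias h j u) v (lab, P) \<bind> return_pmf)
         (\<lambda>y s'' t'. pstate u h j L c a y s'' \<and> row (Suc i) s'' \<and> wreg s'' 15 = Suc i \<and> t + (t1 + t') + 2 \<le> 50 * Suc i)"
      proof (rule sim_com_Seq)
        show "sim_com (IfRLess 0 13 sprinkle_com (Block [])) s2 (sprinkle (Suc u) (bias h j u) v (lab, P))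
          (\<lambda>y s'' t'. pstate u h j L c a y s'' \<and> row i s'' \<and> wreg s'' 15 = i \<and> t' \<le> 32)"
        proof (rule sim_com_IfRLess)
          assume "rreg s2 0 < rreg s2 13"
          then have "v \<in> P" using s2 by (auto simp: pstate_def split: if_splits)
          from sim_sprinkle[OF s2(1) u this s2(4,5)]
          show "sim_com sprinkle_com s2 (sprinkle (Suc u) (bias h j u) v (lab, P)) (\<lambda>y s'' t'. pstate u h j L c a y s'' \<and> row i s'' \<and> wreg s'' 15 = i \<and> t' + 1 \<le> 32)"
            by (rule sim_com_consequence) (use s2 in \<open>auto simp: row_def\<close>)
        next
          \<comment> \<open>A pending vertex has positive similarity and hence a positive cell, so a
            zero cell means that nothing is to be done.\<close>
          assume "\<not> rreg s2 0 < rreg s2 13"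
          moreover have "rmem s2 v = (if v \<in> P then sim u v + of_bool (\<not> h \<and> v \<in> A j) else 0)" "v \<in> P \<Longrightarrow> 0 < sim u v"
            using s2(1) by (auto simp: pstate_def)
          ultimately have "v \<notin> P" using s2(5,8) by (auto simp: add_pos_nonneg)
          then have "sprinkle (Suc u) (bias h j u) v (lab, P) = return_pmf (lab, P)" by simp
          then show "sim_com (Block []) s2 (sprinkle (Suc u) (bias h j u) v (lab, P)) (\<lambda>y s'' t'. pstate u h j L c a y s'' \<and> row i s'' \<and> wreg s'' 15 = i \<and> t' + 2 \<le> 32)"
            using s2 by (auto intro!: sim_com_Block)
        qed
        fix y s'' and t' :: nat assume y: "pstate u h j L c a y s'' \<and> row i s'' \<and> wreg s'' 15 = i \<and> t' \<le> 32"
        show "sim_com (Block [WordOp WPlus 15 15 1]) s'' (return_pmf y) (\<lambda>y s'' t''. pstate u h j L c a y s'' \<and> row (Suc i) s'' \<and> wreg s'' 15 = Suc i \<and> t + (t1 + (t' + t'')) + 2 \<le> 50 * Suc i)"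
          by (rule sim_com_Block) (use y l inv st in \<open>auto simp: pstate_def fixed_regs_def row_def\<close>)
      qed
      then show "sim_com (IfRLess 0 13 sprinkle_com (Block []) ;; Block [WordOp WPlus 15 15 1]) s3 (sprinkle (Suc u) (bias h j u) v z)
         (\<lambda>y s'' t'. pstate u h j L c a y s'' \<and> row (Suc i) s'' \<and> wreg s'' 15 = Suc i \<and> t + (t1 + t') + 2 \<le> 50 * Suc i)"
        unfolding st(1) z by (simp only: bind_return_pmf')
    qed
    then show "wreg s' 15 < wreg s' 13 \<and> sim_com visit_body s' (sprinkle (Suc u) (bias h j u) (xs ! i) z)
       (\<lambda>y s'' t'. pstate u h j L c a y s'' \<and> row (Suc i) s'' \<and> wreg s'' 15 = Suc i \<and> t + t' + 2 \<le> 50 * Suc i)"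
      using inv i by (simp add: row_def v_def)
  qed
  show ?thesis unfolding visit_com_def
  proof (rule sim_com_Seq_det)
    show "sim_com (Block ?B) s (return_pmf ()) (\<lambda>_ s' t. s' = s1 \<and> t = 8)"
      by (rule sim_com_Block) (simp_all add: s1_def)
    fix s3 and t1 :: nat assume "s3 = s1 \<and> t1 = 8"
    then have st: "s3 = s1" "t1 = 8" by simp_all
    have "sim_com (WhileLess 15 13 visit_body ;; Block [WordOp WPlus 9 9 1]) s1 (foldM (sprinkle (Suc u) (bias h j u)) xs x0 \<bind> return_pmf)
      (\<lambda>z s' t. pstate u h j L c a z s' \<and> wreg s' 9 = Suc k \<and> t1 + t \<le> 20 + 50 * length xs)"
      by (rule sim_com_Seq[OF loop], rule sim_com_Block)
        (use st less_W(2)[OF less(6)] in \<open>auto simp: pstate_def fixed_regs_def\<close>)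
    then show "sim_com (WhileLess 15 13 visit_body ;; Block [WordOp WPlus 9 9 1]) s3 (foldM (sprinkle (Suc u) (bias h j u)) xs x0)
      (\<lambda>z s' t. pstate u h j L c a z s' \<and> wreg s' 9 = Suc k \<and> t1 + t \<le> 20 + 50 * length xs)"
      unfolding st by (simp only: bind_return_pmf')
  qed
qed

lemma sim_pass2:
  assumes ps: "pstate u h j L c a x0 s" and u: "u < n" and L: "\<And>j. j < m \<Longrightarrow> set (L j) \<subseteq> {..<n}"
  shows "sim_com pass2_com s (foldM (sprinkle (Suc u) (bias h j u)) (concat (map L (JL u))) x0) (\<lambda>z s' t. pstate u h j L c a z s' \<and>
     t \<le> 10 + 30 * length (JL u) + 50 * (\<Sum>j\<in>J u. length (L j)))"
proof -
  let ?F = "\<lambda>k. foldM (sprinkle (Suc u) (bias h j u)) (L k)"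
  define P where "P k = set (take k (JL u))" for k
  have PJ: "P (length (JL u)) = J u" by (simp add: P_def set_JL)
  show ?thesis unfolding pass2_com_def foldM_concat foldM_map
  proof (rule sim_com_Seq_det)
    show "sim_com (Block [WordOp WPlus 9 0 0]) s (return_pmf ()) (\<lambda>_ s' t. pstate u h j L c a x0 s' \<and> wreg s' 9 = 0 \<and> t = 1)"
      by (rule sim_com_Block) (use ps in \<open>auto simp: pstate_def fixed_regs_def\<close>)
    fix s1 and t1 :: nat assume s1: "pstate u h j L c a x0 s1 \<and> wreg s1 9 = 0 \<and> t1 = 1"
    show "sim_com (WhileLess 9 8 visit_com) s1 (foldM ?F (JL u) x0) (\<lambda>z s' t. pstate u h j L c a z s' \<and>
       t1 + t \<le> 10 + 30 * length (JL u) + 50 * (\<Sum>j\<in>J u. length (L j)))"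
    proof (rule sim_com_for[where Inv = "\<lambda>k z s' t. pstate u h j L c a z s' \<and> wreg s' 9 = k \<and> t \<le> 30 * k + 50 * (\<Sum>j\<in>P k. length (L j))"])
      show "pstate u h j L c a x0 s1 \<and> wreg s1 9 = 0 \<and> 0 \<le> 30 * 0 + 50 * (\<Sum>j\<in>P 0. length (L j))" using s1 by simp
      show "\<not> wreg s' 9 < wreg s' 8 \<and> pstate u h j L c a z s' \<and> t1 + (t + 2) \<le> 10 + 30 * length (JL u) + 50 * (\<Sum>j\<in>J u. length (L j))"
        if "pstate u h j L c a z s' \<and> wreg s' 9 = length (JL u) \<and> t \<le> 30 * length (JL u) + 50 * (\<Sum>j\<in>P (length (JL u)). length (L j))" for z s' t
        using that s1 by (auto simp: PJ pstate_def)
    next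
      fix k z s' and t :: nat assume k: "k < length (JL u)" and inv: "pstate u h j L c a z s' \<and> wreg s' 9 = k \<and> t \<le> 30 * k + 50 * (\<Sum>j\<in>P k. length (L j))"
      have jP: "JL u ! k \<notin> P k" "P (Suc k) = insert (JL u ! k) (P k)" "finite (P k)"
        using distinct_nth_take[OF distinct_JL k] k by (auto simp: P_def take_Suc_conv_app_nth)
      have "sim_com visit_com s' (?F (JL u ! k) z) (\<lambda>z s'' t'. pstate u h j L c a z s'' \<and> wreg s'' 9 = Suc k \<and> t' \<le> 20 + 50 * length (L (JL u ! k)))"
        by (rule sim_visit) (use inv u k L[OF JL_nth[OF k]] in auto)
      then have "sim_com visit_com s' (?F (JL u ! k) z) (\<lambda>y s'' t'. pstate u h j L c a y s'' \<and> wreg s'' 9 = Suc k \<and>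
          t + t' + 2 \<le> 30 * Suc k + 50 * (\<Sum>j\<in>P (Suc k). length (L j)))"
        by (rule sim_com_consequence) (use inv jP in auto)
      then show "wreg s' 9 < wreg s' 8 \<and> sim_com visit_com s' (?F (JL u ! k) z) (\<lambda>y s'' t'. pstate u h j L c a y s'' \<and> wreg s'' 9 = Suc k \<and>
          t + t' + 2 \<le> 30 * Suc k + 50 * (\<Sum>j\<in>P (Suc k). length (L j)))"
        using inv k by (simp add: pstate_def)
    qed
  qed
qed

end

section \<open>Pivots, trials, hits and the sweep on the machine\<close>

definition pivot_com :: com where
  "pivot_com = Block ([WordOp WPlus 7 6 3, WordOp WPlus 7 7 1, WordOp WPlus 10 6 1] @ get 8 7 5) ;;
     Draw (Flip 22 3) ;; Block [RealOfWord 11 22] ;; pick_com ;; pass1_com ;; mark_com ;; pass2_com"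

definition trial_com :: com where
  "trial_com = Draw (RandWord 6 2) ;; Block [Load 17 6] ;;
     IfLess 0 17 (Block []) (IfRLess 10 7 pivot_com (Block [])) ;; Block [RealOp RPlus 9 9 1]"

definition hit_com :: com where
  "hit_com = Draw (RandWord 11 3) ;; Block [QSetValue 12 11] ;; Draw (Flip 19 12) ;;
     IfLess 0 19 absorb_com (Block []) ;; Block [RealOp RPlus 9 9 1]"

definition finish_com :: com where
  "finish_com = Block [WordOp WPlus 20 0 0] ;;
     WhileLess 20 3 (Block [WordOp WPlus 11 20 0] ;; absorb_com ;; Block [WordOp WPlus 20 20 1])"

text \<open>The machine tosses only for live vertices it meets in the lists; all other live vertices
  have bias 0 and change nothing in the product distribution.\<close>

lemma Pi_bernoulli_restrict:
  assumes "finite V" "P \<subseteq> V" "\<And>v. v \<in> V - P \<Longrightarrow> p v = 0"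
  shows "Pi_pmf P False (\<lambda>v. bernoulli_pmf (p v)) = Pi_pmf V False (\<lambda>v. bernoulli_pmf (p v))"
proof -
  have "Pi_pmf P False (\<lambda>v. bernoulli_pmf (p v)) = map_pmf (\<lambda>f v. if v \<in> P then f v else False) (Pi_pmf V False (\<lambda>v. bernoulli_pmf (p v)))"
    by (rule Pi_pmf_subset) (use assms in auto)
  also have "\<dots> = map_pmf (\<lambda>f. f) (Pi_pmf V False (\<lambda>v. bernoulli_pmf (p v)))"
  proof (rule map_pmf_cong[OF refl])
    fix f assume f: "f \<in> set_pmf (Pi_pmf V False (\<lambda>v. bernoulli_pmf (p v)))"
    have "\<not> f v" if "v \<notin> P" for v
    proof (cases "v \<in> V")
      case True
      then have "f v \<in> set_pmf (bernoulli_pmf (p v))" using f assms(1) by (auto simp: set_Pi_pmf PiE_dflt_def)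
      then show ?thesis using assms(3)[of v] True that by (auto simp: set_pmf_iff)
    qed (use f assms(1) in \<open>auto simp: set_Pi_pmf PiE_dflt_def\<close>)
    then show "(\<lambda>v. if v \<in> P then f v else False) = f" by (auto simp: fun_eq_iff)
  qed
  finally show ?thesis by simp
qed

context rounding_ram
begin

text \<open>Real memory is zero between steps, so that the next pivot can accumulate similarities at
  once.\<close>

definition mstate :: "round_state \<Rightarrow> ram_state \<Rightarrow> bool" where
  "mstate z0 s \<longleftrightarrow> fixed_regs s \<and> rep (wmem s) (fst z0) (rowsof (fst (snd z0))) \<and> rmem s = (\<lambda>_. 0) \<and> rreg s 10 = snd (snd z0)"

lemma inv_lists: "inv (lab, L, c) \<Longrightarrow> j < m \<Longrightarrow> distinct (L j) \<and> set (L j) \<subseteq> {..<n}"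
  using A_subset[of j] by (auto simp: inv_def)

lemma inv_live: "inv (lab, L, c) \<Longrightarrow> j < m \<Longrightarrow> set (alive lab (L j)) = A j \<inter> live lab"
  using A_subset[of j] by (auto simp: inv_def live_def)

lemma sim_touched:
  assumes "inv (lab, L, c)" "v \<in> live lab"
  shows "(\<Sum>j\<in>J u. if v \<in> set (alive lab (L j)) then w j else 0) = sim u v"
proof -
  have "(\<Sum>j\<in>J u. if v \<in> set (alive lab (L j)) then w j else 0) = (\<Sum>j\<in>J u. w j * of_bool (v \<in> A j))"
    by (rule sum.cong[OF refl]) (use inv_live[OF assms(1)] assms(2) in \<open>auto simp: J_def\<close>)
  then show ?thesis by (simp add: sim_eq)
qed

text \<open>The set is picked before the lists are scanned, as is the coin for the mode; both are
  independent of the state, and after \<open>pass1_com\<close> the marks can be placed directly on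
  the similarities.\<close>

lemma sim_pivot:
  assumes s: "mstate (lab, L, c) s" "wreg s 6 = u" and inv: "inv (lab, L, c)" and u: "u < n" "lab u = 0"
  shows "sim_com pivot_com s (pivot u (lab, L, c)) (\<lambda>z s' t. mstate z s' \<and> rreg s' 9 = rreg s 9 \<and>
     t \<le> 200 + 100 * length (JL u) + 100 * (\<Sum>j\<in>J u. length (L j)))"
proof -
  let ?L = "\<lambda>j. if j \<in> J u then alive lab (L j) else L j" and ?c = "c + (\<Sum>j\<in>J u. real (length (L j)))"
  let ?T = "200 + 100 * length (JL u) + 100 * (\<Sum>j\<in>J u. length (L j))"
  \<comment> \<open>The candidates: live vertices that share a set with the pivot.\<close>
  define P where "P = {v \<in> live lab. 0 < sim u v}"
  define out where "out B = (\<lambda>v. if v < n \<and> lab v = 0 \<and> B v then Suc u else lab v, ?L, ?c)" for B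
  define post where "post B s' \<longleftrightarrow> mstate (out B) s' \<and> rreg s' 9 = rreg s 9" for B s'
  have fs: "fixed_regs s" and rep: "rep (wmem s) lab (rowsof L)" and rm: "rmem s = (\<lambda>_. 0)" and c: "rreg s 10 = c"
    using s by (simp_all add: mstate_def)
  note urow = rep_row[OF rep, of "Suc (m + u)", simplified, OF n_less_Q(8)[OF u(1)]]
  have less: "u < Q" "Suc u < Q" "m + u < Q" "u + m < Q" "Suc (m + u) < Q" "Suc (u + m) < Q" "n + m < Q" "length (JL u) < Q"
    using n_less_Q(3,6,7,8,11) u(1) urow(3) by (auto simp: add.commute)
  have J: "set (JL u) \<noteq> {}" "finite (J u)" using J_nonempty[OF u(1)] by (simp_all add: set_JL)
  then have JLne: "JL u \<noteq> []" by auto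
  \<comment> \<open>Stale entries contribute nothing, as the scan adds weight only to live
    vertices.\<close>
  have touched: "(\<Sum>j\<in>J u. if v \<in> set (alive lab (L j)) then w j else 0) = (if v \<in> P then sim u v else 0)" for v
  proof (cases "v \<in> live lab")
    case True then show ?thesis using sim_touched[OF inv True, of u] sim_nonneg[of u v] by (auto simp: P_def)
  next
    case False
    have "v \<notin> set (alive lab (L j))" if "j \<in> J u" for j using False inv_live[OF inv, of j] that by (auto simp: J_def)
    then show ?thesis using False by (auto simp: P_def intro!: sum.neutral)
  qed
  have finP: "finite P" by (simp add: P_def)
  have Psub: "P \<subseteq> set (concat (map ?L (JL u)))"
  proof
    fix v assume v: "v \<in> P"
    have "\<exists>j\<in>J u. v \<in> set (alive lab (L j))"
    proof (rule ccontr)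
      assume no: "\<not> (\<exists>j\<in>J u. v \<in> set (alive lab (L j)))"
      have "(if v \<in> P then sim u v else 0) = 0" unfolding touched[symmetric] by (rule sum.neutral) (use no in auto)
      then show False using v by (auto simp: P_def)
    qed
    then show "v \<in> set (concat (map ?L (JL u)))" by (auto simp: set_JL)
  qed
  \<comment> \<open>Zero similarity means that no set of the pivot contains the vertex, since all
    weights are positive; every branch of \<open>bias\<close> then gives 0.\<close>
  have bz: "bias h j u v = 0" if "v \<in> live lab - P" "j \<in> J u" for h j v
  proof -
    have z: "sim u v = 0" using that sim_nonneg[of u v] by (auto simp: P_def)
    have "v \<notin> A j"
    proof
      assume "v \<in> A j"
      then have "w j \<le> sim u v" unfolding sim_def using that(2) by (intro member_le_sum) (auto simp: J_def intro: less_imp_le w_pos)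
      then show False using z w_pos[of j] that(2) by (auto simp: J_def)
    qed
    then show ?thesis using z by (simp add: bias_def)
  qed
  have final: "map_pmf (\<lambda>B. (\<lambda>v. if v \<in> P \<and> B v then Suc u else lab v, {} :: nat set)) (Pi_pmf P False (\<lambda>v. bernoulli_pmf (bias h j u v)))
      = map_pmf (\<lambda>B. (fst (out B), {} :: nat set)) (Pi_pmf (live lab) False (\<lambda>v. bernoulli_pmf (bias h j u v)))" if j: "j \<in> J u" for h j
  proof -
    have sub: "P \<subseteq> live lab" by (auto simp: P_def)
    have *: "Pi_pmf P False (\<lambda>v. bernoulli_pmf (bias h j u v)) = Pi_pmf (live lab) False (\<lambda>v. bernoulli_pmf (bias h j u v))"
      by (rule Pi_bernoulli_restrict[OF finite_live sub]) (rule bz[OF _ j])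
    have supp: "\<not> B v" if "B \<in> set_pmf (Pi_pmf P False (\<lambda>v. bernoulli_pmf (bias h j u v)))" "v \<notin> P" for B v
      using that finite_subset[OF sub finite_live] by (auto simp: set_Pi_pmf PiE_dflt_def)
    show ?thesis unfolding *[symmetric]
      by (rule map_pmf_cong[OF refl]) (use supp sub in \<open>auto simp: out_def fun_eq_iff live_def\<close>)
  qed
  let ?B = "[WordOp WPlus 7 6 3, WordOp WPlus 7 7 1, WordOp WPlus 10 6 1] @ get 8 7 5"
  define s1 where "s1 = block ?B s"
  define base where "base s' \<longleftrightarrow> fixed_regs s' \<and> wreg s' 6 = u \<and> wreg s' 7 = Suc (m + u) \<and> wreg s' 8 = length (JL u) \<and> wreg s' 10 = Suc u \<and>
     rreg s' 9 = rreg s 9" for s'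
  define start where "start s' \<longleftrightarrow> base s' \<and> wmem s' = wmem s \<and> rmem s' = (\<lambda>_. 0) \<and> rreg s' 10 = c" for s'
  have s1: "start s1"
    using s(2) fs rm c less urow(2) unfolding s1_def by (simp_all add: start_def base_def fixed_regs_def block_get add.commute)
  have mapT: "sim_com c1 s' D (\<lambda>B s'' t'. post B s'' \<and> t + t' \<le> ?T) \<Longrightarrow>
     sim_com c1 s' (map_pmf out D) (\<lambda>z s'' t'. mstate z s'' \<and> rreg s'' 9 = rreg s 9 \<and> t + t' \<le> ?T)" for c1 s' D t
    by (rule sim_com_map) (simp add: post_def)
  have rest: "sim_com (pass1_com ;; mark_com ;; pass2_com) s' (map_pmf (\<lambda>B. (fst (out B), {} :: nat set)) (Pi_pmf (live lab) False (\<lambda>v. bernoulli_pmf (bias h j u v))))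
     (\<lambda>z s'' t. snd z = {} \<and> mstate (fst z, ?L, ?c) s'' \<and> rreg s'' 9 = rreg s 9 \<and> t \<le> 100 + 70 * length (JL u) + 76 * (\<Sum>j\<in>J u. length (L j)))"
    if s': "start s'" "rreg s' 11 = of_bool h" "wreg s' 21 = j" and j: "j \<in> J u" for s' h j
  proof -
    have jm: "j < m" using j by (simp add: J_def)
    have leL: "length (?L i) \<le> length (L i)" for i by simp
    have lj: "length (?L j) \<le> (\<Sum>j\<in>J u. length (L j))"
      using member_le_sum[OF j, of "\<lambda>j. length (L j)"] J(2) leL[of j] by simp
    have lists: "distinct (?L i) \<and> set (?L i) \<subseteq> {..<n}" if "i < m" for i using inv_lists[OF inv that] by auto
    show ?thesis
    proof (rule sim_com_Seq_det[OF sim_pass1[of s' lab L u]])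
      show "fixed_regs s'" "rep (wmem s') lab (rowsof L)" "u < n" "wreg s' 7 = Suc (m + u)" "wreg s' 8 = length (JL u)"
        using s' rep u by (simp_all add: start_def base_def)
      show "distinct (L i) \<and> set (L i) \<subseteq> {..<n}" if "i < m" for i by (rule inv_lists[OF inv that])
      fix s2 t2 assume "keeps 9 10 s' s2 \<and> wreg s2 10 = wreg s' 10 \<and> rreg s2 11 = rreg s' 11 \<and>
         rreg s2 10 = rreg s' 10 + (\<Sum>j\<in>J u. real (length (L j))) \<and> rep (wmem s2) lab (rowsof ?L) \<and>
         rmem s2 = (\<lambda>v. rmem s' v + (\<Sum>j\<in>J u. if v \<in> set (alive lab (L j)) then w j else 0)) \<and>
         t2 \<le> 10 + 40 * length (JL u) + 16 * (\<Sum>j\<in>J u. length (L j))"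
      then have s2: "keeps 9 10 s' s2" "wreg s2 10 = Suc u" "rreg s2 11 = of_bool h" "rreg s2 10 = ?c" "rep (wmem s2) lab (rowsof ?L)"
        "rmem s2 = (\<lambda>v. if v \<in> P then sim u v else 0)" "t2 \<le> 10 + 40 * length (JL u) + 16 * (\<Sum>j\<in>J u. length (L j))"
        using s' unfolding touched by (auto simp: start_def base_def)
      have base2: "base s2" "wreg s2 21 = j" using s2(1,2) s' by (auto simp: keeps_def base_def start_def fixed_regs_def)
      show "sim_com (mark_com ;; pass2_com) s2 (map_pmf (\<lambda>B. (fst (out B), {} :: nat set)) (Pi_pmf (live lab) False (\<lambda>v. bernoulli_pmf (bias h j u v))))
       (\<lambda>z s'' t. snd z = {} \<and> mstate (fst z, ?L, ?c) s'' \<and> rreg s'' 9 = rreg s 9 \<and> t2 + t \<le> 100 + 70 * length (JL u) + 76 * (\<Sum>j\<in>J u. length (L j)))"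
      proof (rule sim_com_Seq_det[OF sim_mark[of s2 lab ?L j h]])
        show "fixed_regs s2" using base2 by (simp add: base_def)
        show "rep (wmem s2) lab (rowsof ?L)" "wreg s2 21 = j" "j < m" "rreg s2 11 = of_bool h" "distinct (?L j)" "set (?L j) \<subseteq> {..<n}"
          using s2 base2 jm lists[OF jm] by auto
        fix s3 t3 assume a3: "keeps 11 13 s2 s3 \<and> wmem s3 = wmem s2 \<and>
          rmem s3 = (\<lambda>v. rmem s2 v + (if \<not> h \<and> v \<in> set (?L j) then 1 else 0)) \<and> t3 \<le> 30 + 10 * length (?L j)"
        \<comment> \<open>The purged list of the chosen set consists of candidates, as each of them
          shares this very set with the pivot.\<close>
        have inL: "v \<in> set (?L j) \<longleftrightarrow> v \<in> P \<and> v \<in> A j" for v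
        proof -
          have "v \<in> P" if "v \<in> A j" "v \<in> live lab"
          proof -
            have "w j \<le> sim u v" unfolding sim_def using that(1) j by (intro member_le_sum) (auto simp: J_def intro: less_imp_le w_pos)
            then show ?thesis using w_pos[OF jm] that(2) by (simp add: P_def)
          qed
          then show ?thesis using inv_live[OF inv jm] j by (auto simp: P_def)
        qed
        have rm3: "rmem s3 = (\<lambda>v. if v \<in> P then sim u v + of_bool (\<not> h \<and> v \<in> A j) else 0)"
          using a3 unfolding inL s2(6) by (auto simp: fun_eq_iff)
        have "pstate u h j ?L ?c (rreg s 9) (lab, P) s3"
          using a3 s2 base2 rm3 unfolding pstate_def base_def keeps_def fixed_regs_def
          by (auto simp: P_def live_def)
        from sim_pass2[OF this u(1)] lists
        have "sim_com pass2_com s3 (foldM (sprinkle (Suc u) (bias h j u)) (concat (map ?L (JL u))) (lab, P)) (\<lambda>z s' t. pstate u h j ?L ?c (rreg s 9) z s' \<and>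
          t \<le> 10 + 30 * length (JL u) + 50 * (\<Sum>j\<in>J u. length (?L j)))" by blast
        moreover have "foldM (sprinkle (Suc u) (bias h j u)) (concat (map ?L (JL u))) (lab, P) =
          map_pmf (\<lambda>B. (fst (out B), {} :: nat set)) (Pi_pmf (live lab) False (\<lambda>v. bernoulli_pmf (bias h j u v)))"
          unfolding foldM_sprinkle[OF finP Psub]
          by (rule final[OF j])
        ultimately have "sim_com pass2_com s3 (map_pmf (\<lambda>B. (fst (out B), {} :: nat set)) (Pi_pmf (live lab) False (\<lambda>v. bernoulli_pmf (bias h j u v)))) (\<lambda>z s' t. pstate u h j ?L ?c (rreg s 9) z s' \<and>
          t \<le> 10 + 30 * length (JL u) + 50 * (\<Sum>j\<in>J u. length (?L j)))" by (simp only:)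
        then show "sim_com pass2_com s3 (map_pmf (\<lambda>B. (fst (out B), {} :: nat set)) (Pi_pmf (live lab) False (\<lambda>v. bernoulli_pmf (bias h j u v))))
         (\<lambda>z s'' t. snd z = {} \<and> mstate (fst z, ?L, ?c) s'' \<and> rreg s'' 9 = rreg s 9 \<and> t2 + (t3 + t) \<le> 100 + 70 * length (JL u) + 76 * (\<Sum>j\<in>J u. length (L j)))"
        proof (rule sim_com_consequence)
          fix z s4 t4 assume z: "z \<in> set_pmf (map_pmf (\<lambda>B. (fst (out B), {} :: nat set)) (Pi_pmf (live lab) False (\<lambda>v. bernoulli_pmf (bias h j u v))))"
            and p: "pstate u h j ?L ?c (rreg s 9) z s4 \<and> t4 \<le> 10 + 30 * length (JL u) + 50 * (\<Sum>j\<in>J u. length (?L j))"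
          have zz: "snd z = {}" using z by auto
          have "(\<Sum>j\<in>J u. length (?L j)) \<le> (\<Sum>j\<in>J u. length (L j))" by (rule sum_mono) (rule leL)
          then have "t2 + (t3 + t4) \<le> 100 + 70 * length (JL u) + 76 * (\<Sum>j\<in>J u. length (L j))" using p a3 s2(7) lj by linarith
          then show "snd z = {} \<and> mstate (fst z, ?L, ?c) s4 \<and> rreg s4 9 = rreg s 9 \<and> t2 + (t3 + t4) \<le> 100 + 70 * length (JL u) + 76 * (\<Sum>j\<in>J u. length (L j))"
            using p zz by (simp add: pstate_def mstate_def)
        qed
      qed
    qed
  qed
  define K where "K h j = map_pmf (\<lambda>B. (fst (out B), {} :: nat set)) (Pi_pmf (live lab) False (\<lambda>v. bernoulli_pmf (bias h j u v)))" for h j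
  have pick: "sim_com pick_com s' (pick_pmf w (JL u) 1) (\<lambda>j s'' t. start s'' \<and> rreg s'' 11 = rreg s' 11 \<and> wreg s'' 21 = j \<and> t \<le> 10 + 20 * length (JL u))"
    if s': "start s'" for s'
    unfolding pick_com_def
  proof (rule sim_com_Seq_det)
    let ?P = "[WordOp WPlus 18 8 0, WordOp WPlus 17 0 0, RealOp RPlus 16 1 0]"
    show "sim_com (Block ?P) s' (return_pmf ()) (\<lambda>_ s'' t. s'' = block ?P s' \<and> t = 3)" by (rule sim_com_Block) simp_all
    fix s2 and t2 :: nat assume "s2 = block ?P s' \<and> t2 = 3"
    then have s2: "start s2" "rreg s2 11 = rreg s' 11" "wreg s2 17 = 0" "wreg s2 18 = length (JL u)" "rreg s2 16 = 1" "t2 = 3"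
      using s' less(8) by (auto simp: start_def base_def fixed_regs_def)
    have "sim_com (WhileLess 17 18 pick_body) s2 (pick_pmf w (drop 0 (JL u)) (rreg s2 16)) (\<lambda>j s' t. keeps 11 12 s2 s' \<and>
       wmem s' = wmem s2 \<and> rmem s' = rmem s2 \<and> wreg s' 17 < length (JL u) \<and> JL u ! wreg s' 17 = j \<and> t \<le> 20 * (length (JL u) - 0) + 2)"
      by (rule sim_pick_loop[where R = "rowsof L" and lab = lab])
        (use s2 rep u J sum_J[OF u(1)] in \<open>auto simp: start_def base_def sum_list_JL\<close>)
    then have loop: "sim_com (WhileLess 17 18 pick_body) s2 (pick_pmf w (JL u) 1) (\<lambda>j s' t. keeps 11 12 s2 s' \<and>
       wmem s' = wmem s2 \<and> rmem s' = rmem s2 \<and> wreg s' 17 < length (JL u) \<and> JL u ! wreg s' 17 = j \<and> t \<le> 20 * length (JL u) + 2)"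
      by (simp add: s2(5))
    have "sim_com (WhileLess 17 18 pick_body ;; Block (get 21 7 17)) s2 (pick_pmf w (JL u) 1 \<bind> return_pmf)
      (\<lambda>j s'' t. start s'' \<and> rreg s'' 11 = rreg s' 11 \<and> wreg s'' 21 = j \<and> t2 + t \<le> 10 + 20 * length (JL u))"
    proof (rule sim_com_Seq[OF loop], rule sim_com_Block)
      fix j s3 t3 assume a: "keeps 11 12 s2 s3 \<and> wmem s3 = wmem s2 \<and> rmem s3 = rmem s2 \<and> wreg s3 17 < length (JL u) \<and> JL u ! wreg s3 17 = j \<and> t3 \<le> 20 * length (JL u) + 2"
      have st3: "start s3" "rreg s3 11 = rreg s' 11" using a s2 by (auto simp: start_def base_def keeps_def fixed_regs_def)
      have "j < m" using JL_nth a by blast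
      then have jQ: "j < Q" by (rule n_less_Q(4))
      have "wmem s3 (cell (Suc (m + u)) (wreg s3 17)) = j" using urow(4) a s2 by (simp add: start_def)
      then have "block (get 21 7 17) s3 = s3\<lparr>wreg := (wreg s3)(14 := cell (Suc (m + u)) (wreg s3 17), 21 := j)\<rparr>"
        using st3 a less jQ by (subst block_get(2)) (auto simp: start_def base_def fixed_regs_def)
      then show "start (block (get 21 7 17) s3) \<and> rreg (block (get 21 7 17) s3) 11 = rreg s' 11 \<and> wreg (block (get 21 7 17) s3) 21 = j \<and>
        t2 + (t3 + length (get 21 7 17)) \<le> 10 + 20 * length (JL u)"
        using st3 a s2(6) by (simp add: start_def base_def fixed_regs_def)
    qed simp
    then show "sim_com (WhileLess 17 18 pick_body ;; Block (get 21 7 17)) s2 (pick_pmf w (JL u) 1)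
      (\<lambda>j s'' t. start s'' \<and> rreg s'' 11 = rreg s' 11 \<and> wreg s'' 21 = j \<and> t2 + t \<le> 10 + 20 * length (JL u))"
      by (simp only: bind_return_pmf')
  qed
  have "sim_com pivot_com s (bernoulli_pmf (3/10) \<bind> (\<lambda>h. pick_pmf w (JL u) 1 \<bind> K h))
    (\<lambda>z s'' t. mstate (fst z, ?L, ?c) s'' \<and> rreg s'' 9 = rreg s 9 \<and> t \<le> ?T)"
    unfolding pivot_com_def
  proof (rule sim_com_Seq_det)
    show "sim_com (Block ?B) s (return_pmf ()) (\<lambda>_ s' t. s' = s1 \<and> t = 6)" by (rule sim_com_Block) (simp_all add: s1_def)
    fix s2 and t2 :: nat assume "s2 = s1 \<and> t2 = 6"
    then have st2: "s2 = s1" "t2 = 6" by simp_all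
    show "sim_com (Draw (Flip 22 3) ;; Block [RealOfWord 11 22] ;; pick_com ;; pass1_com ;; mark_com ;; pass2_com) s2
      (bernoulli_pmf (3/10) \<bind> (\<lambda>h. pick_pmf w (JL u) 1 \<bind> K h)) (\<lambda>z s'' t. mstate (fst z, ?L, ?c) s'' \<and> rreg s'' 9 = rreg s 9 \<and> t2 + t \<le> ?T)"
      unfolding st2
    proof (rule sim_com_Seq)
      have r3: "rreg s1 3 = 3/10" using s1 by (simp add: start_def base_def fixed_regs_def)
      show "sim_com (Draw (Flip 22 3)) s1 (bernoulli_pmf (3/10)) (\<lambda>h s' t. s' = s1\<lparr>wreg := (wreg s1)(22 := of_bool h)\<rparr> \<and> t = 1)"
        using sim_com_Flip[of s1 3 _ 22] W_large(2) unfolding r3 by simp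
      fix h s3 and t3 :: nat assume h: "s3 = s1\<lparr>wreg := (wreg s1)(22 := of_bool h)\<rparr> \<and> t3 = 1"
      show "sim_com (Block [RealOfWord 11 22] ;; pick_com ;; pass1_com ;; mark_com ;; pass2_com) s3 (pick_pmf w (JL u) 1 \<bind> K h)
        (\<lambda>z s'' t. mstate (fst z, ?L, ?c) s'' \<and> rreg s'' 9 = rreg s 9 \<and> 6 + (t3 + t) \<le> ?T)"
      proof (rule sim_com_Seq_det)
        show "sim_com (Block [RealOfWord 11 22]) s3 (return_pmf ()) (\<lambda>_ s' t. start s' \<and> rreg s' 11 = of_bool h \<and> t = 1)"
          by (rule sim_com_Block) (use h s1 in \<open>auto simp: start_def base_def fixed_regs_def\<close>)
        fix s4 and t4 :: nat assume s4: "start s4 \<and> rreg s4 11 = of_bool h \<and> t4 = 1"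
        show "sim_com (pick_com ;; pass1_com ;; mark_com ;; pass2_com) s4 (pick_pmf w (JL u) 1 \<bind> K h)
          (\<lambda>z s'' t. mstate (fst z, ?L, ?c) s'' \<and> rreg s'' 9 = rreg s 9 \<and> 6 + (t3 + (t4 + t)) \<le> ?T)"
        proof (rule sim_com_Seq[OF pick])
          show "start s4" using s4 by simp
          fix j s5 t5 assume j: "j \<in> set_pmf (pick_pmf w (JL u) 1)"
            and s5: "start s5 \<and> rreg s5 11 = rreg s4 11 \<and> wreg s5 21 = j \<and> t5 \<le> 10 + 20 * length (JL u)"
          have "j \<in> set (JL u)"
            by (rule set_pick_pmf[OF _ _ JLne j]) (use w_pos sum_J[OF u(1)] in \<open>auto simp: set_JL sum_list_JL J_def\<close>)
          then have jJ: "j \<in> J u" by (simp add: set_JL)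
          have "sim_com (pass1_com ;; mark_com ;; pass2_com) s5 (K h j)
           (\<lambda>z s'' t. snd z = {} \<and> mstate (fst z, ?L, ?c) s'' \<and> rreg s'' 9 = rreg s 9 \<and> t \<le> 100 + 70 * length (JL u) + 76 * (\<Sum>j\<in>J u. length (L j)))"
            unfolding K_def by (rule rest) (use s5 s4 jJ in auto)
          then show "sim_com (pass1_com ;; mark_com ;; pass2_com) s5 (K h j)
           (\<lambda>z s'' t. mstate (fst z, ?L, ?c) s'' \<and> rreg s'' 9 = rreg s 9 \<and> 6 + (t3 + (t4 + (t5 + t))) \<le> ?T)"
            by (rule sim_com_consequence) (use s5 s4 h in auto)
        qed
      qed
    qed
  qed
  then have main: "sim_com pivot_com s (map_pmf (\<lambda>z. (fst z, ?L, ?c)) (bernoulli_pmf (3/10) \<bind> (\<lambda>h. pick_pmf w (JL u) 1 \<bind> K h)))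
    (\<lambda>z s'' t. mstate z s'' \<and> rreg s'' 9 = rreg s 9 \<and> t \<le> ?T)"
    by (rule sim_com_map[where f = "\<lambda>z. (fst z, ?L, ?c)"])
  have eq: "map_pmf (\<lambda>z. (fst z, ?L, ?c)) (bernoulli_pmf (3/10) \<bind> (\<lambda>h. pick_pmf w (JL u) 1 \<bind> K h)) = pivot u (lab, L, c)"
    by (simp only: pivot_def cluster_pmf_def K_def out_def map_bind_pmf map_pmf_comp fst_conv case_prod_conv)
  show ?thesis using main unfolding eq .
qed

end

section \<open>Assembling the program and its running time\<close>

text \<open>Real constants cannot be loaded, so 3/10, 7/10 and 23/31 are computed as quotients of
  small words.\<close>

definition setup_block :: "instr list" where
  "setup_block = [SetWord 1 1, QNumVertices 2, QNumSets 3, WordOp WPlus 5 2 3, WordOp WPlus 4 5 1, RealOfWord 1 1, QDelta 2,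
     SetWord 6 3, SetWord 7 10, RealOfWord 3 6, RealOfWord 4 7, RealOp RDivide 3 3 4, SetWord 6 7, RealOfWord 15 6, RealOp RDivide 4 15 4,
     SetWord 6 23, SetWord 7 31, RealOfWord 5 6, RealOfWord 15 7, RealOp RDivide 5 5 15,
     RealOfWord 6 2, RealOp RDivide 6 6 2, RealOp RDivide 7 6 2, RealOfWord 8 3, RealOp RDivide 8 8 2]"

text \<open>Each member is copied to the list of its set, and at the same time the set index is
  appended to the list of that vertex.\<close>

definition load_body :: com where
  "load_body = Block ([QSetMember 16 20 15, WordOp WPlus 18 16 3, WordOp WPlus 18 18 1] @ put 12 15 16 @ [WordOp WPlus 17 15 1] @ put 12 5 17 @
     get 17 18 5 @ put 18 17 20 @ [WordOp WPlus 17 17 1] @ put 18 5 17 @ [WordOp WPlus 15 15 1])"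

definition load_com :: com where
  "load_com = Block [QSetSize 13 20, WordOp WPlus 12 20 1, WordOp WPlus 15 0 0] ;; WhileLess 15 13 load_body ;; Block [WordOp WPlus 20 20 1]"

definition rounding_com :: com where
  "rounding_com = Draw (Flip 22 5) ;; IfLess 0 22 (Block []) (WhileRLess 9 6 trial_com) ;; Block [RealOp RPlus 9 0 0] ;;
     WhileRLess 9 8 hit_com ;; finish_com"

definition main_com :: com where
  "main_com = Block setup_block ;; WhileLess 20 3 load_com ;; rounding_com"

lemma less_nat_ceiling: "i < nat \<lceil>z\<rceil> \<longleftrightarrow> real i < z"
  by (simp add: zless_nat_eq_int_zless less_ceiling_iff)

context rounding_ram
begin

text \<open>Double counting: each vertex carries total weight 1 and each incidence weighs at least
  \<open>\<Delta>\<close>.\<close>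

lemma sum_card_A: "(\<Sum>j<m. real (card (A j))) \<le> n / \<Delta>"
proof -
  have "(\<Sum>j<m. real (card (A j))) * \<Delta> \<le> (\<Sum>j<m. real (card (A j)) * w j)"
    unfolding sum_distrib_right by (intro sum_mono mult_left_mono) (auto simp: w_ge)
  also have "\<dots> = (\<Sum>j<m. \<Sum>u<n. of_bool (u \<in> A j) * w j)"
  proof (rule sum.cong[OF refl])
    fix j assume "j \<in> {..<m}"
    then have "A j \<subseteq> {..<n}" using A_subset by simp
    then have "real (card (A j)) = (\<Sum>u<n. of_bool (u \<in> A j))" by (simp add: of_bool_def sum.If_cases Int_absorb1)
    then show "real (card (A j)) * w j = (\<Sum>u<n. of_bool (u \<in> A j) * w j)" by (simp add: sum_distrib_right)
  qed
  also have "\<dots> = (\<Sum>u<n. \<Sum>j<m. of_bool (u \<in> A j) * w j)" by (rule sum.swap)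
  also have "\<dots> = (\<Sum>u<n. 1)"
  proof (rule sum.cong[OF refl])
    fix u assume u: "u \<in> {..<n}"
    have "(\<Sum>j<m. of_bool (u \<in> A j) * w j) = (\<Sum>j\<in>J u. w j)"
      by (rule sum.mono_neutral_cong_right) (auto simp: J_def)
    then show "(\<Sum>j<m. of_bool (u \<in> A j) * w j) = 1" using sum_J u by simp
  qed
  finally show ?thesis using Delta_pos by (simp add: pos_le_divide_eq)
qed

lemma length_JL: "u < n \<Longrightarrow> real (length (JL u)) \<le> 1 / \<Delta>"
proof -
  assume u: "u < n"
  have "real (card (J u)) * \<Delta> \<le> (\<Sum>j\<in>J u. w j)" using sum_mono[of "J u" "\<lambda>_. \<Delta>" w] w_ge by (simp add: J_def)
  moreover have "length (JL u) = card (J u)" using distinct_card[OF distinct_JL[of u]] by (simp add: set_JL)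
  ultimately show ?thesis using sum_J[OF u] Delta_pos by (simp add: pos_le_divide_eq)
qed

lemma sum_lists:
  assumes "inv (lab, L, c)"
  shows "(\<Sum>j<m. real (length (L j))) \<le> n / \<Delta>" "(\<Sum>j\<in>J u. real (length (L j))) \<le> n / \<Delta>"
proof -
  have "real (length (L j)) \<le> real (card (A j))" if "j < m" for j
  proof -
    have "distinct (L j)" "set (L j) \<subseteq> A j" using assms that by (auto simp: inv_def)
    then have "length (L j) \<le> card (A j)" using finite_subset[OF A_subset[OF that]] by (metis card_mono distinct_card finite_lessThan)
    then show ?thesis by simp
  qed
  then have "(\<Sum>j<m. real (length (L j))) \<le> (\<Sum>j<m. real (card (A j)))" by (intro sum_mono) simp
  then show *: "(\<Sum>j<m. real (length (L j))) \<le> n / \<Delta>" using sum_card_A by linarith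
  have "(\<Sum>j\<in>J u. real (length (L j))) \<le> (\<Sum>j<m. real (length (L j)))" by (rule sum_mono2) (auto simp: J_def)
  then show "(\<Sum>j\<in>J u. real (length (L j))) \<le> n / \<Delta>" using * by linarith
qed

text \<open>Time is charged to the growth of the reading counter plus \<open>O(1 / \<Delta>)\<close>
  for the sets of the pivot. A pivot starts only below the cap and reads at most
  \<open>n / \<Delta>\<close> entries, so the counter overshoots by no more than that.\<close>

lemma sim_trial:
  assumes s: "mstate z0 s" "inv z0" "snd (snd z0) \<le> n / \<Delta>\<^sup>2 + n / \<Delta>"
  shows "sim_com trial_com s (trial (n / \<Delta>\<^sup>2) z0) (\<lambda>z s' t. mstate z s' \<and> rreg s' 9 = rreg s 9 + 1 \<and>
     snd (snd z) \<le> n / \<Delta>\<^sup>2 + n / \<Delta> \<and> real t \<le> 250 + 100 / \<Delta> + 100 * (snd (snd z) - snd (snd z0)))"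
proof -
  obtain lab L c where z0: "z0 = (lab, L, c)" by (cases z0)
  have fs: "fixed_regs s" and rep: "rep (wmem s) lab (rowsof L)" and c: "rreg s 10 = c" using s by (simp_all add: mstate_def z0)
  have nW: "0 < wreg s 2" "wreg s 2 \<le> W" "wreg s 2 = n" using fs n_pos n_less_Q(1) Q_le_W by (simp_all add: fixed_regs_def)
  show ?thesis unfolding trial_com_def trial_def
  proof (rule sim_com_Seq)
    show "sim_com (Draw (RandWord 6 2)) s (pmf_of_set {..<n}) (\<lambda>u s' t. u < n \<and> s' = s\<lparr>wreg := (wreg s)(6 := u)\<rparr> \<and> t = 1)"
      using sim_com_RandWord[of s 2 _ 6] nW by simp
    fix u s1 and t1 :: nat assume "u < n \<and> s1 = s\<lparr>wreg := (wreg s)(6 := u)\<rparr> \<and> t1 = 1"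
    then have u: "u < n" and s1: "s1 = s\<lparr>wreg := (wreg s)(6 := u)\<rparr>" "t1 = 1" by simp_all
    define s2 where "s2 = block [Load 17 6] s1"
    have s2: "mstate z0 s2" "wreg s2 6 = u" "wreg s2 17 = lab u" "rreg s2 = rreg s" "wreg s2 0 = 0" "fixed_regs s2"
      using s fs rep_lab[OF rep u] by (simp_all add: s2_def s1 mstate_def fixed_regs_def z0)
    let ?D = "if fst z0 u = 0 \<and> snd (snd z0) < n / \<Delta>\<^sup>2 then pivot u z0 else return_pmf z0"
    have body: "sim_com (IfLess 0 17 (Block []) (IfRLess 10 7 pivot_com (Block []))) s2 ?D (\<lambda>z s' t. mstate z s' \<and> rreg s' 9 = rreg s 9 \<and>
     snd (snd z) \<le> n / \<Delta>\<^sup>2 + n / \<Delta> \<and> real t \<le> 210 + 100 / \<Delta> + 100 * (snd (snd z) - snd (snd z0)))"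
    proof (rule sim_com_IfLess)
      assume "wreg s2 0 < wreg s2 17"
      then have D: "?D = return_pmf z0" using s2 by (simp add: z0)
      show "sim_com (Block []) s2 ?D (\<lambda>z s' t. mstate z s' \<and> rreg s' 9 = rreg s 9 \<and>
         snd (snd z) \<le> n / \<Delta>\<^sup>2 + n / \<Delta> \<and> real (t + 1) \<le> 210 + 100 / \<Delta> + 100 * (snd (snd z) - snd (snd z0)))"
        unfolding D by (rule sim_com_Block) (use s2 s Delta_pos in auto)
    next
      assume "\<not> wreg s2 0 < wreg s2 17"
      then have lu: "lab u = 0" using s2 by simp
      show "sim_com (IfRLess 10 7 pivot_com (Block [])) s2 ?D (\<lambda>z s' t. mstate z s' \<and> rreg s' 9 = rreg s 9 \<and>
         snd (snd z) \<le> n / \<Delta>\<^sup>2 + n / \<Delta> \<and> real (t + 2) \<le> 210 + 100 / \<Delta> + 100 * (snd (snd z) - snd (snd z0)))"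
      proof (rule sim_com_IfRLess)
        assume "rreg s2 10 < rreg s2 7"
        then have lt: "c < n / \<Delta>\<^sup>2" using s2 c by (simp add: fixed_regs_def)
        then have D: "?D = pivot u (lab, L, c)" using lu by (simp add: z0)
        show "sim_com pivot_com s2 ?D (\<lambda>z s' t. mstate z s' \<and> rreg s' 9 = rreg s 9 \<and>
         snd (snd z) \<le> n / \<Delta>\<^sup>2 + n / \<Delta> \<and> real (t + 1 + 2) \<le> 210 + 100 / \<Delta> + 100 * (snd (snd z) - snd (snd z0)))"
          unfolding D
        proof (rule sim_com_consequence[OF sim_pivot[of lab L c s2 u, OF _ s2(2) _ u lu]])
          show "mstate (lab, L, c) s2" "inv (lab, L, c)" using s2 s by (simp_all add: z0)
          fix z s' t assume z: "z \<in> set_pmf (pivot u (lab, L, c))"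
            and q: "mstate z s' \<and> rreg s' 9 = rreg s2 9 \<and> t \<le> 200 + 100 * length (JL u) + 100 * (\<Sum>j\<in>J u. length (L j))"
          have cz: "snd (snd z) = c + (\<Sum>j\<in>J u. real (length (L j)))" using z by (auto simp: pivot_def)
          have "real t \<le> real (200 + 100 * length (JL u) + 100 * (\<Sum>j\<in>J u. length (L j)))" using q of_nat_le_iff by blast
          then have "real t \<le> 200 + 100 * real (length (JL u)) + 100 * (\<Sum>j\<in>J u. real (length (L j)))" by simp
          moreover have "100 * real (length (JL u)) \<le> 100 / \<Delta>" using length_JL[OF u] by simp
          ultimately have "real (t + 1 + 2) \<le> 210 + 100 / \<Delta> + 100 * (snd (snd z) - snd (snd z0))" unfolding cz by (simp add: z0)
          then show "mstate z s' \<and> rreg s' 9 = rreg s 9 \<and>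
             snd (snd z) \<le> n / \<Delta>\<^sup>2 + n / \<Delta> \<and> real (t + 1 + 2) \<le> 210 + 100 / \<Delta> + 100 * (snd (snd z) - snd (snd z0))"
            using q s2(4) cz lt sum_lists(2)[of lab L c u] s(2) by (simp add: z0)
        qed
      next
        assume "\<not> rreg s2 10 < rreg s2 7"
        then have D: "?D = return_pmf z0" using s2 c by (simp add: fixed_regs_def z0)
        show "sim_com (Block []) s2 ?D (\<lambda>z s' t. mstate z s' \<and> rreg s' 9 = rreg s 9 \<and>
         snd (snd z) \<le> n / \<Delta>\<^sup>2 + n / \<Delta> \<and> real (t + 2 + 2) \<le> 210 + 100 / \<Delta> + 100 * (snd (snd z) - snd (snd z0)))"
          unfolding D by (rule sim_com_Block) (use s2 s Delta_pos in auto)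
      qed
    qed
    show "sim_com (Block [Load 17 6] ;; IfLess 0 17 (Block []) (IfRLess 10 7 pivot_com (Block [])) ;; Block [RealOp RPlus 9 9 1]) s1 ?D
      (\<lambda>z s' t. mstate z s' \<and> rreg s' 9 = rreg s 9 + 1 \<and>
       snd (snd z) \<le> n / \<Delta>\<^sup>2 + n / \<Delta> \<and> real (t1 + t) \<le> 250 + 100 / \<Delta> + 100 * (snd (snd z) - snd (snd z0)))"
    proof (rule sim_com_Seq_det)
      show "sim_com (Block [Load 17 6]) s1 (return_pmf ()) (\<lambda>_ s' t. s' = s2 \<and> t = 1)" by (rule sim_com_Block) (simp_all add: s2_def)
      fix s3 and t3 :: nat assume s3: "s3 = s2 \<and> t3 = 1"
      have "sim_com (IfLess 0 17 (Block []) (IfRLess 10 7 pivot_com (Block [])) ;; Block [RealOp RPlus 9 9 1]) s2 (?D \<bind> return_pmf)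
        (\<lambda>z s' t. mstate z s' \<and> rreg s' 9 = rreg s 9 + 1 \<and>
         snd (snd z) \<le> n / \<Delta>\<^sup>2 + n / \<Delta> \<and> real (t1 + (t3 + t)) \<le> 250 + 100 / \<Delta> + 100 * (snd (snd z) - snd (snd z0)))"
        by (rule sim_com_Seq[OF body], rule sim_com_Block) (use s1(2) s3 in \<open>auto simp: mstate_def fixed_regs_def\<close>)
      then show "sim_com (IfLess 0 17 (Block []) (IfRLess 10 7 pivot_com (Block [])) ;; Block [RealOp RPlus 9 9 1]) s3 ?D
        (\<lambda>z s' t. mstate z s' \<and> rreg s' 9 = rreg s 9 + 1 \<and>
         snd (snd z) \<le> n / \<Delta>\<^sup>2 + n / \<Delta> \<and> real (t1 + (t3 + t)) \<le> 250 + 100 / \<Delta> + 100 * (snd (snd z) - snd (snd z0)))"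
        using s3 by (simp only: bind_return_pmf' simp_thms)
    qed
  qed
qed

text \<open>The potential that pays for absorptions: an absorbed list is read once and then
  empty.\<close>

definition total :: "round_state \<Rightarrow> nat" where "total z0 = (\<Sum>j<m. length (fst (snd z0) j))"

lemma total_absorb: "j < m \<Longrightarrow> total (absorb j (lab, L, c)) + length (L j) = total (lab, L, c)"
  by (simp add: total_def absorb_def sum.remove[of "{..<m}" j])

lemma sim_absorb_state:
  assumes "mstate (lab, L, c) s" "inv (lab, L, c)" "wreg s 11 = j" "j < m"
  shows "sim_com absorb_com s (return_pmf ()) (\<lambda>_ s' t. mstate (absorb j (lab, L, c)) s' \<and> rreg s' 9 = rreg s 9 \<and> wreg s' 20 = wreg s 20 \<and>
     t + 10 * total (absorb j (lab, L, c)) \<le> 20 + 10 * total (lab, L, c))"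
proof -
  have "sim_com absorb_com s (return_pmf ()) (\<lambda>_ s' t. keeps 10 20 s s' \<and> rmem s' = rmem s \<and>
     rep (wmem s') (fst (absorb j (lab, L, c))) (rowsof (L(j := []))) \<and> t \<le> 20 + 10 * length (L j))"
    by (rule sim_absorb) (use assms inv_lists[OF assms(2,4)] in \<open>simp_all add: mstate_def\<close>)
  then show ?thesis
  proof (rule sim_com_consequence)
    fix y s' t assume q: "keeps 10 20 s s' \<and> rmem s' = rmem s \<and>
     rep (wmem s') (fst (absorb j (lab, L, c))) (rowsof (L(j := []))) \<and> t \<le> 20 + 10 * length (L j)"
    have "fixed_regs s'" by (rule keeps_fixed_regs[of 10 20 s]) (use q assms in \<open>auto simp: mstate_def\<close>)
    then show "mstate (absorb j (lab, L, c)) s' \<and> rreg s' 9 = rreg s 9 \<and> wreg s' 20 = wreg s 20 \<and>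
     t + 10 * total (absorb j (lab, L, c)) \<le> 20 + 10 * total (lab, L, c)"
      using q assms(1) total_absorb[OF assms(4), of lab L c] by (auto simp: mstate_def keeps_def absorb_def)
  qed
qed

lemma sim_hit:
  assumes s: "mstate z0 s" "inv z0"
  shows "sim_com hit_com s (hit z0) (\<lambda>z s' t. mstate z s' \<and> rreg s' 9 = rreg s 9 + 1 \<and> t + 10 * total z \<le> 30 + 10 * total z0)"
proof -
  obtain lab L c where z0: "z0 = (lab, L, c)" by (cases z0)
  have fs: "fixed_regs s" using s by (simp add: mstate_def)
  have mW: "0 < wreg s 3" "wreg s 3 \<le> W" "wreg s 3 = m" using fs m_pos n_less_Q(2) Q_le_W by (simp_all add: fixed_regs_def)
  show ?thesis unfolding hit_com_def hit_def
  proof (rule sim_com_Seq)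
    show "sim_com (Draw (RandWord 11 3)) s (pmf_of_set {..<m}) (\<lambda>j s' t. j < m \<and> s' = s\<lparr>wreg := (wreg s)(11 := j)\<rparr> \<and> t = 1)"
      using sim_com_RandWord[of s 3 _ 11] mW by simp
    fix j s1 and t1 :: nat assume "j < m \<and> s1 = s\<lparr>wreg := (wreg s)(11 := j)\<rparr> \<and> t1 = 1"
    then have j: "j < m" and s1: "s1 = s\<lparr>wreg := (wreg s)(11 := j)\<rparr>" "t1 = 1" by simp_all
    let ?Q = "\<lambda>t0 z s' t. mstate z s' \<and> rreg s' 9 = rreg s 9 + 1 \<and> t0 + t + 10 * total z \<le> 30 + 10 * total z0"
    let ?D = "\<lambda>b. return_pmf (if b then absorb j z0 else z0)"
    have "sim_com (Block [QSetValue 12 11] ;; Draw (Flip 19 12) ;; IfLess 0 19 absorb_com (Block []) ;; Block [RealOp RPlus 9 9 1]) s1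
      (bernoulli_pmf (w j) \<bind> ?D) (?Q 1)"
    proof (rule sim_com_Seq_det)
      show "sim_com (Block [QSetValue 12 11]) s1 (return_pmf ()) (\<lambda>_ s' t. mstate z0 s' \<and> wreg s' 11 = j \<and> rreg s' 12 = w j \<and> rreg s' 9 = rreg s 9 \<and> t = 1)"
        by (rule sim_com_Block) (use s s1 j in \<open>auto simp: mstate_def fixed_regs_def val_sol\<close>)
      fix s2 and t2 :: nat assume s2: "mstate z0 s2 \<and> wreg s2 11 = j \<and> rreg s2 12 = w j \<and> rreg s2 9 = rreg s 9 \<and> t2 = 1"
      show "sim_com (Draw (Flip 19 12) ;; IfLess 0 19 absorb_com (Block []) ;; Block [RealOp RPlus 9 9 1]) s2
        (bernoulli_pmf (w j) \<bind> ?D) (\<lambda>z s' t. ?Q 1 z s' (t2 + t))"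
      proof (rule sim_com_Seq)
        have wj: "rreg s2 12 = w j" using s2 by simp
        show "sim_com (Draw (Flip 19 12)) s2 (bernoulli_pmf (w j)) (\<lambda>b s' t. s' = s2\<lparr>wreg := (wreg s2)(19 := of_bool b)\<rparr> \<and> t = 1)"
          using sim_com_Flip[of s2 12 _ 19] W_large(2) w_pos[OF j] w_le_1[OF j] unfolding wj by simp
        fix b s3 and t3 :: nat assume s3: "s3 = s2\<lparr>wreg := (wreg s2)(19 := of_bool b)\<rparr> \<and> t3 = 1"
        then have m3: "mstate z0 s3" "wreg s3 11 = j" "wreg s3 0 = 0" "wreg s3 19 = of_bool b" "rreg s3 9 = rreg s 9" using s2 by (auto simp: mstate_def fixed_regs_def)
        show "sim_com (IfLess 0 19 absorb_com (Block []) ;; Block [RealOp RPlus 9 9 1]) s3 (?D b) (\<lambda>z s' t. ?Q 1 z s' (t2 + (t3 + t)))"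
        proof (rule sim_com_Seq_det)
          show "sim_com (IfLess 0 19 absorb_com (Block [])) s3 (return_pmf ()) (\<lambda>_ s' t. mstate (if b then absorb j z0 else z0) s' \<and> rreg s' 9 = rreg s 9 \<and>
             t + 10 * total (if b then absorb j z0 else z0) \<le> 22 + 10 * total z0)"
          proof (rule sim_com_IfLess)
            assume "wreg s3 0 < wreg s3 19"
            then have b: b using m3 by (cases b) auto
            show "sim_com absorb_com s3 (return_pmf ()) (\<lambda>_ s' t. mstate (if b then absorb j z0 else z0) s' \<and> rreg s' 9 = rreg s 9 \<and>
             t + 1 + 10 * total (if b then absorb j z0 else z0) \<le> 22 + 10 * total z0)"
              by (rule sim_com_consequence[OF sim_absorb_state[of lab L c s3 j]]) (use m3 s(2) j b in \<open>auto simp: z0\<close>)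
          next
            assume "\<not> wreg s3 0 < wreg s3 19"
            then have b: "\<not> b" using m3 by (cases b) auto
            show "sim_com (Block []) s3 (return_pmf ()) (\<lambda>_ s' t. mstate (if b then absorb j z0 else z0) s' \<and> rreg s' 9 = rreg s 9 \<and>
             t + 2 + 10 * total (if b then absorb j z0 else z0) \<le> 22 + 10 * total z0)"
              by (rule sim_com_Block) (use m3 b in auto)
          qed
          fix s4 t4 assume q: "mstate (if b then absorb j z0 else z0) s4 \<and> rreg s4 9 = rreg s 9 \<and>
             t4 + 10 * total (if b then absorb j z0 else z0) \<le> 22 + 10 * total z0"
          show "sim_com (Block [RealOp RPlus 9 9 1]) s4 (?D b) (\<lambda>z s' t. ?Q 1 z s' (t2 + (t3 + (t4 + t))))"
            by (rule sim_com_Block) (use q s2 s3 in \<open>auto simp: mstate_def fixed_regs_def\<close>)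
        qed
      qed
    qed
    then show "sim_com (Block [QSetValue 12 11] ;; Draw (Flip 19 12) ;; IfLess 0 19 absorb_com (Block []) ;; Block [RealOp RPlus 9 9 1]) s1
      (bernoulli_pmf (w j) \<bind> ?D) (\<lambda>z s' t. mstate z s' \<and> rreg s' 9 = rreg s 9 + 1 \<and> t1 + t + 10 * total z \<le> 30 + 10 * total z0)"
      by (simp add: s1(2))
  qed
qed

lemma inv_fold_absorb: "inv z0 \<Longrightarrow> k \<le> m \<Longrightarrow> inv (fold absorb [0..<k] z0)"
  using finish_invariant by blast

lemma sim_finish:
  assumes s: "mstate z0 s" "inv z0"
  shows "sim_com finish_com s (return_pmf ()) (\<lambda>_ s' t. mstate (finish z0) s' \<and> t \<le> 10 + 40 * m + 10 * total z0)"
proof -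
  let ?z = "\<lambda>k. fold absorb [0..<k] z0"
  let ?body = "Block [WordOp WPlus 11 20 0] ;; absorb_com ;; Block [WordOp WPlus 20 20 1]"
  define Inv where "Inv k s' t \<longleftrightarrow> mstate (?z k) s' \<and> wreg s' 20 = k \<and> t + 10 * total (?z k) \<le> 40 * k + 10 * total z0" for k s' t
  show ?thesis unfolding finish_com_def
  proof (rule sim_com_Seq_det)
    show "sim_com (Block [WordOp WPlus 20 0 0]) s (return_pmf ()) (\<lambda>_ s' t. Inv 0 s' 0 \<and> t = 1)"
      by (rule sim_com_Block) (use s in \<open>auto simp: Inv_def mstate_def fixed_regs_def\<close>)
    fix s1 and t1 :: nat assume s1: "Inv 0 s1 0 \<and> t1 = 1"
    have "sim_com (WhileLess 20 3 ?body) s1 (foldM (\<lambda>_ _. return_pmf ()) [0..<m] ()) (\<lambda>_ s' t. \<exists>t'. t = t' + 2 \<and> Inv m s' t')"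
    proof (rule sim_com_for[where Inv = "\<lambda>i _. Inv i"])
      show "Inv 0 s1 0" using s1 by simp
      show "\<not> wreg s' 20 < wreg s' 3 \<and> (\<exists>t'. t + 2 = t' + 2 \<and> Inv m s' t')" if "Inv (length [0..<m]) s' t" for y s' t
        using that by (auto simp: Inv_def mstate_def fixed_regs_def)
    next
      fix k and y :: unit and s' t assume "k < length [0..<m]" and Inv: "Inv k s' t"
      then have k: "k < m" by simp
      obtain lab L c where z: "?z k = (lab, L, c)" by (cases "?z k")
      have kQ: "k < Q" "Suc k < Q" using n_less_Q(4,5) k by simp_all
      have zS: "?z (Suc k) = absorb k (lab, L, c)" by (simp add: z)
      have "sim_com ?body s' (return_pmf ()) (\<lambda>_ s'' t'. Inv (Suc k) s'' (t + t' + 2))"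
      proof (rule sim_com_Seq_det)
        show "sim_com (Block [WordOp WPlus 11 20 0]) s' (return_pmf ()) (\<lambda>_ s2 t2. mstate (lab, L, c) s2 \<and> wreg s2 11 = k \<and> wreg s2 20 = k \<and> t2 = 1)"
          by (rule sim_com_Block) (use Inv kQ in \<open>auto simp: Inv_def mstate_def fixed_regs_def z\<close>)
        fix s2 and t2 :: nat assume s2: "mstate (lab, L, c) s2 \<and> wreg s2 11 = k \<and> wreg s2 20 = k \<and> t2 = 1"
        have "inv (lab, L, c)" using inv_fold_absorb[OF s(2), of k] k z by simp
        note ab = sim_absorb_state[OF _ this _ k, of s2]
        show "sim_com (absorb_com ;; Block [WordOp WPlus 20 20 1]) s2 (return_pmf ()) (\<lambda>_ s'' t'. Inv (Suc k) s'' (t + (t2 + t') + 2))"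
        proof (rule sim_com_Seq_det[OF ab])
          show "mstate (lab, L, c) s2" "wreg s2 11 = k" using s2 by simp_all
          fix s3 t3 assume s3: "mstate (absorb k (lab, L, c)) s3 \<and> rreg s3 9 = rreg s2 9 \<and> wreg s3 20 = wreg s2 20 \<and>
            t3 + 10 * total (absorb k (lab, L, c)) \<le> 20 + 10 * total (lab, L, c)"
          show "sim_com (Block [WordOp WPlus 20 20 1]) s3 (return_pmf ()) (\<lambda>_ s'' t'. Inv (Suc k) s'' (t + (t2 + (t3 + t')) + 2))"
            by (rule sim_com_Block) (use s2 s3 Inv kQ in \<open>auto simp: Inv_def zS z mstate_def fixed_regs_def simp del: fold_simps upt_Suc\<close>)
        qed
      qed
      then show "wreg s' 20 < wreg s' 3 \<and> sim_com ?body s' (return_pmf ()) (\<lambda>_ s'' t'. Inv (Suc k) s'' (t + t' + 2))"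
        using Inv k by (simp add: Inv_def mstate_def fixed_regs_def)
    qed
    then show "sim_com (WhileLess 20 3 ?body) s1 (return_pmf ()) (\<lambda>_ s' t. mstate (finish z0) s' \<and> t1 + t \<le> 10 + 40 * m + 10 * total z0)"
      unfolding foldM_unit by (rule sim_com_consequence) (use s1 in \<open>auto simp: Inv_def finish_def\<close>)
  qed
qed

text \<open>Summing the amortized bounds telescopes the counter over the trials and
  \<open>total\<close> over hits and sweep, which leaves a constant per hit and
  \<open>O(1 / \<Delta>)\<close> per trial besides the cap.\<close>

theorem sim_rounding:
  assumes s: "mstate z0 s" "inv z0" "rreg s 9 = 0" "snd (snd z0) = 0"
  defines "R \<equiv> nat \<lceil>n / \<Delta>\<rceil>" and "R' \<equiv> nat \<lceil>m / \<Delta>\<rceil>"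
  shows "sim_com rounding_com s (rounding (n / \<Delta>\<^sup>2) R R' z0) (\<lambda>z s' t. mstate z s' \<and>
     real t \<le> 100 + R * (260 + 100 / \<Delta>) + 100 * (n / \<Delta>\<^sup>2 + n / \<Delta>) + 40 * real R' + 40 * m + 20 * (n / \<Delta>))"
proof -
  let ?b = "n / \<Delta>\<^sup>2" and ?c = "n / \<Delta>\<^sup>2 + n / \<Delta>"
  have pos: "0 \<le> n / \<Delta>" "0 \<le> ?c" "0 \<le> R * (260 + 100 / \<Delta>)" using Delta_pos by simp_all
  have tot_le: "real (total z) \<le> n / \<Delta>" if "inv z" for z
    using sum_lists(1)[of "fst z" "fst (snd z)" "snd (snd z)"] that by (simp add: total_def)
  have trials: "sim_com (WhileRLess 9 6 trial_com) s' (iterate_pmf R (trial ?b) z0) (\<lambda>z s'' t. mstate z s'' \<and> inv z \<and>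
     real t \<le> 2 + R * (260 + 100 / \<Delta>) + 100 * ?c)" if s': "mstate z0 s'" "rreg s' 9 = 0" for s'
  proof (rule sim_com_rfor[where Inv = "\<lambda>i z s t. mstate z s \<and> inv z \<and> rreg s 9 = real i \<and> snd (snd z) \<le> ?c \<and>
       real t \<le> i * (260 + 100 / \<Delta>) + 100 * snd (snd z)"])
    show "mstate z0 s' \<and> inv z0 \<and> rreg s' 9 = real 0 \<and> snd (snd z0) \<le> ?c \<and> real 0 \<le> real 0 * (260 + 100 / \<Delta>) + 100 * snd (snd z0)"
      using s s' pos by simp
    show "\<not> rreg s'' 9 < rreg s'' 6 \<and> mstate z s'' \<and> inv z \<and> real (t + 2) \<le> 2 + R * (260 + 100 / \<Delta>) + 100 * ?c"
      if "mstate z s'' \<and> inv z \<and> rreg s'' 9 = real R \<and> snd (snd z) \<le> ?c \<and> real t \<le> R * (260 + 100 / \<Delta>) + 100 * snd (snd z)" for z s'' t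
    proof -
      have "\<not> real R < n / \<Delta>" using less_nat_ceiling[of R "n / \<Delta>"] by (simp add: R_def)
      moreover have "100 * snd (snd z) \<le> 100 * ?c" using that by (intro mult_left_mono) auto
      moreover have "rreg s'' 6 = n / \<Delta>" using that by (simp add: mstate_def fixed_regs_def)
      ultimately show ?thesis using that by auto
    qed
  next
    fix i z s'' t assume i: "i < R" and inv: "mstate z s'' \<and> inv z \<and> rreg s'' 9 = real i \<and> snd (snd z) \<le> ?c \<and>
       real t \<le> i * (260 + 100 / \<Delta>) + 100 * snd (snd z)"
    have lt: "real i < n / \<Delta>" using less_nat_ceiling[of i "n / \<Delta>"] i by (simp add: R_def)
    have r6: "rreg s'' 6 = n / \<Delta>" using inv by (simp add: mstate_def fixed_regs_def)
    have "sim_com trial_com s'' (trial ?b z) (\<lambda>y s3 t'. mstate y s3 \<and> inv y \<and> rreg s3 9 = real (Suc i) \<and> snd (snd y) \<le> ?c \<and>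
       real (t + t' + 2) \<le> Suc i * (260 + 100 / \<Delta>) + 100 * snd (snd y))"
    proof (rule sim_com_consequence[OF sim_trial[of z s'']])
      show "mstate z s''" "inv z" "snd (snd z) \<le> ?c" using inv by simp_all
      fix y s3 t' assume y: "y \<in> set_pmf (trial ?b z)" and q: "mstate y s3 \<and> rreg s3 9 = rreg s'' 9 + 1 \<and> snd (snd y) \<le> ?c \<and>
         real t' \<le> 250 + 100 / \<Delta> + 100 * (snd (snd y) - snd (snd z))"
      have "inv y" using inv_trial y inv by blast
      moreover have "real (Suc i) * (260 + 100 / \<Delta>) = i * (260 + 100 / \<Delta>) + 260 + 100 / \<Delta>" by (simp add: distrib_right)
      ultimately show "mstate y s3 \<and> inv y \<and> rreg s3 9 = real (Suc i) \<and> snd (snd y) \<le> ?c \<and>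
         real (t + t' + 2) \<le> Suc i * (260 + 100 / \<Delta>) + 100 * snd (snd y)"
        using q inv by auto
    qed
    then show "rreg s'' 9 < rreg s'' 6 \<and> sim_com trial_com s'' (trial ?b z) (\<lambda>y s3 t'. mstate y s3 \<and> inv y \<and> rreg s3 9 = real (Suc i) \<and> snd (snd y) \<le> ?c \<and>
       real (t + t' + 2) \<le> Suc i * (260 + 100 / \<Delta>) + 100 * snd (snd y))"
      using inv lt r6 by simp
  qed
  have hits: "sim_com (WhileRLess 9 8 hit_com) s' (iterate_pmf R' hit z) (\<lambda>y s'' t. mstate y s'' \<and> inv y \<and> t + 10 * total y \<le> 2 + 40 * R' + 10 * total z)"
    if s': "mstate z s'" "inv z" "rreg s' 9 = 0" for z s'
  proof (rule sim_com_rfor[where Inv = "\<lambda>i y s t. mstate y s \<and> inv y \<and> rreg s 9 = real i \<and> t + 10 * total y \<le> 40 * i + 10 * total z"])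
    show "mstate z s' \<and> inv z \<and> rreg s' 9 = real 0 \<and> 0 + 10 * total z \<le> 40 * 0 + 10 * total z" using s' by simp
    show "\<not> rreg s'' 9 < rreg s'' 8 \<and> mstate y s'' \<and> inv y \<and> t + 2 + 10 * total y \<le> 2 + 40 * R' + 10 * total z"
      if "mstate y s'' \<and> inv y \<and> rreg s'' 9 = real R' \<and> t + 10 * total y \<le> 40 * R' + 10 * total z" for y s'' t
    proof -
      have "\<not> real R' < m / \<Delta>" using less_nat_ceiling[of R' "m / \<Delta>"] by (simp add: R'_def)
      moreover have "rreg s'' 8 = m / \<Delta>" using that by (simp add: mstate_def fixed_regs_def)
      ultimately show ?thesis using that by auto
    qed
  next
    fix i y s'' t assume i: "i < R'" and inv: "mstate y s'' \<and> inv y \<and> rreg s'' 9 = real i \<and> t + 10 * total y \<le> 40 * i + 10 * total z"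
    have lt: "real i < m / \<Delta>" using less_nat_ceiling[of i "m / \<Delta>"] i by (simp add: R'_def)
    have r8: "rreg s'' 8 = m / \<Delta>" using inv by (simp add: mstate_def fixed_regs_def)
    have "sim_com hit_com s'' (hit y) (\<lambda>y s3 t'. mstate y s3 \<and> inv y \<and> rreg s3 9 = real (Suc i) \<and> t + t' + 2 + 10 * total y \<le> 40 * Suc i + 10 * total z)"
    proof (rule sim_com_consequence[OF sim_hit[of y s'']])
      show "mstate y s''" "inv y" using inv by simp_all
      fix y' s3 t' assume y': "y' \<in> set_pmf (hit y)" and q: "mstate y' s3 \<and> rreg s3 9 = rreg s'' 9 + 1 \<and> t' + 10 * total y' \<le> 30 + 10 * total y"
      have "inv y'" using inv_hit y' inv by blast
      then show "mstate y' s3 \<and> inv y' \<and> rreg s3 9 = real (Suc i) \<and> t + t' + 2 + 10 * total y' \<le> 40 * Suc i + 10 * total z"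
        using q inv by auto
    qed
    then show "rreg s'' 9 < rreg s'' 8 \<and> sim_com hit_com s'' (hit y) (\<lambda>y s3 t'. mstate y s3 \<and> inv y \<and> rreg s3 9 = real (Suc i) \<and> t + t' + 2 + 10 * total y \<le> 40 * Suc i + 10 * total z)"
      using inv lt r8 by simp
  qed
  let ?T = "100 + R * (260 + 100 / \<Delta>) + 100 * ?c + 40 * real R' + 40 * m + 20 * (n / \<Delta>)"
  show ?thesis unfolding rounding_com_def rounding_def
  proof (rule sim_com_Seq)
    have r5: "rreg s 5 = 23/31" using s by (simp add: mstate_def fixed_regs_def)
    show "sim_com (Draw (Flip 22 5)) s (bernoulli_pmf (23/31)) (\<lambda>b s' t. s' = s\<lparr>wreg := (wreg s)(22 := of_bool b)\<rparr> \<and> t = 1)"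
      using sim_com_Flip[of s 5 _ 22] W_large(2) unfolding r5 by simp
    fix h s1 and t1 :: nat assume "s1 = s\<lparr>wreg := (wreg s)(22 := of_bool h)\<rparr> \<and> t1 = 1"
    then have s1: "mstate z0 s1" "rreg s1 9 = 0" "wreg s1 0 = 0" "wreg s1 22 = of_bool h" "t1 = 1"
      using s by (auto simp: mstate_def fixed_regs_def)
    show "sim_com (IfLess 0 22 (Block []) (WhileRLess 9 6 trial_com) ;; Block [RealOp RPlus 9 0 0] ;; WhileRLess 9 8 hit_com ;; finish_com) s1
      ((if h then return_pmf z0 else iterate_pmf R (trial ?b) z0) \<bind> (\<lambda>s'. iterate_pmf R' hit s' \<bind> (\<lambda>s''. return_pmf (finish s''))))
      (\<lambda>z s' t. mstate z s' \<and> real (t1 + t) \<le> ?T)"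
    proof (rule sim_com_Seq)
      show "sim_com (IfLess 0 22 (Block []) (WhileRLess 9 6 trial_com)) s1 (if h then return_pmf z0 else iterate_pmf R (trial ?b) z0)
        (\<lambda>z s'' t. mstate z s'' \<and> inv z \<and> real t \<le> 4 + R * (260 + 100 / \<Delta>) + 100 * ?c)"
      proof (rule sim_com_IfLess)
        assume "wreg s1 0 < wreg s1 22"
        then have h using s1 by (cases h) auto
        then show "sim_com (Block []) s1 (if h then return_pmf z0 else iterate_pmf R (trial ?b) z0)
          (\<lambda>z s'' t. mstate z s'' \<and> inv z \<and> real (t + 1) \<le> 4 + R * (260 + 100 / \<Delta>) + 100 * ?c)"
          using s1 s pos by (auto intro!: sim_com_Block add_nonneg_nonneg)
      next
        assume "\<not> wreg s1 0 < wreg s1 22"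
        then have "\<not> h" using s1 by (cases h) auto
        then show "sim_com (WhileRLess 9 6 trial_com) s1 (if h then return_pmf z0 else iterate_pmf R (trial ?b) z0)
          (\<lambda>z s'' t. mstate z s'' \<and> inv z \<and> real (t + 2) \<le> 4 + R * (260 + 100 / \<Delta>) + 100 * ?c)"
          using trials[OF s1(1,2)] by (auto elim!: sim_com_consequence)
      qed
      fix z s2 t2 assume s2: "mstate z s2 \<and> inv z \<and> real t2 \<le> 4 + R * (260 + 100 / \<Delta>) + 100 * ?c"
      show "sim_com (Block [RealOp RPlus 9 0 0] ;; WhileRLess 9 8 hit_com ;; finish_com) s2 (iterate_pmf R' hit z \<bind> (\<lambda>s''. return_pmf (finish s'')))
        (\<lambda>z s' t. mstate z s' \<and> real (t1 + (t2 + t)) \<le> ?T)"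
      proof (rule sim_com_Seq_det)
        show "sim_com (Block [RealOp RPlus 9 0 0]) s2 (return_pmf ()) (\<lambda>_ s' t. mstate z s' \<and> rreg s' 9 = 0 \<and> t = 1)"
          by (rule sim_com_Block) (use s2 in \<open>auto simp: mstate_def fixed_regs_def\<close>)
        fix s3 and t3 :: nat assume s3: "mstate z s3 \<and> rreg s3 9 = 0 \<and> t3 = 1"
        show "sim_com (WhileRLess 9 8 hit_com ;; finish_com) s3 (iterate_pmf R' hit z \<bind> (\<lambda>s''. return_pmf (finish s'')))
          (\<lambda>z s' t. mstate z s' \<and> real (t1 + (t2 + (t3 + t))) \<le> ?T)"
        proof (rule sim_com_Seq[OF hits])
          show "mstate z s3" "inv z" "rreg s3 9 = 0" using s2 s3 by simp_all
          fix y s4 t4 assume s4: "mstate y s4 \<and> inv y \<and> t4 + 10 * total y \<le> 2 + 40 * R' + 10 * total z"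
          have "sim_com finish_com s4 (map_pmf (\<lambda>_. finish y) (return_pmf ())) (\<lambda>z s' t. mstate z s' \<and> real (t1 + (t2 + (t3 + (t4 + t)))) \<le> ?T)"
          proof (rule sim_com_map, rule sim_com_consequence[OF sim_finish[of y s4]])
            show "mstate y s4" "inv y" using s4 by simp_all
            fix e :: unit and s5 t5 assume s5: "mstate (finish y) s5 \<and> t5 \<le> 10 + 40 * m + 10 * total y"
            then have "t4 + t5 \<le> 12 + 40 * m + 40 * R' + 10 * total z" using s4 by linarith
            then have "real (t4 + t5) \<le> real (12 + 40 * m + 40 * R' + 10 * total z)" by (rule of_nat_mono)
            moreover have "real (total z) \<le> n / \<Delta>" using tot_le s2 by blast
            ultimately show "mstate (finish y) s5 \<and> real (t1 + (t2 + (t3 + (t4 + t5)))) \<le> ?T" using s5 s2 s3 s1(5) pos by auto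
          qed
          then show "sim_com finish_com s4 (return_pmf (finish y)) (\<lambda>z s' t. mstate z s' \<and> real (t1 + (t2 + (t3 + (t4 + t)))) \<le> ?T)" by simp
        qed
      qed
    qed
  qed
qed

end

section \<open>Loading the LP solution\<close>

context rounding_ram
begin

definition sol :: "nat \<Rightarrow> nat list" where "sol j = fst (in_sol I ! j)"

text \<open>The rows after \<open>j\<close> complete sets and \<open>i\<close> members of the next
  one. The index lists come out increasing, as in \<open>JL\<close>, because sets are processed in
  order.\<close>

definition loaded :: "nat \<Rightarrow> nat \<Rightarrow> nat \<Rightarrow> nat list" where
  "loaded j i r = (case r of 0 \<Rightarrow> [] | Suc k \<Rightarrow>
     if k < m then (if k < j then sol k else if k = j then take i (sol j) else [])
     else filter (\<lambda>a. k - m \<in> A a) [0..<j] @ (if j < m \<and> k - m \<in> set (take i (sol j)) then [j] else []))"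

lemma sol_props: "j < m \<Longrightarrow> set (sol j) = A j" "j < m \<Longrightarrow> distinct (sol j)" "j < m \<Longrightarrow> i < length (sol j) \<Longrightarrow> sol j ! i < n"
  using set_sol[of j] distinct_sol[of j] A_subset[of j] nth_mem[of i "sol j"] by (auto simp: sol_def)

lemma length_sol: "j < m \<Longrightarrow> length (sol j) \<le> n"
  using distinct_card[of "sol j"] card_mono[of "{..<n}" "A j"] A_subset[of j] sol_props(1,2)[of j] by simp

definition lstate :: "nat \<Rightarrow> nat \<Rightarrow> ram_state \<Rightarrow> bool" where
  "lstate j i s \<longleftrightarrow> fixed_regs s \<and> rep (wmem s) (\<lambda>_. 0) (loaded j i) \<and> rmem s = (\<lambda>_. 0) \<and> rreg s 9 = 0 \<and> rreg s 10 = 0 \<and> wreg s 20 = j"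

lemma sim_load_body:
  assumes j: "j < m" and i: "i < length (sol j)" and s: "lstate j i s" "wreg s 12 = Suc j" "wreg s 13 = length (sol j)" "wreg s 15 = i"
  shows "sim_com load_body s (return_pmf ()) (\<lambda>_ s' t. lstate j (Suc i) s' \<and> wreg s' 12 = Suc j \<and> wreg s' 13 = length (sol j) \<and>
     wreg s' 15 = Suc i \<and> t = 21)"
proof -
  let ?B1 = "[QSetMember 16 20 15, WordOp WPlus 18 16 3, WordOp WPlus 18 18 1] @ put 12 15 16 @ [WordOp WPlus 17 15 1] @ put 12 5 17"
  let ?B2 = "get 17 18 5 @ put 18 17 20 @ [WordOp WPlus 17 17 1] @ put 18 5 17 @ [WordOp WPlus 15 15 1]"
  define v where "v = sol j ! i"
  have v: "v < n" using sol_props(3)[OF j i] by (simp add: v_def)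
  have less: "v < Q" "j < Q" "Suc j < Q" "m + v < Q" "v + m < Q" "Suc (m + v) < Q" "Suc (v + m) < Q" "n + m < Q" "i < Q" "Suc i < Q" "i < n + m"
    using n_less_Q(3,4,5,7,8,11) v j i length_sol[OF j] by (auto simp: add.commute)
  define M where "M = wmem s"
  define M1 where "M1 = M(cell (Suc j) i := v, cell (Suc j) (n + m) := Suc i)"
  define l where "l = length (loaded j i (Suc (m + v)))"
  define M2 where "M2 = M1(cell (Suc (m + v)) l := j, cell (Suc (m + v)) (n + m) := Suc l)"
  have lj: "loaded j i (Suc j) = take i (sol j)" using j by (simp add: loaded_def)
  have nin: "v \<notin> set (take i (sol j))" using distinct_nth_take[OF sol_props(2)[OF j] i] by (simp add: v_def)
  have lu: "loaded j i (Suc (m + v)) = filter (\<lambda>a. v \<in> A a) [0..<j]" using nin by (simp add: loaded_def)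
  have l_less: "l < n + m" "l < Q" "Suc l < Q"
    using length_filter_le[of "\<lambda>a. v \<in> A a" "[0..<j]"] j n_pos by (auto simp: l_def lu Q_def)
  have rep: "rep M (\<lambda>_. 0) (loaded j i)" using s by (simp add: lstate_def M_def)
  have rep1: "rep M1 (\<lambda>_. 0) ((loaded j i)(Suc j := take i (sol j) @ [v]))"
    using rep_append[OF rep, of "Suc j" v] less i by (simp add: lj M1_def)
  have rep2: "rep M2 (\<lambda>_. 0) ((loaded j i)(Suc j := take i (sol j) @ [v], Suc (m + v) := loaded j i (Suc (m + v)) @ [j]))"
    using rep_append[OF rep1, of "Suc (m + v)" j] less j l_less by (simp add: M2_def l_def)
  have rep3: "rep M2 (\<lambda>_. 0) (loaded j (Suc i))"
  proof (rule rep_cong[OF rep2])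
    fix r assume "0 < r" "r < Q"
    then obtain k where k: "r = Suc k" by (cases r) auto
    show "((loaded j i)(Suc j := take i (sol j) @ [v], Suc (m + v) := loaded j i (Suc (m + v)) @ [j])) r = loaded j (Suc i) r"
      using j i nin by (auto simp: k loaded_def take_Suc_conv_app_nth v_def)
  qed
  have l1: "M1 (cell (Suc (m + v)) (n + m)) = l"
    using rep_row(2)[OF rep1, of "Suc (m + v)"] less j by (simp add: l_def)
  have mem: "nth_or 0 (fst (in_sol I ! j)) i = v" using i by (simp add: nth_or_def v_def sol_def)
  define s1 where "s1 = block ?B1 s"
  have s1: "wmem s1 = M1" "rmem s1 = rmem s" "rreg s1 = rreg s" "wreg s1 18 = Suc (m + v)" "wreg s1 12 = Suc j" "wreg s1 13 = length (sol j)"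
    "wreg s1 15 = i" "wreg s1 20 = j" "wreg s1 5 = n + m" "wreg s1 4 = Q" "wreg s1 1 = 1" "fixed_regs s1"
    using s less mem j unfolding s1_def by (simp_all add: lstate_def fixed_regs_def block_put M1_def M_def add.commute)
  have s2: "lstate j (Suc i) (block ?B2 s1) \<and> wreg (block ?B2 s1) 12 = Suc j \<and> wreg (block ?B2 s1) 13 = length (sol j) \<and> wreg (block ?B2 s1) 15 = Suc i"
    using s s1 less l1 l_less rep3 by (simp add: lstate_def fixed_regs_def block_put block_get M2_def)
  show ?thesis unfolding load_body_def
  proof (rule sim_com_Block)
    show "lstate j (Suc i) (block ([QSetMember 16 20 15, WordOp WPlus 18 16 3, WordOp WPlus 18 18 1] @ put 12 15 16 @ [WordOp WPlus 17 15 1] @ put 12 5 17 @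
     get 17 18 5 @ put 18 17 20 @ [WordOp WPlus 17 17 1] @ put 18 5 17 @ [WordOp WPlus 15 15 1]) s) \<and>
     wreg (block ([QSetMember 16 20 15, WordOp WPlus 18 16 3, WordOp WPlus 18 18 1] @ put 12 15 16 @ [WordOp WPlus 17 15 1] @ put 12 5 17 @
     get 17 18 5 @ put 18 17 20 @ [WordOp WPlus 17 17 1] @ put 18 5 17 @ [WordOp WPlus 15 15 1]) s) 12 = Suc j \<and>
     wreg (block ([QSetMember 16 20 15, WordOp WPlus 18 16 3, WordOp WPlus 18 18 1] @ put 12 15 16 @ [WordOp WPlus 17 15 1] @ put 12 5 17 @
     get 17 18 5 @ put 18 17 20 @ [WordOp WPlus 17 17 1] @ put 18 5 17 @ [WordOp WPlus 15 15 1]) s) 13 = length (sol j) \<and>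
     wreg (block ([QSetMember 16 20 15, WordOp WPlus 18 16 3, WordOp WPlus 18 18 1] @ put 12 15 16 @ [WordOp WPlus 17 15 1] @ put 12 5 17 @
     get 17 18 5 @ put 18 17 20 @ [WordOp WPlus 17 17 1] @ put 18 5 17 @ [WordOp WPlus 15 15 1]) s) 15 = Suc i \<and>
     length ([QSetMember 16 20 15, WordOp WPlus 18 16 3, WordOp WPlus 18 18 1] @ put 12 15 16 @ [WordOp WPlus 17 15 1] @ put 12 5 17 @
     get 17 18 5 @ put 18 17 20 @ [WordOp WPlus 17 17 1] @ put 18 5 17 @ [WordOp WPlus 15 15 1]) = 21"
      using s2 unfolding s1_def block_append[symmetric] append_assoc by (simp only: length_append det_instr_get_put list.size) simp
  qed simp
qed

lemma sim_load:
  assumes j: "j < m" and s: "lstate j 0 s"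
  shows "sim_com load_com s (return_pmf ()) (\<lambda>_ s' t. lstate (Suc j) 0 s' \<and> t \<le> 10 + 23 * length (sol j))"
  unfolding load_com_def
proof (rule sim_com_Seq_det)
  define Inv where "Inv i s' t \<longleftrightarrow> lstate j i s' \<and> wreg s' 12 = Suc j \<and> wreg s' 13 = length (sol j) \<and> wreg s' 15 = i \<and> t \<le> 23 * i" for i s' and t :: nat
  have less: "j < Q" "Suc j < Q" "length (sol j) < Q" using n_less_Q(1,4,5) j length_sol[OF j] by auto
  show "sim_com (Block [QSetSize 13 20, WordOp WPlus 12 20 1, WordOp WPlus 15 0 0]) s (return_pmf ()) (\<lambda>_ s' t. Inv 0 s' 0 \<and> t = 3)"
    by (rule sim_com_Block) (use s j less in \<open>auto simp: Inv_def lstate_def fixed_regs_def sol_def\<close>)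
  fix s1 and t1 :: nat assume s1: "Inv 0 s1 0 \<and> t1 = 3"
  have "sim_com (WhileLess 15 13 load_body) s1 (foldM (\<lambda>_ _. return_pmf ()) (sol j) ()) (\<lambda>_ s' t. \<exists>t'. t = t' + 2 \<and> Inv (length (sol j)) s' t')"
  proof (rule sim_com_for[where Inv = "\<lambda>i _. Inv i"])
    show "Inv 0 s1 0" using s1 by simp
    show "\<not> wreg s' 15 < wreg s' 13 \<and> (\<exists>t'. t + 2 = t' + 2 \<and> Inv (length (sol j)) s' t')" if "Inv (length (sol j)) s' t" for y s' t
      using that by (auto simp: Inv_def)
  next
    fix i and y :: unit and s' t assume i: "i < length (sol j)" and Inv: "Inv i s' t"
    have "sim_com load_body s' (return_pmf ()) (\<lambda>_ s'' t'. Inv (Suc i) s'' (t + t' + 2))"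
      by (rule sim_com_consequence[OF sim_load_body[OF j i]]) (use Inv in \<open>auto simp: Inv_def\<close>)
    then show "wreg s' 15 < wreg s' 13 \<and> sim_com load_body s' (return_pmf ()) (\<lambda>_ s'' t'. Inv (Suc i) s'' (t + t' + 2))"
      using Inv i by (simp add: Inv_def)
  qed
  then have loop: "sim_com (WhileLess 15 13 load_body) s1 (return_pmf ()) (\<lambda>_ s' t. \<exists>t'. t = t' + 2 \<and> Inv (length (sol j)) s' t')"
    unfolding foldM_unit .
  show "sim_com (WhileLess 15 13 load_body ;; Block [WordOp WPlus 20 20 1]) s1 (return_pmf ()) (\<lambda>_ s' t. lstate (Suc j) 0 s' \<and> t1 + t \<le> 10 + 23 * length (sol j))"
  proof (rule sim_com_Seq_det[OF loop], rule sim_com_Block)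
    fix s' t assume "\<exists>t'. t = t' + 2 \<and> Inv (length (sol j)) s' t'"
    then obtain t' where t': "t = t' + 2" "Inv (length (sol j)) s' t'" by auto
    have "rep (wmem s') (\<lambda>_. 0) (loaded (Suc j) 0)"
    proof (rule rep_cong)
      show "rep (wmem s') (\<lambda>_. 0) (loaded j (length (sol j)))" using t' by (simp add: Inv_def lstate_def)
      fix r assume "0 < r" "r < Q"
      then obtain k where k: "r = Suc k" by (cases r) auto
      show "loaded j (length (sol j)) r = loaded (Suc j) 0 r"
        using j by (auto simp: k loaded_def sol_props(1) less_Suc_eq)
    qed
    then show "lstate (Suc j) 0 (block [WordOp WPlus 20 20 1] s') \<and> t1 + (t + length [WordOp WPlus 20 20 1]) \<le> 10 + 23 * length (sol j)"
      using t' s1 less by (simp add: Inv_def lstate_def fixed_regs_def)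
  qed simp
qed

definition start_state :: round_state where "start_state = (\<lambda>_. 0, sol, 0)"

lemma inv_start: "inv start_state"
  using sol_props by (auto simp: start_state_def inv_def fresh_def)

lemma m_le: "real m \<le> n / \<Delta>"
proof -
  have "1 \<le> real (card (A j))" if "j < m" for j
    using A_nonempty[OF that] finite_subset[OF A_subset[OF that]] by (simp add: Suc_le_eq card_gt_0_iff)
  then have "(\<Sum>j<m. 1) \<le> (\<Sum>j<m. real (card (A j)))" by (intro sum_mono) simp
  then show ?thesis using sum_card_A by simp
qed

lemma sum_sol: "(\<Sum>j<m. real (length (sol j))) \<le> n / \<Delta>"
  using sum_lists(1)[of "\<lambda>_. 0" sol 0] inv_start by (simp add: start_state_def)

lemma sim_main:
  defines "R \<equiv> nat \<lceil>n / \<Delta>\<rceil>" and "R' \<equiv> nat \<lceil>m / \<Delta>\<rceil>"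
  shows "sim_com main_com init_state (rounding (n / \<Delta>\<^sup>2) R R' start_state) (\<lambda>z s' t. mstate z s' \<and>
     real t \<le> 200 + R * (260 + 100 / \<Delta>) + 100 * (n / \<Delta>\<^sup>2 + n / \<Delta>) + 40 * real R' + 60 * m + 50 * (n / \<Delta>))"
proof -
  have less: "n < Q" "m < Q" "n + m < Q" "Suc (n + m) = Q" "Q mod W = Q" using n_less_Q(1,2,11) Q_le_W by (simp_all add: Q_def)
  have small: "3 mod W = 3" "10 mod W = 10" "7 mod W = 7" "23 mod W = 23" "31 mod W = 31" "Suc 0 mod W = Suc 0" "n mod W = n" "m mod W = m" "(n + m) mod W = n + m"
    using W_large(2) less by simp_all
  let ?T = "200 + R * (260 + 100 / \<Delta>) + 100 * (n / \<Delta>\<^sup>2 + n / \<Delta>) + 40 * real R' + 60 * m + 50 * (n / \<Delta>)"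
  have rep0: "rep (\<lambda>_. 0) (\<lambda>_. 0) (loaded 0 0)"
  proof -
    have "loaded 0 0 r = []" for r by (cases r) (simp_all add: loaded_def)
    then show ?thesis by (intro repI) (simp_all add: Q_pos)
  qed
  define s0 where "s0 = block setup_block init_state"
  have s0: "lstate 0 0 s0"
    using small less rep0 unfolding s0_def setup_block_def
    by (simp add: lstate_def fixed_regs_def init_state_def power2_eq_square)
  define Inv where "Inv j s t \<longleftrightarrow> lstate j 0 s \<and> t \<le> 12 * j + 23 * (\<Sum>k<j. length (sol k))" for j s t
  have "sim_com (WhileLess 20 3 load_com) s0 (foldM (\<lambda>_ _. return_pmf ()) [0..<m] ()) (\<lambda>_ s t. \<exists>t'. t = t' + 2 \<and> Inv m s t')"
  proof (rule sim_com_for[where Inv = "\<lambda>i _. Inv i"])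
    show "Inv 0 s0 0" using s0 by (simp add: Inv_def)
    show "\<not> wreg s 20 < wreg s 3 \<and> (\<exists>t'. t + 2 = t' + 2 \<and> Inv m s t')" if "Inv (length [0..<m]) s t" for y s t
      using that by (auto simp: Inv_def lstate_def fixed_regs_def)
  next
    fix j and y :: unit and s t assume "j < length [0..<m]" and Inv: "Inv j s t"
    then have j: "j < m" by simp
    have "sim_com load_com s (return_pmf ()) (\<lambda>_ s' t'. Inv (Suc j) s' (t + t' + 2))"
      by (rule sim_com_consequence[OF sim_load[OF j]]) (use Inv in \<open>auto simp: Inv_def\<close>)
    then show "wreg s 20 < wreg s 3 \<and> sim_com load_com s (return_pmf ()) (\<lambda>_ s' t'. Inv (Suc j) s' (t + t' + 2))"
      using Inv j by (simp add: Inv_def lstate_def fixed_regs_def)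
  qed
  then have loop: "sim_com (WhileLess 20 3 load_com) s0 (return_pmf ()) (\<lambda>_ s t. \<exists>t'. t = t' + 2 \<and> Inv m s t')"
    unfolding foldM_unit .
  show ?thesis unfolding main_com_def
  proof (rule sim_com_Seq_det)
    show "sim_com (Block setup_block) init_state (return_pmf ()) (\<lambda>_ s t. s = s0 \<and> t = 25)"
      by (rule sim_com_Block) (simp_all add: s0_def setup_block_def)
    fix s and t :: nat assume st: "s = s0 \<and> t = 25"
    show "sim_com (WhileLess 20 3 load_com ;; rounding_com) s (rounding (n / \<Delta>\<^sup>2) R R' start_state) (\<lambda>z s' t'. mstate z s' \<and> real (t + t') \<le> ?T)"
      unfolding conjunct1[OF st]
    proof (rule sim_com_Seq_det[OF loop])
      fix s1 t1 assume "\<exists>t'. t1 = t' + 2 \<and> Inv m s1 t'"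
      then obtain t' where t': "t1 = t' + 2" "Inv m s1 t'" by auto
      have "rep (wmem s1) (\<lambda>_. 0) (rowsof sol)"
      proof (rule rep_cong)
        show "rep (wmem s1) (\<lambda>_. 0) (loaded m 0)" using t' by (simp add: Inv_def lstate_def)
        show "loaded m 0 r = rowsof sol r" for r by (auto simp: loaded_def rowsof_def JL_def split: nat.split)
      qed
      then have m1: "mstate start_state s1" "rreg s1 9 = 0" using t' by (simp_all add: mstate_def start_state_def Inv_def lstate_def)
      have "t1 \<le> 2 + 12 * m + 23 * (\<Sum>k<m. length (sol k))" using t' by (simp add: Inv_def)
      then have "real t1 \<le> real (2 + 12 * m + 23 * (\<Sum>k<m. length (sol k)))" by (rule of_nat_mono)
      then have "real t1 \<le> 2 + 12 * real m + 23 * (n / \<Delta>)" using sum_sol by simp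
      moreover have "sim_com rounding_com s1 (rounding (n / \<Delta>\<^sup>2) R R' start_state) (\<lambda>z s' t. mstate z s' \<and>
        real t \<le> 100 + R * (260 + 100 / \<Delta>) + 100 * (n / \<Delta>\<^sup>2 + n / \<Delta>) + 40 * real R' + 40 * m + 20 * (n / \<Delta>))"
        unfolding R_def R'_def by (rule sim_rounding[OF m1(1) inv_start m1(2)]) (simp add: start_state_def)
      ultimately show "sim_com rounding_com s1 (rounding (n / \<Delta>\<^sup>2) R R' start_state) (\<lambda>z s' t'. mstate z s' \<and> real (t + (t1 + t')) \<le> ?T)"
        using st Delta_pos by (auto elim!: sim_com_consequence)
    qed
  qed
qed

section \<open>Truncation errors\<close>

lemma rounding_labels_all:
  assumes "z \<in> set_pmf (rounding b R R' start_state)" "v < n"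
  shows "fst z v \<noteq> 0"
proof -
  obtain h s1 s2 where *: "s1 \<in> set_pmf (if h then return_pmf start_state else iterate_pmf R (trial b) start_state)"
    "s2 \<in> set_pmf (iterate_pmf R' hit s1)" "z = finish s2"
    using assms(1) unfolding rounding_def by auto
  have it: "inv y" if "y \<in> set_pmf (iterate_pmf k f y0)" "inv y0" "\<And>a c. inv a \<Longrightarrow> c \<in> set_pmf (f a) \<Longrightarrow> inv c" for k f y0 y
    using that by (induction k arbitrary: y0) auto
  have "inv s1"
  proof (cases h)
    case True then show ?thesis using *(1) inv_start by simp
  next
    case False
    then have "s1 \<in> set_pmf (iterate_pmf R (trial b) start_state)" using *(1) by simp
    then show ?thesis by (rule it[OF _ inv_start]) (rule inv_trial)
  qed
  have "inv s2" by (rule it[OF *(2) \<open>inv s1\<close>]) (rule inv_hit)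
  then show ?thesis using finish_labels_all assms(2) *(3) by blast
qed

text \<open>\<open>exp (- 1 / \<Delta>)\<close> is at most \<open>2 * \<Delta>\<^sup>2\<close>. The
  square is needed because the hit error is afterwards divided by \<open>\<Delta>\<close>.\<close>

lemma decay: "0 < k \<Longrightarrow> (1 - 1 / real k) ^ nat \<lceil>k / \<Delta>\<rceil> \<le> 2 * \<Delta>\<^sup>2"
proof -
  assume k: "0 < k"
  have "(1 - 1 / real k) ^ nat \<lceil>k / \<Delta>\<rceil> \<le> exp (- 1 / real k) ^ nat \<lceil>k / \<Delta>\<rceil>"
    by (rule power_mono) (use exp_ge_add_one_self[of "- 1 / real k"] k in auto)
  also have "\<dots> = exp (- (real (nat \<lceil>k / \<Delta>\<rceil>) / real k))" by (simp add: exp_of_nat_mult[symmetric])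
  also have "\<dots> \<le> exp (- (1 / \<Delta>))"
  proof -
    have "k / \<Delta> \<le> real (nat \<lceil>k / \<Delta>\<rceil>)" using Delta_pos by (simp add: real_nat_ceiling_ge)
    then have "k / \<Delta> / k \<le> real (nat \<lceil>k / \<Delta>\<rceil>) / k" using k by (intro divide_right_mono) auto
    then show ?thesis using k by simp
  qed
  also have "\<dots> = 1 / exp (1 / \<Delta>)" by (simp add: exp_minus inverse_eq_divide)
  also have "\<dots> \<le> 1 / ((1 / \<Delta>)\<^sup>2 / 2)"
  proof (rule divide_left_mono)
    have "1 + 1 / \<Delta> + (1 / \<Delta>)\<^sup>2 / 2 \<le> exp (1 / \<Delta>)" by (rule exp_lower_Taylor_quadratic) (use Delta_pos in simp)
    moreover have "0 < 1 / \<Delta>" using Delta_pos by simp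
    ultimately show "(1 / \<Delta>)\<^sup>2 / 2 \<le> exp (1 / \<Delta>)" by linarith
  qed (use Delta_pos in auto)
  also have "\<dots> = 2 * \<Delta>\<^sup>2" by (simp add: power_one_over)
  finally show ?thesis .
qed

lemma expect_start:
  assumes small: "\<Delta> \<le> 1 / 20000"
  shows "expect (rounding (n / \<Delta>\<^sup>2) (nat \<lceil>n / \<Delta>\<rceil>) (nat \<lceil>m / \<Delta>\<rceil>) start_state) (\<lambda>z. potential nonzero_obj (fst z)) \<le> 1.485 * tot obj"
proof -
  define \<eta> where "\<eta> = (1 - 1 / real m) ^ nat \<lceil>m / \<Delta>\<rceil> / \<Delta>"
  define \<zeta> where "\<zeta> = (1 - 1 / real n) ^ nat \<lceil>n / \<Delta>\<rceil> + work start_state / (n / \<Delta>\<^sup>2)"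
  have d: "0 < \<Delta>" "n > 0" using Delta_pos n_pos by auto
  have \<eta>: "0 \<le> \<eta>" "\<eta> \<le> 2 * \<Delta>"
    using decay[OF m_pos] m_pos d by (simp_all add: \<eta>_def pos_divide_le_eq power2_eq_square)
  have "live (\<lambda>_. 0) = {..<n}" by (auto simp: live_def)
  then have "work start_state \<le> 2 * (n / \<Delta>)" using sum_sol by (simp add: work_def start_state_def)
  then have "work start_state / (n / \<Delta>\<^sup>2) \<le> 2 * (n / \<Delta>) / (n / \<Delta>\<^sup>2)" using d by (intro divide_right_mono) auto
  also have "2 * (n / \<Delta>) / (n / \<Delta>\<^sup>2) = 2 * \<Delta>" using d by (simp add: field_simps power2_eq_square)
  finally have wk: "work start_state / (n / \<Delta>\<^sup>2) \<le> 2 * \<Delta>" .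
  have "\<Delta>\<^sup>2 \<le> \<Delta> * 1" unfolding power2_eq_square by (rule mult_left_mono) (use small d in auto)
  then have \<zeta>: "\<zeta> \<le> 4 * \<Delta>" using decay[OF n_pos] wk by (simp add: \<zeta>_def)
  have "\<zeta> * (2 + \<eta>) \<le> (4 * \<Delta>) * 3" by (rule mult_mono) (use \<zeta> \<eta> small d in auto)
  \<comment> \<open>The losses add up to at most \<open>14 * \<Delta>\<close>, that is 0.0007, while
    46/31 lies more than 0.0011 below 1.485.\<close>
  then have fac: "46/31 + \<eta> + \<zeta> * (2 + \<eta>) \<le> 1.485" using \<eta> small by simp
  have "expect (rounding (n / \<Delta>\<^sup>2) (nat \<lceil>n / \<Delta>\<rceil>) (nat \<lceil>m / \<Delta>\<rceil>) start_state) (\<lambda>z. potential nonzero_obj (fst z)) \<le> (46/31 + \<eta> + \<zeta> * (2 + \<eta>)) * tot obj"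
    unfolding \<eta>_def \<zeta>_def by (rule expect_rounding[OF inv_start]) (use d in \<open>simp_all add: start_state_def\<close>)
  also have "\<dots> \<le> 1.485 * tot obj" by (rule mult_right_mono[OF fac tot_obj_nonneg])
  finally show ?thesis .
qed

end

section \<open>From ordered to unordered pairs, and the final bound\<close>

lemma vertex_pairs_Suc: "vertex_pairs {..<Suc k} = vertex_pairs {..<k} \<union> (\<lambda>v. {v, k}) ` {..k}"
proof (intro equalityI subsetI)
  fix e assume "e \<in> vertex_pairs {..<Suc k}"
  then obtain u v where e: "e = {u, v}" "u \<le> k" "v \<le> k" unfolding vertex_pairs_def by (auto simp: less_Suc_eq_le)
  consider "u = k" | "v = k" | "u < k" "v < k" using e by linarith
  then show "e \<in> vertex_pairs {..<k} \<union> (\<lambda>v. {v, k}) ` {..k}"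
  proof cases
    case 1
    then have "e = {v, k}" using e by (simp add: insert_commute)
    then show ?thesis using e by (intro UnI2 image_eqI[of _ _ v]) simp_all
  next
    case 2
    then show ?thesis using e by (intro UnI2 image_eqI[of _ _ u]) simp_all
  next
    case 3
    then have "e \<in> vertex_pairs {..<k}" unfolding vertex_pairs_def e(1) lessThan_iff by blast
    then show ?thesis by simp
  qed
next
  fix e assume "e \<in> vertex_pairs {..<k} \<union> (\<lambda>v. {v, k}) ` {..k}"
  then show "e \<in> vertex_pairs {..<Suc k}"
  proof
    assume "e \<in> vertex_pairs {..<k}"
    then obtain u v where "e = {u, v}" "u < k" "v < k" unfolding vertex_pairs_def by auto
    then have "e = {u, v}" "u < Suc k" "v < Suc k" by simp_all
    then show ?thesis unfolding vertex_pairs_def lessThan_iff by blast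
  next
    assume "e \<in> (\<lambda>v. {v, k}) ` {..k}"
    then obtain v where "e = {v, k}" "v < Suc k" by (auto simp: less_Suc_eq_le)
    then show ?thesis unfolding vertex_pairs_def lessThan_iff using lessI by blast
  qed
qed

lemma finite_vertex_pairs: "finite (vertex_pairs {..<k :: nat})"
  by (rule finite_subset[OF _ finite_Pow_iff[THEN iffD2, OF finite_lessThan[of k]]]) (auto simp: vertex_pairs_def)

text \<open>The analysis sums over ordered pairs, the objective and the cost over unordered ones.
  Self-loops contribute nothing, which makes the factor exactly 2.\<close>

lemma sum_vertex_pairs:
  fixes g :: "nat set \<Rightarrow> real"
  assumes "\<And>v. v < k \<Longrightarrow> g {v} = 0"
  shows "2 * (\<Sum>e\<in>vertex_pairs {..<k}. g e) = (\<Sum>v<k. \<Sum>t<k. of_bool (v \<noteq> t) * g {v, t})"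
  using assms
proof (induction k)
  case 0 show ?case by (simp add: vertex_pairs_def)
next
  case (Suc k)
  have dis: "vertex_pairs {..<k} \<inter> (\<lambda>v. {v, k}) ` {..k} = {}" by (auto simp: vertex_pairs_def doubleton_eq_iff)
  have inj: "inj_on (\<lambda>v. {v, k}) {..k}" by (auto simp: inj_on_def doubleton_eq_iff)
  have "(\<Sum>e\<in>vertex_pairs {..<Suc k}. g e) = (\<Sum>e\<in>vertex_pairs {..<k}. g e) + (\<Sum>v\<le>k. g {v, k})"
    unfolding vertex_pairs_Suc by (subst sum.union_disjoint[OF finite_vertex_pairs _ dis]) (simp_all add: sum.reindex[OF inj])
  moreover have "(\<Sum>v\<le>k. g {v, k}) = (\<Sum>v<k. g {v, k})"
    using Suc.prems[of k] by (simp add: lessThan_Suc_atMost[symmetric])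
  moreover have "(\<Sum>v<Suc k. \<Sum>t<Suc k. of_bool (v \<noteq> t) * g {v, t}) =
      (\<Sum>v<k. \<Sum>t<k. of_bool (v \<noteq> t) * g {v, t}) + (\<Sum>v<k. g {v, k}) + (\<Sum>t<k. g {k, t})"
  proof -
    have split: "(\<Sum>v<Suc k. \<Sum>t<Suc k. h v t) = (\<Sum>v<k. \<Sum>t<k. h v t) + (\<Sum>v<k. h v k) + (\<Sum>t<k. h k t) + h k k"
      for h :: "nat \<Rightarrow> nat \<Rightarrow> real" by (simp add: sum.distrib)
    have "(\<Sum>v<k. of_bool (v \<noteq> k) * g {v, k}) = (\<Sum>v<k. g {v, k})" "(\<Sum>t<k. of_bool (k \<noteq> t) * g {k, t}) = (\<Sum>t<k. g {k, t})"
      by (rule sum.cong, simp, simp)+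
    then show ?thesis unfolding split by simp
  qed
  moreover have "(\<Sum>t<k. g {k, t}) = (\<Sum>v<k. g {v, k})" by (simp add: insert_commute)
  ultimately show ?case using Suc.IH Suc.prems by simp
qed

lemma real_card_filter: "finite S \<Longrightarrow> real (card {e \<in> S. P e}) = (\<Sum>e\<in>S. of_bool (P e))"
proof -
  assume "finite S"
  moreover have "{e \<in> S. P e} = S \<inter> {e. P e}" by auto
  ultimately show ?thesis by (simp add: of_bool_def sum.If_cases)
qed

text \<open>The factor 2 between ordered and unordered pairs appears both in the cost and in the
  objective and cancels.\<close>

lemma rounding_program_correct:
  assumes n: "1 \<le> n" and inst: "cc_instance {..<n} Ep" and feas: "cluster_lp_feasible {..<n} z"
    and big: "\<forall>S. S \<subseteq> {..<n} \<and> S \<noteq> {} \<longrightarrow> z S = 0 \<or> \<Delta> \<le> z S"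
    and enc: "encodes I n Ep z \<epsilon> \<Delta>" and \<Delta>: "0 < \<Delta>" "\<Delta> \<le> 1 / 20000"
  shows "clusters_within 3 (compile 0 main_com) I (2000 * (real n / \<Delta>\<^sup>2)) (1.485 * lp_obj {..<n} Ep z)"
proof -
  define m where "m = length (in_sol I)"
  define A where "A j = set (fst (in_sol I ! j))" for j
  define w where "w j = snd (in_sol I ! j)" for j
  define pl where "pl u v \<longleftrightarrow> {u, v} \<in> Ep" for u v :: nat
  define W where "W = input_size I ^ 3"
  have e: "in_n I = n" "in_plus I = Ep" "in_delta I = \<Delta>" "distinct (map (set \<circ> fst) (in_sol I))"
    "(set \<circ> fst) ` set (in_sol I) = {S. S \<subseteq> {..<n} \<and> S \<noteq> {} \<and> z S \<noteq> 0}"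
    using enc by (simp_all add: encodes_def)
  have el: "distinct (fst (in_sol I ! j))" "w j = z (A j)" if "j < m" for j
  proof -
    obtain xs y where xy: "in_sol I ! j = (xs, y)" by force
    have "in_sol I ! j \<in> set (in_sol I)" using that by (simp add: m_def)
    moreover have "\<forall>(xs, y)\<in>set (in_sol I). distinct xs \<and> y = z (set xs)" using enc by (simp add: encodes_def)
    ultimately have "distinct xs \<and> y = z (set xs)" unfolding xy by blast
    then show "distinct (fst (in_sol I ! j))" "w j = z (A j)" by (simp_all add: A_def w_def xy)
  qed
  have inj: "inj_on A {..<m}"
    using e(4) by (auto simp: inj_on_def A_def m_def distinct_conv_nth)
  have img: "A ` {..<m} = {S. S \<subseteq> {..<n} \<and> S \<noteq> {} \<and> z S \<noteq> 0}"
  proof -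
    have st: "set (in_sol I) = (\<lambda>j. in_sol I ! j) ` {..<m}"
    proof (intro equalityI subsetI)
      fix y assume "y \<in> set (in_sol I)"
      then obtain i where "i < length (in_sol I)" "in_sol I ! i = y" unfolding in_set_conv_nth by blast
      then show "y \<in> (\<lambda>j. in_sol I ! j) ` {..<m}" by (intro image_eqI[of _ _ i]) (simp_all add: m_def)
    next
      fix y assume "y \<in> (\<lambda>j. in_sol I ! j) ` {..<m}"
      then obtain i where "i \<in> {..<m}" "y = in_sol I ! i" by blast
      then show "y \<in> set (in_sol I)" by (simp add: m_def)
    qed
    have "A = (\<lambda>j. (set \<circ> fst) (in_sol I ! j))" by (simp add: A_def fun_eq_iff)
    then show ?thesis unfolding e(5)[symmetric] st image_image by (rule arg_cong)
  qed
  have Aj: "A j \<subseteq> {..<n}" "A j \<noteq> {}" "z (A j) \<noteq> 0" if "j < m" for j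
    using img that by blast+
  \<comment> \<open>Sums over all subsets reduce to the listed support. The empty set is excluded,
    since its value is unconstrained and not listed.\<close>
  have sumz: "(\<Sum>S | S \<subseteq> {..<n} \<and> Pr S. z S) = (\<Sum>j | j < m \<and> Pr (A j). w j)" if Pr: "\<And>S. Pr S \<Longrightarrow> S \<noteq> {}" for Pr
  proof -
    have im: "A ` {j. j < m \<and> Pr (A j)} = {S. S \<subseteq> {..<n} \<and> Pr S \<and> z S \<noteq> 0}"
    proof (intro equalityI subsetI)
      fix S assume "S \<in> {S. S \<subseteq> {..<n} \<and> Pr S \<and> z S \<noteq> 0}"
      then have S: "S \<in> A ` {..<m}" "Pr S" using Pr img by auto
      then show "S \<in> A ` {j. j < m \<and> Pr (A j)}" by auto
    qed (use Aj in auto)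
    have "(\<Sum>j | j < m \<and> Pr (A j). w j) = (\<Sum>j | j < m \<and> Pr (A j). z (A j))" by (rule sum.cong) (auto simp: el(2))
    also have "\<dots> = (\<Sum>S\<in>A ` {j. j < m \<and> Pr (A j)}. z S)"
      by (rule sum.reindex_cong[symmetric, OF _ refl refl]) (rule inj_on_subset[OF inj], auto)
    also have "\<dots> = (\<Sum>S | S \<subseteq> {..<n} \<and> Pr S. z S)"
      unfolding im by (rule sum.mono_neutral_left) auto
    finally show ?thesis by simp
  qed
  have sz: "n + m + 2 \<le> input_size I"
  proof -
    have "1 \<le> length (fst x)" if "x \<in> set (in_sol I)" for x
    proof -
      obtain j where "j < m" "x = in_sol I ! j" using \<open>x \<in> set (in_sol I)\<close> by (auto simp: in_set_conv_nth m_def)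
      then show ?thesis using Aj(2)[of j] by (cases "fst x") (auto simp: A_def)
    qed
    then have "(\<Sum>x\<leftarrow>in_sol I. 1) \<le> (\<Sum>x\<leftarrow>in_sol I. length (fst x))" by (intro sum_list_mono) auto
    moreover have "(\<lambda>(xs, y). length xs) = (\<lambda>x :: nat list \<times> real. length (fst x))" by auto
    ultimately show ?thesis using e(1) unfolding input_size_def by (simp add: m_def sum_list_triv)
  qed
  have m1: "1 \<le> m"
  proof (rule ccontr)
    assume "\<not> 1 \<le> m"
    then have "(\<Sum>S | S \<subseteq> {..<n} \<and> 0 \<in> S. z S) = 0" by (subst sumz) auto
    then show False using feas n by (auto simp: cluster_lp_feasible_def)
  qed
  interpret rounding_ram n m A w \<Delta> pl W I
  proof unfold_locales
    show "0 < n" using n by simp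
    show "A j \<subseteq> {..<n}" "A j \<noteq> {}" if "j < m" for j using Aj that by auto
    show "0 < \<Delta>" by (rule \<Delta>)
    show "\<Delta> \<le> w j" if "j < m" for j using big Aj[OF that] el(2)[OF that] by auto
    show "(\<Sum>j | j < m \<and> u \<in> A j. w j) = 1" if "u < n" for u
      using sumz[of "\<lambda>S. u \<in> S"] feas that by (auto simp: cluster_lp_feasible_def)
    show "pl u v = pl v u" for u v by (simp add: pl_def insert_commute)
    show "pl u u" if "u < n" for u using inst that by (simp add: pl_def cc_instance_def)
    show "in_n I = n" "length (in_sol I) = m" "in_delta I = \<Delta>" using e by (simp_all add: m_def)
    show "set (fst (in_sol I ! j)) = A j" "distinct (fst (in_sol I ! j))" "snd (in_sol I ! j) = w j" if "j < m" for j
      using el[OF that] by (simp_all add: A_def w_def)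
    show "({u, v} \<in> in_plus I) = pl u v" for u v by (simp add: e pl_def)
    \<comment> \<open>Every listed set is nonempty and adds at least 1 to the input size, so its
      cube exceeds both the square of \<open>n + m + 1\<close> and 32.\<close>
    have N: "n + m + 1 \<le> input_size I" "4 \<le> input_size I" using sz n m1 by simp_all
    have "(n + m + 1) * (n + m + 1) \<le> input_size I * input_size I" by (rule mult_le_mono) (use N in auto)
    also have "\<dots> * 1 \<le> input_size I * input_size I * input_size I" by (rule mult_le_mono2) (use N in auto)
    finally show "(n + m + 1) * (n + m + 1) \<le> W" by (simp add: W_def power3_eq_cube)
    have "(4::nat) ^ 3 \<le> input_size I ^ 3" by (rule power_mono) (use N in auto)
    then show "32 \<le> W" by (simp add: W_def)
  qed
  define D where "D = rounding (n / \<Delta>\<^sup>2) (nat \<lceil>n / \<Delta>\<rceil>) (nat \<lceil>m / \<Delta>\<rceil>) start_state"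
  define q where "q = real n / \<Delta>\<^sup>2"
  have q: "n / \<Delta> \<le> q" "1 \<le> n / \<Delta>" "real m \<le> n / \<Delta>" "n / \<Delta> / \<Delta> = q"
  proof -
    show "n / \<Delta> / \<Delta> = q" by (simp add: q_def power2_eq_square)
    have "\<Delta> * \<Delta> \<le> \<Delta> * 1" by (rule mult_left_mono) (use \<Delta> in auto)
    then show "n / \<Delta> \<le> q" unfolding q_def power2_eq_square using \<Delta> by (intro divide_left_mono) auto
    show "1 \<le> n / \<Delta>" using \<Delta> n by (simp add: le_divide_eq)
  qed (rule m_le)
  define T where "T = nat \<lfloor>2000 * q\<rfloor>"
  have time: "t \<le> T" if "real t \<le> 200 + nat \<lceil>n / \<Delta>\<rceil> * (260 + 100 / \<Delta>) + 100 * (n / \<Delta>\<^sup>2 + n / \<Delta>) + 40 * real (nat \<lceil>m / \<Delta>\<rceil>) + 60 * m + 50 * (n / \<Delta>)" for t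
  proof -
    have R: "real (nat \<lceil>n / \<Delta>\<rceil>) \<le> 2 * (n / \<Delta>)" using q(2) by linarith
    have "260 * \<Delta> \<le> 260" using \<Delta> by simp
    then have "260 + 100 / \<Delta> \<le> 360 / \<Delta>" using \<Delta> by (simp add: field_simps)
    then have "nat \<lceil>n / \<Delta>\<rceil> * (260 + 100 / \<Delta>) \<le> (2 * (n / \<Delta>)) * (360 / \<Delta>)"
      using R \<Delta> by (intro mult_mono) auto
    also have "(2 * (n / \<Delta>)) * (360 / \<Delta>) = 720 * q" unfolding q(4)[symmetric] by simp
    finally have 1: "nat \<lceil>n / \<Delta>\<rceil> * (260 + 100 / \<Delta>) \<le> 720 * q" .
    have "m / \<Delta> \<le> n / \<Delta> / \<Delta>" using q(3) \<Delta> by (intro divide_right_mono) auto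
    then have R': "real (nat \<lceil>m / \<Delta>\<rceil>) \<le> 2 * q" using q by linarith
    \<comment> \<open>All terms are at most multiples of \<open>n / \<Delta>\<^sup>2\<close>, using
      \<open>1 \<le> n / \<Delta> \<le> n / \<Delta>\<^sup>2\<close>; they total 1310 of the
      2000.\<close>
    have arith: "a \<le> 2000 * b" if "a \<le> 200 + P + 100 * (b + d) + 40 * S + 60 * M + 50 * d" "P \<le> 720 * b" "S \<le> 2 * b"
      "d \<le> b" "1 \<le> d" "M \<le> d" for a b d P S M :: real
      using that by argo
    have "real t \<le> 2000 * q"
      by (rule arith[OF that[folded q_def, unfolded of_nat_mult of_nat_numeral] 1 R' q(1,2,3)])
    then show ?thesis unfolding T_def by (rule le_nat_floor)
  qed
  have sm: "sim_com main_com init_state D (\<lambda>a s t. mstate a s \<and> real t \<le> 200 + nat \<lceil>n / \<Delta>\<rceil> * (260 + 100 / \<Delta>) + 100 * (n / \<Delta>\<^sup>2 + n / \<Delta>) + 40 * real (nat \<lceil>m / \<Delta>\<rceil>) + 60 * m + 50 * (n / \<Delta>))"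
    unfolding D_def by (rule sim_main)
  have "\<exists>E. run W I (compile 0 main_com) T = map_pmf (\<lambda>x. (snd x)\<lparr>pc := size_com main_com\<rparr>) E \<and> map_pmf fst E = D \<and>
     (\<forall>a s. (a, s) \<in> set_pmf E \<longrightarrow> (\<exists>t. mstate a s \<and> real t \<le> 200 + nat \<lceil>n / \<Delta>\<rceil> * (260 + 100 / \<Delta>) + 100 * (n / \<Delta>\<^sup>2 + n / \<Delta>) + 40 * real (nat \<lceil>m / \<Delta>\<rceil>) + 60 * m + 50 * (n / \<Delta>)))"
    by (rule run_compile[OF sm]) (rule time, erule conjunct2)
  then obtain E where E: "run W I (compile 0 main_com) T = map_pmf (\<lambda>x. (snd x)\<lparr>pc := size_com main_com\<rparr>) E" "map_pmf fst E = D"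
    "\<And>a s. (a, s) \<in> set_pmf E \<Longrightarrow> mstate a s" by (elim exE conjE) (rule that, assumption, assumption, blast)
  have xv: "lp_dist {..<n} z {v, t} = x v t" for v t
  proof -
    have "(\<Sum>S | S \<subseteq> {..<n} \<and> {v, t} \<subseteq> S. z S) = (\<Sum>j | j < m \<and> {v, t} \<subseteq> A j. w j)" by (rule sumz) auto
    also have "\<dots> = sim v t" unfolding sim_def by (rule sum.cong) (auto simp: J_def)
    finally show ?thesis by (simp add: lp_dist_def)
  qed
  have Ep: "Ep \<subseteq> vertex_pairs {..<n}" "finite Ep" using inst finite_subset[OF _ finite_vertex_pairs] by (auto simp: cc_instance_def)
  have self: "{v} \<in> Ep" if "v < n" for v using inst that by (simp add: cc_instance_def)
  have split: "(\<Sum>e\<in>vertex_pairs {..<n}. if e \<in> Ep then f e else g e) = (\<Sum>e\<in>Ep. f e) + (\<Sum>e\<in>minus_edges {..<n} Ep. g e)"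
    for f g :: "nat set \<Rightarrow> real"
    unfolding minus_edges_def sum.subset_diff[OF Ep(1) finite_vertex_pairs] by (simp add: add.commute)
  have obj: "tot obj = 2 * lp_obj {..<n} Ep z"
  proof -
    have "2 * lp_obj {..<n} Ep z = 2 * (\<Sum>e\<in>vertex_pairs {..<n}. if e \<in> Ep then lp_dist {..<n} z e else 1 - lp_dist {..<n} z e)"
      by (simp add: lp_obj_def split)
    also have "\<dots> = (\<Sum>v<n. \<Sum>t<n. of_bool (v \<noteq> t) * (if {v, t} \<in> Ep then lp_dist {..<n} z {v, t} else 1 - lp_dist {..<n} z {v, t}))"
    proof (rule sum_vertex_pairs)
      fix v assume "v < n"
      then show "(if {v} \<in> Ep then lp_dist {..<n} z {v} else 1 - lp_dist {..<n} z {v}) = 0"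
        using self[of v] xv[of v v] sim_self[of v] by simp
    qed
    also have "\<dots> = tot obj" unfolding tot_def by (intro sum.cong refl) (simp add: obj_def xv pl_def)
    finally show ?thesis by simp
  qed
  \<comment> \<open>With all vertices labelled, every pair of distinct vertices is charged its
    actual cost, and the promise has disappeared from the potential.\<close>
  have cost: "2 * real (cc_cost {..<n} Ep (output_clustering n s)) = potential nonzero_obj (fst a)"
    if s: "\<And>v. v < n \<Longrightarrow> wmem s v = fst a v" and lab: "\<And>v. v < n \<Longrightarrow> fst a v \<noteq> 0" for a :: round_state and s
  proof -
    define co where "co e \<longleftrightarrow> (\<exists>K\<in>output_clustering n s. e \<subseteq> K)" for e
    have co: "co {v, t} \<longleftrightarrow> fst a v = fst a t" if "v < n" "t < n" for v t
    proof -
      have "co {v, t} \<longleftrightarrow> wmem s v = wmem s t" using that by (auto simp: co_def output_clustering_def)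
      then show ?thesis using s that by simp
    qed
    have fm: "finite (minus_edges {..<n} Ep)" by (simp add: minus_edges_def finite_vertex_pairs)
    have "2 * real (cc_cost {..<n} Ep (output_clustering n s)) = 2 * (\<Sum>e\<in>vertex_pairs {..<n}. if e \<in> Ep then of_bool (\<not> co e) else of_bool (co e))"
      unfolding split cc_cost_def co_def[symmetric] of_nat_add real_card_filter[OF Ep(2)] real_card_filter[OF fm] by (rule refl)
    also have "\<dots> = (\<Sum>v<n. \<Sum>t<n. of_bool (v \<noteq> t) * (if {v, t} \<in> Ep then of_bool (\<not> co {v, t}) else of_bool (co {v, t})))"
    proof (rule sum_vertex_pairs)
      fix v assume v: "v < n"
      then show "(if {v} \<in> Ep then of_bool (\<not> co {v}) else of_bool (co {v})) = (0 :: real)"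
        using self[OF v] co[of v v] by simp
    qed
    also have "\<dots> = potential nonzero_obj (fst a)" unfolding potential_def
      by (intro sum.cong refl) (auto simp: charge_def co lab pl_def)
    finally show ?thesis .
  qed
  have "expect (run W I (compile 0 main_com) T) (\<lambda>s. real (cc_cost {..<n} Ep (output_clustering n s))) =
     expect E (\<lambda>x. potential nonzero_obj (fst (fst x)) / 2)"
    unfolding E(1) integral_map_pmf
  proof (rule expect_cong)
    fix y assume y: "y \<in> set_pmf E"
    obtain a s where as: "y = (a, s)" by (cases y)
    have "a \<in> set_pmf D" using E(2) y as by force
    then have "fst a v \<noteq> 0" if "v < n" for v using rounding_labels_all that by (auto simp: D_def)
    moreover have "wmem s v = fst a v" if "v < n" for v using E(3)[of a s] y as that rep_lab(1) by (auto simp: mstate_def)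
    ultimately show "real (cc_cost {..<n} Ep (output_clustering n ((snd y)\<lparr>pc := size_com main_com\<rparr>))) = potential nonzero_obj (fst (fst y)) / 2"
      using cost[of "s\<lparr>pc := size_com main_com\<rparr>" a] by (simp add: as)
  qed
  also have "\<dots> = expect D (\<lambda>a. potential nonzero_obj (fst a)) / 2" unfolding E(2)[symmetric] by simp
  also have "\<dots> \<le> 1.485 * lp_obj {..<n} Ep z" using expect_start[OF \<Delta>(2)] unfolding D_def[symmetric] obj by simp
  finally have "expect (run W I (compile 0 main_com) T) (\<lambda>s. real (cc_cost {..<n} Ep (output_clustering n s))) \<le> 1.485 * lp_obj {..<n} Ep z" .
  moreover have "halted (compile 0 main_com) s" if "s \<in> set_pmf (run W I (compile 0 main_com) T)" for s
    using that unfolding E(1) by (auto simp: halted_def)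
  ultimately show ?thesis unfolding clusters_within_def Let_def e(1,2) W_def[symmetric] q_def[symmetric] T_def[symmetric] by blast
qed

text \<open>Near 0 the polynomial is positive and small, so a single program serves all small
  \<open>\<epsilon>\<close>; it reads \<open>\<Delta>\<close> from its input. The witnesses are word
  bound exponent 3, constant 2000 and logarithmic exponent 0.\<close>

theorem theorem1p2:
  fixes p :: "real poly"
  assumes "poly p 0 = 0"
    and "eventually (\<lambda>\<epsilon>. 0 < poly p \<epsilon>) (at_right 0)"
  shows "\<exists>(P :: instr list) (c :: nat) (C :: real) (k :: nat) (\<epsilon>\<^sub>0 :: real). 0 < \<epsilon>\<^sub>0 \<and>
    (\<forall>\<epsilon> \<Delta>. 0 < \<epsilon> \<and> \<epsilon> < \<epsilon>\<^sub>0 \<and> \<Delta> = poly p \<epsilon> \<longrightarrow>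
      (\<forall>(n :: nat) Ep z I.
         1 \<le> n \<and> cc_instance {..<n} Ep \<and> cluster_lp_feasible {..<n} z \<and>
         (\<forall>S. S \<subseteq> {..<n} \<and> S \<noteq> {} \<longrightarrow> z S = 0 \<or> \<Delta> \<le> z S) \<and>
         encodes I n Ep z \<epsilon> \<Delta> \<longrightarrow>
         clusters_within c P I
           (C * (1 + ln (real n)) ^ k * (real n / \<Delta>\<^sup>2))
           ((1.485 + \<epsilon>) * lp_obj {..<n} Ep z)))"
proof -
  have "isCont (\<lambda>x. poly p x) 0" by (rule poly_isCont)
  from tendsto_within_subset[OF isContD[OF this] subset_UNIV]
  have "(poly p \<longlongrightarrow> 0) (at_right 0)" using assms(1) by simp
  then have "eventually (\<lambda>\<epsilon>. poly p \<epsilon> < 1 / 20000) (at_right 0)" by (rule order_tendstoD) simp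
  then have "eventually (\<lambda>\<epsilon>. 0 < poly p \<epsilon> \<and> poly p \<epsilon> < 1 / 20000) (at_right 0)"
    using assms(2) by eventually_elim simp
  then obtain \<epsilon>\<^sub>0 :: real where \<epsilon>\<^sub>0: "0 < \<epsilon>\<^sub>0" "\<And>\<epsilon>. 0 < \<epsilon> \<Longrightarrow> \<epsilon> < \<epsilon>\<^sub>0 \<Longrightarrow> 0 < poly p \<epsilon> \<and> poly p \<epsilon> < 1 / 20000"
    unfolding eventually_at_right_field by auto
  have main: "clusters_within 3 (compile 0 main_com) I (2000 * (1 + ln (real n)) ^ 0 * (real n / (poly p \<epsilon>)\<^sup>2)) ((1.485 + \<epsilon>) * lp_obj {..<n} Ep z)"
    if h: "0 < \<epsilon>" "\<epsilon> < \<epsilon>\<^sub>0" "1 \<le> n" "cc_instance {..<n} Ep" "cluster_lp_feasible {..<n} z"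
      "\<forall>S. S \<subseteq> {..<n} \<and> S \<noteq> {} \<longrightarrow> z S = 0 \<or> poly p \<epsilon> \<le> z S" "encodes I n Ep z \<epsilon> (poly p \<epsilon>)" for \<epsilon> n Ep z I
  proof -
    have c: "clusters_within 3 (compile 0 main_com) I (2000 * (real n / (poly p \<epsilon>)\<^sup>2)) (1.485 * lp_obj {..<n} Ep z)"
      by (rule rounding_program_correct[OF h(3-7)]) (use \<epsilon>\<^sub>0(2)[OF h(1,2)] in auto)
    let ?D = "run (input_size I ^ 3) I (compile 0 main_com) (nat \<lfloor>2000 * (real n / (poly p \<epsilon>)\<^sup>2)\<rfloor>)"
    let ?f = "\<lambda>s. real (cc_cost {..<in_n I} (in_plus I) (output_clustering (in_n I) s))"
    have c': "\<forall>s\<in>set_pmf ?D. halted (compile 0 main_com) s" "measure_pmf.expectation ?D ?f \<le> 1.485 * lp_obj {..<n} Ep z"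
      using c unfolding clusters_within_def Let_def by (rule conjunct1, rule conjunct2)
    \<comment> \<open>A nonnegative expected cost lies below a multiple of the objective, so the
      objective is nonnegative and the factor can be raised by \<open>\<epsilon>\<close>.\<close>
    have "0 \<le> measure_pmf.expectation ?D ?f" by (rule Bochner_Integration.integral_nonneg) simp
    then have "0 \<le> 1.485 * lp_obj {..<n} Ep z" using c'(2) by (rule order_trans)
    then have "1.485 * lp_obj {..<n} Ep z \<le> (1.485 + \<epsilon>) * lp_obj {..<n} Ep z"
      using h(1) by (intro mult_right_mono) auto
    from order_trans[OF c'(2) this] c'(1)
    show ?thesis unfolding clusters_within_def Let_def power_0 mult_1_right by (intro conjI)
  qed
  show ?thesis
    by (rule exI[of _ "compile 0 main_com"], rule exI[of _ 3], rule exI[of _ 2000], rule exI[of _ 0], rule exI[of _ \<epsilon>\<^sub>0])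
      (use \<epsilon>\<^sub>0(1) main in blast)
qed

end
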